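(* Let $L=L_1\oplus\dots\oplus L_n$ be a direct sum of finitely many fields of the same characteristic, and let $P$ be a connected quasi-Galois $L$-bimodule. Then the center $\mathcal{Z}=\mathcal{Z}(P)$ is a field, which embeds into each $L_i$, with $[L_i:\mathcal{Z}]=d_i<\infty$. Moreover, $P$ has the form $$P=\bigoplus_{i,j}(L_i\otimes_{\mathcal{Z}}L_j)^{a_ir_j}$$ for some positive integers $a_i,r_j$ ($1\le i,j\le n$). In particular, if $P$ is Galois, then it is a multiple of $L\otimes_{\mathcal{Z}}L$.
   Context: For a vector $\mathbf{p}=(p_1,\dots,p_n)\in\mathbb{Z}_{\ge 0}^n$, $L^{\mathbf p}$ denotes the $L$-module $L_1^{p_1}\oplus\dots\oplus L_n^{p_n}$. A quasi-Galois bimodule over $L$ of rank $d$ and type $(\mathbf p,\mathbf q)$, where $\mathbf p,\mathbf q\in\mathbb{Z}_{\ge 0}^n$, is an $L$-bimodule $P$ which is isomorphic to $L^{\mathbf p}$ as a left $L$-module, to $L^{\mathbf q}$ as a right $L$-module, and such that $P\otimes_L P\cong P^d$ as a bimodule. A Galois $L$-bimodule of rank $d\ge 1$ is an $L$-bimodule $P$ which is isomorphic to $L^d$ as a left and as a right $L$-module and such that $P\otimes_L P\cong P^d$ as a bimodule; equivalently, it is a quasi-Galois $L$-bimodule of rank $d$ and type $((d,\dots,d),(d,\dots,d))$. Any $L$-bimodule has the form $P=\oplus_{i,j}P_{ij}$ with $P_{ij}$ an $(L_i,L_j)$-bimodule; its oriented incidence graph $\Gamma(P)$ has vertices labeled by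 $1,\dots,n$ and edges $i\to j$ whenever $P_{ji}\neq 0$; $P$ is connected if $\Gamma(P)$ is a connected graph. The center of $P$ is $\mathcal{Z}(P)=\{z\in L: zx=xz\text{ for all }x\in P\}$. The tensor products $L_i\otimes_{\mathcal Z}L_j$ are formed using the embeddings of $\mathcal Z$ into the $L_i$, and $L\otimes_{\mathcal Z}L$ using the corresponding diagonal embedding of $\mathcal Z$ into $L$.
   Formalization: The type (p,q) of P is assumed to have all p_i, q_i positive; with zero entries allowed the claim fails, e.g. for P=0 with n=1, or for L=K⊕K, P=P_11⊕P_12=K⊕K, where P_22=0. *)

theory Defs
  imports
    "HOL-Algebra.Algebra"
    "Graph_Theory.Digraph_Component"
begin

section \<open>Bimodules over commutative rings\<close>

text \<open>
  Only commutative scalars occur, so a right module over \<open>S\<close> is the same thing as a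
  \<^locale>\<open>module\<close> over \<open>S\<close>. As for library modules, the inherited fields \<open>mult\<close> and \<open>one\<close>
  carry no meaning.
\<close>

record ('r, 's, 'm) bimodule = "('r, 'm) module" +
  rsmult :: "'m \<Rightarrow> 's \<Rightarrow> 'm"

definition right_module :: "('r, 's, 'm) bimodule \<Rightarrow> ('s, 'm) module" where
  "right_module M =
     \<lparr>carrier = carrier M, monoid.mult = monoid.mult M, monoid.one = monoid.one M,
      ring.zero = ring.zero M, ring.add = ring.add M,
      module.smult = (\<lambda>s x. rsmult M x s)\<rparr>"

locale bimodule =
  fixes R :: "('r, 'c) ring_scheme" and S :: "('s, 'e) ring_scheme"
    and M :: "('r, 's, 'm) bimodule"
  assumes left: "module R M"
    and right: "module S (right_module M)"
    and smult_rsmult: "\<And>r x s. \<lbrakk>r \<in> carrier R; x \<in> carrier M; s \<in> carrier S\<rbrakk> \<Longrightarrow>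
          rsmult M (module.smult M r x) s = module.smult M r (rsmult M x s)"

definition module_isomorphic ::
  "('r, 'c) ring_scheme \<Rightarrow> ('r, 'm, 'e) module_scheme \<Rightarrow> ('r, 'n, 'f) module_scheme \<Rightarrow> bool" where
  "module_isomorphic R M N \<longleftrightarrow>
     (\<exists>f \<in> iso (add_monoid M) (add_monoid N).
        \<forall>r \<in> carrier R. \<forall>x \<in> carrier M. f (module.smult M r x) = module.smult N r (f x))"

definition bimodule_isomorphic ::
  "('r, 'c) ring_scheme \<Rightarrow> ('s, 'e) ring_scheme \<Rightarrow> ('r, 's, 'm) bimodule \<Rightarrow>
   ('r, 's, 'n) bimodule \<Rightarrow> bool" where
  "bimodule_isomorphic R S M N \<longleftrightarrow>
     (\<exists>f \<in> iso (add_monoid M) (add_monoid N).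
        (\<forall>r \<in> carrier R. \<forall>x \<in> carrier M. f (module.smult M r x) = module.smult N r (f x)) \<and>
        (\<forall>s \<in> carrier S. \<forall>x \<in> carrier M. f (rsmult M x s) = rsmult N (f x) s))"

text \<open>Direct sum of a family indexed by a finite set (for infinite \<open>I\<close> it would be the product).\<close>

definition bimodule_sum ::
  "'i set \<Rightarrow> ('i \<Rightarrow> ('r, 's, 'm) bimodule) \<Rightarrow> ('r, 's, 'i \<Rightarrow> 'm) bimodule" where
  "bimodule_sum I M =
     \<lparr>carrier = (\<Pi>\<^sub>E i\<in>I. carrier (M i)), monoid.mult = undefined, monoid.one = undefined,
      ring.zero = (\<lambda>i\<in>I. ring.zero (M i)), ring.add = (\<lambda>x y. \<lambda>i\<in>I. ring.add (M i) (x i) (y i)),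
      module.smult = (\<lambda>r x. \<lambda>i\<in>I. module.smult (M i) r (x i)),
      rsmult = (\<lambda>x s. \<lambda>i\<in>I. rsmult (M i) (x i) s)\<rparr>"

definition bimodule_power ::
  "('r, 's, 'm) bimodule \<Rightarrow> nat \<Rightarrow> ('r, 's, nat \<Rightarrow> 'm) bimodule" where
  "bimodule_power M d = bimodule_sum {..<d} (\<lambda>_. M)"

text \<open>The ring \<open>B\<close> as a bimodule, scalars on both sides acting through the homomorphism \<open>h\<close>.\<close>

definition bimodule_via :: "('r \<Rightarrow> 'b) \<Rightarrow> ('b, 'c) ring_scheme \<Rightarrow> ('r, 'r, 'b) bimodule" where
  "bimodule_via h B =
     \<lparr>carrier = carrier B, monoid.mult = monoid.mult B, monoid.one = monoid.one B,
      ring.zero = ring.zero B, ring.add = ring.add B,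
      module.smult = (\<lambda>r x. h r \<otimes>\<^bsub>B\<^esub> x), rsmult = (\<lambda>x r. x \<otimes>\<^bsub>B\<^esub> h r)\<rparr>"


section \<open>Tensor products\<close>

text \<open>
  For an \<open>(R,S)\<close>-bimodule \<open>M\<close> and an \<open>(S,T)\<close>-bimodule \<open>N\<close>, the tensor product over \<open>S\<close> is the
  quotient of the free abelian group on \<open>M \<times> N\<close> by the subgroup generated by the relations of
  additivity in each variable and \<open>S\<close>-balancedness. Its elements are cosets of that subgroup; the
  outer scalars act on generators.
\<close>

definition tensor_free :: "('r, 's, 'm) bimodule \<Rightarrow> ('s, 't, 'n) bimodule \<Rightarrow> ('m \<times> 'n \<Rightarrow>\<^sub>0 int) monoid"
  where "tensor_free M N = free_Abelian_group (carrier M \<times> carrier N)"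

definition tensor_relations ::
  "('s, 'c) ring_scheme \<Rightarrow> ('r, 's, 'm) bimodule \<Rightarrow> ('s, 't, 'n) bimodule \<Rightarrow> ('m \<times> 'n \<Rightarrow>\<^sub>0 int) set"
  where
  "tensor_relations S M N = generate (tensor_free M N)
     ({frag_of (x \<oplus>\<^bsub>M\<^esub> x', y) - frag_of (x, y) - frag_of (x', y) | x x' y.
         x \<in> carrier M \<and> x' \<in> carrier M \<and> y \<in> carrier N} \<union>
      {frag_of (x, y \<oplus>\<^bsub>N\<^esub> y') - frag_of (x, y) - frag_of (x, y') | x y y'.
         x \<in> carrier M \<and> y \<in> carrier N \<and> y' \<in> carrier N} \<union>
      {frag_of (rsmult M x s, y) - frag_of (x, module.smult N s y) | x s y.
         x \<in> carrier M \<and> s \<in> carrier S \<and> y \<in> carrier N})"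

definition tensor_product ::
  "('s, 'c) ring_scheme \<Rightarrow> ('r, 's, 'm) bimodule \<Rightarrow> ('s, 't, 'n) bimodule \<Rightarrow>
   ('r, 't, ('m \<times> 'n \<Rightarrow>\<^sub>0 int) set) bimodule" where
  "tensor_product S M N =
     (let F = tensor_free M N; H = tensor_relations S M N; Q = F Mod H in
      \<lparr>carrier = carrier Q, monoid.mult = undefined, monoid.one = undefined,
       ring.zero = \<one>\<^bsub>Q\<^esub>, ring.add = monoid.mult Q,
       module.smult = (\<lambda>r C. H <#>\<^bsub>F\<^esub> frag_extend (\<lambda>(x, y). frag_of (module.smult M r x, y)) ` C),
       rsmult = (\<lambda>C t. H <#>\<^bsub>F\<^esub> frag_extend (\<lambda>(x, y). frag_of (x, rsmult N y t)) ` C)\<rparr>)"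


section \<open>Bimodules over a finite direct sum of fields\<close>

text \<open>
  The ring \<open>L = L\<^sub>1 \<oplus> \<dots> \<oplus> L\<^sub>n\<close> is \<^term>\<open>RDirProd_list Ls\<close>; its elements are lists of
  length \<open>n\<close>, and indices run from \<open>0\<close> to \<open>n - 1\<close>.
\<close>

text \<open>The additive order \<^const>\<open>group.ord\<close> of \<open>1\<close> is \<open>0\<close> when it is infinite.\<close>

definition ring_char :: "('a, 'c) ring_scheme \<Rightarrow> nat" where
  "ring_char R = group.ord (add_monoid R) \<one>\<^bsub>R\<^esub>"

definition summand :: "'a ring list \<Rightarrow> nat \<Rightarrow> ('a list, 'a list, 'a) bimodule" where
  "summand Ls i = bimodule_via (\<lambda>z. z ! i) (Ls ! i)"

text \<open>\<open>L\<^sup>p = L\<^sub>1\<^sup>p\<^sup>1 \<oplus> \<dots> \<oplus> L\<^sub>n\<^sup>p\<^sup>n\<close>, usable as a left and as a right module.\<close>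

definition multi_power ::
  "'a ring list \<Rightarrow> (nat \<Rightarrow> nat) \<Rightarrow> ('a list, 'a list, nat \<times> nat \<Rightarrow> 'a) bimodule" where
  "multi_power Ls p = bimodule_sum (SIGMA i:{..<length Ls}. {..<p i}) (\<lambda>(i, k). summand Ls i)"

definition quasi_galois ::
  "'a ring list \<Rightarrow> nat \<Rightarrow> (nat \<Rightarrow> nat) \<Rightarrow> (nat \<Rightarrow> nat) \<Rightarrow> ('a list, 'a list, 'p) bimodule \<Rightarrow> bool" where
  "quasi_galois Ls d p q P \<longleftrightarrow>
     (let L = RDirProd_list Ls in
      bimodule L L P \<and>
      module_isomorphic L P (multi_power Ls p) \<and>
      module_isomorphic L (right_module P) (right_module (multi_power Ls q)) \<and>
      bimodule_isomorphic L L (tensor_product L P P) (bimodule_power P d))"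

definition galois ::
  "'a ring list \<Rightarrow> nat \<Rightarrow> ('a list, 'a list, 'p) bimodule \<Rightarrow> bool" where
  "galois Ls d P \<longleftrightarrow>
     (let L = RDirProd_list Ls; Ld = bimodule_power (bimodule_via id L) d in
      d \<ge> 1 \<and> bimodule L L P \<and>
      module_isomorphic L P Ld \<and>
      module_isomorphic L (right_module P) (right_module Ld) \<and>
      bimodule_isomorphic L L (tensor_product L P P) (bimodule_power P d))"

text \<open>The identity element of the \<open>i\<close>-th summand, as an idempotent of \<open>L\<close>.\<close>

definition summand_idem :: "'a ring list \<Rightarrow> nat \<Rightarrow> 'a list" where
  "summand_idem Ls i =
     map (\<lambda>k. if k = i then \<one>\<^bsub>Ls ! k\<^esub> else \<zero>\<^bsub>Ls ! k\<^esub>) [0..<length Ls]"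

definition block :: "'a ring list \<Rightarrow> ('a list, 'a list, 'p) bimodule \<Rightarrow> nat \<Rightarrow> nat \<Rightarrow> 'p set" where
  "block Ls P i j =
     (\<lambda>x. rsmult P (module.smult P (summand_idem Ls i) x) (summand_idem Ls j)) ` carrier P"

definition incidence_graph ::
  "'a ring list \<Rightarrow> ('a list, 'a list, 'p) bimodule \<Rightarrow> (nat, nat \<times> nat) pre_digraph" where
  "incidence_graph Ls P =
     \<lparr>verts = {..<length Ls},
      arcs = {(i, j). i < length Ls \<and> j < length Ls \<and> block Ls P j i \<noteq> {\<zero>\<^bsub>P\<^esub>}},
      tail = fst, head = snd\<rparr>"

text \<open>
  Connectedness of a directed graph in \<^theory>\<open>Graph_Theory.Digraph_Component\<close> is
  connectedness of the underlying undirected graph, and requires a nonempty vertex set.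
\<close>

definition connected_bimodule :: "'a ring list \<Rightarrow> ('a list, 'a list, 'p) bimodule \<Rightarrow> bool" where
  "connected_bimodule Ls P \<longleftrightarrow> Digraph_Component.connected (incidence_graph Ls P)"

definition bimodule_center :: "('r, 'c) ring_scheme \<Rightarrow> ('r, 'r, 'p) bimodule \<Rightarrow> 'r set" where
  "bimodule_center L P = {z \<in> carrier L. \<forall>x \<in> carrier P. module.smult P z x = rsmult P x z}"

end

theory Submission
 imports Defs
begin

text \<open>
 Write \<open>e\<^sub>i\<close> for the idempotents of \<open>L\<close>. A left linear functional \<open>phi\<close> on \<open>P\<close> and a vector \<open>x\<close> give an additive map
 \<open>b \<mapsto> phi(x b)\<close> of \<open>L\<close>; sums of such maps are called coefficients. Since \<open>P \<otimes> P \<cong> P\<^sup>d\<close>, they are closed under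
 composition (\<open>coef_compose\<close>). If all blocks \<open>e\<^sub>i P e\<^sub>j\<close> are nonzero, the ring of coefficients acts irreducibly on \<open>L\<close>,
 and a density argument shows that the maps commuting with it, the multiplications by central elements, form a field
 \<open>Z\<close> over which every \<open>L\<^sub>j\<close> is finite (\<open>density\<close>, \<open>center_basis\<close>). Moreover some \<open>Z\<close>-linear form \<open>tau\<^sub>j\<close> on \<open>L\<^sub>j\<close> with dual
 bases is itself a coefficient (\<open>trace_form_exists\<close>). The dimensions of the blocks form a matrix \<open>X\<close> with \<open>X\<^sup>2 = d X\<close>, and
 this together with connectedness makes all blocks nonzero (\<open>connected_matrix_positive\<close>).

 A family of vectors of \<open>e\<^sub>i P e\<^sub>j\<close> with functionals pairing to \<open>tau\<^sub>j\<close> spans a direct summand that is a power of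
 \<open>L\<^sub>i \<otimes>\<^sub>Z L\<^sub>j\<close>. Every block contains such a family, because \<open>tau\<^sub>j\<close> is a coefficient; let \<open>m\<^sub>i\<^sub>j\<close> be the largest size. As
 \<open>L\<^sub>i \<otimes>\<^sub>Z L\<^sub>j\<close> is a finite-dimensional commutative ring, hence a product of local rings, a free summand of \<open>P\<^sup>N\<close> forces a
 proportionally large one in \<open>P\<close> (\<open>dual_at_of_power\<close>, \<open>free_family_of_power\<close>). Applied to the products of free and
 arbitrary vectors in \<open>P \<otimes> P \<cong> P\<^sup>d\<close>, this shows that the defect \<open>r = X - m D\<close>, with \<open>D\<^sub>j = [L\<^sub>j : Z]\<close>, satisfies
 \<open>d r \<le> r\<^sup>2\<close>. Since \<open>r < X\<close> entrywise, comparison with \<open>X\<^sup>2 = d X\<close> gives \<open>r = 0\<close> (\<open>defect_matrix_zero\<close>, \<open>block_free\<close>): every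
 block is a power of \<open>L\<^sub>i \<otimes>\<^sub>Z L\<^sub>j\<close>. Now \<open>m D m = d m\<close> with positive entries, so \<open>m\<close> has rank one and
 \<open>m\<^sub>i\<^sub>j = a\<^sub>i r\<^sub>j\<close> (\<open>multiplicity_factorization\<close>). In the Galois case the ranks on both sides make \<open>m\<close> constant.

 Throughout, \<open>l \<cdot> x\<close> and \<open>x \<star> l\<close> denote the two actions on \<open>P\<close>, and \<open>CL\<close>, \<open>CP\<close> the carriers of \<open>L\<close> and \<open>P\<close>.
\<close>

section \<open>Linear systems modulo a maximal ideal\<close>

lemma (in abelian_group) finsum_diff:
 assumes "f : A \<rightarrow> carrier G" "g : A \<rightarrow> carrier G"
 shows "(\<Oplus>a\<in>A. f a \<ominus> g a) = (\<Oplus>a\<in>A. f a) \<ominus> (\<Oplus>a\<in>A. g a)"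
 using assms
proof (induction A rule: infinite_finite_induct)
 case (insert x F)
 then have "f x : carrier G" "g x : carrier G" "finsum G f F : carrier G" "finsum G g F : carrier G"
  by (auto intro!: finsum_closed)
 with insert show ?case
  by (simp add: Pi_def a_minus_def minus_add a_ac)
qed (simp_all add: a_minus_def r_neg)

lemma (in abelian_monoid) finsum_swap:
 assumes "finite A" "finite B" "!!a b. a : A ==> b : B ==> f a b : carrier G"
 shows "(\<Oplus>a\<in>A. \<Oplus>b\<in>B. f a b) = (\<Oplus>b\<in>B. \<Oplus>a\<in>A. f a b)"
 using assms(1,3)
proof (induction A rule: finite_induct)
 case empty
 then show ?case by simp
next
 case (insert x F)
 have "(\<Oplus>a\<in>insert x F. \<Oplus>b\<in>B. f a b) = (\<Oplus>b\<in>B. f x b) \<oplus> (\<Oplus>a\<in>F. \<Oplus>b\<in>B. f a b)"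
  using insert by (subst finsum_insert) (auto intro!: finsum_closed)
 also have "... = (\<Oplus>b\<in>B. f x b \<oplus> (\<Oplus>a\<in>F. f a b))"
  using insert by (subst finsum_addf) (auto intro!: finsum_closed)
 also have "... = (\<Oplus>b\<in>B. \<Oplus>a\<in>insert x F. f a b)"
  using insert by (intro finsum_cong') (auto intro!: finsum_closed)
 finally show ?case .
qed

lemma (in abelian_monoid) finsum_delta:
 assumes "finite A" "i : A" "!!j. j : A ==> f j : carrier G" "!!j. j : A ==> j ~= i ==> f j = \<zero>"
 shows "(\<Oplus>j\<in>A. f j) = f i"
proof -
 have "(\<Oplus>j\<in>A. f j) = (\<Oplus>j\<in>A. if i = j then f j else \<zero>)"
  using assms by (intro finsum_cong') auto
 then show ?thesis using finsum_singleton[OF assms(2,1), of f] assms(3) by auto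
qed

lemma (in abelian_monoid) finsum_Sigma:
 assumes "finite A" "!!a. a : A ==> finite (B a)" "!!a b. a : A ==> b : B a ==> f (a, b) : carrier G"
 shows "(\<Oplus>p\<in>Sigma A B. f p) = (\<Oplus>a\<in>A. \<Oplus>b\<in>B a. f (a, b))"
 using assms
proof (induction A rule: finite_induct)
 case (insert a A)
 have "Sigma (insert a A) B = Pair a ` B a \<union> Sigma A B" by auto
 then have "(\<Oplus>p\<in>Sigma (insert a A) B. f p) = (\<Oplus>p\<in>Pair a ` B a. f p) \<oplus> (\<Oplus>p\<in>Sigma A B. f p)"
  using insert by (simp only:) (rule finsum_Un_disjoint, auto)
 also have "(\<Oplus>p\<in>Pair a ` B a. f p) = (\<Oplus>b\<in>B a. f (a, b))"
  using insert.prems by (subst finsum_reindex) (auto simp: inj_on_def)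
 also have "(\<Oplus>b\<in>B a. f (a, b)) \<oplus> (\<Oplus>p\<in>Sigma A B. f p) = (\<Oplus>a\<in>insert a A. \<Oplus>b\<in>B a. f (a, b))"
  using insert by (subst finsum_insert) (auto intro!: finsum_closed)
 finally show ?case .
qed simp

text \<open>
 Gaussian elimination: elements outside \<open>I\<close> are units modulo \<open>I\<close>, so a system with more unknowns
 than equations has a solution modulo \<open>I\<close> that is nonzero modulo \<open>I\<close>. For a maximal ideal this is
 linear algebra over the residue field, without passing to the quotient.
\<close>

lemma (in cring) homogeneous_system_mod_ideal:
 fixes W :: "'s => 'i => 'a"
 assumes I: "ideal I R" and one: "\<one> \<notin> I"
  and inv: "!!x. x : carrier R ==> x \<notin> I ==> EX y:carrier R. y \<otimes> x \<ominus> \<one> : I"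
  and "finite J" "finite A" "card J < card A"
  and "!!s a. s : J ==> a : A ==> W s a : carrier R"
 shows "EX c. (ALL a:A. c a : carrier R) & (EX a:A. c a \<notin> I) & (ALL s:J. (\<Oplus>a\<in>A. c a \<otimes> W s a) : I)"
 using assms(4-)
proof (induction J arbitrary: A W rule: finite_induct)
 case empty
 then have "A ~= {}" by auto
 with one show ?case by (intro exI[of _ "%_. \<one>"]) auto
next
 case (insert s J)
 interpret I: ideal I R by (rule I)
 have WC: "!!t a. t : insert s J ==> a : A ==> W t a : carrier R" using insert.prems by auto
 show ?case
 proof (cases "ALL a:A. W s a : I")
  case True
  have "EX c. (ALL a:A. c a : carrier R) & (EX a:A. c a \<notin> I) & (ALL t:J. (\<Oplus>a\<in>A. c a \<otimes> W t a) : I)"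
   using insert.prems insert.hyps by (intro insert.IH) auto
  then obtain c where c: "ALL a:A. c a : carrier R" "EX a:A. c a \<notin> I" "ALL t:J. (\<Oplus>a\<in>A. c a \<otimes> W t a) : I"
   by blast
  have gen: "(\<Oplus>a\<in>B. c a \<otimes> W s a) : I" if "finite B" "B \<subseteq> A" for B
   using that
  proof (induction B rule: finite_induct)
   case (insert b B)
   have "(\<Oplus>a\<in>insert b B. c a \<otimes> W s a) = c b \<otimes> W s b \<oplus> (\<Oplus>a\<in>B. c a \<otimes> W s a)"
    using insert c(1) WC by (subst finsum_insert) auto
   moreover have "c b \<otimes> W s b : I" using insert c(1) True I.I_l_closed by auto
   ultimately show ?case using insert by auto
  qed auto
  then show ?thesis using c insert.prems(1) by (intro exI[of _ c]) auto
 next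
  case False
  then obtain c0 where c0: "c0 : A" "W s c0 \<notin> I" by auto
  with inv WC obtain y where y: "y : carrier R" "y \<otimes> W s c0 \<ominus> \<one> : I" by blast
  define B where "B = A - {c0}"
  define V where "V t a = W t a \<ominus> (W t c0 \<otimes> y) \<otimes> W s a" for t a
  have fB: "finite B" "c0 \<notin> B" "A = insert c0 B" using insert.prems c0 by (auto simp: B_def)
  have W0: "W t c0 : carrier R" if "t : insert s J" for t using WC c0 that by auto
  have WB: "W t a : carrier R" if "t : insert s J" "a : B" for t a using WC B_def that by auto
  have "card J < card B" using insert.prems insert.hyps fB by auto
  moreover have "!!t a. t : J ==> a : B ==> V t a : carrier R"
   using W0 WB y by (auto simp: V_def)
  ultimately obtain c where c: "ALL a:B. c a : carrier R" "EX a:B. c a \<notin> I"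
    "ALL t:J. (\<Oplus>a\<in>B. c a \<otimes> V t a) : I"
   using insert.IH[of B V] fB(1) by blast
  define S where "S = (\<Oplus>a\<in>B. c a \<otimes> W s a)"
  have SC: "S : carrier R" using c WB by (auto simp: S_def intro!: finsum_closed)
  define c' where "c' = c(c0 := \<ominus> (y \<otimes> S))"
  have sum': "(\<Oplus>a\<in>A. c' a \<otimes> W t a) = \<ominus> (y \<otimes> S) \<otimes> W t c0 \<oplus> (\<Oplus>a\<in>B. c a \<otimes> W t a)"
   if t: "t : insert s J" for t
  proof -
   have "(\<Oplus>a\<in>A. c' a \<otimes> W t a) = c' c0 \<otimes> W t c0 \<oplus> (\<Oplus>a\<in>B. c' a \<otimes> W t a)"
    unfolding fB(3) using fB c SC W0[OF t] WB[OF t] y by (subst finsum_insert) (auto simp: c'_def)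
   also have "(\<Oplus>a\<in>B. c' a \<otimes> W t a) = (\<Oplus>a\<in>B. c a \<otimes> W t a)"
    using fB c WB[OF t] by (intro finsum_cong') (auto simp: c'_def)
   finally show ?thesis by (simp add: c'_def)
  qed
  have id1: "u \<otimes> (v \<ominus> (x \<otimes> z) \<otimes> w) = u \<otimes> v \<ominus> (x \<otimes> z) \<otimes> (u \<otimes> w)"
   if "u : carrier R" "v : carrier R" "x : carrier R" "w : carrier R" "z : carrier R" for u v w x z
   using that by algebra
  have id2: "u \<ominus> (w \<otimes> z) \<otimes> v = \<ominus> (z \<otimes> v) \<otimes> w \<oplus> u"
   if "u : carrier R" "w : carrier R" "z : carrier R" "v : carrier R" for u v w z
   using that by algebra
  have id3: "\<ominus> (z \<otimes> v) \<otimes> w \<oplus> v = (\<ominus> v) \<otimes> (z \<otimes> w \<ominus> \<one>)"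
   if "w : carrier R" "z : carrier R" "v : carrier R" for v w z
   using that by algebra
  have "(\<Oplus>a\<in>A. c' a \<otimes> W t a) : I" if t: "t : J" for t
  proof -
   have "(\<Oplus>a\<in>B. c a \<otimes> V t a) = (\<Oplus>a\<in>B. c a \<otimes> W t a \<ominus> (W t c0 \<otimes> y) \<otimes> (c a \<otimes> W s a))"
   proof (intro finsum_cong')
    fix a assume a: "a : B"
    have "c a : carrier R" "W t a : carrier R" "W s a : carrier R" "W t c0 : carrier R"
     using a t c WB W0 by auto
    then show "c a \<otimes> V t a = c a \<otimes> W t a \<ominus> (W t c0 \<otimes> y) \<otimes> (c a \<otimes> W s a)"
     unfolding V_def using id1[OF _ _ _ _ y(1)] by simp
   qed (use c t WB W0 y in auto)
   also have "... = (\<Oplus>a\<in>B. c a \<otimes> W t a) \<ominus> (\<Oplus>a\<in>B. (W t c0 \<otimes> y) \<otimes> (c a \<otimes> W s a))"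
    using c t WB W0 y by (intro finsum_diff) auto
   also have "(\<Oplus>a\<in>B. (W t c0 \<otimes> y) \<otimes> (c a \<otimes> W s a)) = (W t c0 \<otimes> y) \<otimes> S"
    unfolding S_def using c t WB W0 y fB by (subst finsum_rdistr) auto
   also have "(\<Oplus>a\<in>B. c a \<otimes> W t a) \<ominus> (W t c0 \<otimes> y) \<otimes> S = (\<Oplus>a\<in>A. c' a \<otimes> W t a)"
   proof -
    have "(\<Oplus>a\<in>B. c a \<otimes> W t a) : carrier R" "W t c0 : carrier R"
     using c t WB W0 by (auto intro!: finsum_closed)
    then show ?thesis using id2[OF _ _ y(1) SC] t by (simp add: sum')
   qed
   finally show ?thesis using c t by auto
  qed
  moreover have "(\<Oplus>a\<in>A. c' a \<otimes> W s a) : I"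
  proof -
   have "(\<Oplus>a\<in>A. c' a \<otimes> W s a) = \<ominus> (y \<otimes> S) \<otimes> W s c0 \<oplus> S"
    by (simp add: sum' S_def)
   also have "... = (\<ominus> S) \<otimes> (y \<otimes> W s c0 \<ominus> \<one>)"
    using id3[OF _ y(1) SC] W0[of s] by simp
   finally show ?thesis using I.I_l_closed[OF y(2), of "\<ominus> S"] SC by auto
  qed
  ultimately have "ALL t:insert s J. (\<Oplus>a\<in>A. c' a \<otimes> W t a) : I" by auto
  moreover have "ALL a:A. c' a : carrier R" "EX a:A. c' a \<notin> I"
   using c SC y fB by (auto simp: c'_def)
  ultimately show ?thesis by blast
 qed
qed

lemma (in abelian_group) eq_if_minus_zero:
 assumes "x \<ominus> y = \<zero>" "x : carrier G" "y : carrier G"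
 shows "x = y"
 using assms by (metis a_minus_def add.inv_equality add.inv_inv a_inv_closed)

section \<open>Dual families of vectors and functionals\<close>

definition duals :: "('a, 'c) ring_scheme => ('a, 'b, 'd) module_scheme => ('b => 'a) set" where
 "duals R M = {f. (ALL x:carrier M. f x : carrier R) &
  (ALL x:carrier M. ALL y:carrier M. f (x \<oplus>\<^bsub>M\<^esub> y) = f x \<oplus>\<^bsub>R\<^esub> f y) &
  (ALL r:carrier R. ALL x:carrier M. f (r \<odot>\<^bsub>M\<^esub> x) = r \<otimes>\<^bsub>R\<^esub> f x)}"

text \<open>
 The elements that are not invertible at \<open>e\<close>. When they form an ideal, \<open>e R\<close> is a local ring and they are the
 preimage of its maximal ideal.
\<close>

definition res_ideal :: "('a, 'c) ring_scheme => 'a => 'a set" where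
 "res_ideal R e = {b : carrier R. ~ (EX y:carrier R. y \<otimes>\<^bsub>R\<^esub> b \<otimes>\<^bsub>R\<^esub> e = e)}"

definition local_idem :: "('a, 'c) ring_scheme => 'a => bool" where
 "local_idem R e \<longleftrightarrow> e : carrier R & e \<otimes>\<^bsub>R\<^esub> e = e & e ~= \<zero>\<^bsub>R\<^esub> & ideal (res_ideal R e) R"

definition field_idem :: "('a, 'c) ring_scheme => 'a => bool" where
 "field_idem R e \<longleftrightarrow> e : carrier R & e \<otimes>\<^bsub>R\<^esub> e = e & e ~= \<zero>\<^bsub>R\<^esub> &
  (ALL b:carrier R. b \<otimes>\<^bsub>R\<^esub> e ~= \<zero>\<^bsub>R\<^esub> --> (EX y:carrier R. y \<otimes>\<^bsub>R\<^esub> b \<otimes>\<^bsub>R\<^esub> e = e))"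

lemma dualsD:
 assumes "f : duals R M"
 shows "x : carrier M ==> f x : carrier R"
  "[|x : carrier M; y : carrier M|] ==> f (x \<oplus>\<^bsub>M\<^esub> y) = f x \<oplus>\<^bsub>R\<^esub> f y"
  "[|r : carrier R; x : carrier M|] ==> f (r \<odot>\<^bsub>M\<^esub> x) = r \<otimes>\<^bsub>R\<^esub> f x"
 using assms by (auto simp: duals_def)

context module
begin

lemma functional_zero: "f : duals R M ==> f \<zero>\<^bsub>M\<^esub> = \<zero>"
 using dualsD(3)[of f R M \<zero> "\<zero>\<^bsub>M\<^esub>"] dualsD(1)[of f R M "\<zero>\<^bsub>M\<^esub>"]
 by auto

lemma functional_minus:
 assumes "f : duals R M" "x : carrier M" "y : carrier M"
 shows "f (x \<ominus>\<^bsub>M\<^esub> y) = f x \<ominus> f y"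
proof -
 have "f (\<ominus>\<^bsub>M\<^esub> y) = \<ominus> f y"
  using dualsD(3)[OF assms(1), of "\<ominus> \<one>" y] dualsD(1)[OF assms(1)] assms
   smult_l_minus[of \<one> y] by (auto simp: R.l_minus)
 then show ?thesis using assms dualsD(2)[OF assms(1), of x "\<ominus>\<^bsub>M\<^esub> y"] by (simp add: a_minus_def)
qed

lemma functional_finsum:
 assumes "f : duals R M" "finite I" "!!i. i : I ==> x i : carrier M"
 shows "f (\<Oplus>\<^bsub>M\<^esub>i\<in>I. x i) = (\<Oplus>i\<in>I. f (x i))"
 using assms(2,3)
proof (induction I rule: finite_induct)
 case empty
 then show ?case using functional_zero[OF assms(1)] by simp
next
 case (insert i I)
 then show ?case
  using dualsD[OF assms(1)]
  by (simp add: Pi_def M.finsum_closed)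
qed

lemma functional_sum:
 assumes "finite I" "!!i. i : I ==> f i : duals R M" "!!i. i : I ==> c i : carrier R"
 shows "(%x. \<Oplus>i\<in>I. c i \<otimes> f i x) : duals R M"
proof -
 have C: "!!i x. i : I ==> x : carrier M ==> f i x : carrier R" using dualsD assms by metis
 have "(\<Oplus>i\<in>I. c i \<otimes> f i (x \<oplus>\<^bsub>M\<^esub> y)) = (\<Oplus>i\<in>I. c i \<otimes> f i x) \<oplus> (\<Oplus>i\<in>I. c i \<otimes> f i y)"
  if "x : carrier M" "y : carrier M" for x y
 proof -
  have "(\<Oplus>i\<in>I. c i \<otimes> f i (x \<oplus>\<^bsub>M\<^esub> y)) = (\<Oplus>i\<in>I. c i \<otimes> f i x \<oplus> c i \<otimes> f i y)"
   using that C assms dualsD(2)[OF assms(2)]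
   by (intro R.finsum_cong') (auto simp: R.r_distr)
  also have "... = (\<Oplus>i\<in>I. c i \<otimes> f i x) \<oplus> (\<Oplus>i\<in>I. c i \<otimes> f i y)"
   using that C assms by (intro R.finsum_addf) auto
  finally show ?thesis .
 qed
 moreover have "(\<Oplus>i\<in>I. c i \<otimes> f i (r \<odot>\<^bsub>M\<^esub> x)) = r \<otimes> (\<Oplus>i\<in>I. c i \<otimes> f i x)"
  if "x : carrier M" "r : carrier R" for x r
 proof -
  have "(\<Oplus>i\<in>I. c i \<otimes> f i (r \<odot>\<^bsub>M\<^esub> x)) = (\<Oplus>i\<in>I. r \<otimes> (c i \<otimes> f i x))"
   using that C assms dualsD(3)[OF assms(2)]
   by (intro R.finsum_cong') (auto simp: R.m_lcomm)
  also have "... = r \<otimes> (\<Oplus>i\<in>I. c i \<otimes> f i x)"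
   using that C assms by (subst R.finsum_rdistr) auto
  finally show ?thesis .
 qed
 ultimately show ?thesis
  using C assms by (auto simp: duals_def intro!: R.finsum_closed)
qed

lemma functional_diff:
 assumes "f : duals R M" "g : duals R M"
 shows "(%x. f x \<ominus> g x) : duals R M"
proof -
 have 1: "(a \<oplus> b) \<ominus> (c \<oplus> d) = (a \<ominus> c) \<oplus> (b \<ominus> d)" if "a : carrier R" "b : carrier R" "c : carrier R" "d : carrier R"
  for a b c d using that by (simp add: a_minus_def R.minus_add R.a_ac)
 have 2: "r \<otimes> a \<ominus> r \<otimes> b = r \<otimes> (a \<ominus> b)" if "a : carrier R" "b : carrier R" "r : carrier R"
  for a b r using that by (simp add: a_minus_def R.r_distr R.r_minus)
 show ?thesis
  using dualsD[OF assms(1)] dualsD[OF assms(2)]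
  by (auto simp: duals_def 1 2)
qed

lemma functional_scale:
 assumes "f : duals R M" "r : carrier R"
 shows "(%x. r \<otimes> f x) : duals R M"
 using dualsD[OF assms(1)] assms(2) by (auto simp: duals_def R.r_distr R.m_lcomm)

end

lemma (in cring) local_idem_system:
 fixes W :: "'s => 'i => 'a"
 assumes e: "local_idem R e" and "finite J" "finite A" "card J < card A"
  and "!!s a. s : J ==> a : A ==> W s a : carrier R"
 shows "EX c. (ALL a:A. c a : carrier R) & (EX a:A. c a \<notin> res_ideal R e) &
  (ALL s:J. (\<Oplus>a\<in>A. c a \<otimes> W s a) : res_ideal R e)"
proof (rule homogeneous_system_mod_ideal)
 have eC: "e : carrier R" "e \<otimes> e = e" "e ~= \<zero>" using e by (auto simp: local_idem_def)
 show "ideal (res_ideal R e) R" using e by (simp add: local_idem_def)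
 show "\<one> \<notin> res_ideal R e" using eC by (auto simp: res_ideal_def)
 fix x assume x: "x : carrier R" "x \<notin> res_ideal R e"
 then obtain y where y: "y : carrier R" "y \<otimes> x \<otimes> e = e" by (auto simp: res_ideal_def)
 have "(y \<otimes> x \<ominus> \<one>) \<otimes> e = y \<otimes> x \<otimes> e \<ominus> e"
  using x y eC by algebra
 then have 0: "(y \<otimes> x \<ominus> \<one>) \<otimes> e = \<zero>" using y eC by simp
 have "z \<otimes> (y \<otimes> x \<ominus> \<one>) \<otimes> e = \<zero>" if "z : carrier R" for z
  using 0 x y eC that by (simp add: m_assoc)
 then show "EX y:carrier R. y \<otimes> x \<ominus> \<one> : res_ideal R e"
  using y x eC by (intro bexI[of _ y]) (auto simp: res_ideal_def)
qed (use assms in auto)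

lemma (in cring) field_idem_residue:
 assumes "field_idem R e"
 shows "res_ideal R e = {b : carrier R. b \<otimes> e = \<zero>}"
 using assms by (auto simp: res_ideal_def field_idem_def m_assoc)

lemma (in cring) field_idem_local:
 assumes "field_idem R e"
 shows "local_idem R e"
proof -
 have e: "e : carrier R" using assms by (simp add: field_idem_def)
 have "ideal {b : carrier R. b \<otimes> e = \<zero>} R"
 proof (rule idealI)
  show "ring R" by (rule ring_axioms)
  show "subgroup {b : carrier R. b \<otimes> e = \<zero>} (add_monoid R)"
   using e by (intro subgroup.intro)
    (auto simp: l_distr a_inv_def[symmetric] l_minus simp del: a_inv_def)
  fix a x assume "a : {b : carrier R. b \<otimes> e = \<zero>}" "x : carrier R"
  then show "x \<otimes> a : {b : carrier R. b \<otimes> e = \<zero>}" "a \<otimes> x : {b : carrier R. b \<otimes> e = \<zero>}"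
   using e by (auto simp: m_assoc m_comm[of x e]) (auto simp: m_assoc[symmetric])
 qed
 then show ?thesis using assms field_idem_residue[OF assms] by (auto simp: local_idem_def field_idem_def)
qed

lemma (in cring) field_idem_system:
 fixes W :: "'s => 'i => 'a"
 assumes e: "field_idem R e" and "finite J" "finite A" "card J < card A"
  and "!!s a. s : J ==> a : A ==> W s a : carrier R"
 shows "EX c. (ALL a:A. c a : carrier R) & (EX a:A. c a \<otimes> e ~= \<zero>) &
  (ALL s:J. (\<Oplus>a\<in>A. c a \<otimes> W s a) \<otimes> e = \<zero>)"
proof -
 obtain c where "ALL a:A. c a : carrier R" "EX a:A. c a \<notin> res_ideal R e"
  "ALL s:J. (\<Oplus>a\<in>A. c a \<otimes> W s a) : res_ideal R e"
  using local_idem_system[OF field_idem_local[OF e] assms(2-4), of W] assms(5) by blast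
 then show ?thesis unfolding field_idem_residue[OF e] by (intro exI[of _ c]) auto
qed

text \<open>
 For a block \<open>e\<^sub>i P e\<^sub>j\<close> the operator \<open>p\<close> is multiplication by the other idempotent, so that left and right bases
 of blocks, over \<open>e\<^sub>i L\<close> and over \<open>e\<^sub>j L\<close>, are instances of one theory.
\<close>

locale dual_setting = module R M for R (structure) and M (structure) +
 fixes e :: 'a and p :: "'c => 'c"
 assumes e_closed [simp]: "e : carrier R" and e_idem: "e \<otimes> e = e"
  and p_closed [simp]: "x : carrier M ==> p x : carrier M"
  and p_add: "[|x : carrier M; y : carrier M|] ==> p (x \<oplus>\<^bsub>M\<^esub> y) = p x \<oplus>\<^bsub>M\<^esub> p y"
  and p_smult: "[|r : carrier R; x : carrier M|] ==> p (r \<odot>\<^bsub>M\<^esub> x) = r \<odot>\<^bsub>M\<^esub> p x"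
  and p_idem: "x : carrier M ==> p (p x) = p x"
begin

definition dual_family :: "'i set => ('i => 'c) => ('i => 'c => 'a) => bool" where
 "dual_family I x f \<longleftrightarrow> finite I &
  (ALL s:I. x s : carrier M & e \<odot>\<^bsub>M\<^esub> x s = x s & p (x s) = x s) &
  (ALL s:I. f s : duals R M & (ALL y:carrier M. e \<otimes> f s y = f s y & f s (p y) = f s y)) &
  (ALL s:I. ALL t:I. f s (x t) = (if s = t then e else \<zero>))"

lemma dual_familyD:
 assumes "dual_family I x f"
 shows "finite I" "s : I ==> x s : carrier M" "s : I ==> e \<odot>\<^bsub>M\<^esub> x s = x s" "s : I ==> p (x s) = x s"
  "s : I ==> f s : duals R M" "s : I ==> y : carrier M ==> e \<otimes> f s y = f s y"
  "s : I ==> y : carrier M ==> f s (p y) = f s y" "s : I ==> t : I ==> f s (x t) = (if s = t then e else \<zero>)"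
  "s : I ==> y : carrier M ==> f s y : carrier R"
 using assms dualsD(1)[of "f s" R M] by (auto simp: dual_family_def)

lemma p_zero: "p \<zero>\<^bsub>M\<^esub> = \<zero>\<^bsub>M\<^esub>"
 using p_smult[of \<zero> "\<zero>\<^bsub>M\<^esub>"] by simp

lemma p_minus: "[|x : carrier M; y : carrier M|] ==> p (x \<ominus>\<^bsub>M\<^esub> y) = p x \<ominus>\<^bsub>M\<^esub> p y"
 using p_add[of x "\<ominus>\<^bsub>M\<^esub> y"] p_smult[of "\<ominus> \<one>" y] smult_l_minus[of \<one> y] smult_l_minus[of \<one> "p y"]
 by (auto simp: a_minus_def)

lemma p_finsum:
 assumes "finite I" "!!i. i : I ==> x i : carrier M"
 shows "p (\<Oplus>\<^bsub>M\<^esub>i\<in>I. x i) = (\<Oplus>\<^bsub>M\<^esub>i\<in>I. p (x i))"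
 using assms by (induction I rule: finite_induct) (auto simp: p_zero p_add Pi_def M.finsum_closed)

text \<open>
 One step of Gram--Schmidt orthogonalisation: the residue of \<open>y\<close> and of \<open>g\<close> with respect to the given
 family pair to a unit of \<open>e R\<close>, so they extend the family.
\<close>

lemma dual_family_extend:
 assumes D: "dual_family I x f" and k: "k \<notin> I" and y: "y : carrier M" and g: "g : duals R M"
  and u: "u : carrier R" "u \<otimes> (g (p y) \<ominus> (\<Oplus>s\<in>I. f s y \<otimes> g (x s))) \<otimes> e = e"
 shows "dual_family (insert k I) (x(k := e \<odot>\<^bsub>M\<^esub> (p y \<ominus>\<^bsub>M\<^esub> (\<Oplus>\<^bsub>M\<^esub>s\<in>I. f s y \<odot>\<^bsub>M\<^esub> x s))))
  (f(k := %z. (u \<otimes> e) \<otimes> (g (p z) \<ominus> (\<Oplus>s\<in>I. g (x s) \<otimes> f s z))))"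
proof -
 note D' = dual_familyD[OF D]
 note gD = dualsD[OF g]
 define w where "w = p y \<ominus>\<^bsub>M\<^esub> (\<Oplus>\<^bsub>M\<^esub>s\<in>I. f s y \<odot>\<^bsub>M\<^esub> x s)"
 define h where "h = (%z. (u \<otimes> e) \<otimes> (g (p z) \<ominus> (\<Oplus>s\<in>I. g (x s) \<otimes> f s z)))"
 have fx: "f s y \<odot>\<^bsub>M\<^esub> x s : carrier M" if "s : I" for s
  using D' that y by auto
 have SC: "(\<Oplus>\<^bsub>M\<^esub>s\<in>I. f s y \<odot>\<^bsub>M\<^esub> x s) : carrier M"
  using fx by (auto intro!: M.finsum_closed)
 have w: "w : carrier M" using SC y by (auto simp: w_def)
 have pw: "p w = w"
 proof -
  have "p (\<Oplus>\<^bsub>M\<^esub>s\<in>I. f s y \<odot>\<^bsub>M\<^esub> x s) = (\<Oplus>\<^bsub>M\<^esub>s\<in>I. f s y \<odot>\<^bsub>M\<^esub> x s)"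
   using fx D' y by (subst p_finsum) (auto intro!: M.finsum_cong' simp: p_smult)
  then show ?thesis using SC y by (simp add: w_def p_minus p_idem)
 qed
 have gp: "(%z. g (p z)) : duals R M"
  using gD by (auto simp: duals_def p_add p_smult)
 have h: "h : duals R M"
  unfolding h_def using D' gD u gp
  by (intro functional_scale functional_diff functional_sum) auto
 have hx: "h (x s) = \<zero>" if s: "s : I" for s
 proof -
  have "(\<Oplus>t\<in>I. g (x t) \<otimes> f t (x s)) = g (x s) \<otimes> f s (x s)"
   using D' s gD by (intro R.finsum_delta) auto
  then have "h (x s) = (u \<otimes> e) \<otimes> (g (x s) \<ominus> g (x s) \<otimes> e)"
   using D' s by (simp add: h_def)
  also have "... = u \<otimes> (g (x s) \<otimes> (e \<ominus> e \<otimes> e))"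
  proof -
   have "(u \<otimes> e) \<otimes> (a \<ominus> a \<otimes> e) = u \<otimes> (a \<otimes> (e \<ominus> e \<otimes> e))" if "a : carrier R" for a
    using that u(1) e_closed by algebra
   then show ?thesis using gD D' s by simp
  qed
  finally show ?thesis using u(1) gD(1)[OF D'(2)[OF s]] by (simp add: e_idem a_minus_def R.r_neg)
 qed
 have fw: "e \<otimes> f s w = \<zero>" if s: "s : I" for s
 proof -
  have "f s (\<Oplus>\<^bsub>M\<^esub>t\<in>I. f t y \<odot>\<^bsub>M\<^esub> x t) = (\<Oplus>t\<in>I. f t y \<otimes> f s (x t))"
   using D' s fx y dualsD(3)[OF D'(5)]
   by (subst functional_finsum[OF D'(5)]) (auto intro!: R.finsum_cong')
  also have "... = f s y \<otimes> f s (x s)"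
   using D' s y by (intro R.finsum_delta) auto
  finally have "f s (\<Oplus>\<^bsub>M\<^esub>t\<in>I. f t y \<odot>\<^bsub>M\<^esub> x t) = e \<otimes> f s y"
   using D' s y by (simp add: R.m_comm)
  then have "f s w = f s y \<ominus> f s y"
   using D' s y SC by (simp add: w_def functional_minus[OF D'(5)])
  then show ?thesis using D' s y by (simp add: R.r_neg a_minus_def)
 qed
 have hw: "h w = e"
 proof -
  have 1: "h (\<Oplus>\<^bsub>M\<^esub>s\<in>I. f s y \<odot>\<^bsub>M\<^esub> x s) = \<zero>"
  proof -
   have "h (f s y \<odot>\<^bsub>M\<^esub> x s) = \<zero>" if "s : I" for s
    using D' y dualsD(3)[OF h] hx that by simp
   then have "(\<Oplus>s\<in>I. h (f s y \<odot>\<^bsub>M\<^esub> x s)) = \<zero>" by (intro R.add.finprod_one_eqI)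
   then show ?thesis using fx D'(1) by (simp add: functional_finsum[OF h])
  qed
  have "h (p y) = (u \<otimes> e) \<otimes> (g (p y) \<ominus> (\<Oplus>s\<in>I. f s y \<otimes> g (x s)))"
  proof -
   have "(\<Oplus>s\<in>I. g (x s) \<otimes> f s (p y)) = (\<Oplus>s\<in>I. f s y \<otimes> g (x s))"
    using D' y gD by (intro R.finsum_cong') (auto simp: R.m_comm)
   then show ?thesis using y by (simp add: h_def p_idem)
  qed
  also have "... = e"
  proof -
   have "(\<Oplus>s\<in>I. f s y \<otimes> g (x s)) : carrier R"
    using D' y gD by (auto intro!: R.finsum_closed)
   then have "g (p y) \<ominus> (\<Oplus>s\<in>I. f s y \<otimes> g (x s)) : carrier R" using gD y by auto
   moreover have "(u \<otimes> e) \<otimes> a = u \<otimes> a \<otimes> e" if "a : carrier R" for a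
    using that u(1) e_closed by algebra
   ultimately show ?thesis using u(2) by simp
  qed
  finally have "h (p y) = e" .
  then show ?thesis unfolding w_def using 1 y SC by (subst functional_minus[OF h]) (auto simp: a_minus_def)
 qed
 have eh: "e \<otimes> h z = h z" "h (p z) = h z" if "z : carrier M" for z
 proof -
  have "(\<Oplus>s\<in>I. g (x s) \<otimes> f s z) : carrier R"
   using D' that gD by (auto intro!: R.finsum_closed)
  then have "g (p z) \<ominus> (\<Oplus>s\<in>I. g (x s) \<otimes> f s z) : carrier R" using gD that by auto
  moreover have "e \<otimes> ((u \<otimes> e) \<otimes> a) = (u \<otimes> (e \<otimes> e)) \<otimes> a" if "a : carrier R" for a
   using that u(1) e_closed by algebra
  ultimately show "e \<otimes> h z = h z" by (simp add: h_def e_idem)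
  have "(\<Oplus>s\<in>I. g (x s) \<otimes> f s (p z)) = (\<Oplus>s\<in>I. g (x s) \<otimes> f s z)"
   using D' that gD by (intro R.finsum_cong') auto
  then show "h (p z) = h z" using that by (simp add: h_def p_idem)
 qed
 have "e \<odot>\<^bsub>M\<^esub> w : carrier M" "e \<odot>\<^bsub>M\<^esub> (e \<odot>\<^bsub>M\<^esub> w) = e \<odot>\<^bsub>M\<^esub> w" "p (e \<odot>\<^bsub>M\<^esub> w) = e \<odot>\<^bsub>M\<^esub> w"
  using w pw by (auto simp: p_smult smult_assoc1[symmetric] e_idem)
 moreover have "h (e \<odot>\<^bsub>M\<^esub> w) = e" using dualsD(3)[OF h] w hw e_idem by simp
 moreover have "!!s. s : I ==> f s (e \<odot>\<^bsub>M\<^esub> w) = \<zero>" using fw dualsD(3)[OF D'(5)] w by simp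
 ultimately show ?thesis
  using D' k h hx eh unfolding w_def[symmetric] h_def[symmetric]
  by (auto simp: dual_family_def)
qed

text \<open>
 The functionals of a dual family are independent modulo the residue ideal, so they cannot be more
 numerous than the elements generating \<open>M\<close>.
\<close>

lemma dual_family_card_le:
 assumes e: "local_idem R e" and D: "dual_family I x f"
  and J: "finite J" "!!r. r : J ==> v r : carrier M"
  and span: "!!g s. [|g : duals R M; s : I; ALL r:J. g (v r) : res_ideal R e|] ==>
   g (x s) : res_ideal R e"
 shows "card I <= card J"
proof (rule ccontr)
 assume "~ card I <= card J"
 note D' = dual_familyD[OF D]
 interpret RI: ideal "res_ideal R e" R using e by (simp add: local_idem_def)
 have "card J < card I" using `~ card I <= card J` by simp
 moreover have "f a (v s) : carrier R" if "s : J" "a : I" for s a using D'(9) J(2) that by blast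
 ultimately obtain c where c: "ALL a:I. c a : carrier R" "EX a:I. c a \<notin> res_ideal R e"
  "ALL s:J. (\<Oplus>a\<in>I. c a \<otimes> f a (v s)) : res_ideal R e"
  using R.local_idem_system[OF e J(1) D'(1), of "%s a. f a (v s)"] by blast
 then obtain b where b: "b : I" "c b \<notin> res_ideal R e" by blast
 define g where "g = (%z. \<Oplus>a\<in>I. c a \<otimes> f a z)"
 have "g : duals R M" unfolding g_def using D' c by (intro functional_sum) auto
 then have "g (x b) : res_ideal R e" using span[of g b] c(3) b by (auto simp: g_def)
 moreover have "g (x b) = c b \<otimes> f b (x b)"
  unfolding g_def using D' b c by (intro R.finsum_delta) auto
 ultimately have *: "c b \<otimes> e : res_ideal R e" using D' b by simp
 have "c b : res_ideal R e"
 proof (rule ccontr)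
  assume "c b \<notin> res_ideal R e"
  moreover have cb: "c b : carrier R" using b c by blast
  ultimately obtain y where y: "y : carrier R" "y \<otimes> c b \<otimes> e = e" unfolding res_ideal_def by blast
  have "y \<otimes> (c b \<otimes> e) \<otimes> e = y \<otimes> c b \<otimes> (e \<otimes> e)" using y(1) cb by (simp add: R.m_assoc)
  then have "y \<otimes> (c b \<otimes> e) \<otimes> e = e" using y(2) by (simp only: e_idem)
  with * y(1) show False unfolding res_ideal_def by blast
 qed
 with b show False by simp
qed

end

text \<open>A dual basis in the sense of projective modules: it splits a surjection from a free module.\<close>

locale projective_dual_setting = dual_setting +
 fixes V :: "'v set" and v :: "'v => 'c" and v' :: "'v => 'c => 'a"
 assumes V_finite: "finite V" and v_closed: "r : V ==> v r : carrier M"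
  and v'_functional: "r : V ==> v' r : duals R M"
  and v_expand: "x : carrier M ==> x = (\<Oplus>\<^bsub>M\<^esub>r\<in>V. v' r x \<odot>\<^bsub>M\<^esub> v r)"
begin

lemma functional_in_ideal:
 assumes I: "ideal I R" and g: "g : duals R M" and "ALL r:V. g (v r) : I" and x: "x : carrier M"
 shows "g x : I"
proof -
 interpret I: ideal I R by (rule I)
 have 1: "g x = (\<Oplus>r\<in>V. v' r x \<otimes> g (v r))"
 proof -
  have "g x = g (\<Oplus>\<^bsub>M\<^esub>r\<in>V. v' r x \<odot>\<^bsub>M\<^esub> v r)" using v_expand[OF x] by simp
  also have "... = (\<Oplus>r\<in>V. g (v' r x \<odot>\<^bsub>M\<^esub> v r))"
   using x v_closed dualsD(1)[OF v'_functional] V_finite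
   by (intro functional_finsum[OF g]) auto
  also have "... = (\<Oplus>r\<in>V. v' r x \<otimes> g (v r))"
   using x v_closed dualsD(1)[OF v'_functional] dualsD[OF g]
   by (intro R.finsum_cong') auto
  finally show ?thesis .
 qed
 have "(\<Oplus>r\<in>W. v' r x \<otimes> g (v r)) : I" if "finite W" "W \<subseteq> V" for W
  using that
 proof (induction W rule: finite_induct)
  case (insert r W)
  have *: "!!s. s : V ==> v' s x \<otimes> g (v s) : I"
   using assms(3) dualsD(1)[OF v'_functional] x by (auto intro!: I.I_l_closed)
  have "(\<Oplus>r\<in>insert r W. v' r x \<otimes> g (v r)) = v' r x \<otimes> g (v r) \<oplus> (\<Oplus>r\<in>W. v' r x \<otimes> g (v r))"
   using insert * I.Icarr by (subst R.finsum_insert) auto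
  then show ?case using insert * by auto
 qed simp
 then show ?thesis using 1 V_finite by simp
qed

lemma duals_separate:
 assumes "x : carrier M" "x ~= \<zero>\<^bsub>M\<^esub>"
 shows "EX r:V. v' r x ~= \<zero>"
proof (rule ccontr)
 assume "~ (EX r:V. v' r x ~= \<zero>)"
 then have "(\<Oplus>\<^bsub>M\<^esub>r\<in>V. v' r x \<odot>\<^bsub>M\<^esub> v r) = (\<Oplus>\<^bsub>M\<^esub>r\<in>V. \<zero>\<^bsub>M\<^esub>)"
  using v_closed by (intro M.finsum_cong') auto
 with v_expand[OF assms(1)] assms(2) show False by simp
qed

text \<open>Vectors outside the span extend the family, and the number of generators bounds its size.\<close>

lemma dual_family_complete:
 assumes e: "field_idem R e" and inf: "infinite (UNIV :: 'i set)"
  and D0: "dual_family (I0 :: 'i set) x0 f0"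
 obtains I x f where "I0 \<subseteq> I" "!!s. s : I0 ==> x s = x0 s" "!!s. s : I0 ==> f s = f0 s" "dual_family I x f"
  "!!y. y : carrier M ==> e \<odot>\<^bsub>M\<^esub> p y = (\<Oplus>\<^bsub>M\<^esub>s\<in>I. f s y \<odot>\<^bsub>M\<^esub> x s)"
proof -
 define Q where "Q k \<longleftrightarrow> (EX I x f. I0 \<subseteq> I & (ALL s:I0. x s = x0 s & f s = f0 s) & dual_family I x f & card I = k)" for k
 have loc: "local_idem R e" using R.field_idem_local[OF e] .
 then have idl: "ideal (res_ideal R e) R" by (simp add: local_idem_def)
 have bound: "k <= card V" if "Q k" for k
 proof -
  from that obtain I :: "'i set" and x f where "dual_family I x f" "card I = k" by (auto simp: Q_def)
  then show ?thesis
   using dual_family_card_le[OF loc, of I x f V v] V_finite v_closed functional_in_ideal[OF idl]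
    dual_familyD(2)[of I x f] by metis
 qed
 have "Q (card I0)" unfolding Q_def using D0 by auto
 then have "EX k. Q k & (ALL k'. Q k' --> k' <= k)"
  using ex_has_greatest_nat[of Q "card I0" id "Suc (card V)"] bound by (fastforce simp: less_Suc_eq_le)
 then obtain k where k: "Q k" "!!k'. Q k' ==> k' <= k" by blast
 then obtain I x f where I: "I0 \<subseteq> I" "ALL s:I0. x s = x0 s & f s = f0 s" "dual_family I x f" "card I = k"
  by (auto simp: Q_def)
 note D' = dual_familyD[OF I(3)]
 have "e \<odot>\<^bsub>M\<^esub> p y = (\<Oplus>\<^bsub>M\<^esub>s\<in>I. f s y \<odot>\<^bsub>M\<^esub> x s)" if y: "y : carrier M" for y
 proof (rule ccontr)
  assume neq: "e \<odot>\<^bsub>M\<^esub> p y ~= (\<Oplus>\<^bsub>M\<^esub>s\<in>I. f s y \<odot>\<^bsub>M\<^esub> x s)"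
  have fx: "f s y \<odot>\<^bsub>M\<^esub> x s : carrier M" if "s : I" for s
   using D' that y by auto
  define S where "S = (\<Oplus>\<^bsub>M\<^esub>s\<in>I. f s y \<odot>\<^bsub>M\<^esub> x s)"
  have SC: "S : carrier M"
   using fx by (auto intro!: M.finsum_closed simp: S_def)
  have eS: "e \<odot>\<^bsub>M\<^esub> S = S"
  proof -
   have "e \<odot>\<^bsub>M\<^esub> S = (\<Oplus>\<^bsub>M\<^esub>s\<in>I. e \<odot>\<^bsub>M\<^esub> (f s y \<odot>\<^bsub>M\<^esub> x s))"
    unfolding S_def using D' fx by (intro finsum_smult_ldistr) auto
   also have "... = S"
    unfolding S_def using D' y fx by (intro M.finsum_cong') (auto simp: smult_assoc1[symmetric])
   finally show ?thesis .
  qed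
  define w where "w = e \<odot>\<^bsub>M\<^esub> (p y \<ominus>\<^bsub>M\<^esub> S)"
  have "w = e \<odot>\<^bsub>M\<^esub> p y \<ominus>\<^bsub>M\<^esub> S"
   using y SC by (simp add: w_def smult_r_distr a_minus_def smult_r_minus eS)
  then have w: "w : carrier M" "w ~= \<zero>\<^bsub>M\<^esub>"
   using neq y SC by (auto simp: S_def[symmetric] dest!: M.eq_if_minus_zero)
  then obtain r where r: "r : V" "v' r w ~= \<zero>" using duals_separate by blast
  define g where "g = v' r"
  have g: "g : duals R M" using r v'_functional by (simp add: g_def)
  note gD = dualsD[OF g]
  have gS: "g S = (\<Oplus>s\<in>I. f s y \<otimes> g (x s))"
   unfolding S_def using fx D' y gD by (subst functional_finsum[OF g]) (auto intro!: R.finsum_cong')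
  have "g w = (g (p y) \<ominus> (\<Oplus>s\<in>I. f s y \<otimes> g (x s))) \<otimes> e"
   using y SC gD by (simp add: w_def functional_minus[OF g] gS[symmetric] R.m_comm)
  with r(2) have "(g (p y) \<ominus> (\<Oplus>s\<in>I. f s y \<otimes> g (x s))) \<otimes> e ~= \<zero>" by (simp add: g_def)
  moreover have "(g (p y) \<ominus> (\<Oplus>s\<in>I. f s y \<otimes> g (x s))) : carrier R"
   using y SC gD by (simp add: gS[symmetric])
  ultimately obtain u where u: "u : carrier R" "u \<otimes> (g (p y) \<ominus> (\<Oplus>s\<in>I. f s y \<otimes> g (x s))) \<otimes> e = e"
   using e by (auto simp: field_idem_def)
  obtain k1 where k1: "k1 \<notin> I" using inf D'(1) by (meson ex_new_if_finite)
  from dual_family_extend[OF I(3) k1 y g u] obtain x' f' where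
   "dual_family (insert k1 I) x' f'" "ALL s:I. x' s = x s & f' s = f s"
   using k1 by (smt (verit) fun_upd_apply)
  then have "Q (Suc k)" unfolding Q_def using I k1 D'(1)
   by (intro exI[of _ "insert k1 I"] exI[of _ x'] exI[of _ f']) auto
  with k(2) show False by fastforce
 qed
 then show ?thesis using that[of I x f] I by auto
qed

end

section \<open>Finite-dimensional commutative rings\<close>

text \<open>
 The condition under which all of the following works says that \<open>e R\<close> is finite-dimensional: any \<open>D + 1\<close>
 elements satisfy a nontrivial linear relation whose coefficients are zero or invertible at \<open>e\<close>.
\<close>

definition fd_idem :: "('a, 'c) ring_scheme => 'a => nat => bool" where
 "fd_idem R e D \<longleftrightarrow> e : carrier R & e \<otimes>\<^bsub>R\<^esub> e = e &
  (ALL T. (ALL l<=D. T l : carrier R) -->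
   (EX k. (ALL l<=D. k l : carrier R &
       (k l \<otimes>\<^bsub>R\<^esub> e = \<zero>\<^bsub>R\<^esub> | (EX y:carrier R. y \<otimes>\<^bsub>R\<^esub> k l \<otimes>\<^bsub>R\<^esub> e = e))) &
      (EX l<=D. k l \<otimes>\<^bsub>R\<^esub> e ~= \<zero>\<^bsub>R\<^esub>) &
      (\<Oplus>\<^bsub>R\<^esub>l\<in>{..D}. k l \<otimes>\<^bsub>R\<^esub> T l) \<otimes>\<^bsub>R\<^esub> e = \<zero>\<^bsub>R\<^esub>))"

context cring
begin

lemma fd_idem_sub:
 assumes E: "fd_idem R E D" and e: "e : carrier R" "e \<otimes> e = e" "e \<otimes> E = e" "e ~= \<zero>"
 shows "fd_idem R e D"
 unfolding fd_idem_def
proof (intro conjI allI impI)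
 fix T assume T: "ALL l<=D. T l : carrier R"
 have EC: "E : carrier R" using E by (simp add: fd_idem_def)
 from E T obtain k where k: "ALL l<=D. k l : carrier R & (k l \<otimes> E = \<zero> | (EX y:carrier R. y \<otimes> k l \<otimes> E = E))"
  "EX l<=D. k l \<otimes> E ~= \<zero>" "(\<Oplus>l\<in>{..D}. k l \<otimes> T l) \<otimes> E = \<zero>"
  unfolding fd_idem_def by blast
 have eE: "a \<otimes> e = (a \<otimes> E) \<otimes> e" if "a : carrier R" for a
  using that EC e by (metis m_assoc m_comm)
 have 1: "k l \<otimes> e = \<zero> | (EX y:carrier R. y \<otimes> k l \<otimes> e = e)" if l: "l <= D" for l
 proof (cases "k l \<otimes> E = \<zero>")
  case True
  then show ?thesis using eE[of "k l"] k(1) l e(1) by auto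
 next
  case False
  then obtain y where y: "y : carrier R" "y \<otimes> k l \<otimes> E = E" using k(1) l by blast
  then have "y \<otimes> k l \<otimes> e = E \<otimes> e" using eE[of "y \<otimes> k l"] k(1) l by simp
  also have "... = e" using e EC by (simp add: m_comm)
  finally show ?thesis using y by blast
 qed
 have 2: "EX l<=D. k l \<otimes> e ~= \<zero>"
 proof -
  obtain l where l: "l <= D" "k l \<otimes> E ~= \<zero>" using k(2) by blast
  then obtain y where y: "y : carrier R" "y \<otimes> k l \<otimes> E = E" using k(1) by blast
  have kl: "k l : carrier R" using k(1) l by blast
  have "y \<otimes> (k l \<otimes> e) = E \<otimes> e" using eE[of "y \<otimes> k l"] kl y e by (simp add: m_assoc)
  also have "... = e" using e EC by (simp add: m_comm)
  finally have "k l \<otimes> e ~= \<zero>" using e(4) y(1) by auto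
  then show ?thesis using l(1) by blast
 qed
 have SC: "(\<Oplus>l\<in>{..D}. k l \<otimes> T l) : carrier R" using k(1) T by (auto intro!: finsum_closed)
 have 3: "(\<Oplus>l\<in>{..D}. k l \<otimes> T l) \<otimes> e = \<zero>" using eE[OF SC] k(3) e(1) by simp
 show "EX k. (ALL l<=D. k l : carrier R & (k l \<otimes> e = \<zero> | (EX y:carrier R. y \<otimes> k l \<otimes> e = e))) &
      (EX l<=D. k l \<otimes> e ~= \<zero>) & (\<Oplus>l\<in>{..D}. k l \<otimes> T l) \<otimes> e = \<zero>"
  using 1 2 3 k(1) by (intro exI[of _ k]) blast
qed (use e in auto)

text \<open>
 The lowest nonzero coefficient of a linear relation between the powers of \<open>b\<close> is invertible at \<open>e\<close>; solving for its
 power makes that power a multiple of the next one.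
\<close>

lemma finite_dim_power_stable:
 assumes e: "fd_idem R e D" and b: "b : carrier R" "b \<otimes> e = b"
 obtains l S where "S : carrier R" "b [^] Suc l = b [^] Suc l \<otimes> b \<otimes> S"
proof -
 have eC: "e : carrier R" "e \<otimes> e = e" using e by (auto simp: fd_idem_def)
 have "EX k. (ALL l<=D. k l : carrier R & (k l \<otimes> e = \<zero> | (EX y:carrier R. y \<otimes> k l \<otimes> e = e))) &
  (EX l<=D. k l \<otimes> e ~= \<zero>) & (\<Oplus>l\<in>{..D}. k l \<otimes> b [^] l) \<otimes> e = \<zero>"
  using e b unfolding fd_idem_def by blast
 then obtain k where k: "!!l. l <= D ==> k l : carrier R"
  "!!l. l <= D ==> k l \<otimes> e = \<zero> | (EX y:carrier R. y \<otimes> k l \<otimes> e = e)"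
  "EX l<=D. k l \<otimes> e ~= \<zero>" "(\<Oplus>l\<in>{..D}. k l \<otimes> b [^] l) \<otimes> e = \<zero>"
  by blast
 define m where "m = (LEAST l. l <= D & k l \<otimes> e ~= \<zero>)"
 have m: "m <= D" "k m \<otimes> e ~= \<zero>" using LeastI_ex[OF k(3)[unfolded Bex_def]] unfolding m_def by auto
 have lt: "k l \<otimes> e = \<zero>" if "l < m" for l
  using not_less_Least[of l "%l. l <= D & k l \<otimes> e ~= \<zero>"] that m(1) unfolding m_def[symmetric] by auto
 obtain y where y: "y : carrier R" "y \<otimes> k m \<otimes> e = e" using k(2) m by blast
 have low: "(\<Oplus>l\<in>{..<m}. k l \<otimes> b [^] l) \<otimes> e = \<zero>"
 proof -
  have "k l \<otimes> b [^] l \<otimes> e = \<zero>" if l: "l < m" for l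
  proof -
   have "k l : carrier R" using k(1) l m(1) by simp
   then have "k l \<otimes> b [^] l \<otimes> e = b [^] l \<otimes> (k l \<otimes> e)" using b eC by (simp add: m_ac)
   then show ?thesis using lt[OF l] b by simp
  qed
  then have "(\<Oplus>l\<in>{..<m}. k l \<otimes> b [^] l \<otimes> e) = \<zero>" by (intro add.finprod_one_eqI) auto
  then show ?thesis using k(1) m(1) b eC by (subst finsum_ldistr) auto
 qed
 have high: "EX S:carrier R. (\<Oplus>l\<in>A. k l \<otimes> b [^] l) = b [^] Suc m \<otimes> S" if "finite A" "A \<subseteq> {m<..D}" for A
  using that
 proof (induction A rule: finite_induct)
  case empty
  then show ?case using b by (intro bexI[of _ \<zero>]) auto
 next
  case (insert l A)
  then obtain S where S: "S : carrier R" "(\<Oplus>l\<in>A. k l \<otimes> b [^] l) = b [^] Suc m \<otimes> S" by auto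
  have kl: "k l : carrier R" using k(1) insert.prems by auto
  have "l = Suc m + (l - Suc m)" using insert.prems by auto
  then have "b [^] l = b [^] Suc m \<otimes> b [^] (l - Suc m)" using b nat_pow_mult[of b "Suc m" "l - Suc m"] by simp
  then have "k l \<otimes> b [^] l = b [^] Suc m \<otimes> (k l \<otimes> b [^] (l - Suc m))" using kl b by (simp add: m_ac)
  moreover have "(\<Oplus>l\<in>insert l A. k l \<otimes> b [^] l) = k l \<otimes> b [^] l \<oplus> (\<Oplus>l\<in>A. k l \<otimes> b [^] l)"
   using insert k(1) b by (subst finsum_insert) auto
  ultimately have "(\<Oplus>l\<in>insert l A. k l \<otimes> b [^] l) = b [^] Suc m \<otimes> (k l \<otimes> b [^] (l - Suc m) \<oplus> S)"
   using S kl b by (simp add: r_distr del: nat_pow_Suc)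
  then show ?case using S kl b by (intro bexI[of _ "k l \<otimes> b [^] (l - Suc m) \<oplus> S"]) auto
 qed
 obtain S where S: "S : carrier R" "(\<Oplus>l\<in>{m<..D}. k l \<otimes> b [^] l) = b [^] Suc m \<otimes> S"
  using high[of "{m<..D}"] by auto
 define lo where "lo = (\<Oplus>l\<in>{..<m}. k l \<otimes> b [^] l)"
 have loC: "lo : carrier R" unfolding lo_def using k(1) m(1) b by (intro finsum_closed) auto
 have km: "k m : carrier R" using k(1) m by simp
 have "{..D} = insert m ({..<m} \<union> {m<..D})" using m(1) by auto
 then have "(\<Oplus>l\<in>{..D}. k l \<otimes> b [^] l) = (\<Oplus>l\<in>insert m ({..<m} \<union> {m<..D}). k l \<otimes> b [^] l)" by simp
 also have "... = k m \<otimes> b [^] m \<oplus> (\<Oplus>l\<in>{..<m} \<union> {m<..D}. k l \<otimes> b [^] l)"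
  using k(1) m(1) b by (subst finsum_insert) auto
 also have "(\<Oplus>l\<in>{..<m} \<union> {m<..D}. k l \<otimes> b [^] l) = lo \<oplus> b [^] Suc m \<otimes> S"
  unfolding lo_def S(2)[symmetric] using k(1) m(1) b by (subst finsum_Un_disjoint) auto
 finally have "(k m \<otimes> b [^] m \<oplus> (lo \<oplus> b [^] Suc m \<otimes> S)) \<otimes> e = \<zero>" using k(4) by simp
 then have "k m \<otimes> b [^] m \<otimes> e \<oplus> b [^] Suc m \<otimes> S \<otimes> e = \<zero>"
  using km b S loC eC low by (simp add: l_distr lo_def[symmetric] del: nat_pow_Suc)
 then have "y \<otimes> (k m \<otimes> b [^] m \<otimes> e \<oplus> b [^] Suc m \<otimes> S \<otimes> e) = \<zero>" using y(1) by simp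
 moreover have "y \<otimes> (k m \<otimes> b [^] m \<otimes> e \<oplus> b [^] Suc m \<otimes> S \<otimes> e) = b [^] m \<otimes> (y \<otimes> k m \<otimes> e) \<oplus> b [^] Suc m \<otimes> (y \<otimes> S \<otimes> e)"
  using y(1) km b S eC by (simp add: r_distr m_ac del: nat_pow_Suc)
 ultimately have 1: "b [^] m \<otimes> e \<oplus> b [^] Suc m \<otimes> (y \<otimes> S \<otimes> e) = \<zero>" using y(2) by simp
 then have "b [^] m \<otimes> e = \<ominus> (b [^] Suc m \<otimes> (y \<otimes> S \<otimes> e))"
  using b y(1) S eC by (intro minus_equality[symmetric]) (auto simp del: nat_pow_Suc)
 also have "... = b [^] Suc m \<otimes> (\<ominus> (y \<otimes> S \<otimes> e))" using b y(1) S eC by (simp add: r_minus del: nat_pow_Suc)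
 finally have "b [^] m \<otimes> e \<otimes> b = b [^] Suc m \<otimes> (\<ominus> (y \<otimes> S \<otimes> e)) \<otimes> b" by simp
 moreover have "b [^] m \<otimes> e \<otimes> b = b [^] Suc m" using b eC by (simp add: m_assoc m_comm[of e b])
 moreover have "b [^] Suc m \<otimes> (\<ominus> (y \<otimes> S \<otimes> e)) \<otimes> b = b [^] Suc m \<otimes> b \<otimes> (\<ominus> (y \<otimes> S \<otimes> e))"
  using b y(1) S eC by (simp add: m_ac del: nat_pow_Suc)
 ultimately have "b [^] Suc m = b [^] Suc m \<otimes> b \<otimes> (\<ominus> (y \<otimes> S \<otimes> e))" by simp
 moreover have "\<ominus> (y \<otimes> S \<otimes> e) : carrier R" using y S eC by simp
 ultimately show thesis using that by blast
qed

text \<open>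
 Fitting's lemma: stabilisation of the powers of \<open>b e\<close> produces an idempotent below \<open>e\<close>, and
 primitivity of \<open>e\<close> leaves only two possibilities for it.
\<close>

lemma primitive_idem_unit_or_nilpotent:
 assumes e: "fd_idem R e D"
  and prim: "!!h. [|h : carrier R; h \<otimes> h = h; h \<otimes> e = h|] ==> h = \<zero> | h = e"
  and b: "b : carrier R"
 shows "(EX y:carrier R. y \<otimes> b \<otimes> e = e) | (EX l::nat. (b \<otimes> e) [^] l = \<zero>)"
proof -
 have eC: "e : carrier R" "e \<otimes> e = e" using e by (auto simp: fd_idem_def)
 define c where "c = b \<otimes> e"
 have c: "c : carrier R" "c \<otimes> e = c" using b eC by (auto simp: c_def m_assoc)
 obtain l S where S: "S : carrier R" "c [^] Suc l = c [^] Suc l \<otimes> c \<otimes> S"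
  using finite_dim_power_stable[OF e c] by blast
 define u where "u = c [^] Suc l"
 have u: "u : carrier R" "u = u \<otimes> c \<otimes> S" using S c by (auto simp: u_def)
 have uj: "u = u \<otimes> c [^] j \<otimes> S [^] j" for j :: nat
 proof (induction j)
  case (Suc j)
  have "u \<otimes> c [^] Suc j \<otimes> S [^] Suc j = (u \<otimes> c \<otimes> S) \<otimes> c [^] j \<otimes> S [^] j" using u(1) c S by (simp add: m_ac)
  then show ?case using Suc u(2) by simp
 qed (use u in simp)
 define w where "w = S [^] Suc l"
 have w: "w : carrier R" using S by (simp add: w_def)
 have uuw: "u \<otimes> u \<otimes> w = u" using uj[of "Suc l", folded u_def w_def] by simp
 define h where "h = u \<otimes> w"
 have "h \<otimes> h = (u \<otimes> u \<otimes> w) \<otimes> w" using u w by (simp add: h_def m_ac)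
 then have hh: "h \<otimes> h = h" using uuw by (simp add: h_def)
 have "u = c [^] l \<otimes> c" by (simp add: u_def)
 then have "u \<otimes> e = u" using c eC by (simp add: m_assoc)
 then have "h \<otimes> e = h" using u w eC by (simp add: h_def m_assoc m_comm[of w e]) (simp add: m_assoc[symmetric])
 then have "h = \<zero> | h = e" using hh prim[of h] u w by (auto simp: h_def)
 then show ?thesis
 proof
  assume "h = \<zero>"
  then have "u = \<zero>" using uuw u w by (simp add: h_def m_assoc)
  then show ?thesis unfolding u_def c_def by blast
 next
  assume "h = e"
  have "h = (c [^] l \<otimes> w) \<otimes> b \<otimes> e" using c w b eC by (simp add: h_def u_def m_ac) (simp add: c_def m_ac)
  with `h = e` have "(c [^] l \<otimes> w) \<otimes> b \<otimes> e = e" by simp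
  then show ?thesis using c w by blast
 qed
qed

text \<open>
 A non-unit of \<open>e R\<close> is nilpotent, hence \<open>e\<close> minus it is a unit by the geometric series, so the non-units are closed
 under addition.
\<close>

lemma primitive_idem_local:
 assumes e: "fd_idem R e D" "e ~= \<zero>"
  and prim: "!!h. [|h : carrier R; h \<otimes> h = h; h \<otimes> e = h|] ==> h = \<zero> | h = e"
 shows "local_idem R e"
proof -
 have eC: "e : carrier R" "e \<otimes> e = e" using e by (auto simp: fd_idem_def)
 have mult: "r \<otimes> b : res_ideal R e" if b: "b : res_ideal R e" and r: "r : carrier R" for r b
 proof -
  have bC: "b : carrier R" using b by (simp add: res_ideal_def)
  have "~ y \<otimes> (r \<otimes> b) \<otimes> e = e" if y: "y : carrier R" for y
  proof -
   have "(y \<otimes> r) \<otimes> b \<otimes> e ~= e" using b y r by (auto simp: res_ideal_def)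
   then show ?thesis using y r bC by (simp add: m_assoc)
  qed
  then show ?thesis using bC r by (auto simp: res_ideal_def)
 qed
 have geom: "EX u:carrier R. (e \<ominus> t) \<otimes> u = e \<ominus> e \<otimes> t [^] l" if t: "t : carrier R" "t \<otimes> e = t" for t and l :: nat
 proof (induction l)
  case 0
  then show ?case using t eC by (intro bexI[of _ \<zero>]) (auto simp: a_minus_def r_neg)
 next
  case (Suc l)
  then obtain u where u: "u : carrier R" "(e \<ominus> t) \<otimes> u = e \<ominus> e \<otimes> t [^] l" by blast
  define s where "s = t [^] l"
  have s: "s : carrier R" using t by (simp add: s_def)
  have "(e \<ominus> t) \<otimes> (e \<oplus> t \<otimes> u) = (e \<otimes> e \<ominus> t \<otimes> e) \<oplus> t \<otimes> ((e \<ominus> t) \<otimes> u)" using t(1) u(1) eC(1) by algebra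
  also have "... = (e \<ominus> t) \<oplus> t \<otimes> (e \<ominus> e \<otimes> s)" using t u(2) eC by (simp add: s_def)
  also have "... = e \<ominus> t \<oplus> (t \<otimes> e \<ominus> e \<otimes> (s \<otimes> t))" using t(1) eC(1) s by algebra
  also have "... = e \<ominus> e \<otimes> (s \<otimes> t)"
  proof -
   have "e \<ominus> t \<oplus> (t \<ominus> x) = e \<ominus> x" if "x : carrier R" for x using t(1) eC(1) that by algebra
   then show ?thesis using t eC(1) s by simp
  qed
  finally show ?case using t u eC by (intro bexI[of _ "e \<oplus> t \<otimes> u"]) (auto simp: s_def)
 qed
 have add: "b \<oplus> c : res_ideal R e" if b: "b : res_ideal R e" and c: "c : res_ideal R e" for b c
 proof (rule ccontr)
  have bC: "b : carrier R" "c : carrier R" using b c by (auto simp: res_ideal_def)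
  assume "b \<oplus> c \<notin> res_ideal R e"
  then obtain y where y: "y : carrier R" "y \<otimes> (b \<oplus> c) \<otimes> e = e" using bC unfolding res_ideal_def by blast
  have "y \<otimes> b : res_ideal R e" using mult b y by blast
  then obtain l :: nat where l: "(y \<otimes> b \<otimes> e) [^] l = \<zero>"
   using primitive_idem_unit_or_nilpotent[OF e(1) prim, of "y \<otimes> b"] y bC unfolding res_ideal_def by blast
  define t where "t = y \<otimes> b \<otimes> e"
  have t: "t : carrier R" "t \<otimes> e = t" using y bC eC by (auto simp: t_def m_assoc)
  obtain u where u: "u : carrier R" "(e \<ominus> t) \<otimes> u = e \<ominus> e \<otimes> t [^] l" using geom[OF t] by blast
  have "(e \<ominus> t) \<otimes> u = e" using u(2) l eC by (simp add: t_def a_minus_def)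
  moreover have "e \<ominus> t = y \<otimes> c \<otimes> e"
  proof -
   have "y \<otimes> (b \<oplus> c) \<otimes> e \<ominus> t = y \<otimes> c \<otimes> e" unfolding t_def using y(1) bC eC(1) by algebra
   with y(2) show ?thesis by simp
  qed
  ultimately have "(u \<otimes> y) \<otimes> c \<otimes> e = e" using u(1) y(1) bC eC by (simp add: m_ac)
  then show False using c u y unfolding res_ideal_def by blast
 qed
 have zero: "\<zero> : res_ideal R e" using eC e(2) by (auto simp: res_ideal_def)
 have "ideal (res_ideal R e) R"
 proof (rule idealI)
  show "ring R" by (rule ring_axioms)
  show "subgroup (res_ideal R e) (add_monoid R)"
  proof (intro subgroup.intro)
   fix x assume x: "x : res_ideal R e"
   then have "x : carrier R" by (simp add: res_ideal_def)
   then show "inv\<^bsub>add_monoid R\<^esub> x : res_ideal R e"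
    using mult[OF x, of "\<ominus> \<one>"] by (simp add: l_minus flip: a_inv_def)
  qed (use zero add in "auto simp: res_ideal_def")
  fix a x assume "a : res_ideal R e" "x : carrier R"
  then show "x \<otimes> a : res_ideal R e" "a \<otimes> x : res_ideal R e"
   using mult[of a x] by (auto simp: res_ideal_def m_comm[of x a])
 qed
 then show ?thesis using eC e(2) by (simp add: local_idem_def)
qed

text \<open>Multiplying a relation between orthogonal idempotents by one of them isolates its coefficient.\<close>

lemma orthogonal_idems_card_le:
 assumes e: "fd_idem R e D" and E: "finite E"
  "!!h. h : E ==> h : carrier R & h ~= \<zero> & h \<otimes> h = h & h \<otimes> e = h"
  "!!h h'. h : E ==> h' : E ==> h ~= h' ==> h \<otimes> h' = \<zero>"
 shows "card E <= D"
proof (rule ccontr)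
 assume "~ card E <= D"
 then have "card {..D} <= card E" by simp
 then obtain T where T: "inj_on T {..D}" "T ` {..D} \<subseteq> E" using card_le_inj[OF finite_atMost E(1)] by blast
 have eC: "e : carrier R" using e by (auto simp: fd_idem_def)
 have TC: "ALL l<=D. T l : carrier R" using T E by auto
 then have "EX k. (ALL l<=D. k l : carrier R & (k l \<otimes> e = \<zero> | (EX y:carrier R. y \<otimes> k l \<otimes> e = e))) &
  (EX l<=D. k l \<otimes> e ~= \<zero>) & (\<Oplus>l\<in>{..D}. k l \<otimes> T l) \<otimes> e = \<zero>"
  using e unfolding fd_idem_def by blast
 then obtain k m y where k: "!!l. l <= D ==> k l : carrier R" "m <= D" "y : carrier R" "y \<otimes> k m \<otimes> e = e"
  "(\<Oplus>l\<in>{..D}. k l \<otimes> T l) \<otimes> e = \<zero>" by blast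
 have Tm: "T m : carrier R" "T m \<otimes> T m = T m" "T m \<otimes> e = T m" "T m ~= \<zero>" using T k(2) E(2) by auto
 have SC: "(\<Oplus>l\<in>{..D}. k l \<otimes> T l) : carrier R" using k TC by (auto intro!: finsum_closed)
 have "T m \<otimes> (\<Oplus>l\<in>{..D}. k l \<otimes> T l) = (\<Oplus>l\<in>{..D}. T m \<otimes> (k l \<otimes> T l))"
  using k TC Tm by (subst finsum_rdistr) auto
 also have "... = T m \<otimes> (k m \<otimes> T m)"
 proof (rule finsum_delta)
  fix l assume l: "l : {..D}" "l ~= m"
  then have "T m ~= T l" using T(1) k(2) by (auto simp: inj_on_def)
  then have "T m \<otimes> T l = \<zero>" using E(3) T(2) l k(2) by auto
  moreover have "T m \<otimes> (k l \<otimes> T l) = k l \<otimes> (T m \<otimes> T l)" using k l TC Tm by (simp add: m_ac)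
  ultimately show "T m \<otimes> (k l \<otimes> T l) = \<zero>" using k l by simp
 qed (use k TC Tm in auto)
 also have "... = k m \<otimes> T m" using k(1)[OF k(2)] Tm(1,2) m_lcomm[of "T m" "k m" "T m"] by simp
 finally have "T m \<otimes> (\<Oplus>l\<in>{..D}. k l \<otimes> T l) \<otimes> e = k m \<otimes> T m \<otimes> e" by simp
 moreover have "T m \<otimes> (\<Oplus>l\<in>{..D}. k l \<otimes> T l) \<otimes> e = \<zero>" using k(5) SC Tm eC by (simp add: m_assoc)
 ultimately have "k m \<otimes> T m \<otimes> e = \<zero>" by metis
 then have "y \<otimes> (k m \<otimes> T m \<otimes> e) = \<zero>" using k(3) by (simp only: r_null)
 moreover have "y \<otimes> (k m \<otimes> T m \<otimes> e) = (y \<otimes> k m \<otimes> e) \<otimes> T m" using k(1)[OF k(2)] k(3) Tm eC by (simp add: m_ac)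
 ultimately have "e \<otimes> T m = \<zero>" using k(4) by simp
 then show False using Tm eC by (simp add: m_comm)
qed

end

text \<open>
 In a largest orthogonal family below \<open>e\<close> every member is primitive, since it could be split otherwise, and the sum is
 \<open>e\<close>, since its complement could be added otherwise.
\<close>

lemma (in cring) primitive_decomposition:
 assumes e: "fd_idem R e D"
 obtains E where "finite E" "(\<Oplus>h\<in>E. h) = e"
  "!!h. h : E ==> h \<otimes> h = h & h \<otimes> e = h & local_idem R h"
  "!!h h'. h : E ==> h' : E ==> h ~= h' ==> h \<otimes> h' = \<zero>"
proof -
 have eC: "e : carrier R" "e \<otimes> e = e" using e by (auto simp: fd_idem_def)
 define Q where "Q E \<longleftrightarrow> finite E & (ALL h:E. h : carrier R & h ~= \<zero> & h \<otimes> h = h & h \<otimes> e = h) &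
  (ALL h:E. ALL h':E. h ~= h' --> h \<otimes> h' = \<zero>)" for E
 have bound: "card E <= D" if "Q E" for E
  using orthogonal_idems_card_le[OF e, of E] that by (auto simp: Q_def)
 have "Q {}" by (simp add: Q_def)
 then have "EX E. Q E & (ALL E'. Q E' --> card E' <= card E)"
  using ex_has_greatest_nat[of Q "{}" card "Suc D"] bound by (fastforce simp: less_Suc_eq_le)
 then obtain E where E: "Q E" "!!E'. Q E' ==> card E' <= card E" by blast
 have fin: "finite E" using E by (simp add: Q_def)
 have QE: "h : carrier R" "h ~= \<zero>" "h \<otimes> h = h" "h \<otimes> e = h" if "h : E" for h
  using E(1) that by (auto simp: Q_def)
 have orth: "h \<otimes> h' = \<zero>" if "h : E" "h' : E" "h ~= h'" for h h'
  using E(1) that by (auto simp: Q_def)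
 define s where "s = (\<Oplus>h\<in>E. h)"
 have sC: "s : carrier R" using QE by (auto simp: s_def intro!: finsum_closed)
 have hs: "h \<otimes> s = h" if "h : E" for h
 proof -
  have "h \<otimes> s = (\<Oplus>h'\<in>E. h \<otimes> h')" unfolding s_def using fin QE that by (subst finsum_rdistr) auto
  also have "... = h \<otimes> h" using fin QE that orth by (intro finsum_delta) auto
  finally show ?thesis using QE that by simp
 qed
 have ss: "s \<otimes> s = s" "s \<otimes> e = s"
 proof -
  have "s \<otimes> s = (\<Oplus>h\<in>E. h \<otimes> s)" using fin QE sC by (subst (1) s_def, subst finsum_ldistr) auto
  also have "... = s" unfolding s_def using hs QE by (intro finsum_cong') (auto simp: s_def)
  finally show "s \<otimes> s = s" .
  have "s \<otimes> e = (\<Oplus>h\<in>E. h \<otimes> e)" unfolding s_def using fin QE eC by (subst finsum_ldistr) auto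
  also have "... = s" unfolding s_def using QE by (intro finsum_cong') auto
  finally show "s \<otimes> e = s" .
 qed
 have "s = e"
 proof (rule ccontr)
  assume "s ~= e"
  define h where "h = e \<ominus> s"
  have hC: "h : carrier R" "h ~= \<zero>"
   using eC sC `s ~= e` by (auto simp: h_def dest: eq_if_minus_zero)
  have "(e \<ominus> s) \<otimes> (e \<ominus> s) = e \<otimes> e \<ominus> s \<otimes> e \<ominus> (s \<otimes> e \<ominus> s \<otimes> s)" using eC(1) sC by algebra
  then have hh: "h \<otimes> h = h" using ss eC sC by (simp add: h_def a_minus_def r_neg)
  have "(e \<ominus> s) \<otimes> e = e \<otimes> e \<ominus> s \<otimes> e" using eC(1) sC by algebra
  then have he: "h \<otimes> e = h" using ss eC by (simp add: h_def)
  have hE: "h' \<otimes> h = \<zero>" "h \<otimes> h' = \<zero>" if "h' : E" for h'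
  proof -
   have C: "h' : carrier R" using QE that by simp
   then have "h' \<otimes> (e \<ominus> s) = h' \<otimes> e \<ominus> h' \<otimes> s" using eC(1) sC by algebra
   then show "h' \<otimes> h = \<zero>" using hs[OF that] QE(4)[OF that] C by (simp add: h_def a_minus_def r_neg)
   then show "h \<otimes> h' = \<zero>" using C hC by (simp add: m_comm)
  qed
  have "h \<notin> E" using hE hh hC by force
  moreover have "Q (insert h E)" using E(1) hC hh he hE by (auto simp: Q_def)
  ultimately show False using E(2)[of "insert h E"] fin by simp
 qed
 moreover have "local_idem R h" if h: "h : E" for h
 proof (rule primitive_idem_local)
  show "fd_idem R h D" using QE[OF h] fd_idem_sub[OF e] by blast
  show "h ~= \<zero>" using QE[OF h] by simp
  fix g assume g: "g : carrier R" "g \<otimes> g = g" "g \<otimes> h = g"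
  show "g = \<zero> | g = h"
  proof (rule ccontr)
   assume ng: "~ (g = \<zero> | g = h)"
   have hC: "h : carrier R" "h \<otimes> h = h" "h \<otimes> e = h" using QE[OF h] by auto
   define k where "k = h \<ominus> g"
   have k: "k : carrier R" "k ~= \<zero>" using ng hC g by (auto simp: k_def dest: eq_if_minus_zero)
   have "(h \<ominus> g) \<otimes> (h \<ominus> g) = h \<otimes> h \<ominus> g \<otimes> h \<ominus> (g \<otimes> h \<ominus> g \<otimes> g)" using hC(1) g(1) by algebra
   then have kk: "k \<otimes> k = k" using g hC by (simp add: k_def a_minus_def r_neg)
   have gk: "g \<otimes> k = \<zero>" "k \<otimes> g = \<zero>"
   proof -
    have "g \<otimes> (h \<ominus> g) = g \<otimes> h \<ominus> g \<otimes> g" using hC(1) g(1) by algebra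
    then show "g \<otimes> k = \<zero>" using g by (simp add: k_def a_minus_def r_neg)
    then show "k \<otimes> g = \<zero>" using g k by (simp add: m_comm)
   qed
   have kh: "k \<otimes> h = k"
   proof -
    have "(h \<ominus> g) \<otimes> h = h \<otimes> h \<ominus> g \<otimes> h" using hC(1) g(1) by algebra
    then show ?thesis using g hC by (simp add: k_def)
   qed
   have below: "x \<otimes> e = x" "!!h'. h' : E ==> h' ~= h ==> x \<otimes> h' = \<zero> & h' \<otimes> x = \<zero>"
    if x: "x : carrier R" "x \<otimes> h = x" for x
   proof -
    have "x \<otimes> (h \<otimes> e) = (x \<otimes> h) \<otimes> e" using x(1) hC(1) eC(1) by (simp add: m_assoc)
    then show "x \<otimes> e = x" using hC(3) x(2) by simp
    fix h' assume h': "h' : E" "h' ~= h"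
    have "x \<otimes> h' = x \<otimes> (h \<otimes> h')" using x hC QE(1)[OF h'(1)] by (simp add: m_assoc[symmetric])
    then have "x \<otimes> h' = \<zero>" using orth[OF h h'(1)] h'(2) x by simp
    then show "x \<otimes> h' = \<zero> & h' \<otimes> x = \<zero>" using x QE(1)[OF h'(1)] by (simp add: m_comm)
   qed
   define E' where "E' = insert g (insert k (E - {h}))"
   have "g ~= k" using gk g ng by force
   have "g \<notin> E - {h}" using below(2)[OF g(1,3)] g ng by force
   moreover have "k \<notin> E - {h}" using below(2)[OF k(1) kh] kk k by force
   ultimately have "card E' = Suc (card E)"
    using `g ~= k` fin h card_Suc_Diff1[OF fin h] by (simp add: E'_def)
   moreover have "Q E'"
    unfolding Q_def E'_def using fin QE orth g k kk gk ng below[OF g(1,3)] below[OF k(1) kh] by auto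
   ultimately show False using E(2)[of E'] by simp
  qed
 qed
 ultimately show thesis using that[of E] fin QE orth by (auto simp: s_def)
qed

section \<open>Free summands of a power\<close>

context module
begin

abbreviation dual_at :: "'a => 'i set => ('i => 'c) => ('i => 'c => 'a) => bool" where
 "dual_at e == dual_setting.dual_family R M e (%x. x)"

lemma dual_setting_id: "e : carrier R ==> e \<otimes> e = e ==> dual_setting R M e (%x. x)"
 by unfold_locales auto

lemma dual_at_iff:
 assumes "e : carrier R" "e \<otimes> e = e"
 shows "dual_at e I x f \<longleftrightarrow> finite I & (ALL s:I. x s : carrier M & e \<odot>\<^bsub>M\<^esub> x s = x s) &
  (ALL s:I. f s : duals R M & (ALL y:carrier M. e \<otimes> f s y = f s y)) &
  (ALL s:I. ALL t:I. f s (x t) = (if s = t then e else \<zero>))"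
 unfolding dual_setting.dual_family_def[OF dual_setting_id[OF assms]] by auto

lemma dual_at_add:
 assumes e: "e : carrier R" "e \<otimes> e = e" and h: "h : carrier R" "h \<otimes> h = h" and eh: "e \<otimes> h = \<zero>"
  and D: "dual_at e I x f" and D': "dual_at h I x' f'"
 shows "dual_at (e \<oplus> h) I (%s. x s \<oplus>\<^bsub>M\<^esub> x' s) (%s y. f s y \<oplus> f' s y)"
proof -
 have he: "h \<otimes> e = \<zero>" using eh e h by (simp add: R.m_comm)
 have s: "e \<oplus> h : carrier R" "(e \<oplus> h) \<otimes> (e \<oplus> h) = e \<oplus> h"
  using e h eh he by (auto simp: R.l_distr R.r_distr)
 note D1 = D[unfolded dual_at_iff[OF e]] and D2 = D'[unfolded dual_at_iff[OF h]]
 have fC: "f s y : carrier R" "f' s y : carrier R" if "s : I" "y : carrier M" for s y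
  using D1 D2 dualsD(1) that by fast+
 have xC: "x s : carrier M" "x' s : carrier M" if "s : I" for s using D1 D2 that by auto
 have ex: "e \<odot>\<^bsub>M\<^esub> x' s = \<zero>\<^bsub>M\<^esub>" "h \<odot>\<^bsub>M\<^esub> x s = \<zero>\<^bsub>M\<^esub>" if "s : I" for s
 proof -
  have "e \<odot>\<^bsub>M\<^esub> x' s = e \<odot>\<^bsub>M\<^esub> (h \<odot>\<^bsub>M\<^esub> x' s)" using D2 that by simp
  then show "e \<odot>\<^bsub>M\<^esub> x' s = \<zero>\<^bsub>M\<^esub>" using e h xC[OF that] eh by (simp add: smult_assoc1[symmetric])
  have "h \<odot>\<^bsub>M\<^esub> x s = h \<odot>\<^bsub>M\<^esub> (e \<odot>\<^bsub>M\<^esub> x s)" using D1 that by simp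
  then show "h \<odot>\<^bsub>M\<^esub> x s = \<zero>\<^bsub>M\<^esub>" using e h xC[OF that] he by (simp add: smult_assoc1[symmetric])
 qed
 have ef: "e \<otimes> f' s y = \<zero>" "h \<otimes> f s y = \<zero>" if "s : I" "y : carrier M" for s y
 proof -
  have "e \<otimes> f' s y = e \<otimes> (h \<otimes> f' s y)" using D2 that by simp
  then show "e \<otimes> f' s y = \<zero>" using e h fC[OF that] eh by (simp add: R.m_assoc[symmetric])
  have "h \<otimes> f s y = h \<otimes> (e \<otimes> f s y)" using D1 that by simp
  then show "h \<otimes> f s y = \<zero>" using e h fC[OF that] he by (simp add: R.m_assoc[symmetric])
 qed
 have cross: "f s (x' t) = \<zero>" "f' s (x t) = \<zero>" if st: "s : I" "t : I" for s t
 proof -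
  have "f s (x' t) = f s (h \<odot>\<^bsub>M\<^esub> x' t)" using D2 st by simp
  also have "... = h \<otimes> f s (x' t)" using D1 st h xC dualsD(3)[of "f s" R M h "x' t"] by simp
  finally show "f s (x' t) = \<zero>" using ef(2)[OF st(1), of "x' t"] xC st by simp
  have "f' s (x t) = f' s (e \<odot>\<^bsub>M\<^esub> x t)" using D1 st by simp
  also have "... = e \<otimes> f' s (x t)" using D2 st e xC dualsD(3)[of "f' s" R M e "x t"] by simp
  finally show "f' s (x t) = \<zero>" using ef(1)[OF st(1), of "x t"] xC st by simp
 qed
 have F: "(%y. f s y \<oplus> f' s y) : duals R M" if "s : I" for s
 proof -
  have "f s : duals R M" "f' s : duals R M" using D1 D2 that by auto
  note dualsD[OF this(1)] dualsD[OF this(2)]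
  then show ?thesis by (auto simp: duals_def R.r_distr R.a_ac)
 qed
 have "(e \<oplus> h) \<odot>\<^bsub>M\<^esub> (x s \<oplus>\<^bsub>M\<^esub> x' s) = x s \<oplus>\<^bsub>M\<^esub> x' s" if "s : I" for s
  using D1 D2 that e h xC[OF that] ex[OF that] by (simp add: smult_l_distr smult_r_distr)
 moreover have "(e \<oplus> h) \<otimes> (f s y \<oplus> f' s y) = f s y \<oplus> f' s y" if "s : I" "y : carrier M" for s y
  using D1 D2 that e h fC[OF that] ef[OF that] by (simp add: R.l_distr R.r_distr)
 moreover have "f s (x t \<oplus>\<^bsub>M\<^esub> x' t) \<oplus> f' s (x t \<oplus>\<^bsub>M\<^esub> x' t) = (if s = t then e \<oplus> h else \<zero>)"
  if "s : I" "t : I" for s t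
 proof -
  have "f s : duals R M" "f' s : duals R M" using D1 D2 that by auto
  note dualsD[OF this(1)] dualsD[OF this(2)]
  then show ?thesis using D1 D2 that xC cross[OF that] e h by auto
 qed
 ultimately show ?thesis
  unfolding dual_at_iff[OF s] using D1 F xC by simp
qed

text \<open>
 Let \<open>g\<close>, \<open>xi\<close> exhibit a free summand of rank \<open>card A\<close> in the \<open>N\<close>-th power of \<open>M\<close>. If the free summand of
 rank \<open>r\<close> in \<open>M\<close> could not be enlarged, all pairings would factor through it modulo the residue
 ideal, so that the \<open>card A\<close> functionals would factor through dimension \<open>N * r\<close>.
\<close>

lemma dual_at_local_step:
 fixes A :: "'i set"
 assumes e: "local_idem R e" and A: "finite A"
  and g: "!!a t. a : A ==> t < N ==> g a t : duals R M"
  and xi: "!!a t. a : A ==> t < N ==> xi a t : carrier M"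
  and pair: "!!a c. a : A ==> c : A ==> (\<Oplus>t\<in>{..<N}. g a t (xi c t)) \<otimes> e = (if a = c then e else \<zero>)"
  and D: "dual_at e {..<r::nat} x f" and lt: "N * r < card A"
 shows "EX x f. dual_at e {..<Suc r} x f"
proof (rule ccontr)
 assume no: "~ ?thesis"
 have eC: "e : carrier R" "e \<otimes> e = e" using e by (auto simp: local_idem_def)
 interpret dual_setting R M e "%x. x" by (rule dual_setting_id[OF eC])
 interpret RI: ideal "res_ideal R e" R using e by (simp add: local_idem_def)
 note D' = dual_familyD[OF D]
 have res: "h y \<ominus> (\<Oplus>s\<in>{..<r}. f s y \<otimes> h (x s)) : res_ideal R e"
  if h: "h : duals R M" and y: "y : carrier M" for h y
 proof (rule ccontr)
  have "h y \<ominus> (\<Oplus>s\<in>{..<r}. f s y \<otimes> h (x s)) : carrier R"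
   using D' y dualsD(1)[OF h] by (auto intro!: R.finsum_closed)
  moreover assume "h y \<ominus> (\<Oplus>s\<in>{..<r}. f s y \<otimes> h (x s)) \<notin> res_ideal R e"
  ultimately obtain u where u: "u : carrier R" "u \<otimes> (h y \<ominus> (\<Oplus>s\<in>{..<r}. f s y \<otimes> h (x s))) \<otimes> e = e"
   unfolding res_ideal_def by blast
  have "r \<notin> {..<r}" by simp
  from dual_family_extend[OF D this y h u] no show False unfolding lessThan_Suc by blast
 qed
 have "card ({..<N} \<times> {..<r}) < card A" using lt by simp
 moreover have "g a (fst ts) (x (snd ts)) : carrier R" if "ts : {..<N} \<times> {..<r}" "a : A" for ts a
  using that D' g dualsD(1) by (metis SigmaE fst_conv lessThan_iff snd_conv)
 ultimately obtain c where c: "ALL a:A. c a : carrier R" "EX a:A. c a \<notin> res_ideal R e"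
   "ALL ts:{..<N} \<times> {..<r}. (\<Oplus>a\<in>A. c a \<otimes> g a (fst ts) (x (snd ts))) : res_ideal R e"
  using R.local_idem_system[OF e _ A, of "{..<N} \<times> {..<r}" "%ts a. g a (fst ts) (x (snd ts))"] by blast
 then obtain b where b: "b : A" "c b \<notin> res_ideal R e" by blast
 have bC: "c b : carrier R" using c b by blast
 define G where "G t = (%z. \<Oplus>a\<in>A. c a \<otimes> g a t z)" for t
 have G: "G t : duals R M" if "t < N" for t
  unfolding G_def using A g c that by (intro functional_sum) auto
 have sumI: "(\<Oplus>s\<in>S. F s) : res_ideal R e" if "finite S" "!!s. s : S ==> F s : res_ideal R e" for S :: "nat set" and F
  using that
 proof (induction S rule: finite_induct)
  case (insert s S)
  then show ?case using RI.Icarr by (subst R.finsum_insert) auto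
 qed simp
 have Gin: "G t z : res_ideal R e" if t: "t < N" and z: "z : carrier M" for t z
 proof -
  have "G t (x s) : res_ideal R e" if "s < r" for s
   using c(3) t that by (auto simp: G_def)
  then have 1: "(\<Oplus>s\<in>{..<r}. f s z \<otimes> G t (x s)) : res_ideal R e"
   using D' z by (intro sumI) (auto intro!: RI.I_l_closed)
  have 2: "G t z \<ominus> (\<Oplus>s\<in>{..<r}. f s z \<otimes> G t (x s)) : res_ideal R e"
   using res[OF G[OF t] z] .
  have "a = (a \<ominus> d) \<oplus> d" if "a : carrier R" "d : carrier R" for a d using that by algebra
  then have "G t z = (G t z \<ominus> (\<Oplus>s\<in>{..<r}. f s z \<otimes> G t (x s))) \<oplus> (\<Oplus>s\<in>{..<r}. f s z \<otimes> G t (x s))"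
   using 1 RI.Icarr dualsD(1)[OF G[OF t] z] by blast
  then show ?thesis using 1 2 RI.a_closed by metis
 qed
 have gC: "g a t (xi b t) : carrier R" if "a : A" "t < N" for a t
  using dualsD(1)[OF g[OF that]] xi[OF b(1) that(2)] by blast
 have "(\<Oplus>t\<in>{..<N}. G t (xi b t)) : res_ideal R e"
  using Gin xi b by (intro sumI) auto
 then have 3: "e \<otimes> (\<Oplus>t\<in>{..<N}. G t (xi b t)) : res_ideal R e" using eC by (auto intro!: RI.I_l_closed)
 have "(\<Oplus>t\<in>{..<N}. G t (xi b t)) = (\<Oplus>a\<in>A. \<Oplus>t\<in>{..<N}. c a \<otimes> g a t (xi b t))"
  unfolding G_def using A c gC by (intro R.finsum_swap) auto
 also have "... = (\<Oplus>a\<in>A. c a \<otimes> (\<Oplus>t\<in>{..<N}. g a t (xi b t)))"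
  using c gC by (intro R.finsum_cong') (auto simp: R.finsum_rdistr intro!: R.finsum_closed)
 finally have "e \<otimes> (\<Oplus>t\<in>{..<N}. G t (xi b t)) = (\<Oplus>a\<in>A. e \<otimes> (c a \<otimes> (\<Oplus>t\<in>{..<N}. g a t (xi b t))))"
  using A c gC eC by (subst R.finsum_rdistr[symmetric]) (auto intro!: R.finsum_closed)
 also have "... = (\<Oplus>a\<in>A. c a \<otimes> (if a = b then e else \<zero>))"
 proof (intro R.finsum_cong')
  fix a assume a: "a : A"
  have "(\<Oplus>t\<in>{..<N}. g a t (xi b t)) : carrier R" using gC a by (auto intro!: R.finsum_closed)
  then have "e \<otimes> (c a \<otimes> (\<Oplus>t\<in>{..<N}. g a t (xi b t))) = c a \<otimes> ((\<Oplus>t\<in>{..<N}. g a t (xi b t)) \<otimes> e)"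
   using c a eC by (simp add: R.m_ac)
  then show "e \<otimes> (c a \<otimes> (\<Oplus>t\<in>{..<N}. g a t (xi b t))) = c a \<otimes> (if a = b then e else \<zero>)"
   using pair[OF a b(1)] by simp
 qed (use c eC in auto)
 also have "... = c b \<otimes> e"
  using A b c eC by (subst R.finsum_delta[of A b]) auto
 finally have "c b \<otimes> e : res_ideal R e" using 3 by simp
 moreover obtain y where y: "y : carrier R" "y \<otimes> c b \<otimes> e = e" using b bC unfolding res_ideal_def by blast
 moreover have "y \<otimes> (c b \<otimes> e) \<otimes> e = y \<otimes> c b \<otimes> (e \<otimes> e)" using y(1) bC by (simp add: R.m_assoc)
 ultimately show False using eC(2) unfolding res_ideal_def by auto
qed

text \<open>Over a local ring the rank grows step by step; in general one argues block by block.\<close>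

lemma dual_at_of_power:
 fixes A :: "'i set"
 assumes e: "fd_idem R e D" and A: "finite A"
  and g: "!!a t. a : A ==> t < N ==> g a t : duals R M"
  and xi: "!!a t. a : A ==> t < N ==> xi a t : carrier M"
  and pair: "!!a c. a : A ==> c : A ==> (\<Oplus>t\<in>{..<N}. g a t (xi c t)) = (if a = c then e else \<zero>)"
  and r: "!!r'. r' < r ==> N * r' < card A"
 shows "EX x f. dual_at e {..<r::nat} x f"
proof -
 have eC: "e : carrier R" "e \<otimes> e = e" using e by (auto simp: fd_idem_def)
 obtain E where E: "finite E" "(\<Oplus>h\<in>E. h) = e"
  "!!h. h : E ==> h \<otimes> h = h & h \<otimes> e = h & local_idem R h"
  "!!h h'. h : E ==> h' : E ==> h ~= h' ==> h \<otimes> h' = \<zero>"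
  using R.primitive_decomposition[OF e] by metis
 have hC: "h : carrier R" if "h : E" for h using E(3)[OF that] by (simp add: local_idem_def)
 have loc: "EX x f. dual_at h {..<k} x f" if h: "h : E" and k: "k <= r" for h k
  using k
 proof (induction k)
  case 0
  have "dual_at h ({}::nat set) (%_. \<zero>\<^bsub>M\<^esub>) (%_ _. \<zero>)"
   using E(3)[OF h] hC[OF h] by (subst dual_at_iff) auto
  then show ?case unfolding lessThan_0 by blast
 next
  case (Suc k)
  then obtain x f where "dual_at h {..<k} x f" by auto
  moreover have "(\<Oplus>t\<in>{..<N}. g a t (xi c t)) \<otimes> h = (if a = c then h else \<zero>)" if "a : A" "c : A" for a c
   using pair[OF that] E(3)[OF h] hC[OF h] eC by (simp add: R.m_comm)
  ultimately show ?case
   using E(3)[OF h] r[of k] Suc.prems by (intro dual_at_local_step[OF _ A g xi]) auto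
 qed
 have "EX x f. dual_at (\<Oplus>h\<in>F. h) {..<r} x f & (\<Oplus>h\<in>F. h) \<otimes> (\<Oplus>h\<in>F. h) = (\<Oplus>h\<in>F. h)" if "finite F" "F \<subseteq> E" for F
  using that
 proof (induction F rule: finite_induct)
  case empty
  have "dual_at \<zero> {..<r} (%_. \<zero>\<^bsub>M\<^esub>) (%_ _. \<zero>)"
   by (subst dual_at_iff) (auto simp: duals_def)
  then show ?case by auto
 next
  case (insert h F)
  define s where "s = (\<Oplus>h\<in>F. h)"
  have sC: "s : carrier R" using insert.prems hC by (auto simp: s_def intro!: R.finsum_closed)
  obtain x f where xf: "dual_at s {..<r} x f" "s \<otimes> s = s" using insert by (auto simp: s_def)
  obtain x' f' where x'f': "dual_at h {..<r} x' f'" using loc[of h r] insert.prems by auto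
  have "h \<otimes> s = (\<Oplus>h'\<in>F. h \<otimes> h')"
   unfolding s_def using insert hC by (subst R.finsum_rdistr) auto
  also have "... = \<zero>" using insert E(4) by (intro R.add.finprod_one_eqI) auto
  finally have hs: "h \<otimes> s = \<zero>" .
  have h: "h : carrier R" "h \<otimes> h = h" using hC E(3) insert.prems by auto
  have eq: "(\<Oplus>h\<in>insert h F. h) = h \<oplus> s" unfolding s_def using insert hC by (subst R.finsum_insert) auto
  have "(h \<oplus> s) \<otimes> (h \<oplus> s) = h \<oplus> s"
   using h sC xf(2) hs by (simp add: R.l_distr R.r_distr R.m_comm[of s h])
  then show ?case unfolding eq using dual_at_add[OF h sC xf(2) hs x'f' xf(1)] by blast
 qed
 from this[of E] show ?thesis using E by auto
qed

end

section \<open>Bimodules over a product of fields\<close>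

lemma carrier_right_module [simp]: "carrier (right_module P) = carrier P"
 and zero_right_module [simp]: "\<zero>\<^bsub>right_module P\<^esub> = \<zero>\<^bsub>P\<^esub>"
 and add_right_module [simp]: "x \<oplus>\<^bsub>right_module P\<^esub> y = x \<oplus>\<^bsub>P\<^esub> y"
 and smult_right_module [simp]: "r \<odot>\<^bsub>right_module P\<^esub> x = rsmult P x r"
 by (simp_all add: right_module_def)

lemma finsum_right_module [simp]: "finsum (right_module P) f A = finsum P f A"
 by (simp add: finsum_def finprod_def right_module_def)

locale comm_bimodule = l: module L P + r: module L "right_module P"
 for L (structure) and P :: "('a, 'a, 'p) bimodule" +
 assumes rs_ls: "[|l : carrier L; x : carrier P; m : carrier L|] ==>
  rsmult P (l \<odot>\<^bsub>P\<^esub> x) m = l \<odot>\<^bsub>P\<^esub> rsmult P x m"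
begin

abbreviation CL where "CL == carrier L"
abbreviation CP where "CP == carrier P"
abbreviation ls (infixl "\<cdot>" 70) where "l \<cdot> x == l \<odot>\<^bsub>P\<^esub> x"
abbreviation rs (infixl "\<star>" 70) where "x \<star> l == rsmult P x l"

lemma rs_closed [simp]: "[|x : CP; l : CL|] ==> x \<star> l : CP"
 using r.smult_closed[of l x] by simp

lemma rs_distr: "[|x : CP; l : CL; m : CL|] ==> x \<star> (l \<oplus> m) = x \<star> l \<oplus>\<^bsub>P\<^esub> x \<star> m"
 using r.smult_l_distr[of l m x] by simp

lemma rs_add: "[|x : CP; y : CP; l : CL|] ==> (x \<oplus>\<^bsub>P\<^esub> y) \<star> l = x \<star> l \<oplus>\<^bsub>P\<^esub> y \<star> l"
 using r.smult_r_distr[of l x y] by simp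

lemma rs_assoc: "[|x : CP; l : CL; m : CL|] ==> x \<star> l \<star> m = x \<star> (l \<otimes> m)"
 using r.smult_assoc1[of m l x] by (simp add: l.R.m_comm)

lemma rs_one [simp]: "x : CP ==> x \<star> \<one> = x"
 using r.smult_one[of x] by simp

lemma rs_null [simp]: "x : CP ==> x \<star> \<zero> = \<zero>\<^bsub>P\<^esub>"
 using r.smult_l_null[of x] by simp

lemma rs_zero [simp]: "l : CL ==> \<zero>\<^bsub>P\<^esub> \<star> l = \<zero>\<^bsub>P\<^esub>"
 using r.smult_r_null[of l] by simp

lemma rs_finsum:
 "[|finite A; l : CL; !!a. a : A ==> f a : CP|] ==> (\<Oplus>\<^bsub>P\<^esub>a\<in>A. f a) \<star> l = (\<Oplus>\<^bsub>P\<^esub>a\<in>A. f a \<star> l)"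
 using r.finsum_smult_ldistr[of A l f] by auto

lemma rs_finsum_right:
 assumes "finite A" "x : CP" "!!a. a : A ==> f a : CL"
 shows "x \<star> (\<Oplus>a\<in>A. f a) = (\<Oplus>\<^bsub>P\<^esub>a\<in>A. x \<star> f a)"
 using assms(1,3)
 by (induction A rule: finite_induct) (auto simp: assms(2) rs_distr Pi_def l.R.finsum_closed)

lemma smult_finsum_left:
 assumes "finite A" "x : CP" "!!a. a : A ==> f a : CL"
 shows "(\<Oplus>a\<in>A. f a) \<cdot> x = (\<Oplus>\<^bsub>P\<^esub>a\<in>A. f a \<cdot> x)"
 using assms(1,3)
 by (induction A rule: finite_induct) (auto simp: assms(2) l.smult_l_distr Pi_def l.R.finsum_closed)

text \<open>A balanced map \<open>P \<times> P \<rightarrow> L\<close> is a left linear functional on \<open>P \<otimes> P\<close>.\<close>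

definition balanced :: "('p => 'p => 'a) => bool" where
 "balanced B \<longleftrightarrow>
  (ALL x:CP. ALL y:CP. B x y : CL) &
  (ALL x:CP. ALL x':CP. ALL y:CP. B (x \<oplus>\<^bsub>P\<^esub> x') y = B x y \<oplus> B x' y) &
  (ALL x:CP. ALL y:CP. ALL y':CP. B x (y \<oplus>\<^bsub>P\<^esub> y') = B x y \<oplus> B x y') &
  (ALL l:CL. ALL x:CP. ALL y:CP. B (l \<cdot> x) y = l \<otimes> B x y) &
  (ALL l:CL. ALL x:CP. ALL y:CP. B (x \<star> l) y = B x (l \<cdot> y))"

lemma balanced_compose:
 assumes f: "f : duals L P" and g: "g : duals L P"
 shows "balanced (%x y. f (x \<star> g y))"
 using dualsD[OF f] dualsD[OF g]
 by (auto simp: balanced_def rs_add rs_distr rs_ls rs_assoc)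

lemma balanced_finsum_right:
 assumes "balanced B" "x : CP" "finite A" "!!a. a : A ==> y a : CP"
 shows "B x (\<Oplus>\<^bsub>P\<^esub>a\<in>A. y a) = (\<Oplus>a\<in>A. B x (y a))"
proof -
 have 0: "B x \<zero>\<^bsub>P\<^esub> = \<zero>"
 proof -
  have "B x (\<zero> \<cdot> \<zero>\<^bsub>P\<^esub>) = B (x \<star> \<zero>) \<zero>\<^bsub>P\<^esub>" using assms(1,2) unfolding balanced_def
   by (metis l.M.zero_closed l.R.zero_closed)
  also have "... = B (\<zero> \<cdot> \<zero>\<^bsub>P\<^esub>) \<zero>\<^bsub>P\<^esub>" using assms(2) by simp
  also have "... = \<zero> \<otimes> B \<zero>\<^bsub>P\<^esub> \<zero>\<^bsub>P\<^esub>" using assms(1) unfolding balanced_def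
   by (metis l.M.zero_closed l.R.zero_closed)
  also have "... = \<zero>" using assms(1) by (simp add: balanced_def)
  finally show ?thesis by simp
 qed
 show ?thesis
  using assms(3,4)
 proof (induction A rule: finite_induct)
  case (insert a A)
  then have "B x (\<Oplus>\<^bsub>P\<^esub>a\<in>insert a A. y a) = B x (y a \<oplus>\<^bsub>P\<^esub> (\<Oplus>\<^bsub>P\<^esub>a\<in>A. y a))"
   by (subst l.M.finsum_insert) auto
  also have "... = B x (y a) \<oplus> B x (\<Oplus>\<^bsub>P\<^esub>a\<in>A. y a)"
   using assms(1,2) insert by (simp add: balanced_def l.M.finsum_closed)
  also have "... = (\<Oplus>a\<in>insert a A. B x (y a))"
   using insert assms(1,2) by (subst l.R.finsum_insert) (auto simp: balanced_def)
  finally show ?case .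
 qed (simp add: 0)
qed

lemma balanced_finsum_left:
 assumes "balanced B" "y : CP" "finite A" "!!a. a : A ==> x a : CP"
 shows "B (\<Oplus>\<^bsub>P\<^esub>a\<in>A. x a) y = (\<Oplus>a\<in>A. B (x a) y)"
proof -
 have "(%x. B x y) : duals L P" using assms(1,2) by (auto simp: balanced_def duals_def)
 from l.functional_finsum[OF this assms(3,4)] show ?thesis by simp
qed

end

locale split_bimodule = comm_bimodule L P for L (structure) and P :: "('a, 'a, 'p) bimodule" +
 fixes n :: nat and e :: "nat => 'a"
  and V :: "'v set" and v :: "'v => 'p" and v' :: "'v => 'p => 'a"
  and W :: "'w set" and w :: "'w => 'p" and w' :: "'w => 'p => 'a"
 assumes e_field: "i < n ==> field_idem L (e i)"
  and e_orth: "[|i < n; j < n; i ~= j|] ==> e i \<otimes> e j = \<zero>"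
  and e_sum: "(\<Oplus>i\<in>{..<n}. e i) = \<one>"
  and V_finite: "finite V" and v_closed: "r : V ==> v r : CP"
  and v'_functional: "r : V ==> v' r : duals L P"
  and v_expand: "x : CP ==> x = (\<Oplus>\<^bsub>P\<^esub>r\<in>V. v' r x \<cdot> v r)"
  and W_finite: "finite W" and w_closed: "q : W ==> w q : CP"
  and w'_functional: "q : W ==> w' q : duals L (right_module P)"
  and w_expand: "x : CP ==> x = (\<Oplus>\<^bsub>P\<^esub>q\<in>W. w q \<star> w' q x)"
begin

lemma e_closed [simp]: "i < n ==> e i : CL"
 and e_idem [simp]: "i < n ==> e i \<otimes> e i = e i"
 and e_nonzero: "i < n ==> e i ~= \<zero>"
 using e_field by (auto simp: field_idem_def)

lemma e_inverse: "[|i < n; b : CL; b \<otimes> e i ~= \<zero>|] ==> EX y:CL. y \<otimes> b \<otimes> e i = e i"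
 using e_field[of i] by (auto simp: field_idem_def)

lemma split_scalar: "l : CL ==> l = (\<Oplus>i\<in>{..<n}. l \<otimes> e i)"
 using l.R.finsum_rdistr[of "{..<n}" l e] by (simp add: e_sum Pi_def)

lemma scalar_nonzero_component:
 assumes "l : CL" "l ~= \<zero>"
 shows "EX i<n. l \<otimes> e i ~= \<zero>"
proof (rule ccontr)
 assume "~ ?thesis"
 then have "(\<Oplus>i\<in>{..<n}. l \<otimes> e i) = \<zero>" by (intro l.R.add.finprod_one_eqI) auto
 with split_scalar[OF assms(1)] assms(2) show False by simp
qed

lemma split_left: "x : CP ==> x = (\<Oplus>\<^bsub>P\<^esub>i\<in>{..<n}. e i \<cdot> x)"
 using smult_finsum_left[of "{..<n}" x e] by (simp add: e_sum)

lemma split_right: "x : CP ==> x = (\<Oplus>\<^bsub>P\<^esub>i\<in>{..<n}. x \<star> e i)"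
 using rs_finsum_right[of "{..<n}" x e] by (simp add: e_sum)

lemma left_setting:
 assumes "i < n" "j < n"
 shows "projective_dual_setting L P (e i) (%x. x \<star> e j) V v v'"
 using assms
 by unfold_locales (auto simp: rs_add rs_ls rs_assoc V_finite v_closed v'_functional v_expand[symmetric])

lemma right_setting:
 assumes "i < n" "j < n"
 shows "projective_dual_setting L (right_module P) (e j) (%x. e i \<cdot> x) W w w'"
 using assms
 by unfold_locales (auto simp: l.smult_r_distr rs_ls l.smult_assoc1[symmetric]
   W_finite w_closed w'_functional w_expand[symmetric])

abbreviation left_dual :: "nat => nat => 'i set => ('i => 'p) => ('i => 'p => 'a) => bool" where
 "left_dual i j == dual_setting.dual_family L P (e i) (%x. x \<star> e j)"

abbreviation right_dual :: "nat => nat => 'i set => ('i => 'p) => ('i => 'p => 'a) => bool" where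
 "right_dual i j == dual_setting.dual_family L (right_module P) (e j) (%x. e i \<cdot> x)"

text \<open>
 A left frame for \<open>(i, j)\<close> is a basis of the left vector space \<open>e\<^sub>i P e\<^sub>j\<close> over \<open>e\<^sub>i L\<close> with its dual
 basis, a right frame one of the same space over \<open>e\<^sub>j L\<close>.
\<close>

definition left_frame :: "nat => nat => 'i set => ('i => 'p) => ('i => 'p => 'a) => bool" where
 "left_frame i j F u f \<longleftrightarrow> left_dual i j F u f &
  (ALL y:CP. e i \<cdot> (y \<star> e j) = (\<Oplus>\<^bsub>P\<^esub>s\<in>F. f s y \<cdot> u s))"

definition right_frame :: "nat => nat => 'i set => ('i => 'p) => ('i => 'p => 'a) => bool" where
 "right_frame i j F u f \<longleftrightarrow> right_dual i j F u f &
  (ALL y:CP. e i \<cdot> (y \<star> e j) = (\<Oplus>\<^bsub>P\<^esub>s\<in>F. u s \<star> f s y))"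

lemma left_dualD:
 assumes ij: "i < n" "j < n" and D: "left_dual i j F u f"
 shows "finite F" "s : F ==> u s : CP" "s : F ==> e i \<cdot> u s = u s" "s : F ==> u s \<star> e j = u s"
  "s : F ==> f s : duals L P" "s : F ==> y : CP ==> e i \<otimes> f s y = f s y"
  "s : F ==> y : CP ==> f s (y \<star> e j) = f s y" "s : F ==> t : F ==> f s (u t) = (if s = t then e i else \<zero>)"
  "s : F ==> y : CP ==> f s y : CL"
 using dual_setting.dual_familyD[OF projective_dual_setting.axioms(1)[OF left_setting[OF ij]] D] by auto

lemma right_dualD:
 assumes ij: "i < n" "j < n" and D: "right_dual i j F u f"
 shows "finite F" "s : F ==> u s : CP" "s : F ==> e i \<cdot> u s = u s" "s : F ==> u s \<star> e j = u s"
  "s : F ==> f s : duals L (right_module P)" "s : F ==> y : CP ==> e j \<otimes> f s y = f s y"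
  "s : F ==> y : CP ==> f s (e i \<cdot> y) = f s y" "s : F ==> t : F ==> f s (u t) = (if s = t then e j else \<zero>)"
  "s : F ==> y : CP ==> f s y : CL"
 using dual_setting.dual_familyD[OF projective_dual_setting.axioms(1)[OF right_setting[OF ij]] D] by auto

lemma left_dual_extend_frame:
 assumes ij: "i < n" "j < n" and D: "left_dual i j (I0 :: 'i set) x0 f0" and inf: "infinite (UNIV :: 'i set)"
 obtains I x f where "I0 \<subseteq> I" "!!s. s : I0 ==> x s = x0 s" "!!s. s : I0 ==> f s = f0 s" "left_frame i j I x f"
proof -
 interpret projective_dual_setting L P "e i" "%x. x \<star> e j" V v v' by (rule left_setting[OF ij])
 show thesis
 proof (rule dual_family_complete[OF e_field[OF ij(1)] inf D])
  fix I x f assume a: "I0 \<subseteq> I" "!!s. s : I0 ==> x s = x0 s" "!!s. s : I0 ==> f s = f0 s"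
   "left_dual i j I x f" "!!y. y : CP ==> e i \<cdot> (y \<star> e j) = (\<Oplus>\<^bsub>P\<^esub>s\<in>I. f s y \<cdot> x s)"
  have fr: "left_frame i j I x f" unfolding left_frame_def using a(4,5) by blast
  show thesis by (rule that[of I x f]) (use a(1-3) fr in auto)
 qed
qed

lemma right_frame_exists:
 assumes ij: "i < n" "j < n"
 shows "EX (I :: nat set) x f. right_frame i j I x f"
proof -
 interpret projective_dual_setting L "right_module P" "e j" "%x. e i \<cdot> x" W w w' by (rule right_setting[OF ij])
 have "dual_family ({}::nat set) undefined undefined" by (simp add: dual_family_def)
 from dual_family_complete[OF e_field[OF ij(2)] infinite_UNIV_nat this]
 obtain I x f where "dual_family (I :: nat set) x f"
  "!!y. y : CP ==> (e i \<cdot> y) \<star> e j = (\<Oplus>\<^bsub>P\<^esub>s\<in>I. x s \<star> f s y)" by auto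
 then show ?thesis unfolding right_frame_def using ij by (auto simp: rs_ls)
qed

lemma left_frame_vanish:
 assumes ij: "i < n" "j < n" and F: "left_frame i j F u f" and g: "g : duals L P"
  and 0: "!!s. s : F ==> g (u s) \<otimes> e i = \<zero>"
  and y: "y : CP" "e i \<cdot> (y \<star> e j) = y"
 shows "g y \<otimes> e i = \<zero>"
proof -
 have "left_dual i j F u f" using F by (simp add: left_frame_def)
 note D = left_dualD[OF ij this]
 have "g y = g (\<Oplus>\<^bsub>P\<^esub>s\<in>F. f s y \<cdot> u s)" using F y by (auto simp: left_frame_def)
 also have "... = (\<Oplus>s\<in>F. f s y \<otimes> g (u s))"
  using D y dualsD[OF g]
  by (subst l.functional_finsum[OF g]) (auto intro!: l.R.finsum_cong')
 finally have "g y \<otimes> e i = (\<Oplus>s\<in>F. f s y \<otimes> g (u s) \<otimes> e i)"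
  using D y ij dualsD[OF g] by (simp add: l.R.finsum_ldistr Pi_def)
 also have "... = \<zero>"
  using D y ij dualsD[OF g] 0 by (intro l.R.add.finprod_one_eqI) (auto simp: l.R.m_assoc)
 finally show ?thesis .
qed

end

text \<open>
 The hypothesis that \<open>P \<otimes> P\<close> is isomorphic to the \<open>d\<close>-th power of \<open>P\<close> enters through the components
 \<open>T t\<close>, \<open>t < d\<close>, of the image of \<open>x \<otimes> y\<close>: functionals on \<open>P \<otimes> P\<close> are \<open>d\<close>-tuples of functionals on \<open>P\<close>,
 and they are determined by their values on pure tensors.
\<close>

locale quasi_galois_bimodule = split_bimodule L P n e V v v' W w w'
 for L (structure) and P :: "('a, 'a, 'p) bimodule" and n e and V :: "'v set" and v v' and W :: "'w set" and w w' +
 fixes d :: nat and T :: "nat => 'p => 'p => 'p"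
 assumes T_closed [simp]: "[|t < d; x : CP; y : CP|] ==> T t x y : CP"
  and T_add_left: "[|t < d; x : CP; x' : CP; y : CP|] ==>
   T t (x \<oplus>\<^bsub>P\<^esub> x') y = T t x y \<oplus>\<^bsub>P\<^esub> T t x' y"
  and T_add_right: "[|t < d; x : CP; y : CP; y' : CP|] ==>
   T t x (y \<oplus>\<^bsub>P\<^esub> y') = T t x y \<oplus>\<^bsub>P\<^esub> T t x y'"
  and T_smult: "[|t < d; l : CL; x : CP; y : CP|] ==> T t (l \<cdot> x) y = l \<cdot> T t x y"
  and T_rsmult: "[|t < d; l : CL; x : CP; y : CP|] ==> T t x (y \<star> l) = T t x y \<star> l"
  and T_balanced: "[|t < d; l : CL; x : CP; y : CP|] ==> T t (x \<star> l) y = T t x (l \<cdot> y)"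
  and T_functional: "balanced B ==> EX chi. (ALL t<d. chi t : duals L P) &
   (ALL x:CP. ALL y:CP. B x y = (\<Oplus>t\<in>{..<d}. chi t (T t x y)))"
  and T_generate: "[|!!t. t < d ==> chi t : duals L P;
   !!x y. [|x : CP; y : CP|] ==> (\<Oplus>t\<in>{..<d}. chi t (T t x y)) = \<zero>; t < d; x : CP|] ==> chi t x = \<zero>"
begin

lemma T_block:
 assumes "t < d" "i < n" "k < n" "x : CP" "y : CP" "e i \<cdot> x = x" "y \<star> e k = y"
 shows "e i \<cdot> (T t x y \<star> e k) = T t x y"
 using assms T_smult[of t "e i" x y] T_rsmult[of t "e k" x y] by simp

text \<open>A family of balanced maps dual to a family of pure tensors stays within the dimension of the \<open>d\<close>-th power.\<close>

lemma tensor_family_card_le: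
 fixes A :: "'i set"
 assumes ik: "i < n" "k < n" and F: "left_frame i k F u f" and A: "finite A"
  and B: "!!a. a : A ==> balanced (B a)"
  and xy: "!!a. a : A ==> x a : CP & y a : CP & e i \<cdot> x a = x a & y a \<star> e k = y a"
  and dual: "!!a b. a : A ==> b : A ==> B a (x b) (y b) = (if a = b then e i else \<zero>)"
 shows "card A <= d * card F"
proof (rule ccontr)
 assume neg: "~ card A <= d * card F"
 have "left_dual i k F u f" using F by (simp add: left_frame_def)
 note D = left_dualD[OF ik this]
 obtain chi where chi: "!!a t. a : A ==> t < d ==> chi a t : duals L P"
  "!!a x y. a : A ==> x : CP ==> y : CP ==> B a x y = (\<Oplus>t\<in>{..<d}. chi a t (T t x y))"
  using T_functional[OF B] by metis
 have "card ({..<d} \<times> F) < card A" using neg by (simp add: card_cartesian_product)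
 moreover have "chi a (fst ts) (u (snd ts)) : CL" if "ts : {..<d} \<times> F" "a : A" for ts a
  using that D(2) dualsD(1)[OF chi(1)] by (cases ts) auto
 ultimately obtain c where c: "ALL a:A. c a : CL" "EX a:A. c a \<otimes> e i ~= \<zero>"
  "ALL ts:{..<d} \<times> F. (\<Oplus>a\<in>A. c a \<otimes> chi a (fst ts) (u (snd ts))) \<otimes> e i = \<zero>"
  using l.R.field_idem_system[OF e_field[OF ik(1)] _ A, of "{..<d} \<times> F" "%ts a. chi a (fst ts) (u (snd ts))"] D(1)
  by blast
 then obtain b where b: "b : A" "c b \<otimes> e i ~= \<zero>" by blast
 define G where "G t = (%z. \<Oplus>a\<in>A. c a \<otimes> chi a t z)" for t
 have G: "G t : duals L P" if "t < d" for t
  unfolding G_def using A chi(1) c that by (intro l.functional_sum) auto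
 have xyb: "x b : CP" "y b : CP" using xy[OF b(1)] by auto
 have G0: "G t (T t (x b) (y b)) \<otimes> e i = \<zero>" if t: "t < d" for t
 proof (rule left_frame_vanish[OF ik F G[OF t]])
  show "G t (u s) \<otimes> e i = \<zero>" if "s : F" for s using c(3) t that by (auto simp: G_def)
  show "e i \<cdot> (T t (x b) (y b) \<star> e k) = T t (x b) (y b)"
   using T_block[OF t ik] xy[OF b(1)] by auto
 qed (use t xyb in auto)
 have chiC: "chi a t (T t (x b) (y b)) : CL" if "a : A" "t < d" for a t
  using dualsD(1)[OF chi(1)[OF that]] xyb that by auto
 have "(\<Oplus>t\<in>{..<d}. G t (T t (x b) (y b))) = (\<Oplus>a\<in>A. \<Oplus>t\<in>{..<d}. c a \<otimes> chi a t (T t (x b) (y b)))"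
  unfolding G_def using A c chiC by (intro l.R.finsum_swap) auto
 also have "... = (\<Oplus>a\<in>A. c a \<otimes> B a (x b) (y b))"
  using c chiC xyb by (intro l.R.finsum_cong') (auto simp: l.R.finsum_rdistr chi(2) intro!: l.R.finsum_closed)
 also have "... = c b \<otimes> e i"
  using A b c dual ik by (subst l.R.finsum_delta[of A b]) auto
 finally have "c b \<otimes> e i \<otimes> e i = (\<Oplus>t\<in>{..<d}. G t (T t (x b) (y b))) \<otimes> e i" by simp
 also have "... = (\<Oplus>t\<in>{..<d}. G t (T t (x b) (y b)) \<otimes> e i)"
  using dualsD(1)[OF G] xyb ik by (subst l.R.finsum_ldistr) auto
 also have "... = \<zero>" using G0 by (intro l.R.add.finprod_one_eqI) auto
 finally show False using b c ik by (simp add: l.R.m_assoc)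
qed

lemma balanced_of_duals:
 assumes "!!t. t < d ==> chi t : duals L P"
 shows "balanced (%x y. \<Oplus>t\<in>{..<d}. chi t (T t x y))"
proof -
 note chiD = dualsD[OF assms]
 have C: "chi t (T t x y) : CL" if "t < d" "x : CP" "y : CP" for t x y
  using chiD(1) that by simp
 have "(\<Oplus>t\<in>{..<d}. chi t (T t (x \<oplus>\<^bsub>P\<^esub> x') y)) = (\<Oplus>t\<in>{..<d}. chi t (T t x y)) \<oplus> (\<Oplus>t\<in>{..<d}. chi t (T t x' y))"
  if "x : CP" "x' : CP" "y : CP" for x x' y
  using that C chiD by (intro trans[OF l.R.finsum_cong' l.R.finsum_addf]) (auto simp: T_add_left)
 moreover have "(\<Oplus>t\<in>{..<d}. chi t (T t x (y \<oplus>\<^bsub>P\<^esub> y'))) = (\<Oplus>t\<in>{..<d}. chi t (T t x y)) \<oplus> (\<Oplus>t\<in>{..<d}. chi t (T t x y'))"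
  if "x : CP" "y : CP" "y' : CP" for x y y'
  using that C chiD by (intro trans[OF l.R.finsum_cong' l.R.finsum_addf]) (auto simp: T_add_right)
 moreover have "(\<Oplus>t\<in>{..<d}. chi t (T t (l \<cdot> x) y)) = l \<otimes> (\<Oplus>t\<in>{..<d}. chi t (T t x y))"
  if "l : CL" "x : CP" "y : CP" for l x y
  using that C chiD by (subst l.R.finsum_rdistr) (auto intro!: l.R.finsum_cong' simp: T_smult)
 moreover have "(\<Oplus>t\<in>{..<d}. chi t (T t (x \<star> l) y)) = (\<Oplus>t\<in>{..<d}. chi t (T t x (l \<cdot> y)))"
  if "l : CL" "x : CP" "y : CP" for l x y
  using that C chiD by (auto intro!: l.R.finsum_cong' simp: T_balanced)
 ultimately show ?thesis using C by (auto simp: balanced_def intro!: l.R.finsum_closed)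
qed

text \<open>Products of bases form a basis of the tensor product, so the matrix of dimensions is idempotent up to \<open>d\<close>.\<close>

lemma frame_matrix_square:
 fixes F :: "nat => nat => 'i set"
 assumes ik: "i < n" "k < n"
  and F: "!!i j. i < n ==> j < n ==> left_frame i j (F i j) (u i j) (f i j)"
 shows "(\<Sum>j<n. card (F i j) * card (F j k)) = d * card (F i k)"
proof -
 define A where "A = (SIGMA j:{..<n}. F i j \<times> F j k)"
 have LD: "left_dual i j (F i j) (u i j) (f i j)" if "i < n" "j < n" for i j
  using F[OF that] by (simp add: left_frame_def)
 note D = left_dualD[OF _ _ LD]
 have finF: "finite (F i j)" if "i < n" "j < n" for i j using D(1)[OF that that] .
 have A: "finite A" unfolding A_def using finF ik by auto
 have cardA: "card A = (\<Sum>j<n. card (F i j) * card (F j k))"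
  unfolding A_def using finF ik by (simp add: card_SigmaI card_cartesian_product)
 have "card A <= d * card (F i k)"
 proof (rule tensor_family_card_le[OF ik F[OF ik] A])
  show "balanced ((%(j, a, c) x y. f i j a (x \<star> f j k c y)) p)" if "p : A" for p
   using that ik D(5) by (auto simp: A_def intro!: balanced_compose)
  show "(%(j, a, c). u i j a) p : CP & (%(j, a, c). u j k c) p : CP &
    e i \<cdot> (%(j, a, c). u i j a) p = (%(j, a, c). u i j a) p &
    (%(j, a, c). u j k c) p \<star> e k = (%(j, a, c). u j k c) p" if "p : A" for p
   using that ik D(2-4) by (auto simp: A_def)
  fix p p' assume pp': "p : A" "p' : A"
  obtain j a c where p: "p = (j, a, c)" "j < n" "a : F i j" "c : F j k" using pp' by (auto simp: A_def)
  obtain j' a' c' where p': "p' = (j', a', c')" "j' < n" "a' : F i j'" "c' : F j' k" using pp' by (auto simp: A_def)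
  have "f i j a (u i j' a' \<star> f j k c (u j' k c')) = (if p = p' then e i else \<zero>)"
  proof (cases "j = j'")
   case True
   show ?thesis
   proof (cases "c = c'")
    case c: True
    then have "f i j a (u i j' a' \<star> f j k c (u j' k c')) = f i j a (u i j a')"
     using True p p' ik D by simp
    then show ?thesis using True c p p' ik D(8) by auto
   next
    case False
    then have "f j k c (u j' k c') = \<zero>" using True p p' ik D(8) by auto
    then show ?thesis using False p p' ik D(2)[OF ik(1)] l.functional_zero[OF D(5)[OF ik(1) p(2) ik(1) p(2) p(3)]] by auto
   qed
  next
   case False
   have g: "f j k c : duals L P" using p ik D(5) by blast
   have uC: "u j' k c' : CP" using p' ik D(2) by blast
   have "f j k c (u j' k c') = f j k c (e j' \<cdot> u j' k c')" using p' ik D(3) by simp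
   also have "... = e j' \<otimes> (e j \<otimes> f j k c (u j' k c'))" using dualsD(3)[OF g] p p' ik uC D(6) by simp
   also have "... = \<zero>" using e_orth[of j' j] False p p' dualsD(1)[OF g uC] by (simp add: l.R.m_assoc[symmetric])
   finally have "f j k c (u j' k c') = \<zero>" .
   then show ?thesis using False p p' ik D(2)[OF ik(1)] l.functional_zero[OF D(5)[OF ik(1) p(2) ik(1) p(2) p(3)]] by auto
  qed
  then show "(%(j, a, c) x y. f i j a (x \<star> f j k c y)) p ((%(j, a, c). u i j a) p') ((%(j, a, c). u j k c) p') =
   (if p = p' then e i else \<zero>)" by (simp add: p(1) p'(1))
 qed
 moreover have "d * card (F i k) <= card A"
 proof (rule ccontr)
  assume neg: "~ d * card (F i k) <= card A"
  define C where "C = {..<d} \<times> F i k"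
  have C: "finite C" "card A < card C" using neg finF ik by (auto simp: C_def card_cartesian_product)
  define TX where "TX p = T (fst p) ((%(j, a, c). u i j a) (snd p)) ((%(j, a, c). u j k c) (snd p))" for p
  have XC: "T t ((%(j, a, c). u i j a) p) ((%(j, a, c). u j k c) p) : CP" if "p : A" "t < d" for p t
   using that ik D(2) by (auto simp: A_def)
  have "f i k (snd ts) (TX (fst ts, p)) : CL" if "p : A" "ts : C" for p ts
   using that ik D(9) XC by (cases p) (auto simp: C_def TX_def)
  then obtain c where c: "ALL ts:C. c ts : CL" "EX ts:C. c ts \<otimes> e i ~= \<zero>"
   "ALL p:A. (\<Oplus>ts\<in>C. c ts \<otimes> f i k (snd ts) (TX (fst ts, p))) \<otimes> e i = \<zero>"
   using l.R.field_idem_system[OF e_field[OF ik(1)] A C, of "%p ts. f i k (snd ts) (TX (fst ts, p))"] by blast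
  then obtain t0 s0 where ts0: "t0 < d" "s0 : F i k" "c (t0, s0) \<otimes> e i ~= \<zero>" by (auto simp: C_def)
  define chi where "chi t = (%z. e i \<otimes> (\<Oplus>s\<in>F i k. c (t, s) \<otimes> f i k s z))" for t
  have cC: "c (t, s) : CL" if "t < d" "s : F i k" for t s using c(1) that by (auto simp: C_def)
  have chi: "chi t : duals L P" if "t < d" for t
   unfolding chi_def using that cC finF ik D(5) by (intro l.functional_scale l.functional_sum) auto
  define B where "B = (%x y. \<Oplus>t\<in>{..<d}. chi t (T t x y))"
  have B: "balanced B" unfolding B_def by (rule balanced_of_duals[OF chi])
  have chik: "chi t (z \<star> e k) = chi t z" "e i \<otimes> chi t z = chi t z" if t: "t < d" and z: "z : CP" for t z
  proof -
   have fC: "!!s. s : F i k ==> f i k s z : CL" using ik z D(9) by blast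
   have "(\<Oplus>s\<in>F i k. c (t, s) \<otimes> f i k s (z \<star> e k)) = (\<Oplus>s\<in>F i k. c (t, s) \<otimes> f i k s z)"
    using t z ik D(7) cC fC by (intro l.R.finsum_cong') auto
   then show "chi t (z \<star> e k) = chi t z" by (simp add: chi_def)
   have "(\<Oplus>s\<in>F i k. c (t, s) \<otimes> f i k s z) : CL" using fC cC t by (auto intro!: l.R.finsum_closed)
   then show "e i \<otimes> chi t z = chi t z" using ik by (simp add: chi_def l.R.m_assoc[symmetric])
  qed
  have BC: "B x y : CL" if "x : CP" "y : CP" for x y
   using B that by (auto simp: balanced_def)
  have Bk: "B x (y \<star> e k) = B x y" if "x : CP" "y : CP" for x y
   unfolding B_def using that ik chik dualsD(1)[OF chi]
   by (intro l.R.finsum_cong') (auto simp: T_rsmult)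
  have Bi: "e i \<otimes> B x y = B x y" if "x : CP" "y : CP" for x y
   unfolding B_def using that ik chik dualsD(1)[OF chi]
   by (subst l.R.finsum_rdistr) (auto intro!: l.R.finsum_cong')
  have Bbase: "B (u i j a) (u j k b) = \<zero>" if p: "j < n" "a : F i j" "b : F j k" for j a b
  proof -
   have pA: "(j, a, b) : A" using p by (simp add: A_def)
   have uC: "u i j a : CP" "u j k b : CP" using p ik D(2) by blast+
   have fC: "f i k s (T t (u i j a) (u j k b)) : CL" if "s : F i k" "t < d" for s t
    using that ik uC D(9) by auto
   have "(\<Oplus>ts\<in>C. c ts \<otimes> f i k (snd ts) (TX (fst ts, (j, a, b)))) =
     (\<Oplus>t\<in>{..<d}. \<Oplus>s\<in>F i k. c (t, s) \<otimes> f i k s (T t (u i j a) (u j k b)))"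
   proof -
    have "(\<Oplus>ts\<in>C. c ts \<otimes> f i k (snd ts) (TX (fst ts, (j, a, b)))) =
     (\<Oplus>t\<in>{..<d}. \<Oplus>s\<in>F i k. c (t, s) \<otimes> f i k (snd (t, s)) (TX (fst (t, s), (j, a, b))))"
     unfolding C_def using finF[OF ik] cC fC by (intro l.R.finsum_Sigma) (auto simp: TX_def)
    also have "... = (\<Oplus>t\<in>{..<d}. \<Oplus>s\<in>F i k. c (t, s) \<otimes> f i k s (T t (u i j a) (u j k b)))"
     by (simp add: TX_def)
    finally show ?thesis .
   qed
   then have 0: "(\<Oplus>t\<in>{..<d}. \<Oplus>s\<in>F i k. c (t, s) \<otimes> f i k s (T t (u i j a) (u j k b))) \<otimes> e i = \<zero>"
    using c(3) pA by auto
   have "B (u i j a) (u j k b) = e i \<otimes> (\<Oplus>t\<in>{..<d}. \<Oplus>s\<in>F i k. c (t, s) \<otimes> f i k s (T t (u i j a) (u j k b)))"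
    unfolding B_def chi_def using cC fC ik by (subst l.R.finsum_rdistr) (auto intro!: l.R.finsum_closed)
   moreover have "(\<Oplus>t\<in>{..<d}. \<Oplus>s\<in>F i k. c (t, s) \<otimes> f i k s (T t (u i j a) (u j k b))) : CL"
    using cC fC by (auto intro!: l.R.finsum_closed)
   ultimately show ?thesis using 0 ik by (simp add: l.R.m_comm)
  qed
  have Bu: "B x (u j k b) = \<zero>" if x: "x : CP" and p: "j < n" "b : F j k" for x j b
  proof -
   have uC: "u j k b : CP" "e j \<cdot> u j k b = u j k b" using p ik D(2,3) by blast+
   have "B x (u j k b) = B (x \<star> e j) (u j k b)"
    using B x uC p(1) by (simp add: balanced_def)
   also have "... = B (e i \<cdot> (x \<star> e j)) (u j k b)"
    using Bi[of "x \<star> e j" "u j k b"] x uC p(1) ik B by (simp add: balanced_def)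
   also have "... = B (\<Oplus>\<^bsub>P\<^esub>a\<in>F i j. f i j a x \<cdot> u i j a) (u j k b)"
    using F[OF ik(1) p(1)] x by (simp add: left_frame_def)
   also have "... = (\<Oplus>a\<in>F i j. B (f i j a x \<cdot> u i j a) (u j k b))"
    using x uC D(9,2) ik p(1) finF by (intro balanced_finsum_left[OF B]) auto
   also have "... = \<zero>"
   proof (intro l.R.add.finprod_one_eqI)
    fix a assume a: "a : F i j"
    have "u i j a : CP" "f i j a x : CL" using a ik p(1) x D(2,9) by blast+
    then have "B (f i j a x \<cdot> u i j a) (u j k b) = f i j a x \<otimes> B (u i j a) (u j k b)"
     using B uC by (simp add: balanced_def)
    then show "B (f i j a x \<cdot> u i j a) (u j k b) = \<zero>"
     using Bbase[OF p(1) a p(2)] `f i j a x : CL` by simp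
   qed
   finally show ?thesis by simp
  qed
  have Bz: "B x y = \<zero>" if x: "x : CP" and y: "y : CP" for x y
  proof -
   have yk: "y \<star> e k : CP" using y ik by simp
   have "B x y = B x (\<Oplus>\<^bsub>P\<^esub>j\<in>{..<n}. e j \<cdot> (y \<star> e k))"
    using Bk[OF x y] split_left[OF yk] by simp
   also have "... = (\<Oplus>j\<in>{..<n}. B x (e j \<cdot> (y \<star> e k)))"
    using yk by (intro balanced_finsum_right[OF B x]) auto
   also have "... = \<zero>"
   proof (intro l.R.add.finprod_one_eqI)
    fix j assume "j : {..<n}"
    then have j: "j < n" by simp
    have "B x (e j \<cdot> (y \<star> e k)) = B x (\<Oplus>\<^bsub>P\<^esub>b\<in>F j k. f j k b y \<cdot> u j k b)"
     using F[OF j ik(2)] y by (simp add: left_frame_def)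
    also have "... = (\<Oplus>b\<in>F j k. B x (f j k b y \<cdot> u j k b))"
     using y D(9,2) ik j finF by (intro balanced_finsum_right[OF B x]) auto
    also have "... = \<zero>"
    proof (intro l.R.add.finprod_one_eqI)
     fix b assume b: "b : F j k"
     have "u j k b : CP" "f j k b y : CL" using b ik j y D(2,9) by blast+
     then have "B x (f j k b y \<cdot> u j k b) = B (x \<star> f j k b y) (u j k b)"
      using B x by (simp add: balanced_def)
     then show "B x (f j k b y \<cdot> u j k b) = \<zero>"
      using Bu[OF _ j b] x `f j k b y : CL` by simp
    qed
    finally show "B x (e j \<cdot> (y \<star> e k)) = \<zero>" by simp
   qed
   finally show ?thesis by simp
  qed
  have us0: "u i k s0 : CP" using ts0 ik D(2) by blast
  have "chi t0 (u i k s0) = \<zero>"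
   using T_generate[of chi, OF chi _ ts0(1) us0] Bz by (simp add: B_def)
  moreover have "chi t0 (u i k s0) = e i \<otimes> (c (t0, s0) \<otimes> e i)"
  proof -
   have "(\<Oplus>s\<in>F i k. c (t0, s) \<otimes> f i k s (u i k s0)) = c (t0, s0) \<otimes> f i k s0 (u i k s0)"
    using ts0 ik finF cC D(8) by (intro l.R.finsum_delta) auto
   then show ?thesis using ts0 ik D(8) by (simp add: chi_def)
  qed
  moreover have "e i \<otimes> (c (t0, s0) \<otimes> e i) = c (t0, s0) \<otimes> e i"
   using cC[OF ts0(1,2)] ik l.R.m_lcomm[of "e i" "c (t0, s0)" "e i"] by simp
  ultimately show False using ts0 by simp
 qed
 ultimately show ?thesis using cardA by simp
qed

end

section \<open>The center and the density theorem\<close>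

locale connected_quasi_galois_bimodule = quasi_galois_bimodule L P n e V v v' W w w' d T
 for L (structure) and P :: "('a, 'a, 'p) bimodule" and n e and V :: "'v set" and v v' and W :: "'w set" and w w' d T +
 assumes block_nonzero: "[|i < n; j < n|] ==> EX x:CP. e i \<cdot> (x \<star> e j) ~= \<zero>\<^bsub>P\<^esub>"
begin

abbreviation Z where "Z == bimodule_center L P"

lemma ZD: "z : Z ==> z : CL" "[|z : Z; x : CP|] ==> x \<star> z = z \<cdot> x"
 by (auto simp: bimodule_center_def)

lemma ZI: "z : CL ==> (!!x. x : CP ==> x \<star> z = z \<cdot> x) ==> z : Z"
 by (auto simp: bimodule_center_def)

lemma Z_zero: "\<zero> : Z" and Z_one: "\<one> : Z"
 by (auto intro!: ZI)

lemma Z_add: "[|z : Z; z' : Z|] ==> z \<oplus> z' : Z"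
 by (auto intro!: ZI simp: ZD rs_distr l.smult_l_distr)

lemma Z_mult: "[|z : Z; z' : Z|] ==> z \<otimes> z' : Z"
 by (auto intro!: ZI simp: ZD rs_assoc[symmetric] rs_ls l.smult_assoc1[symmetric] l.R.m_comm)

lemma Z_minus: "z : Z ==> \<ominus> z : Z"
proof (rule ZI)
 assume z: "z : Z"
 fix x assume x: "x : CP"
 have "x \<star> (\<ominus> z) \<oplus>\<^bsub>P\<^esub> x \<star> z = \<zero>\<^bsub>P\<^esub>"
  using x ZD(1)[OF z] by (simp add: rs_distr[symmetric] l.R.l_neg)
 then have "\<ominus>\<^bsub>P\<^esub> (x \<star> z) = x \<star> (\<ominus> z)" using x ZD(1)[OF z] by (intro l.M.minus_equality) auto
 then show "x \<star> (\<ominus> z) = \<ominus> z \<cdot> x" using x ZD[OF z] by (simp add: l.smult_l_minus)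
qed (simp add: ZD)

text \<open>The coefficients of \<open>P\<close>: the maps \<open>b \<mapsto> phi (x b)\<close> and their finite sums.\<close>

definition coef :: "('a => 'a) => bool" where
 "coef a \<longleftrightarrow> (EX (N::nat) phi x. (ALL t<N. phi t : duals L P & x t : CP) &
  (ALL b:CL. a b = (\<Oplus>t\<in>{..<N}. phi t (x t \<star> b))))"

lemma coef_cong: "coef a ==> (!!b. b : CL ==> a' b = a b) ==> coef a'"
 unfolding coef_def by metis

lemma coef_zero: "coef (%_. \<zero>)"
 unfolding coef_def by (intro exI[of _ 0]) auto

lemma coef_step:
 assumes a: "coef a" and phi: "phi : duals L P" and x: "x : CP"
 shows "coef (%b. a b \<oplus> phi (x \<star> b))"
proof -
 obtain N :: nat and psi y where N: "!!t. t < N ==> psi t : duals L P & y t : CP"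
  "!!b. b : CL ==> a b = (\<Oplus>t\<in>{..<N}. psi t (y t \<star> b))"
  using a unfolding coef_def by blast
 have "a b \<oplus> phi (x \<star> b) = (\<Oplus>t\<in>{..<Suc N}. (psi(N := phi)) t ((y(N := x)) t \<star> b))" if b: "b : CL" for b
 proof -
  have C: "psi t (y t \<star> b) : CL" if "t < N" for t using dualsD(1)[of "psi t" L P "y t \<star> b"] N(1)[OF that] b by simp
  have "(\<Oplus>t\<in>{..<Suc N}. (psi(N := phi)) t ((y(N := x)) t \<star> b)) =
   phi (x \<star> b) \<oplus> (\<Oplus>t\<in>{..<N}. (psi(N := phi)) t ((y(N := x)) t \<star> b))"
   unfolding lessThan_Suc using C dualsD(1)[OF phi] x b by (subst l.R.finsum_insert) auto
  also have "(\<Oplus>t\<in>{..<N}. (psi(N := phi)) t ((y(N := x)) t \<star> b)) = a b"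
   unfolding N(2)[OF b] using C by (intro l.R.finsum_cong') auto
  finally show ?thesis using N(2)[OF b] C dualsD(1)[OF phi] x b
   by (auto simp: l.R.a_comm intro!: l.R.finsum_closed)
 qed
 then show ?thesis unfolding coef_def using N(1) phi x
  by (intro exI[of _ "Suc N"] exI[of _ "psi(N := phi)"] exI[of _ "y(N := x)"]) auto
qed

lemma coef_finsum:
 assumes "!!t. t < N ==> phi t : duals L P" "!!t. t < N ==> x t : CP"
 shows "coef (%b. \<Oplus>t\<in>{..<N::nat}. phi t (x t \<star> b))"
 unfolding coef_def using assms by (intro exI[of _ N] exI[of _ phi] exI[of _ x]) auto

lemma coef_induct [consumes 1, case_names cong zero step]:
 assumes a: "coef a"
  and cong: "!!a a'. coef a ==> Q a ==> (!!b. b : CL ==> a' b = a b) ==> Q a'"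
  and zero: "Q (%_. \<zero>)"
  and step: "!!a phi x. coef a ==> Q a ==> phi : duals L P ==> x : CP ==> Q (%b. a b \<oplus> phi (x \<star> b))"
 shows "Q a"
proof -
 obtain N :: nat and psi y where N: "!!t. t < N ==> psi t : duals L P & y t : CP"
  "!!b. b : CL ==> a b = (\<Oplus>t\<in>{..<N}. psi t (y t \<star> b))"
  using a unfolding coef_def by blast
 have "Q (%b. \<Oplus>t\<in>{..<k}. psi t (y t \<star> b))" if "k <= N" for k
  using that
 proof (induction k)
  case 0
  show ?case by (rule cong[OF coef_zero zero]) simp
 next
  case (Suc k)
  then have k: "k < N" "Q (%b. \<Oplus>t\<in>{..<k}. psi t (y t \<star> b))" by auto
  have "coef (%b. \<Oplus>t\<in>{..<k}. psi t (y t \<star> b))"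
   using N(1) k(1) by (intro coef_finsum) auto
  note ck = this
  from step[OF this k(2), of "psi k" "y k"]
  have st: "Q (%b. (\<Oplus>t\<in>{..<k}. psi t (y t \<star> b)) \<oplus> psi k (y k \<star> b))" using N(1)[OF k(1)] by simp
  show ?case
  proof (rule cong[OF coef_step[OF ck, of "psi k" "y k"] st])
   show "psi k : duals L P" "y k : CP" using N(1)[OF k(1)] by auto
   fix b assume b: "b : CL"
   have C: "psi t (y t \<star> b) : CL" if "t < N" for t using dualsD(1)[of "psi t" L P "y t \<star> b"] N(1)[OF that] b by simp
   show "(\<Oplus>t\<in>{..<Suc k}. psi t (y t \<star> b)) = (\<Oplus>t\<in>{..<k}. psi t (y t \<star> b)) \<oplus> psi k (y k \<star> b)"
    unfolding lessThan_Suc using C k(1)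
    by (subst l.R.finsum_insert) (auto intro!: l.R.a_comm l.R.finsum_closed)
  qed
 qed
 from this[of N] have QN: "Q (%b. \<Oplus>t\<in>{..<N}. psi t (y t \<star> b))" by simp
 show ?thesis by (rule cong[OF coef_finsum QN]) (use N in auto)
qed

lemma coef_closed: "coef a ==> b : CL ==> a b : CL"
 unfolding coef_def using dualsD(1) by (fastforce intro!: l.R.finsum_closed)

lemma coef_additive:
 "coef a ==> b : CL ==> b' : CL ==> a (b \<oplus> b') = a b \<oplus> a b'"
proof (induction a arbitrary: b b' rule: coef_induct)
 case (step a phi x)
 have "a b : CL" "a b' : CL" using coef_closed step by auto
 then show ?case using step dualsD[OF step.hyps(2)] by (simp add: rs_distr l.R.a_ac)
qed auto

lemma coef_Z_linear:
 "coef a ==> b : CL ==> z : Z ==> a (z \<otimes> b) = z \<otimes> a b"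
proof (induction a arbitrary: b rule: coef_induct)
 case (step a phi x)
 have "x \<star> (z \<otimes> b) = z \<cdot> (x \<star> b)"
  using step ZD[OF step.prems(2)] by (simp add: rs_assoc[symmetric] rs_ls)
 then show ?case using step dualsD[OF step.hyps(2)] ZD(1)[OF step.prems(2)] coef_closed[OF step.hyps(1)]
  by (simp add: l.R.r_distr)
qed (auto simp: ZD)

lemma coef_add: "coef a' ==> coef a ==> coef (%b. a b \<oplus> a' b)"
proof (induction a' rule: coef_induct)
 case zero
 then show ?case by (rule coef_cong) (use zero coef_closed in auto)
next
 case (step a' phi x)
 show ?case
  by (rule coef_cong[OF coef_step[OF step.IH[OF step.prems(1)] step.hyps(2,3)]])
   (use step coef_closed dualsD(1)[OF step.hyps(2)] in "auto simp: l.R.a_assoc")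
next
 case (cong a a')
 then show ?case by (auto intro: coef_cong)
qed

lemma coef_scale: "coef a ==> l : CL ==> coef (%b. l \<otimes> a b)"
proof (induction a rule: coef_induct)
 case zero
 show ?case by (rule coef_cong[OF coef_zero]) (use zero in auto)
next
 case (step a phi x)
 show ?case
  by (rule coef_cong[OF coef_step[OF step.IH[OF step.prems(1)] l.functional_scale[OF step.hyps(2) step.prems(1)] step.hyps(3)]])
   (use step coef_closed dualsD(1)[OF step.hyps(2)] in "auto simp: l.R.r_distr")
next
 case (cong a a')
 then show ?case by (auto intro: coef_cong)
qed

lemma coef_sub: "coef a' ==> coef a ==> coef (%b. a b \<ominus> a' b)"
 by (rule coef_cong[OF coef_add[OF coef_scale[of a' "\<ominus> \<one>"]]])
  (auto simp: a_minus_def l.R.l_minus coef_closed)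

lemma coef_sum:
 "finite I ==> (!!s. s : I ==> coef (a s)) ==> coef (%b. \<Oplus>s\<in>I. a s b)"
proof (induction I rule: finite_induct)
 case empty
 show ?case by (rule coef_cong[OF coef_zero]) simp
next
 case (insert s I)
 have "coef (%b. a s b \<oplus> (\<Oplus>s\<in>I. a s b))" using insert by (intro coef_add) auto
 then show ?case
  by (rule coef_cong) (use insert coef_closed in auto)
qed

lemma coef_precompose: "coef a ==> m : CL ==> coef (%b. a (m \<otimes> b))"
proof (induction a rule: coef_induct)
 case zero
 show ?case by (rule coef_zero)
next
 case (step a phi x)
 show ?case
  by (rule coef_cong[OF coef_step[OF step.IH[OF step.prems(1)] step.hyps(2), of "x \<star> m"]])
   (use step in "auto simp: rs_assoc")
next
 case (cong a a')
 then show ?case by (auto intro!: coef_cong[OF cong.IH])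
qed

text \<open>
 The composite of \<open>b \<mapsto> phi (y b)\<close> after \<open>b \<mapsto> psi (x b)\<close> is a coefficient of \<open>P \<otimes> P\<close> at \<open>y \<otimes> x\<close>,
 hence a sum of \<open>d\<close> coefficients of \<open>P\<close>: the coefficients form a ring of operators on \<open>L\<close>.
\<close>

lemma coef_compose: "coef a' ==> coef a ==> coef (%b. a (a' b))"
proof (induction a' rule: coef_induct)
 case zero
 have "a \<zero> = \<zero>" using coef_additive[OF zero, of \<zero> \<zero>] coef_closed[OF zero, of \<zero>] by simp
 then show ?case by (intro coef_cong[OF coef_zero]) simp
next
 case (step a' psi x)
 have psi: "psi : duals L P" and x: "x : CP" by fact+
 have single: "coef (%b. a (psi (x \<star> b)))"
  using step.prems(1)
 proof (induction a rule: coef_induct)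
  case zero
  show ?case by (rule coef_zero)
 next
  case (step a phi y)
  define B where "B = (%y z. phi (y \<star> psi z))"
  have "balanced B" unfolding B_def by (rule balanced_compose[OF step.hyps(2) psi])
  from T_functional[OF this] obtain chi where chi: "!!t. t < d ==> chi t : duals L P"
   "!!y z. y : CP ==> z : CP ==> B y z = (\<Oplus>t\<in>{..<d}. chi t (T t y z))" by blast
  have y: "y : CP" by fact
  have "coef (%b. \<Oplus>t\<in>{..<d}. chi t (T t y x \<star> b))" using chi(1) y x by (intro coef_finsum) auto
  then have "coef (%b. B y (x \<star> b))"
   by (rule coef_cong) (use chi x y T_rsmult dualsD(1)[OF chi(1)] in "auto intro!: l.R.finsum_cong'")
  from coef_add[OF this step.IH] show ?case by (simp add: B_def)
 next
  case (cong a a')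
  then show ?case using dualsD(1)[OF psi] x
   by (auto intro!: coef_cong[OF cong.IH])
 qed
 have "coef (%b. a (a' b) \<oplus> a (psi (x \<star> b)))" using coef_add[OF single step.IH[OF step.prems(1)]] .
 then show ?case
  by (rule coef_cong)
   (use step coef_closed dualsD(1)[OF step.hyps(2)] coef_additive[OF step.prems(1)] in auto)
next
 case (cong a' a'')
 then show ?case by (auto intro!: coef_cong[OF cong.IH])
qed

lemma duals_separate:
 assumes "x : CP" "!!phi. phi : duals L P ==> phi x = \<zero>"
 shows "x = \<zero>\<^bsub>P\<^esub>"
proof -
 have "x = (\<Oplus>\<^bsub>P\<^esub>r\<in>V. v' r x \<cdot> v r)" using v_expand[OF assms(1)] .
 also have "... = \<zero>\<^bsub>P\<^esub>"
  using assms(2)[OF v'_functional] v_closed by (intro l.M.add.finprod_one_eqI) auto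
 finally show ?thesis .
qed

text \<open>The ring of coefficients acts on \<open>L\<close> without nontrivial invariant subgroups.\<close>

lemma coef_transitive:
 assumes b: "b : CL" "b ~= \<zero>" and i: "i < n"
 shows "EX a. coef a & a b = e i"
proof -
 obtain k where k: "k < n" "b \<otimes> e k ~= \<zero>" using scalar_nonzero_component[OF b] by blast
 obtain y where y: "y : CL" "y \<otimes> b \<otimes> e k = e k" using e_inverse[OF k(1) b(1) k(2)] by blast
 obtain x0 where x0: "x0 : CP" "e i \<cdot> (x0 \<star> e k) ~= \<zero>\<^bsub>P\<^esub>" using block_nonzero[OF i k(1)] by blast
 define x where "x = e i \<cdot> (x0 \<star> e k)"
 have x: "x : CP" "x ~= \<zero>\<^bsub>P\<^esub>" "e i \<cdot> x = x" "x \<star> e k = x"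
  using x0 i k by (auto simp: x_def l.smult_assoc1[symmetric] rs_ls rs_assoc)
 have "x \<star> b \<star> (y \<otimes> e k) = x"
 proof -
  have "b \<otimes> (y \<otimes> e k) = y \<otimes> b \<otimes> e k" using b y(1) k(1) by (simp add: l.R.m_ac)
  then show ?thesis using x y b(1) k by (simp add: rs_assoc)
 qed
 then have "x \<star> b ~= \<zero>\<^bsub>P\<^esub>" using x y k by auto
 then obtain phi where phi: "phi : duals L P" "phi (x \<star> b) ~= \<zero>" using duals_separate[of "x \<star> b"] x b by auto
 have ex: "e i \<cdot> (x \<star> b) = x \<star> b" using x b i by (simp add: rs_ls[symmetric])
 have C: "phi (x \<star> b) : CL" using dualsD(1)[OF phi(1)] x b by simp
 have "phi (x \<star> b) \<otimes> e i = phi (x \<star> b)"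
  using dualsD(3)[OF phi(1), of "e i" "x \<star> b"] ex x b i C by (simp add: l.R.m_comm)
 then obtain u where u: "u : CL" "u \<otimes> phi (x \<star> b) \<otimes> e i = e i" using e_inverse[OF i C] phi(2) by auto
 have "coef (%b. (e i \<otimes> u) \<otimes> (\<zero> \<oplus> phi (x \<star> b)))"
  using coef_scale[OF coef_step[OF coef_zero phi(1) x(1)]] u i by simp
 moreover have "(e i \<otimes> u) \<otimes> (\<zero> \<oplus> phi (x \<star> b)) = e i"
 proof -
  have "(e i \<otimes> u) \<otimes> (\<zero> \<oplus> phi (x \<star> b)) = u \<otimes> phi (x \<star> b) \<otimes> e i" using u(1) i C by (simp add: l.R.m_ac)
  then show ?thesis using u by simp
 qed
 ultimately show ?thesis by blast
qed

lemma coef_one: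
 assumes b: "b : CL" "b ~= \<zero>"
 shows "EX a. coef a & a b = \<one>"
proof -
 have "ALL i. EX a. i < n --> coef a & a b = e i" using coef_transitive[OF b] by blast
 then obtain a where a: "!!i. i < n ==> coef (a i) & a i b = e i" by metis
 have "coef (%b. \<Oplus>i\<in>{..<n}. a i b)" using a by (intro coef_sum) auto
 moreover have "(\<Oplus>i\<in>{..<n}. a i b) = (\<Oplus>i\<in>{..<n}. e i)" using a by (intro l.R.finsum_cong') auto
 ultimately show ?thesis using e_sum by metis
qed

text \<open>Functionals separate the vectors \<open>x z\<close> and \<open>z x\<close>.\<close>

lemma center_of_coefficients:
 assumes z: "z : CL"
  and comm: "!!a c. coef a ==> c : CL ==> a (c \<otimes> z) = a c \<otimes> z"
 shows "z : Z"
proof (rule ZI[OF z])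
 fix x assume x: "x : CP"
 have "x \<star> z \<ominus>\<^bsub>P\<^esub> z \<cdot> x = \<zero>\<^bsub>P\<^esub>"
 proof (rule duals_separate)
  fix phi assume phi: "phi : duals L P"
  have "coef (%b. \<zero> \<oplus> phi (x \<star> b))" using coef_step[OF coef_zero phi x] .
  from comm[OF this, of \<one>] have "phi (x \<star> z) = phi x \<otimes> z" using dualsD(1)[OF phi] x z by simp
  then show "phi (x \<star> z \<ominus>\<^bsub>P\<^esub> z \<cdot> x) = \<zero>"
   using x z dualsD[OF phi] l.functional_minus[OF phi, of "x \<star> z" "z \<cdot> x"]
   by (simp add: l.R.m_comm a_minus_def l.R.r_neg)
 qed (use x z in auto)
 then show "x \<star> z = z \<cdot> x" using x z by - (rule l.M.eq_if_minus_zero, auto)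
qed

text \<open>Maximal families of this kind turn out to be bases of \<open>e\<^sub>j L\<close> over the center.\<close>

definition center_family :: "nat => nat => (nat => 'a) => (nat => 'a => 'a) => bool" where
 "center_family j m b a \<longleftrightarrow> (ALL s<m. b s : CL & b s \<otimes> e j = b s & coef (a s)) &
  (ALL s<m. ALL t<m. a s (b t) = (if s = t then \<one> else \<zero>))"

text \<open>
 The density argument. If every coefficient that kills all \<open>b s\<close> also kills \<open>c\<close>, then
 \<open>a c = \<Sum> a (b s) z\<^sub>s\<close> for all coefficients \<open>a\<close>, where \<open>z\<^sub>s = a\<^sub>s c\<close>. Applied to the coefficients
 \<open>a \<circ> l \<circ> a\<^sub>s\<close> this shows that \<open>z\<^sub>s\<close> is central, and then all coefficients kill \<open>c - \<Sum> z\<^sub>s b\<^sub>s\<close>.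
\<close>

lemma density:
 assumes F: "center_family j m b a" and j: "j < n" and c: "c : CL" "c \<otimes> e j = c"
  and no: "~ (EX a0. coef a0 & (ALL s<m. a0 (b s) = \<zero>) & a0 c = \<one>)"
 shows "(ALL s<m. a s c : Z) & c = (\<Oplus>s\<in>{..<m}. a s c \<otimes> b s)"
proof -
 have bC: "!!s. s < m ==> b s : CL" and ca: "!!s. s < m ==> coef (a s)"
  and dual: "!!s t. s < m ==> t < m ==> a s (b t) = (if s = t then \<one> else \<zero>)"
  using F by (auto simp: center_family_def)
 have kill: "a0 c = \<zero>" if a0: "coef a0" "ALL s<m. a0 (b s) = \<zero>" for a0
 proof (rule ccontr)
  assume "a0 c ~= \<zero>"
  then obtain a1 where a1: "coef a1" "a1 (a0 c) = \<one>" using coef_one coef_closed[OF a0(1) c(1)] by blast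
  have "a1 \<zero> = \<zero>" using coef_additive[OF a1(1), of \<zero> \<zero>] coef_closed[OF a1(1), of \<zero>] by simp
  then show False using no coef_compose[OF a0(1) a1(1)] a0(2) a1(2) by auto
 qed
 have zC: "a s c : CL" if "s < m" for s using coef_closed[OF ca[OF that] c(1)] .
 have key: "a' c = (\<Oplus>s\<in>{..<m}. a' (b s) \<otimes> a s c)" if a': "coef a'" for a'
 proof -
  have a'b: "a' (b s) : CL" if "s < m" for s using coef_closed[OF a' bC[OF that]] .
  define a0 where "a0 = (%x. a' x \<ominus> (\<Oplus>s\<in>{..<m}. a' (b s) \<otimes> a s x))"
  have "coef a0" unfolding a0_def
   using a' ca a'b by (intro coef_sub coef_sum coef_scale) auto
  moreover have "a0 (b t) = \<zero>" if t: "t < m" for t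
  proof -
   have "(\<Oplus>s\<in>{..<m}. a' (b s) \<otimes> a s (b t)) = a' (b t) \<otimes> a t (b t)"
    using t a'b dual by (intro l.R.finsum_delta) auto
   then show ?thesis using a'b[OF t] dual[OF t t] by (simp add: a0_def a_minus_def l.R.r_neg)
  qed
  ultimately have "a0 c = \<zero>" using kill by blast
  then show ?thesis unfolding a0_def using a'b zC coef_closed[OF a' c(1)]
   by - (rule l.R.eq_if_minus_zero, auto intro!: l.R.finsum_closed)
 qed
 have Z: "a s c : Z" if s: "s < m" for s
 proof (rule center_of_coefficients[OF zC[OF s]])
  fix a' l assume a': "coef a'" and l: "l : CL"
  have "a' \<zero> = \<zero>" using coef_additive[OF a', of \<zero> \<zero>] coef_closed[OF a', of \<zero>] by simp
  have "coef (%x. a' (l \<otimes> a s x))" using coef_compose[OF coef_scale[OF ca[OF s] l] a'] .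
  from key[OF this] have "a' (l \<otimes> a s c) = (\<Oplus>t\<in>{..<m}. a' (l \<otimes> a s (b t)) \<otimes> a t c)" .
  also have "... = a' (l \<otimes> a s (b s)) \<otimes> a s c"
   using s dual l zC coef_closed[OF a'] `a' \<zero> = \<zero>` bC coef_closed[OF ca]
   by (intro l.R.finsum_delta) auto
  finally show "a' (l \<otimes> a s c) = a' l \<otimes> a s c" using dual[OF s s] l by simp
 qed
 have SC: "(\<Oplus>s\<in>{..<m}. a s c \<otimes> b s) : CL" using zC bC by (auto intro!: l.R.finsum_closed)
 have "c \<ominus> (\<Oplus>s\<in>{..<m}. a s c \<otimes> b s) = \<zero>"
 proof (rule ccontr)
  assume "c \<ominus> (\<Oplus>s\<in>{..<m}. a s c \<otimes> b s) ~= \<zero>"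
  then obtain a' where a': "coef a'" "a' (c \<ominus> (\<Oplus>s\<in>{..<m}. a s c \<otimes> b s)) = \<one>"
   using coef_one[of "c \<ominus> (\<Oplus>s\<in>{..<m}. a s c \<otimes> b s)"] c SC by auto
  have sum: "a' (\<Oplus>s\<in>{..<k}. a s c \<otimes> b s) = (\<Oplus>s\<in>{..<k}. a' (b s) \<otimes> a s c)" if "k <= m" for k
   using that
  proof (induction k)
   case 0
   show ?case using coef_additive[OF a'(1), of \<zero> \<zero>] coef_closed[OF a'(1), of \<zero>] by simp
  next
   case (Suc k)
   have 1: "(\<Oplus>s\<in>{..<k}. a s c \<otimes> b s) : CL" using zC bC Suc.prems by (auto intro!: l.R.finsum_closed)
   have "a' (\<Oplus>s\<in>{..<Suc k}. a s c \<otimes> b s) = a' (a k c \<otimes> b k) \<oplus> a' (\<Oplus>s\<in>{..<k}. a s c \<otimes> b s)"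
    unfolding lessThan_Suc using zC bC Suc.prems coef_additive[OF a'(1) _ 1, of "a k c \<otimes> b k"]
    by (subst l.R.finsum_insert) auto
   also have "a' (a k c \<otimes> b k) = a' (b k) \<otimes> a k c"
    using coef_Z_linear[OF a'(1) bC Z] zC bC coef_closed[OF a'(1)] Suc.prems by (simp add: l.R.m_comm)
   finally show ?case
    unfolding lessThan_Suc using zC bC coef_closed[OF a'(1)] Suc
    by (subst l.R.finsum_insert) auto
  qed
  define S where "S = (\<Oplus>s\<in>{..<m}. a s c \<otimes> b s)"
  have aS: "a' S = a' c" using sum[of m] key[OF a'(1)] by (simp add: S_def)
  have "a' c = a' ((c \<ominus> S) \<oplus> S)"
  proof -
   have "c = (c \<ominus> S) \<oplus> S" using c(1) SC unfolding S_def[symmetric] by (simp add: a_minus_def l.R.a_assoc l.R.l_neg)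
   then show ?thesis by simp
  qed
  also have "... = a' (c \<ominus> S) \<oplus> a' S" using c SC by (intro coef_additive[OF a'(1)]) (auto simp: S_def)
  finally have "a' c = \<one> \<oplus> a' c" using a'(2) aS by (simp add: S_def)
  then have "\<one> = \<zero>" using coef_closed[OF a'(1) c(1)] by (simp add: l.R.add.r_cancel_one')
  then show False using e_nonzero[OF j] l.R.one_zeroD j e_closed[OF j] by blast
 qed
 then have "c = (\<Oplus>s\<in>{..<m}. a s c \<otimes> b s)" using c SC by - (rule l.R.eq_if_minus_zero, auto)
 with Z show ?thesis by blast
qed

text \<open>
 In a longer family there is a linear relation annihilated by the maps \<open>b \<mapsto> v' (v b)\<close>. These determine all
 coefficients, among them those dual to the family.
\<close>

lemma center_family_bound:
 assumes F: "center_family j m b a" and j: "j < n"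
 shows "m <= card V * card V"
proof (rule ccontr)
 assume neg: "~ m <= card V * card V"
 have bC: "!!s. s < m ==> b s : CL" and ca: "!!s. s < m ==> coef (a s)"
  and dual: "!!s t. s < m ==> t < m ==> a s (b t) = (if s = t then \<one> else \<zero>)"
  using F by (auto simp: center_family_def)
 interpret S: projective_dual_setting L P "e j" "%x. x \<star> e j" V v v' by (rule left_setting[OF j j])
 have 1: "card (V \<times> V) < card {..<m}" "finite (V \<times> V)" using neg V_finite by (simp_all add: card_cartesian_product)
 have 2: "v' (fst rq) (v (snd rq) \<star> b t) : CL" if "rq : V \<times> V" "t : {..<m}" for rq t
  using that v_closed bC dualsD(1)[OF v'_functional] by (cases rq) auto
 obtain c where c: "ALL t:{..<m}. c t : CL" "EX t:{..<m}. c t \<otimes> e j ~= \<zero>"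
  "ALL rq:V \<times> V. (\<Oplus>t\<in>{..<m}. c t \<otimes> v' (fst rq) (v (snd rq) \<star> b t)) \<otimes> e j = \<zero>"
  using l.R.field_idem_system[OF e_field[OF j] 1(2) finite_lessThan 1(1), of "%rq t. v' (fst rq) (v (snd rq) \<star> b t)", OF 2] by blast
 then obtain t0 where t0: "t0 < m" "c t0 \<otimes> e j ~= \<zero>" by auto
 have cC: "!!t. t < m ==> c t : CL" using c by auto
 have res: "res_ideal L (e j) = {b : CL. b \<otimes> e j = \<zero>}" by (rule l.R.field_idem_residue[OF e_field[OF j]])
 have idl: "ideal (res_ideal L (e j)) L"
  using l.R.field_idem_local[OF e_field[OF j]] by (simp add: local_idem_def)
 have single: "(\<Oplus>t\<in>{..<m}. c t \<otimes> phi (x \<star> b t)) \<otimes> e j = \<zero>" if phi: "phi : duals L P" and x: "x : CP" for phi x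
 proof -
  note phiD = dualsD[OF phi]
  have "(%x. phi (x \<star> b t)) : duals L P" if "t < m" for t
   using phiD bC[OF that] by (auto simp: duals_def rs_add rs_ls)
  then have "(%x. \<Oplus>t\<in>{..<m}. c t \<otimes> phi (x \<star> b t)) : duals L P"
   using cC by (intro l.functional_sum) auto
  moreover have "(\<Oplus>t\<in>{..<m}. c t \<otimes> phi (v q \<star> b t)) : res_ideal L (e j)" if q: "q : V" for q
  proof -
   define y where "y = (\<Oplus>\<^bsub>P\<^esub>t\<in>{..<m}. c t \<cdot> (v q \<star> b t))"
   have tC: "c t \<cdot> (v q \<star> b t) : CP" if "t < m" for t using that cC bC v_closed q by auto
   have y: "y : CP" unfolding y_def using tC by (auto intro!: l.M.finsum_closed)
   have fy: "psi y = (\<Oplus>t\<in>{..<m}. c t \<otimes> psi (v q \<star> b t))" if psi: "psi : duals L P" for psi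
    unfolding y_def using tC cC bC v_closed q dualsD[OF psi]
    by (subst l.functional_finsum[OF psi]) (auto intro!: l.R.finsum_cong')
   have "v' r (e j \<cdot> y) = \<zero>" if r: "r : V" for r
   proof -
    have "v' r y \<otimes> e j = \<zero>" unfolding fy[OF v'_functional[OF r]] using c(3) q r by auto
    then show ?thesis
     using dualsD(1)[OF v'_functional[OF r] y] dualsD(3)[OF v'_functional[OF r] _ y, of "e j"] j
     by (simp add: l.R.m_comm)
   qed
   then have "e j \<cdot> y = \<zero>\<^bsub>P\<^esub>" using S.duals_separate[of "e j \<cdot> y"] y j by auto
   then have "phi y \<otimes> e j = \<zero>" using phiD(3)[of "e j" y] phiD(1)[OF y] l.functional_zero[OF phi] y j by (simp add: l.R.m_comm)
   then show ?thesis using fy[OF phi] phiD(1)[OF y] unfolding res by auto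
  qed
  ultimately have "(\<Oplus>t\<in>{..<m}. c t \<otimes> phi (x \<star> b t)) : res_ideal L (e j)"
   using S.functional_in_ideal[OF idl _ _ x, of "%x. \<Oplus>t\<in>{..<m}. c t \<otimes> phi (x \<star> b t)"] by blast
  then show ?thesis by (simp add: res)
 qed
 have all: "(\<Oplus>t\<in>{..<m}. c t \<otimes> a' (b t)) \<otimes> e j = \<zero>" if "coef a'" for a'
  using that
 proof (induction a' rule: coef_induct)
  case zero
  have "(\<Oplus>t\<in>{..<m}. c t \<otimes> \<zero>) = \<zero>" using cC by (intro l.R.add.finprod_one_eqI) auto
  then show ?case using j by simp
 next
  case (step a' phi x)
  have C: "a' (b t) : CL" "phi (x \<star> b t) : CL" if "t < m" for t
   using coef_closed[OF step.hyps(1) bC[OF that]] dualsD(1)[OF step.hyps(2)] step.hyps(3) bC[OF that] by auto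
  have "(\<Oplus>t\<in>{..<m}. c t \<otimes> (a' (b t) \<oplus> phi (x \<star> b t))) =
   (\<Oplus>t\<in>{..<m}. c t \<otimes> a' (b t)) \<oplus> (\<Oplus>t\<in>{..<m}. c t \<otimes> phi (x \<star> b t))"
   using C cC by (intro trans[OF l.R.finsum_cong' l.R.finsum_addf]) (auto simp: l.R.r_distr)
  moreover have "(\<Oplus>t\<in>{..<m}. c t \<otimes> a' (b t)) : CL" "(\<Oplus>t\<in>{..<m}. c t \<otimes> phi (x \<star> b t)) : CL"
   using C cC by (auto intro!: l.R.finsum_closed)
  ultimately show ?case using single[OF step.hyps(2,3)] step.IH j by (simp add: l.R.l_distr)
 next
  case (cong a a')
  have "(\<Oplus>t\<in>{..<m}. c t \<otimes> a' (b t)) = (\<Oplus>t\<in>{..<m}. c t \<otimes> a (b t))"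
   using cong.hyps(2)[OF bC] cC coef_closed[OF cong.hyps(1) bC] by (intro l.R.finsum_cong') auto
  then show ?case using cong.IH by simp
 qed
 have "(\<Oplus>t\<in>{..<m}. c t \<otimes> a t0 (b t)) = c t0 \<otimes> a t0 (b t0)"
  using t0 cC dual by (intro l.R.finsum_delta) auto
 then show False using all[OF ca[OF t0(1)]] dual[OF t0(1) t0(1)] cC[OF t0(1)] t0(2) by simp
qed

text \<open>A coefficient killing the family but not \<open>c\<close> would extend the family by \<open>c\<close>.\<close>

lemma center_basis:
 assumes j: "j < n"
 obtains m b a where "0 < m" "center_family j m b a"
  "!!c. c : CL ==> c \<otimes> e j = c ==> (ALL s<m. a s c : Z) & c = (\<Oplus>s\<in>{..<m}. a s c \<otimes> b s)"
proof -
 define Q where "Q m \<longleftrightarrow> (EX b a. center_family j m b a)" for m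
 have bound: "k <= card V * card V" if Qk: "Q k" for k
 proof -
  from Qk obtain b a where "center_family j k b a" by (auto simp: Q_def)
  then show ?thesis by (rule center_family_bound[OF _ j])
 qed
 have "Q 0" by (auto simp: Q_def center_family_def)
 then have "EX m. Q m & (ALL m'. Q m' --> m' <= m)"
  using ex_has_greatest_nat[of Q 0 id "Suc (card V * card V)"] bound by (fastforce simp: less_Suc_eq_le)
 then obtain m where m: "Q m" "!!m'. Q m' ==> m' <= m" by blast
 then obtain b a where F: "center_family j m b a" by (auto simp: Q_def)
 have bC: "!!s. s < m ==> b s : CL" and be: "!!s. s < m ==> b s \<otimes> e j = b s" and ca: "!!s. s < m ==> coef (a s)"
  and dual: "!!s t. s < m ==> t < m ==> a s (b t) = (if s = t then \<one> else \<zero>)"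
  using F by (auto simp: center_family_def)
 have all: "(ALL s<m. a s c : Z) & c = (\<Oplus>s\<in>{..<m}. a s c \<otimes> b s)" if c: "c : CL" "c \<otimes> e j = c" for c
 proof (rule density[OF F j c])
  show "~ (EX a0. coef a0 & (ALL s<m. a0 (b s) = \<zero>) & a0 c = \<one>)"
  proof
   assume "EX a0. coef a0 & (ALL s<m. a0 (b s) = \<zero>) & a0 c = \<one>"
   then obtain a0 where a0: "coef a0" "ALL s<m. a0 (b s) = \<zero>" "a0 c = \<one>" by blast
   define a1 where "a1 s = (if s < m then %x. a s x \<ominus> a s c \<otimes> a0 x else a0)" for s
   have zC: "a s c : CL" if "s < m" for s using coef_closed[OF ca[OF that] c(1)] .
   have "center_family j (Suc m) (b(m := c)) a1"
    unfolding center_family_def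
   proof (intro conjI allI impI)
    fix s assume "s < Suc m"
    then show "(b(m := c)) s : CL" "(b(m := c)) s \<otimes> e j = (b(m := c)) s"
     using bC be c by (auto simp: less_Suc_eq)
    show "coef (a1 s)"
     using `s < Suc m` ca a0 zC by (auto simp: a1_def less_Suc_eq intro!: coef_sub coef_scale)
   next
    fix s t assume "s < Suc m" "t < Suc m"
    then show "a1 s ((b(m := c)) t) = (if s = t then \<one> else \<zero>)"
     using dual a0 zC by (auto simp: a1_def less_Suc_eq a_minus_def l.R.r_neg)
   qed
   then have "Q (Suc m)" by (auto simp: Q_def)
   with m(2) show False by fastforce
  qed
 qed
 have "0 < m"
 proof (rule ccontr)
  assume "~ 0 < m"
  then have "e j = \<zero>" using all[of "e j"] j by simp
  with e_nonzero[OF j] show False by simp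
 qed
 then show thesis by (rule that[OF _ F all])
qed

text \<open>
 A trace form \<open>tau\<close> for \<open>j\<close> is a nonzero \<open>Z\<close>-linear map from the field \<open>e\<^sub>j L\<close> to \<open>Z\<close>, given together with
 a pair of bases that are dual with respect to it. It is itself a coefficient of \<open>P\<close>.
\<close>

definition trace_form :: "nat => ('a => 'a) => nat => (nat => 'a) => (nat => 'a) => bool" where
 "trace_form j tau D beta gamma \<longleftrightarrow> coef tau & (ALL b:CL. tau b : Z & tau (b \<otimes> e j) = tau b) &
  (ALL s<D. beta s : CL & beta s \<otimes> e j = beta s & gamma s : CL & gamma s \<otimes> e j = gamma s) &
  (ALL s<D. ALL t<D. tau (beta s \<otimes> gamma t) = (if s = t then \<one> else \<zero>)) &
  (ALL c:CL. c \<otimes> e j = (\<Oplus>s\<in>{..<D}. tau (c \<otimes> gamma s) \<otimes> beta s)) &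
  (ALL c:CL. c \<otimes> e j = (\<Oplus>s\<in>{..<D}. tau (c \<otimes> beta s) \<otimes> gamma s))"

lemma Z_linear_finsum:
 assumes a: "coef a" and I: "finite I" and z: "!!s. s : I ==> z s : Z" and b: "!!s. s : I ==> b s : CL"
 shows "a (\<Oplus>s\<in>I. z s \<otimes> b s) = (\<Oplus>s\<in>I. z s \<otimes> a (b s))"
 using I z b
proof (induction I rule: finite_induct)
 case empty
 show ?case using coef_additive[OF a, of \<zero> \<zero>] coef_closed[OF a, of \<zero>] by simp
next
 case (insert s I)
 have zC: "!!t. t : insert s I ==> z t : CL" using insert ZD by blast
 have 1: "(\<Oplus>s\<in>I. z s \<otimes> b s) : CL" using zC insert by (auto intro!: l.R.finsum_closed)
 have "a (\<Oplus>s\<in>insert s I. z s \<otimes> b s) = a (z s \<otimes> b s) \<oplus> a (\<Oplus>s\<in>I. z s \<otimes> b s)"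
  using insert zC coef_additive[OF a _ 1, of "z s \<otimes> b s"] by (subst l.R.finsum_insert) auto
 also have "... = z s \<otimes> a (b s) \<oplus> (\<Oplus>s\<in>I. z s \<otimes> a (b s))"
  using insert coef_Z_linear[OF a] by simp
 also have "... = (\<Oplus>s\<in>insert s I. z s \<otimes> a (b s))"
  using insert zC coef_closed[OF a] by (subst l.R.finsum_insert) auto
 finally show ?case .
qed

text \<open>
 The first coordinate with respect to a basis over the center is a nonzero linear form, hence nondegenerate because
 \<open>e\<^sub>j L\<close> is a field. A pair of families dual for it is in particular a family separated by coefficients, so its length is
 bounded; in a longest pair both families are bases, and the situation is symmetric in them.
\<close>

lemma trace_form_exists:
 assumes j: "j < n"
 shows "EX tau D beta gamma. trace_form j tau D beta gamma"
proof -
 obtain m b a where m: "0 < m" and F: "center_family j m b a" and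
  all: "!!c. c : CL ==> c \<otimes> e j = c ==> (ALL s<m. a s c : Z) & c = (\<Oplus>s\<in>{..<m}. a s c \<otimes> b s)"
  using center_basis[OF j] by blast
 have bC: "!!s. s < m ==> b s : CL" and be: "!!s. s < m ==> b s \<otimes> e j = b s" and ca: "!!s. s < m ==> coef (a s)"
  and dual: "!!s t. s < m ==> t < m ==> a s (b t) = (if s = t then \<one> else \<zero>)"
  using F by (auto simp: center_family_def)
 define tau where "tau = (%c. a 0 (e j \<otimes> c))"
 have tauc: "coef tau" unfolding tau_def using coef_precompose[OF ca[OF m] e_closed[OF j]] .
 note tauC = coef_closed[OF tauc] and tauadd = coef_additive[OF tauc]
 have tauZ: "tau c : Z" "tau (c \<otimes> e j) = tau c" if c: "c : CL" for c
 proof -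
  have "e j \<otimes> c \<otimes> e j = e j \<otimes> c" using c j by (simp add: l.R.m_ac)
  then show "tau c : Z" "tau (c \<otimes> e j) = tau c" using all[of "e j \<otimes> c"] m c j by (auto simp: tau_def l.R.m_assoc)
 qed
 have tauzero: "tau \<zero> = \<zero>" using tauadd[of \<zero> \<zero>] tauC[of \<zero>] by simp
 have nondeg: "EX c:CL. c \<otimes> e j = c & tau (l \<otimes> c) = \<one>" if l: "l : CL" "l \<otimes> e j ~= \<zero>" for l
 proof -
  obtain y where y: "y : CL" "y \<otimes> l \<otimes> e j = e j" using e_inverse[OF j l] by blast
  have b0: "b 0 : CL" "b 0 \<otimes> e j = b 0" using bC be m by auto
  have "l \<otimes> (y \<otimes> b 0) = (y \<otimes> l \<otimes> e j) \<otimes> b 0" using y(1) l(1) j b0 by (simp add: l.R.m_ac)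
  also have "... = b 0" using y(2) b0 j by (simp add: l.R.m_comm)
  finally have "tau (l \<otimes> (y \<otimes> b 0)) = a 0 (e j \<otimes> b 0)" by (simp add: tau_def)
  also have "... = \<one>" using b0 j dual[OF m m] by (simp add: l.R.m_comm)
  finally show ?thesis using y b0 j by (intro bexI[of _ "y \<otimes> b 0"]) (auto simp: l.R.m_assoc)
 qed
 define pair where "pair D beta gamma \<longleftrightarrow> (ALL s<D. beta s : CL & beta s \<otimes> e j = beta s & gamma s : CL & gamma s \<otimes> e j = gamma s) &
  (ALL s<D. ALL t<D. tau (beta s \<otimes> gamma t) = (if s = t then \<one> else \<zero>))" for D :: nat and beta gamma
 have pair_sym: "pair D gamma beta" if "pair D beta gamma" for D beta gamma
  using that unfolding pair_def by (auto simp: l.R.m_comm[of "gamma _" "beta _"])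
 have bound: "D <= card V * card V" if p: "pair D beta gamma" for D beta gamma
 proof (rule center_family_bound[OF _ j])
  show "center_family j D beta (%s c. tau (gamma s \<otimes> c))"
   using p pair_sym[OF p] coef_precompose[OF tauc] by (simp add: center_family_def pair_def)
 qed
 define Q where "Q D \<longleftrightarrow> (EX beta gamma. pair D beta gamma)" for D
 have Q_bound: "D <= card V * card V" if "Q D" for D
  using that unfolding Q_def by (elim exE) (rule bound)
 have "Q 0" by (simp add: Q_def pair_def)
 then have "EX D. Q D & (ALL D'. Q D' --> D' <= D)"
  using ex_has_greatest_nat[of Q 0 id "Suc (card V * card V)"] Q_bound by (fastforce simp: less_Suc_eq_le)
 then obtain D where D: "Q D" "!!D'. Q D' ==> D' <= D" by blast
 have tausum: "tau ((\<Oplus>s\<in>{..<D}. z s \<otimes> x s) \<otimes> l) = (\<Oplus>s\<in>{..<D}. z s \<otimes> tau (x s \<otimes> l))"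
  if "!!s. s < D ==> z s : Z" "!!s. s < D ==> x s : CL" "l : CL" for z x l
 proof -
  have "(\<Oplus>s\<in>{..<D}. z s \<otimes> x s) \<otimes> l = (\<Oplus>s\<in>{..<D}. z s \<otimes> (x s \<otimes> l))"
   using that ZD(1) by (subst l.R.finsum_ldistr) (auto intro!: l.R.finsum_cong' simp: l.R.m_assoc)
  then show ?thesis using that Z_linear_finsum[OF tauc, of "{..<D}" z "%s. x s \<otimes> l"] by auto
 qed
 have sum_e: "(\<Oplus>s\<in>{..<D}. z s \<otimes> x s) \<otimes> e j = (\<Oplus>s\<in>{..<D}. z s \<otimes> x s)"
  if "!!s. s < D ==> z s : CL" "!!s. s < D ==> x s : CL" "!!s. s < D ==> x s \<otimes> e j = x s" for z x
  using that j by (subst l.R.finsum_ldistr) (auto intro!: l.R.finsum_cong' simp: l.R.m_assoc)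
 \<comment> \<open>A nonzero residue of the expansion would extend the maximal pair of dual families.\<close>
 have expand: "c \<otimes> e j = (\<Oplus>s\<in>{..<D}. tau (c \<otimes> gamma s) \<otimes> beta s)" if p: "pair D beta gamma" and c: "c : CL" for beta gamma c
 proof (rule ccontr)
  have B: "!!s. s < D ==> beta s : CL" "!!s. s < D ==> beta s \<otimes> e j = beta s"
   "!!s. s < D ==> gamma s : CL" "!!s. s < D ==> gamma s \<otimes> e j = gamma s"
   "!!s t. s < D ==> t < D ==> tau (beta s \<otimes> gamma t) = (if s = t then \<one> else \<zero>)" using p unfolding pair_def by blast+
  assume neq: "c \<otimes> e j ~= (\<Oplus>s\<in>{..<D}. tau (c \<otimes> gamma s) \<otimes> beta s)"
  define S where "S = (\<Oplus>s\<in>{..<D}. tau (c \<otimes> gamma s) \<otimes> beta s)"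
  have SC: "S : CL" unfolding S_def using tauC B c by (auto intro!: l.R.finsum_closed)
  have Sg: "tau (S \<otimes> gamma t) = tau (c \<otimes> gamma t)" if t: "t < D" for t
  proof -
   have "tau (S \<otimes> gamma t) = (\<Oplus>s\<in>{..<D}. tau (c \<otimes> gamma s) \<otimes> tau (beta s \<otimes> gamma t))"
    unfolding S_def using t B tauZ c by (intro tausum) auto
   also have "... = tau (c \<otimes> gamma t) \<otimes> tau (beta t \<otimes> gamma t)" using t B tauC c by (intro l.R.finsum_delta) auto
   finally show ?thesis using B t tauC c by simp
  qed
  have "S \<otimes> e j = S"
   unfolding S_def using tauC B c by (intro sum_e) auto
  define r where "r = c \<otimes> e j \<ominus> S"
  have r: "r : CL" "r ~= \<zero>" "r \<otimes> e j = r"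
  proof -
   show "r : CL" "r ~= \<zero>" using neq c SC j l.R.eq_if_minus_zero[of "c \<otimes> e j" S] by (auto simp: r_def S_def[symmetric])
   have ej: "e j : CL" using j by simp
   have "(c \<otimes> e j \<ominus> S) \<otimes> e j = c \<otimes> (e j \<otimes> e j) \<ominus> S \<otimes> e j"
    using c SC ej by (simp add: a_minus_def l.R.l_distr l.R.l_minus l.R.m_assoc)
   then show "r \<otimes> e j = r" using `S \<otimes> e j = S` j by (simp add: r_def)
  qed
  have tauminus: "tau (x \<ominus> y) = tau x \<ominus> tau y" if "x : CL" "y : CL" for x y
  proof -
   have "tau x = tau ((x \<ominus> y) \<oplus> y)" using that by (simp add: a_minus_def l.R.a_assoc l.R.l_neg)
   also have "... = tau (x \<ominus> y) \<oplus> tau y" using that by (intro tauadd) auto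
   finally show ?thesis using that tauC by (simp add: a_minus_def l.R.a_assoc l.R.r_neg)
  qed
  have rg: "tau (r \<otimes> gamma t) = \<zero>" if t: "t < D" for t
  proof -
   have "r \<otimes> gamma t = c \<otimes> gamma t \<ominus> S \<otimes> gamma t"
   proof -
    have "e j \<otimes> gamma t = gamma t" using B t j by (simp add: l.R.m_comm)
    then show ?thesis using c SC B t j by (simp add: r_def a_minus_def l.R.l_distr l.R.l_minus l.R.m_assoc)
   qed
   then show ?thesis using Sg[OF t] tauminus[of "c \<otimes> gamma t" "S \<otimes> gamma t"] c SC B t tauC by (simp add: a_minus_def l.R.r_neg)
  qed
  obtain g where g: "g : CL" "g \<otimes> e j = g" "tau (r \<otimes> g) = \<one>" using nondeg[of r] r by auto
  define G where "G = (\<Oplus>s\<in>{..<D}. tau (beta s \<otimes> g) \<otimes> gamma s)"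
  have GC: "G : CL" unfolding G_def using tauC B g by (auto intro!: l.R.finsum_closed)
  have "G \<otimes> e j = G" unfolding G_def using tauC B g by (intro sum_e) auto
  have tG: "tau (x \<otimes> G) = (\<Oplus>s\<in>{..<D}. tau (beta s \<otimes> g) \<otimes> tau (x \<otimes> gamma s))" if x: "x : CL" for x
  proof -
   have "tau (G \<otimes> x) = (\<Oplus>s\<in>{..<D}. tau (beta s \<otimes> g) \<otimes> tau (gamma s \<otimes> x))"
    unfolding G_def using x B tauZ g by (intro tausum) auto
   moreover have "!!s. s < D ==> gamma s \<otimes> x = x \<otimes> gamma s" using x B by (simp add: l.R.m_comm)
   ultimately show ?thesis using x GC tauC B g by (simp add: l.R.m_comm[of x G] cong: l.R.finsum_cong)
  qed
  define g' where "g' = g \<ominus> G"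
  have g': "g' : CL" "g' \<otimes> e j = g'"
   using g GC j `G \<otimes> e j = G` by (auto simp: g'_def a_minus_def l.R.l_distr l.R.l_minus)
  have "tau (r \<otimes> G) = \<zero>"
   unfolding tG[OF r(1)] using rg tauC B g by (intro l.R.add.finprod_one_eqI) auto
  then have rg': "tau (r \<otimes> g') = \<one>"
   using tauminus[of "r \<otimes> g" "r \<otimes> G"] r g GC by (simp add: g'_def a_minus_def l.R.r_distr l.R.r_minus)
  have bg': "tau (beta t \<otimes> g') = \<zero>" if t: "t < D" for t
  proof -
   have "tau (beta t \<otimes> G) = tau (beta t \<otimes> g) \<otimes> tau (beta t \<otimes> gamma t)"
    unfolding tG[OF B(1)[OF t]] using t B tauC g by (intro l.R.finsum_delta) auto
   then have "tau (beta t \<otimes> G) = tau (beta t \<otimes> g)" using B t tauC g by simp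
   moreover have "beta t \<otimes> g' = beta t \<otimes> g \<ominus> beta t \<otimes> G"
    using B t g GC by (simp add: g'_def a_minus_def l.R.r_distr l.R.r_minus)
   ultimately show ?thesis
    using tauminus[of "beta t \<otimes> g" "beta t \<otimes> G"] B t g GC tauC by (simp add: a_minus_def l.R.r_neg)
  qed
  have "pair (Suc D) (beta(D := r)) (gamma(D := g'))"
   unfolding pair_def
  proof (intro conjI allI impI)
   fix s t assume "s < Suc D" "t < Suc D"
   then show "tau ((beta(D := r)) s \<otimes> (gamma(D := g')) t) = (if s = t then \<one> else \<zero>)"
    using B rg bg' rg' by (auto simp: less_Suc_eq)
  qed (use B r g' in "auto simp: less_Suc_eq")
  then have "Q (Suc D)" unfolding Q_def by (intro exI)
  with D(2) show False by fastforce
 qed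
 obtain beta gamma where p: "pair D beta gamma" using D(1) unfolding Q_def by (elim exE)
 have "ALL c:CL. c \<otimes> e j = (\<Oplus>s\<in>{..<D}. tau (c \<otimes> gamma s) \<otimes> beta s)" using expand[OF p] by blast
 moreover have "ALL c:CL. c \<otimes> e j = (\<Oplus>s\<in>{..<D}. tau (c \<otimes> beta s) \<otimes> gamma s)"
  using expand[OF pair_sym[OF p]] by blast
 moreover have "ALL b:CL. tau b : Z & tau (b \<otimes> e j) = tau b" using tauZ by blast
 ultimately have "trace_form j tau D beta gamma"
  using p tauc unfolding trace_form_def pair_def by (elim conjE, intro conjI)
 then show ?thesis by blast
qed

end

section \<open>Free families and powers\<close>

locale traced_bimodule = connected_quasi_galois_bimodule L P n e V v v' W w w' d T
 for L (structure) and P :: "('a, 'a, 'p) bimodule" and n e and V :: "'v set" and v v' and W :: "'w set" and w w' d T +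
 fixes tau :: "nat => 'a => 'a" and D :: "nat => nat" and beta gamma :: "nat => nat => 'a"
 assumes trace: "j < n ==> trace_form j (tau j) (D j) (beta j) (gamma j)"
begin

lemma trace_coefficient: "j < n ==> coef (tau j)"
 and trace_Z: "[|j < n; b : CL|] ==> tau j b : Z"
 and trace_e: "[|j < n; b : CL|] ==> tau j (b \<otimes> e j) = tau j b"
 and beta_closed [simp]: "[|j < n; s < D j|] ==> beta j s : CL"
 and gamma_closed [simp]: "[|j < n; s < D j|] ==> gamma j s : CL"
 and beta_e: "[|j < n; s < D j|] ==> beta j s \<otimes> e j = beta j s"
 and gamma_e: "[|j < n; s < D j|] ==> gamma j s \<otimes> e j = gamma j s"
 and trace_dual: "[|j < n; s < D j; t < D j|] ==> tau j (beta j s \<otimes> gamma j t) = (if s = t then \<one> else \<zero>)"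
 and expand_beta: "[|j < n; c : CL|] ==> c \<otimes> e j = (\<Oplus>s\<in>{..<D j}. tau j (c \<otimes> gamma j s) \<otimes> beta j s)"
 and expand_gamma: "[|j < n; c : CL|] ==> c \<otimes> e j = (\<Oplus>s\<in>{..<D j}. tau j (c \<otimes> beta j s) \<otimes> gamma j s)"
 using trace[of j] unfolding trace_form_def by blast+

lemma trace_closed [simp]: "[|j < n; b : CL|] ==> tau j b : CL"
 using trace_Z ZD by blast

lemma trace_add: "[|j < n; b : CL; c : CL|] ==> tau j (b \<oplus> c) = tau j b \<oplus> tau j c"
 using coef_additive[OF trace_coefficient] by blast

lemma trace_Z_linear: "[|j < n; b : CL; z : Z|] ==> tau j (z \<otimes> b) = z \<otimes> tau j b"
 using coef_Z_linear[OF trace_coefficient] by blast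

lemma degree_pos: "j < n ==> 0 < D j"
 using expand_beta[of j \<one>] e_nonzero[of j] by (cases "D j") auto

lemma rs_central: "[|z : Z; x : CP; l : CL|] ==> x \<star> (z \<otimes> l) = z \<cdot> (x \<star> l)"
 using ZD(1)[of z] ZD(2)[of z x] by (simp add: rs_assoc[symmetric] rs_ls ZD(1))

lemma functional_expand_gamma:
 assumes j: "j < n" and phi: "phi : duals L P" and x: "x : CP" "x \<star> e j = x" and b: "b : CL"
 shows "phi (x \<star> b) = (\<Oplus>s\<in>{..<D j}. tau j (b \<otimes> beta j s) \<otimes> phi (x \<star> gamma j s))"
proof -
 note phiD = dualsD[OF phi]
 have "x \<star> b = x \<star> e j \<star> b" using x by simp
 also have "... = x \<star> (b \<otimes> e j)" using x(1) b j by (simp add: rs_assoc l.R.m_comm)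
 also have "... = (\<Oplus>\<^bsub>P\<^esub>s\<in>{..<D j}. x \<star> (tau j (b \<otimes> beta j s) \<otimes> gamma j s))"
  unfolding expand_gamma[OF j b] using x b j by (subst rs_finsum_right) auto
 also have "... = (\<Oplus>\<^bsub>P\<^esub>s\<in>{..<D j}. tau j (b \<otimes> beta j s) \<cdot> (x \<star> gamma j s))"
  using x b j by (intro l.M.finsum_cong') (auto simp: rs_central trace_Z)
 finally have "phi (x \<star> b) = phi (\<Oplus>\<^bsub>P\<^esub>s\<in>{..<D j}. tau j (b \<otimes> beta j s) \<cdot> (x \<star> gamma j s))" by simp
 also have "... = (\<Oplus>s\<in>{..<D j}. tau j (b \<otimes> beta j s) \<otimes> phi (x \<star> gamma j s))"
  using x b j phiD by (subst l.functional_finsum[OF phi]) (auto intro!: l.R.finsum_cong')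
 finally show ?thesis .
qed

subsection \<open>The ring of two-sided multiplications\<close>

text \<open>
 The image of \<open>L \<otimes> L\<close> in the endomorphisms of \<open>P\<close>. Working with operators instead of tensors makes
 associativity and commutativity immediate.
\<close>

definition res :: "('p => 'p) => 'p => 'p" where
 "res S = restrict S (CP)"

lemma res_apply [simp]: "x : CP ==> res S x = S x"
 by (simp add: res_def)

lemma res_ext: "(!!x. x : CP ==> S x = S' x) ==> res S = res S'"
 unfolding res_def by (rule restrict_ext)

definition ops :: "('p => 'p) set" where
 "ops = {S. EX (N::nat) k l. (ALL t<N. k t : CL & l t : CL) &
  S = (res (%x. \<Oplus>\<^bsub>P\<^esub>t\<in>{..<N}. (k t \<cdot> x) \<star> l t))}"

lemma ops_zero: "(res (%x. \<zero>\<^bsub>P\<^esub>)) : ops"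
proof -
 have "(res (%x. \<zero>\<^bsub>P\<^esub>)) = (res (%x. \<Oplus>\<^bsub>P\<^esub>t\<in>{..<0::nat}. (\<zero> \<cdot> x) \<star> \<zero>))" by simp
 then show ?thesis unfolding ops_def by (intro CollectI exI[of _ 0] exI[of _ "%_. \<zero>"]) auto
qed

lemma res_sum_Suc:
 assumes "!!t. t < Suc N ==> k t : CL & l t : CL"
 shows "(res (%x. \<Oplus>\<^bsub>P\<^esub>t\<in>{..<Suc N}. (k t \<cdot> x) \<star> l t)) =
  (res (%x. (res (%x. \<Oplus>\<^bsub>P\<^esub>t\<in>{..<N}. (k t \<cdot> x) \<star> l t)) x \<oplus>\<^bsub>P\<^esub> (k N \<cdot> x) \<star> l N))"
proof (rule res_ext)
 fix x assume x: "x : CP"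
 have "(k t \<cdot> x) \<star> l t : CP" if "t < Suc N" for t using assms[OF that] x by simp
 then show "(\<Oplus>\<^bsub>P\<^esub>t\<in>{..<Suc N}. (k t \<cdot> x) \<star> l t) =
  (res (%x. \<Oplus>\<^bsub>P\<^esub>t\<in>{..<N}. (k t \<cdot> x) \<star> l t)) x \<oplus>\<^bsub>P\<^esub> (k N \<cdot> x) \<star> l N"
  unfolding lessThan_Suc using x by (subst l.M.finsum_insert) (auto simp: l.M.a_comm l.M.finsum_closed)
qed

lemma ops_step:
 assumes "S : ops" "k : CL" "l : CL"
 shows "(res (%x. S x \<oplus>\<^bsub>P\<^esub> (k \<cdot> x) \<star> l)) : ops"
proof -
 obtain N :: nat and k' l' where N: "ALL t<N. k' t : CL & l' t : CL"
  "S = (res (%x. \<Oplus>\<^bsub>P\<^esub>t\<in>{..<N}. (k' t \<cdot> x) \<star> l' t))" using assms(1) unfolding ops_def by blast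
 define k'' l'' where "k'' = k'(N := k)" and "l'' = l'(N := l)"
 have C: "t < Suc N ==> k'' t : CL & l'' t : CL" for t
  using N assms by (auto simp: k''_def l''_def less_Suc_eq)
 have "S = (res (%x. \<Oplus>\<^bsub>P\<^esub>t\<in>{..<N}. (k'' t \<cdot> x) \<star> l'' t))"
  unfolding N(2) using N(1) by (intro res_ext l.M.finsum_cong') (auto simp: k''_def l''_def)
 then have "(res (%x. S x \<oplus>\<^bsub>P\<^esub> (k \<cdot> x) \<star> l)) = (res (%x. \<Oplus>\<^bsub>P\<^esub>t\<in>{..<Suc N}. (k'' t \<cdot> x) \<star> l'' t))"
  using res_sum_Suc[OF C] by (simp only: k''_def l''_def fun_upd_same)
 then show ?thesis unfolding ops_def using C by (intro CollectI exI[of _ "Suc N"] exI[of _ k''] exI[of _ l'']) auto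
qed

lemma ops_induct [consumes 1, case_names zero step]:
 assumes S: "S : ops" and zero: "Q (res (%x. \<zero>\<^bsub>P\<^esub>))"
  and step: "!!S k l. [|S : ops; Q S; k : CL; l : CL|] ==> Q (res (%x. S x \<oplus>\<^bsub>P\<^esub> (k \<cdot> x) \<star> l))"
 shows "Q S"
proof -
 obtain N :: nat and k l where N: "!!t. t < N ==> k t : CL & l t : CL"
  "S = (res (%x. \<Oplus>\<^bsub>P\<^esub>t\<in>{..<N}. (k t \<cdot> x) \<star> l t))" using S unfolding ops_def by blast
 have "Q (res (%x. \<Oplus>\<^bsub>P\<^esub>t\<in>{..<m}. (k t \<cdot> x) \<star> l t))" if "m <= N" for m
  using that
 proof (induction m)
  case (Suc m)
  have "(res (%x. \<Oplus>\<^bsub>P\<^esub>t\<in>{..<m}. (k t \<cdot> x) \<star> l t)) : ops"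
   unfolding ops_def using N(1) Suc.prems by (intro CollectI exI[of _ m] exI[of _ k] exI[of _ l]) auto
  then have "Q (res (%x. (res (%x. \<Oplus>\<^bsub>P\<^esub>t\<in>{..<m}. (k t \<cdot> x) \<star> l t)) x \<oplus>\<^bsub>P\<^esub> (k m \<cdot> x) \<star> l m))"
   using N(1)[of m] Suc by (intro step) auto
  then show ?case using N(1) Suc.prems by (subst res_sum_Suc) auto
 qed (use zero in simp)
 then show ?thesis using N(2) by blast
qed

definition op :: "'a => 'a => 'p => 'p" where
 "op k l = (res (%x. (k \<cdot> x) \<star> l))"

definition Op :: "('p => 'p) ring" where
 "Op = \<lparr>carrier = ops, monoid.mult = (%S S'. res (%x. S (S' x))), one = (res (%x. x)),
  ring.zero = (res (%x. \<zero>\<^bsub>P\<^esub>)), ring.add = (%S S'. res (%x. S x \<oplus>\<^bsub>P\<^esub> S' x))\<rparr>"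

definition OpM :: "('p => 'p, 'p) module" where
 "OpM = \<lparr>carrier = CP, monoid.mult = undefined, one = undefined,
  ring.zero = \<zero>\<^bsub>P\<^esub>, ring.add = ring.add P, module.smult = (%S x. S x)\<rparr>"

lemma op_apply [simp]: "x : CP ==> op k l x = (k \<cdot> x) \<star> l"
 by (simp add: op_def)

lemma ops_closed: "S : ops ==> x : CP ==> S x : CP"
 by (induction rule: ops_induct) auto

lemma res_eqI: "S : ops ==> (!!x. x : CP ==> S' x = S x) ==> res S' = S"
 unfolding ops_def by (auto intro!: res_ext)

lemma ops_eqI: "S : ops ==> S' : ops ==> (!!x. x : CP ==> S x = S' x) ==> S = S'"
 by (rule trans[OF res_eqI[of S S', symmetric] res_eqI[of S' S']]) auto

lemma ops_add_arg: "S : ops ==> x : CP ==> y : CP ==> S (x \<oplus>\<^bsub>P\<^esub> y) = S x \<oplus>\<^bsub>P\<^esub> S y"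
proof (induction arbitrary: x y rule: ops_induct)
 case (step S k l)
 then show ?case by (simp add: l.smult_r_distr rs_add l.M.a_ac ops_closed)
qed simp

lemma ops_smult: "S : ops ==> x : CP ==> m : CL ==> S (m \<cdot> x) = m \<cdot> S x"
proof (induction arbitrary: x rule: ops_induct)
 case (step S k l)
 have "k \<cdot> (m \<cdot> x) = m \<cdot> (k \<cdot> x)"
  using step by (simp add: l.smult_assoc1[symmetric] l.R.m_comm)
 then show ?case using step by (simp add: l.smult_r_distr rs_ls ops_closed)
qed simp

lemma ops_rs: "S : ops ==> x : CP ==> m : CL ==> S (x \<star> m) = S x \<star> m"
proof (induction arbitrary: x rule: ops_induct)
 case (step S k l)
 have "(k \<cdot> (x \<star> m)) \<star> l = (k \<cdot> x) \<star> l \<star> m"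
  using step by (simp add: rs_assoc l.R.m_comm rs_ls)
 then show ?case using step by (simp add: rs_add ops_closed)
qed simp

lemma ops_zero_arg: "S : ops ==> S \<zero>\<^bsub>P\<^esub> = \<zero>\<^bsub>P\<^esub>"
 using ops_smult[of S "\<zero>\<^bsub>P\<^esub>" \<zero>] ops_closed[of S "\<zero>\<^bsub>P\<^esub>"] by simp

lemma ops_add: "S' : ops ==> S : ops ==> (res (%x. S x \<oplus>\<^bsub>P\<^esub> S' x)) : ops"
proof (induction S' rule: ops_induct)
 case zero
 have "(res (%x. S x \<oplus>\<^bsub>P\<^esub> (res (%x. \<zero>\<^bsub>P\<^esub>)) x)) = S"
  using ops_closed[OF zero] by (intro res_eqI[OF zero]) auto
 then show ?case using zero by simp
next
 case (step S' k l)
 have "(res (%x. (res (%x. S x \<oplus>\<^bsub>P\<^esub> S' x)) x \<oplus>\<^bsub>P\<^esub> (k \<cdot> x) \<star> l)) : ops"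
  using step by (intro ops_step) auto
 moreover have "(res (%x. (res (%x. S x \<oplus>\<^bsub>P\<^esub> S' x)) x \<oplus>\<^bsub>P\<^esub> (k \<cdot> x) \<star> l)) =
  (res (%x. S x \<oplus>\<^bsub>P\<^esub> (res (%x. S' x \<oplus>\<^bsub>P\<^esub> (k \<cdot> x) \<star> l)) x))"
  using step by (auto intro!: res_ext simp: l.M.a_assoc ops_closed)
 ultimately show ?case by simp
qed

lemma op_ops [simp]: "k : CL ==> l : CL ==> op k l : ops"
proof -
 assume "k : CL" "l : CL"
 then have "(res (%x. (res (%x. \<zero>\<^bsub>P\<^esub>)) x \<oplus>\<^bsub>P\<^esub> (k \<cdot> x) \<star> l)) = op k l"
  by (auto intro!: res_ext simp: op_def)
 with ops_step[OF ops_zero, of k l] show ?thesis using `k : CL` `l : CL` by simp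
qed

lemma ops_compose: "S' : ops ==> S : ops ==> (res (%x. S (S' x))) : ops"
proof (induction S' rule: ops_induct)
 case zero
 have "(res (%x. S ((res (%x. \<zero>\<^bsub>P\<^esub>)) x))) = (res (%x. \<zero>\<^bsub>P\<^esub>))"
  using ops_zero_arg[OF zero] by (auto intro!: res_ext)
 then show ?case using ops_zero by simp
next
 case (step S' k l)
 have 1: "(res (%x. S ((k \<cdot> x) \<star> l))) : ops"
  using step.prems
 proof (induction S rule: ops_induct)
  case zero
  have "(res (%x. (res (%x. \<zero>\<^bsub>P\<^esub>)) ((k \<cdot> x) \<star> l))) = (res (%x. \<zero>\<^bsub>P\<^esub>))"
   using `k : CL` `l : CL` by (auto intro!: res_ext)
  then show ?case using ops_zero by simp
 next
  case (step S k' l')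
  have "(res (%x. (res (%x. S ((k \<cdot> x) \<star> l))) x \<oplus>\<^bsub>P\<^esub> ((k' \<otimes> k) \<cdot> x) \<star> (l \<otimes> l'))) : ops"
   using step `k : CL` `l : CL` by (intro ops_step) auto
  moreover have "(res (%x. (res (%x. S ((k \<cdot> x) \<star> l))) x \<oplus>\<^bsub>P\<^esub> ((k' \<otimes> k) \<cdot> x) \<star> (l \<otimes> l'))) =
   (res (%x. (res (%x. S x \<oplus>\<^bsub>P\<^esub> (k' \<cdot> x) \<star> l')) ((k \<cdot> x) \<star> l)))"
   using step `k : CL` `l : CL`
   by (auto intro!: res_ext simp: rs_assoc[symmetric] l.smult_assoc1 rs_ls)
  ultimately show ?case by simp
 qed
 have "(res (%x. (res (%x. S (S' x))) x \<oplus>\<^bsub>P\<^esub> (res (%x. S ((k \<cdot> x) \<star> l))) x)) : ops"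
  by (rule ops_add[OF 1 step.IH[OF step.prems]])
 moreover have "(res (%x. (res (%x. S (S' x))) x \<oplus>\<^bsub>P\<^esub> (res (%x. S ((k \<cdot> x) \<star> l))) x)) =
  (res (%x. S ((res (%x. S' x \<oplus>\<^bsub>P\<^esub> (k \<cdot> x) \<star> l)) x)))"
  using step by (auto intro!: res_ext simp: ops_add_arg ops_closed)
 ultimately show ?case by simp
qed

lemma ops_commute: "S : ops ==> S' : ops ==> x : CP ==> S (S' x) = S' (S x)"
proof (induction arbitrary: x rule: ops_induct)
 case zero
 then show ?case by (simp add: ops_zero_arg ops_closed)
next
 case (step S k l)
 then show ?case by (simp add: ops_closed ops_add_arg ops_smult ops_rs)
qed

lemma Op_simps [simp]:
 "carrier Op = ops" "\<one>\<^bsub>Op\<^esub> = (res (%x. x))" "\<zero>\<^bsub>Op\<^esub> = (res (%x. \<zero>\<^bsub>P\<^esub>))"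
 "S \<otimes>\<^bsub>Op\<^esub> S' = (res (%x. S (S' x)))" "S \<oplus>\<^bsub>Op\<^esub> S' = (res (%x. S x \<oplus>\<^bsub>P\<^esub> S' x))"
 by (simp_all add: Op_def)

lemma OpM_simps [simp]:
 "carrier OpM = CP" "\<zero>\<^bsub>OpM\<^esub> = \<zero>\<^bsub>P\<^esub>" "x \<oplus>\<^bsub>OpM\<^esub> y = x \<oplus>\<^bsub>P\<^esub> y" "S \<odot>\<^bsub>OpM\<^esub> x = S x"
 by (simp_all add: OpM_def)

lemma id_ops: "(res (%x. x)) : ops"
proof -
 have "op \<one> \<one> = (res (%x. x))" by (auto intro!: res_ext simp: op_def)
 then show ?thesis using op_ops[of \<one> \<one>] by simp
qed

lemma cring_Op: "cring Op"
proof (rule cringI)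
 show "abelian_group Op"
 proof (rule abelian_groupI)
  fix S assume S: "S : carrier Op"
  have "(res (%x. op (\<ominus> \<one>) \<one> (S x))) : ops" using S by (intro ops_compose op_ops) auto
  moreover have "(res (%x. op (\<ominus> \<one>) \<one> (S x))) \<oplus>\<^bsub>Op\<^esub> S = \<zero>\<^bsub>Op\<^esub>"
   using S by (auto intro!: res_ext simp: ops_closed l.smult_l_minus l.M.l_neg)
  ultimately show "EX y:carrier Op. y \<oplus>\<^bsub>Op\<^esub> S = \<zero>\<^bsub>Op\<^esub>" by auto
  show "\<zero>\<^bsub>Op\<^esub> \<oplus>\<^bsub>Op\<^esub> S = S" using S by (auto intro!: res_eqI simp: ops_closed)
  fix S' assume S': "S' : carrier Op"
  show "S \<oplus>\<^bsub>Op\<^esub> S' = S' \<oplus>\<^bsub>Op\<^esub> S"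
   using S S' by simp (rule res_ext, simp add: ops_closed l.M.a_comm)
  fix S'' assume S'': "S'' : carrier Op"
  show "S \<oplus>\<^bsub>Op\<^esub> S' \<oplus>\<^bsub>Op\<^esub> S'' = S \<oplus>\<^bsub>Op\<^esub> (S' \<oplus>\<^bsub>Op\<^esub> S'')"
   using S S' S'' by simp (rule res_ext, simp add: ops_closed l.M.a_assoc)
 qed (auto simp: ops_add ops_zero)
 show "comm_monoid Op"
 proof (rule comm_monoidI)
  fix S assume S: "S : carrier Op"
  show "\<one>\<^bsub>Op\<^esub> \<otimes>\<^bsub>Op\<^esub> S = S" using S by (auto intro!: res_eqI simp: ops_closed)
  fix S' assume S': "S' : carrier Op"
  show "S \<otimes>\<^bsub>Op\<^esub> S' = S' \<otimes>\<^bsub>Op\<^esub> S"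
   using S S' by simp (rule res_ext, simp add: ops_commute)
  fix S'' assume S'': "S'' : carrier Op"
  show "S \<otimes>\<^bsub>Op\<^esub> S' \<otimes>\<^bsub>Op\<^esub> S'' = S \<otimes>\<^bsub>Op\<^esub> (S' \<otimes>\<^bsub>Op\<^esub> S'')"
   using S S' S'' by simp (rule res_ext, simp add: ops_closed)
 qed (auto simp: ops_compose id_ops)
 fix S S' S'' assume "S : carrier Op" "S' : carrier Op" "S'' : carrier Op"
 then show "(S \<oplus>\<^bsub>Op\<^esub> S') \<otimes>\<^bsub>Op\<^esub> S'' = S \<otimes>\<^bsub>Op\<^esub> S'' \<oplus>\<^bsub>Op\<^esub> S' \<otimes>\<^bsub>Op\<^esub> S''"
  by simp (rule res_ext, simp add: ops_closed)
qed

lemma module_op: "module Op OpM"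
proof (rule moduleI)
 show "cring Op" by (rule cring_Op)
 show "abelian_group OpM"
 proof (rule abelian_groupI)
  fix x assume "x : carrier OpM"
  then show "EX y:carrier OpM. y \<oplus>\<^bsub>OpM\<^esub> x = \<zero>\<^bsub>OpM\<^esub>"
   by (intro bexI[of _ "\<ominus>\<^bsub>P\<^esub> x"]) (auto simp: l.M.l_neg)
 qed (auto simp: l.M.a_ac)
qed (auto simp: ops_closed ops_add_arg)

lemma finsum_Op:
 assumes "finite I" "!!s. s : I ==> F s : ops"
 shows "(\<Oplus>\<^bsub>Op\<^esub>s\<in>I. F s) : ops & (ALL x:CP. (\<Oplus>\<^bsub>Op\<^esub>s\<in>I. F s) x = (\<Oplus>\<^bsub>P\<^esub>s\<in>I. F s x))"
proof -
 interpret O: cring Op by (rule cring_Op)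
 show ?thesis using assms
 proof (induction I rule: finite_induct)
  case empty
  then show ?case using ops_zero by simp
 next
  case (insert s I)
  have "(\<Oplus>\<^bsub>Op\<^esub>s\<in>insert s I. F s) = F s \<oplus>\<^bsub>Op\<^esub> (\<Oplus>\<^bsub>Op\<^esub>s\<in>I. F s)"
   using insert by (subst O.finsum_insert) auto
  moreover have "(\<Oplus>\<^bsub>P\<^esub>s\<in>insert s I. F s x) = F s x \<oplus>\<^bsub>P\<^esub> (\<Oplus>\<^bsub>P\<^esub>s\<in>I. F s x)" if "x : CP" for x
   using insert that by (subst l.M.finsum_insert) (auto simp: ops_closed)
  ultimately show ?case using insert ops_add[of "\<Oplus>\<^bsub>Op\<^esub>s\<in>I. F s" "F s"] by auto
 qed
qed

lemma ops_finsum: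
 assumes "finite I" "!!s. s : I ==> k s : CL" "!!s. s : I ==> l s : CL"
 shows "(res (%x. \<Oplus>\<^bsub>P\<^esub>s\<in>I. (k s \<cdot> x) \<star> l s)) : ops"
proof -
 have "(\<Oplus>\<^bsub>Op\<^esub>s\<in>I. op (k s) (l s)) = (res (%x. \<Oplus>\<^bsub>P\<^esub>s\<in>I. (k s \<cdot> x) \<star> l s))"
  using finsum_Op[of I "%s. op (k s) (l s)"] assms
  by (intro res_eqI[symmetric]) (auto intro!: l.M.finsum_cong')
 then show ?thesis using finsum_Op[of I "%s. op (k s) (l s)"] assms by simp
qed

lemma ops_expand:
 assumes j: "j < n"
 shows "S : ops ==> EX c. (ALL s. c s : CL) &
  (ALL x:CP. S (x \<star> e j) = (\<Oplus>\<^bsub>P\<^esub>s\<in>{..<D j}. (c s \<cdot> x) \<star> beta j s))"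
proof (induction rule: ops_induct)
 case zero
 have "(\<Oplus>\<^bsub>P\<^esub>s\<in>{..<D j}. (\<zero> \<cdot> x) \<star> beta j s) = \<zero>\<^bsub>P\<^esub>" if "x : CP" for x
  using that j by (intro l.M.add.finprod_one_eqI) auto
 then show ?case using j by (intro exI[of _ "%_. \<zero>"]) auto
next
 case (step S k l)
 then obtain c where c: "!!s. c s : CL"
  "!!x. x : CP ==> S (x \<star> e j) = (\<Oplus>\<^bsub>P\<^esub>s\<in>{..<D j}. (c s \<cdot> x) \<star> beta j s)" by blast
 define c' where "c' s = (if s < D j then c s \<oplus> k \<otimes> tau j (l \<otimes> gamma j s) else \<zero>)" for s
 have "S (x \<star> e j) \<oplus>\<^bsub>P\<^esub> (k \<cdot> (x \<star> e j)) \<star> l = (\<Oplus>\<^bsub>P\<^esub>s\<in>{..<D j}. (c' s \<cdot> x) \<star> beta j s)"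
  if x: "x : CP" for x
 proof -
  have "(k \<cdot> (x \<star> e j)) \<star> l = (k \<cdot> x) \<star> (l \<otimes> e j)"
   using x step.hyps j by (simp add: rs_ls rs_assoc l.R.m_comm)
  also have "... = (\<Oplus>\<^bsub>P\<^esub>s\<in>{..<D j}. (k \<cdot> x) \<star> (tau j (l \<otimes> gamma j s) \<otimes> beta j s))"
   unfolding expand_beta[OF j step.hyps(3)] using x step.hyps j by (subst rs_finsum_right) auto
  also have "... = (\<Oplus>\<^bsub>P\<^esub>s\<in>{..<D j}. ((k \<otimes> tau j (l \<otimes> gamma j s)) \<cdot> x) \<star> beta j s)"
   using x step.hyps j
   by (intro l.M.finsum_cong')
    (auto simp: rs_central trace_Z l.smult_assoc1[symmetric] rs_ls l.R.m_comm[of k])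
  finally have 1: "(k \<cdot> (x \<star> e j)) \<star> l = (\<Oplus>\<^bsub>P\<^esub>s\<in>{..<D j}. ((k \<otimes> tau j (l \<otimes> gamma j s)) \<cdot> x) \<star> beta j s)" .
  have "(\<Oplus>\<^bsub>P\<^esub>s\<in>{..<D j}. (c' s \<cdot> x) \<star> beta j s) =
   (\<Oplus>\<^bsub>P\<^esub>s\<in>{..<D j}. (c s \<cdot> x) \<star> beta j s) \<oplus>\<^bsub>P\<^esub> (\<Oplus>\<^bsub>P\<^esub>s\<in>{..<D j}. ((k \<otimes> tau j (l \<otimes> gamma j s)) \<cdot> x) \<star> beta j s)"
   using x step.hyps j c(1)
   by (intro trans[OF l.M.finsum_cong' l.M.finsum_addf]) (auto simp: c'_def l.smult_l_distr rs_add)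
  with 1 c(2)[OF x] show ?thesis by simp
 qed
 moreover have "c' s : CL" for s using c(1) step.hyps j by (auto simp: c'_def)
 ultimately show ?case using j by (intro exI[of _ c']) auto
qed

lemma op_idem:
 assumes "i < n" "j < n"
 shows "op (e i) (e j) \<otimes>\<^bsub>Op\<^esub> op (e i) (e j) = op (e i) (e j)"
 using assms by (auto intro!: res_ext simp: op_def rs_ls rs_assoc l.smult_assoc1[symmetric])

text \<open>
 On \<open>P e\<^sub>j\<close> an operator has \<open>D j\<close> coordinates in \<open>L\<close> with respect to the right multiplications by \<open>beta\<close>, so \<open>D j + 1\<close>
 operators satisfy a relation over the field \<open>e\<^sub>i L\<close>.
\<close>

lemma op_finite_dim:
 assumes ij: "i < n" "j < n"
 shows "fd_idem Op (op (e i) (e j)) (D j)"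
 unfolding fd_idem_def
proof (intro conjI allI impI)
 let ?epsilon = "op (e i) (e j)"
 show "?epsilon : carrier Op" "?epsilon \<otimes>\<^bsub>Op\<^esub> ?epsilon = ?epsilon" using ij op_idem[OF ij] by auto
 fix S assume S: "ALL l<=D j. S l : carrier Op"
 then have "ALL l. EX c. l <= D j --> (ALL s. c s : CL) &
  (ALL x:CP. S l (x \<star> e j) = (\<Oplus>\<^bsub>P\<^esub>s\<in>{..<D j}. (c s \<cdot> x) \<star> beta j s))"
  using ops_expand[OF ij(2)] by auto
 then obtain c where c: "!!l s. l <= D j ==> c l s : CL"
  "!!l x. l <= D j ==> x : CP ==> S l (x \<star> e j) = (\<Oplus>\<^bsub>P\<^esub>s\<in>{..<D j}. (c l s \<cdot> x) \<star> beta j s)"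
  by metis
 have 1: "card {..<D j} < card {..D j}" by simp
 have 2: "c l s : CL" if "s : {..<D j}" "l : {..D j}" for s l using c(1) that by auto
 obtain k where k: "ALL l:{..D j}. k l : CL" "EX l:{..D j}. k l \<otimes> e i ~= \<zero>"
  "ALL s:{..<D j}. (\<Oplus>l\<in>{..D j}. k l \<otimes> c l s) \<otimes> e i = \<zero>"
  using l.R.field_idem_system[OF e_field[OF ij(1)] finite_lessThan finite_atMost 1, of "%s l. c l s", OF 2] by blast
 have kC: "k l : CL" if "l <= D j" for l using k(1) that by auto
 have op_mult: "op a \<one> \<otimes>\<^bsub>Op\<^esub> op b' b = op (a \<otimes> b') b" if "a : CL" "b' : CL" "b : CL" for a b b'
  using that by (auto intro!: res_ext simp: op_def l.smult_assoc1 rs_ls)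
 have op_null: "op \<zero> b = \<zero>\<^bsub>Op\<^esub>" if "b : CL" for b
  using that by (auto intro!: res_ext simp: op_def)
 have inv: "EX y:carrier Op. y \<otimes>\<^bsub>Op\<^esub> op (k l) \<one> \<otimes>\<^bsub>Op\<^esub> ?epsilon = ?epsilon"
  if l: "l <= D j" and nz: "k l \<otimes> e i ~= \<zero>" for l
 proof -
  obtain y where y: "y : CL" "y \<otimes> k l \<otimes> e i = e i" using e_inverse[OF ij(1) kC[OF l] nz] by blast
  have "op y \<one> \<otimes>\<^bsub>Op\<^esub> op (k l) \<one> \<otimes>\<^bsub>Op\<^esub> ?epsilon = op (y \<otimes> k l \<otimes> e i) (e j)"
   using y(1) kC[OF l] ij op_mult[of y "k l" \<one>] op_mult[of "y \<otimes> k l" "e i" "e j"] by simp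
  then show ?thesis using y by (intro bexI[of _ "op y \<one>"]) auto
 qed
 have z: "op (k l) \<one> \<otimes>\<^bsub>Op\<^esub> ?epsilon = \<zero>\<^bsub>Op\<^esub>" if l: "l <= D j" and nz: "k l \<otimes> e i = \<zero>" for l
  using op_mult[of "k l" "e i" "e j"] op_null[of "e j"] nz kC[OF l] ij by simp
 have 3: "op (k l) \<one> \<otimes>\<^bsub>Op\<^esub> ?epsilon = \<zero>\<^bsub>Op\<^esub> |
  (EX y:carrier Op. y \<otimes>\<^bsub>Op\<^esub> op (k l) \<one> \<otimes>\<^bsub>Op\<^esub> ?epsilon = ?epsilon)" if "l <= D j" for l
  using inv[OF that] z[OF that] by blast
 have epsilonnz: "?epsilon ~= \<zero>\<^bsub>Op\<^esub>"
 proof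
  assume "?epsilon = \<zero>\<^bsub>Op\<^esub>"
  then have "?epsilon x = \<zero>\<^bsub>Op\<^esub> x" for x by simp
  moreover obtain x where "x : CP" "e i \<cdot> (x \<star> e j) ~= \<zero>\<^bsub>P\<^esub>" using block_nonzero[OF ij] by blast
  ultimately show False using ij by (auto simp: rs_ls dest: meta_spec[of _ x])
 qed
 have 4: "EX l<=D j. op (k l) \<one> \<otimes>\<^bsub>Op\<^esub> ?epsilon ~= \<zero>\<^bsub>Op\<^esub>"
 proof -
  obtain l where l: "l <= D j" "k l \<otimes> e i ~= \<zero>" using k(2) by auto
  obtain y where y: "y : carrier Op" "y \<otimes>\<^bsub>Op\<^esub> op (k l) \<one> \<otimes>\<^bsub>Op\<^esub> ?epsilon = ?epsilon" using inv[OF l] by blast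
  interpret O: cring Op by (rule cring_Op)
  have C: "op (k l) \<one> : carrier Op" "?epsilon : carrier Op" using kC[OF l(1)] ij by auto
  have "op (k l) \<one> \<otimes>\<^bsub>Op\<^esub> ?epsilon ~= \<zero>\<^bsub>Op\<^esub>"
   using y epsilonnz O.m_assoc[OF y(1) C] O.r_null[OF y(1)] by metis
  then show ?thesis using l(1) by blast
 qed
 have 5: "(\<Oplus>\<^bsub>Op\<^esub>l\<in>{..D j}. op (k l) \<one> \<otimes>\<^bsub>Op\<^esub> S l) \<otimes>\<^bsub>Op\<^esub> ?epsilon = \<zero>\<^bsub>Op\<^esub>"
 proof -
  have kS: "op (k l) \<one> \<otimes>\<^bsub>Op\<^esub> S l : ops" if "l : {..D j}" for l using S kC that ops_compose[of "S l" "op (k l) \<one>"] by simp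
  note F = finsum_Op[OF finite_atMost kS]
  have mem: "(\<Oplus>\<^bsub>Op\<^esub>l\<in>{..D j}. op (k l) \<one> \<otimes>\<^bsub>Op\<^esub> S l) \<otimes>\<^bsub>Op\<^esub> ?epsilon : ops"
   using ops_compose[OF op_ops[of "e i" "e j"] conjunct1[OF F]] ij by simp
  have val: "((\<Oplus>\<^bsub>Op\<^esub>l\<in>{..D j}. op (k l) \<one> \<otimes>\<^bsub>Op\<^esub> S l) \<otimes>\<^bsub>Op\<^esub> ?epsilon) x = \<zero>\<^bsub>P\<^esub>"
   if x: "x : CP" for x
  proof -
  have ex: "e i \<cdot> x : CP" using x ij by simp
  have "((\<Oplus>\<^bsub>Op\<^esub>l\<in>{..D j}. op (k l) \<one> \<otimes>\<^bsub>Op\<^esub> S l) \<otimes>\<^bsub>Op\<^esub> ?epsilon) x =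
   (\<Oplus>\<^bsub>P\<^esub>l\<in>{..D j}. (op (k l) \<one> \<otimes>\<^bsub>Op\<^esub> S l) ((e i \<cdot> x) \<star> e j))"
   using conjunct2[OF F] x ij by simp
  also have "... = (\<Oplus>\<^bsub>P\<^esub>l\<in>{..D j}. \<Oplus>\<^bsub>P\<^esub>s\<in>{..<D j}. (k l \<otimes> c l s \<cdot> (e i \<cdot> x)) \<star> beta j s)"
  proof (intro l.M.finsum_cong')
   fix l assume l: "l : {..D j}"
   have SC: "S l ((e i \<cdot> x) \<star> e j) : CP" using S l ops_closed ex ij by auto
   have "(op (k l) \<one> \<otimes>\<^bsub>Op\<^esub> S l) ((e i \<cdot> x) \<star> e j) = k l \<cdot> S l ((e i \<cdot> x) \<star> e j)"
    using SC ex ij l kC by simp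
   also have "... = k l \<cdot> (\<Oplus>\<^bsub>P\<^esub>s\<in>{..<D j}. (c l s \<cdot> (e i \<cdot> x)) \<star> beta j s)" using c(2)[of l "e i \<cdot> x"] ex l by simp
   also have "... = (\<Oplus>\<^bsub>P\<^esub>s\<in>{..<D j}. k l \<cdot> ((c l s \<cdot> (e i \<cdot> x)) \<star> beta j s))"
    using c(1) ex l kC ij by (intro l.finsum_smult_ldistr) auto
   also have "... = (\<Oplus>\<^bsub>P\<^esub>s\<in>{..<D j}. (k l \<otimes> c l s \<cdot> (e i \<cdot> x)) \<star> beta j s)"
    using c(1) ex l kC ij by (intro l.M.finsum_cong') (auto simp: rs_ls[symmetric] l.smult_assoc1)
   finally show "(op (k l) \<one> \<otimes>\<^bsub>Op\<^esub> S l) ((e i \<cdot> x) \<star> e j) =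
    (\<Oplus>\<^bsub>P\<^esub>s\<in>{..<D j}. (k l \<otimes> c l s \<cdot> (e i \<cdot> x)) \<star> beta j s)" .
  qed (use c(1) ex kC ij in "auto intro!: l.M.finsum_closed")
  also have "... = (\<Oplus>\<^bsub>P\<^esub>s\<in>{..<D j}. \<Oplus>\<^bsub>P\<^esub>l\<in>{..D j}. (k l \<otimes> c l s \<cdot> (e i \<cdot> x)) \<star> beta j s)"
   using c(1) ex kC ij by (intro l.M.finsum_swap) auto
  also have "... = \<zero>\<^bsub>P\<^esub>"
  proof (rule l.M.add.finprod_one_eqI)
   fix s assume s: "s : {..<D j}"
   have "(\<Oplus>\<^bsub>P\<^esub>l\<in>{..D j}. (k l \<otimes> c l s \<cdot> (e i \<cdot> x)) \<star> beta j s) = ((\<Oplus>l\<in>{..D j}. k l \<otimes> c l s) \<cdot> (e i \<cdot> x)) \<star> beta j s"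
    using c(1) ex kC ij s by (subst smult_finsum_left, auto, subst rs_finsum, auto)
   also have "(\<Oplus>l\<in>{..D j}. k l \<otimes> c l s) \<cdot> (e i \<cdot> x) = ((\<Oplus>l\<in>{..D j}. k l \<otimes> c l s) \<otimes> e i) \<cdot> x"
    using c(1) kC ij x by (intro l.smult_assoc1[symmetric]) (auto intro!: l.R.finsum_closed)
   also have "... = \<zero>\<^bsub>P\<^esub>" using k(3) s x by simp
   finally show "(\<Oplus>\<^bsub>P\<^esub>l\<in>{..D j}. (k l \<otimes> c l s \<cdot> (e i \<cdot> x)) \<star> beta j s) = \<zero>\<^bsub>P\<^esub>" using s ij by simp
  qed
  finally show ?thesis .
  qed
  show ?thesis using res_eqI[OF mem, of "%_. \<zero>\<^bsub>P\<^esub>"] val by simp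
 qed
 show "EX k. (ALL l<=D j. k l : carrier Op & (k l \<otimes>\<^bsub>Op\<^esub> ?epsilon = \<zero>\<^bsub>Op\<^esub> |
   (EX y:carrier Op. y \<otimes>\<^bsub>Op\<^esub> k l \<otimes>\<^bsub>Op\<^esub> ?epsilon = ?epsilon))) &
   (EX l<=D j. k l \<otimes>\<^bsub>Op\<^esub> ?epsilon ~= \<zero>\<^bsub>Op\<^esub>) &
   (\<Oplus>\<^bsub>Op\<^esub>l\<in>{..D j}. k l \<otimes>\<^bsub>Op\<^esub> S l) \<otimes>\<^bsub>Op\<^esub> ?epsilon = \<zero>\<^bsub>Op\<^esub>"
 proof (rule exI[of _ "%l. op (k l) \<one>"], rule conjI[OF _ conjI[OF 4 5]], intro allI impI)
  fix l assume l: "l <= D j"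
  have "op (k l) \<one> : carrier Op" using kC[OF l] by simp
  then show "op (k l) \<one> : carrier Op & (op (k l) \<one> \<otimes>\<^bsub>Op\<^esub> ?epsilon = \<zero>\<^bsub>Op\<^esub> |
   (EX y:carrier Op. y \<otimes>\<^bsub>Op\<^esub> op (k l) \<one> \<otimes>\<^bsub>Op\<^esub> ?epsilon = ?epsilon))"
   using 3[OF l] by (rule conjI)
 qed
qed

end

context traced_bimodule
begin

lemma trace_coefficients:
 assumes j: "j < n"
 shows "EX (N::nat) psi y. (ALL t<N. psi t : duals L P & y t : CP) &
  (ALL b:CL. tau j b = (\<Oplus>t\<in>{..<N}. psi t (y t \<star> b)))"
 using trace_coefficient[OF j] unfolding coef_def by blast

text \<open>
 The pairing of a functional \<open>phi\<close> with a vector \<open>x\<close>, with values in the ring of operators: the two-sided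
 multiplication \<open>\<Sum> phi(x gamma\<^sub>s) \<otimes> beta\<^sub>s\<close>. Through it left linear functionals become linear over the ring of
 operators; linearity in \<open>x\<close> over right multiplications is the invariance of the Casimir element
 \<open>\<Sum> gamma\<^sub>s \<otimes> beta\<^sub>s\<close>.
\<close>

definition pairing :: "nat => ('p => 'a) => 'p => 'p => 'p" where
 "pairing j phi x = res (%y. \<Oplus>\<^bsub>P\<^esub>s\<in>{..<D j}. (phi (x \<star> gamma j s) \<cdot> y) \<star> beta j s)"

lemma pairing_ops:
 assumes "j < n" "phi : duals L P" "x : CP"
 shows "pairing j phi x : ops"
 unfolding pairing_def using assms dualsD(1)[OF assms(2)] by (intro ops_finsum) auto

lemma pairing_apply: "y : CP ==>
  pairing j phi x y = (\<Oplus>\<^bsub>P\<^esub>s\<in>{..<D j}. (phi (x \<star> gamma j s) \<cdot> y) \<star> beta j s)"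
 by (simp add: pairing_def)

lemma pairing_add:
 assumes j: "j < n" and phi: "phi : duals L P" and x: "x : CP" "x' : CP" and y: "y : CP"
 shows "pairing j phi (x \<oplus>\<^bsub>P\<^esub> x') y = pairing j phi x y \<oplus>\<^bsub>P\<^esub> pairing j phi x' y"
 unfolding pairing_apply[OF y]
 using assms dualsD[OF phi]
 by (intro trans[OF l.M.finsum_cong' l.M.finsum_addf]) (auto simp: rs_add l.smult_l_distr)

lemma pairing_op:
 assumes j: "j < n" and phi: "phi : duals L P" and x: "x : CP" and y: "y : CP"
  and k: "k : CL" and l: "l : CL"
 shows "pairing j phi ((k \<cdot> x) \<star> l) y = (k \<cdot> pairing j phi x y) \<star> l"
proof -
 note phiD = dualsD[OF phi]
 define f where "f s = phi (x \<star> gamma j s)" for s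
 have f: "f s : CL" if "s < D j" for s using phiD(1) x j that by (simp add: f_def)
 define m where "m s t = tau j (l \<otimes> gamma j s \<otimes> beta j t)" for s t
 have mZ: "m s t : Z" if "s < D j" "t < D j" for s t unfolding m_def using trace_Z[OF j] l j that by simp
 note mC = ZD(1)[OF mZ]
 have 1: "phi ((k \<cdot> x) \<star> l \<star> gamma j s) = (\<Oplus>t\<in>{..<D j}. k \<otimes> (m s t \<otimes> f t))" if s: "s < D j" for s
 proof -
  have g: "l \<otimes> gamma j s \<otimes> e j = l \<otimes> gamma j s" using l j s gamma_e[OF j s] by (simp add: l.R.m_assoc)
  have "(k \<cdot> x) \<star> l \<star> gamma j s = k \<cdot> (x \<star> (l \<otimes> gamma j s))"
   using k l x j s by (simp add: rs_assoc rs_ls)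
  also have "x \<star> (l \<otimes> gamma j s) = x \<star> e j \<star> (l \<otimes> gamma j s)"
   using g x l j s by (simp add: rs_assoc l.R.m_comm)
  finally have "phi ((k \<cdot> x) \<star> l \<star> gamma j s) = k \<otimes> phi (x \<star> e j \<star> (l \<otimes> gamma j s))"
   using phiD(3)[OF k, of "x \<star> e j \<star> (l \<otimes> gamma j s)"] x l j s by simp
  also have "phi (x \<star> e j \<star> (l \<otimes> gamma j s)) = (\<Oplus>t\<in>{..<D j}. m s t \<otimes> phi (x \<star> e j \<star> gamma j t))"
   unfolding m_def using x l j s by (intro functional_expand_gamma[OF j phi]) (auto simp: rs_assoc)
  also have "... = (\<Oplus>t\<in>{..<D j}. m s t \<otimes> f t)"
   using x j mC[OF s] f gamma_e[OF j] by (intro l.R.finsum_cong') (auto simp: f_def rs_assoc l.R.m_comm)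
  also have "k \<otimes> ... = (\<Oplus>t\<in>{..<D j}. k \<otimes> (m s t \<otimes> f t))"
   using k mC[OF s] f by (intro l.R.finsum_rdistr) auto
  finally show ?thesis .
 qed
 have "pairing j phi ((k \<cdot> x) \<star> l) y =
   (\<Oplus>\<^bsub>P\<^esub>s\<in>{..<D j}. \<Oplus>\<^bsub>P\<^esub>t\<in>{..<D j}. (k \<otimes> f t) \<cdot> (y \<star> (m s t \<otimes> beta j s)))"
  unfolding pairing_apply[OF y]
 proof (intro l.M.finsum_cong')
  fix s assume "s : {..<D j}" then have s: "s < D j" by simp
  have "(phi ((k \<cdot> x) \<star> l \<star> gamma j s) \<cdot> y) \<star> beta j s =
   (\<Oplus>\<^bsub>P\<^esub>t\<in>{..<D j}. (k \<otimes> (m s t \<otimes> f t)) \<cdot> y) \<star> beta j s"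
   unfolding 1[OF s] using k mC[OF s] f y by (subst smult_finsum_left) auto
  also have "... = (\<Oplus>\<^bsub>P\<^esub>t\<in>{..<D j}. ((k \<otimes> (m s t \<otimes> f t)) \<cdot> y) \<star> beta j s)"
   using k mC[OF s] f y j s by (subst rs_finsum) auto
  also have "... = (\<Oplus>\<^bsub>P\<^esub>t\<in>{..<D j}. (k \<otimes> f t) \<cdot> (y \<star> (m s t \<otimes> beta j s)))"
  proof (intro l.M.finsum_cong')
   fix t assume "t : {..<D j}" then have t: "t < D j" by simp
   have "(k \<otimes> (m s t \<otimes> f t)) \<cdot> y = (k \<otimes> f t) \<cdot> (m s t \<cdot> y)"
    using k mC[OF s t] f[OF t] y by (simp add: l.smult_assoc1[symmetric] l.R.m_ac)
   then show "((k \<otimes> (m s t \<otimes> f t)) \<cdot> y) \<star> beta j s = (k \<otimes> f t) \<cdot> (y \<star> (m s t \<otimes> beta j s))"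
    using k mC[OF s t] f[OF t] y j s mZ[OF s t] by (simp add: rs_central rs_ls)
  qed (use k mC[OF s] f y j s in auto)
  finally show "(phi ((k \<cdot> x) \<star> l \<star> gamma j s) \<cdot> y) \<star> beta j s =
   (\<Oplus>\<^bsub>P\<^esub>t\<in>{..<D j}. (k \<otimes> f t) \<cdot> (y \<star> (m s t \<otimes> beta j s)))" .
 qed (use k mC f y j in "auto intro!: l.M.finsum_closed")
 also have "... = (\<Oplus>\<^bsub>P\<^esub>t\<in>{..<D j}. \<Oplus>\<^bsub>P\<^esub>s\<in>{..<D j}. (k \<otimes> f t) \<cdot> (y \<star> (m s t \<otimes> beta j s)))"
  using k mC f y j by (intro l.M.finsum_swap) auto
 also have "... = (\<Oplus>\<^bsub>P\<^esub>t\<in>{..<D j}. (k \<cdot> ((f t \<cdot> y) \<star> beta j t)) \<star> l)"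
 proof (intro l.M.finsum_cong')
  fix t assume "t : {..<D j}" then have t: "t < D j" by simp
  have C: "m s t \<otimes> beta j s : CL" if "s < D j" for s using mC[OF that t] j that by simp
  have "l \<otimes> beta j t = l \<otimes> beta j t \<otimes> e j" using beta_e[OF j t] l j t by (simp add: l.R.m_assoc)
  also have "... = (\<Oplus>s\<in>{..<D j}. tau j (l \<otimes> beta j t \<otimes> gamma j s) \<otimes> beta j s)" using l j t by (intro expand_beta) auto
  also have "... = (\<Oplus>s\<in>{..<D j}. m s t \<otimes> beta j s)"
   using l j t C by (intro l.R.finsum_cong') (auto simp: m_def l.R.m_ac)
  finally have lb: "l \<otimes> beta j t = (\<Oplus>s\<in>{..<D j}. m s t \<otimes> beta j s)" .
  have "(\<Oplus>\<^bsub>P\<^esub>s\<in>{..<D j}. (k \<otimes> f t) \<cdot> (y \<star> (m s t \<otimes> beta j s))) =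
   (k \<otimes> f t) \<cdot> (\<Oplus>\<^bsub>P\<^esub>s\<in>{..<D j}. y \<star> (m s t \<otimes> beta j s))"
   using k f[OF t] y C by (intro l.finsum_smult_ldistr[symmetric]) auto
  also have "(\<Oplus>\<^bsub>P\<^esub>s\<in>{..<D j}. y \<star> (m s t \<otimes> beta j s)) = y \<star> (l \<otimes> beta j t)"
   unfolding lb using y C by (subst rs_finsum_right) auto
  also have "(k \<otimes> f t) \<cdot> (y \<star> (l \<otimes> beta j t)) = (k \<cdot> ((f t \<cdot> y) \<star> beta j t)) \<star> l"
   using k f[OF t] y l j t by (simp add: l.smult_assoc1 rs_ls rs_assoc l.R.m_comm)
  finally show "(\<Oplus>\<^bsub>P\<^esub>s\<in>{..<D j}. (k \<otimes> f t) \<cdot> (y \<star> (m s t \<otimes> beta j s))) = (k \<cdot> ((f t \<cdot> y) \<star> beta j t)) \<star> l" .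
 qed (use k f y j l in auto)
 also have "... = (k \<cdot> pairing j phi x y) \<star> l"
  unfolding pairing_apply[OF y] f_def[symmetric] using k f y j l
  by (subst l.finsum_smult_ldistr, auto, subst rs_finsum, auto)
 finally show ?thesis .
qed

lemma pairing_functional:
 assumes j: "j < n" and phi: "phi : duals L P"
 shows "pairing j phi : duals Op OpM"
 unfolding duals_def
proof (intro CollectI conjI ballI)
 fix x assume "x : carrier OpM"
 then have x: "x : CP" by simp
 show "pairing j phi x : carrier Op" using pairing_ops[OF j phi x] by simp
 fix x' assume "x' : carrier OpM"
 then have x': "x' : CP" by simp
 have "res (%y. pairing j phi x y \<oplus>\<^bsub>P\<^esub> pairing j phi x' y) = pairing j phi (x \<oplus>\<^bsub>P\<^esub> x')"
  using pairing_ops[OF j phi] x x' pairing_add[OF j phi x x'] by (intro res_eqI) auto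
 then show "pairing j phi (x \<oplus>\<^bsub>OpM\<^esub> x') = pairing j phi x \<oplus>\<^bsub>Op\<^esub> pairing j phi x'" by simp
next
 fix S x assume "S : carrier Op" "x : carrier OpM"
 then have S: "S : ops" and x: "x : CP" by auto
 have "pairing j phi (S x) y = S (pairing j phi x y)" if y: "y : CP" for y
  using S
 proof (induction S rule: ops_induct)
  case zero
  have "phi \<zero>\<^bsub>P\<^esub> = \<zero>" by (rule l.functional_zero[OF phi])
  then have "pairing j phi \<zero>\<^bsub>P\<^esub> y = \<zero>\<^bsub>P\<^esub>"
   unfolding pairing_apply[OF y] using y j by (intro l.M.add.finprod_one_eqI) auto
  then show ?case using x y ops_closed[OF pairing_ops[OF j phi x] y] by simp
 next
  case (step S k l)
  have C: "pairing j phi x y : CP" using ops_closed[OF pairing_ops[OF j phi x] y] .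
  show ?case
   using pairing_add[OF j phi ops_closed[OF step.hyps(1) x] _ y] pairing_op[OF j phi x y step.hyps(2,3)] step x C
   by simp
 qed
 then have "res (%y. S (pairing j phi x y)) = pairing j phi (S x)"
  using pairing_ops[OF j phi ops_closed[OF S x]] by (intro res_eqI) auto
 then show "pairing j phi (S \<odot>\<^bsub>OpM\<^esub> x) = S \<otimes>\<^bsub>Op\<^esub> pairing j phi x" by simp
qed

definition free_family :: "nat => nat => 'i set => ('i => 'p) => ('i => 'p => 'a) => bool" where
 "free_family i j I x phi \<longleftrightarrow> finite I &
  (ALL a:I. x a : CP & e i \<cdot> x a = x a & x a \<star> e j = x a) &
  (ALL a:I. phi a : duals L P & (ALL y:CP. e i \<otimes> phi a y = phi a y)) &
  (ALL a:I. ALL c:I. ALL b:CL. phi a (x c \<star> b) = (if a = c then e i \<otimes> tau j b else \<zero>))"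

text \<open>
 A free family of size \<open>r\<close> for \<open>(i, j)\<close> exhibits the \<open>r\<close>-th power of \<open>L\<^sub>i \<otimes>\<^sub>Z L\<^sub>j\<close> as a summand of
 \<open>e\<^sub>i P e\<^sub>j\<close>. If the \<open>N\<close>-th power of \<open>P\<close> has such a summand of rank \<open>card A\<close>, then \<open>P\<close> itself has one of
 any rank \<open>r\<close> below the expected bound.
\<close>

lemma free_family_of_power:
 fixes A :: "'i set"
 assumes ij: "i < n" "j < n" and A: "finite A"
  and phi: "!!a t. a : A ==> t < N ==> phi a t : duals L P"
  and xi: "!!a t. a : A ==> t < N ==> xi a t : CP"
  and pair: "!!a c b. a : A ==> c : A ==> b : CL ==>
   (\<Oplus>t\<in>{..<N}. phi a t (xi c t \<star> b)) = (if a = c then e i \<otimes> tau j b else \<zero>)"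
  and r: "!!r'. r' < r ==> N * r' < card A"
 shows "EX x f. free_family i j {..<r::nat} x f"
proof -
 interpret O: module Op OpM by (rule module_op)
 let ?epsilon = "op (e i) (e j)"
 have epsilon: "?epsilon : carrier Op" "?epsilon \<otimes>\<^bsub>Op\<^esub> ?epsilon = ?epsilon" using ij op_idem[OF ij] by auto
 have pairing_sum: "(\<Oplus>\<^bsub>Op\<^esub>t\<in>{..<N}. pairing j (phi a t) (xi c t)) = (if a = c then ?epsilon else \<zero>\<^bsub>Op\<^esub>)"
  if a: "a : A" and c: "c : A" for a c
 proof (rule ops_eqI)
  have po: "pairing j (phi a t) (xi c t) : ops" if "t : {..<N}" for t
   using that pairing_ops[OF ij(2) phi xi] a c by simp
  note F = finsum_Op[where I = "{..<N}" and F = "%t. pairing j (phi a t) (xi c t)", OF finite_lessThan po]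
  show "(\<Oplus>\<^bsub>Op\<^esub>t\<in>{..<N}. pairing j (phi a t) (xi c t)) : ops" using F by blast
  show "(if a = c then ?epsilon else \<zero>\<^bsub>Op\<^esub>) : ops" using ij ops_zero by simp
  fix y assume y: "y : CP"
  have fC: "phi a t (xi c t \<star> gamma j s) : CL" if "t < N" "s < D j" for t s
   using dualsD(1)[OF phi[OF a that(1)]] xi[OF c that(1)] ij that by simp
  have "(\<Oplus>\<^bsub>Op\<^esub>t\<in>{..<N}. pairing j (phi a t) (xi c t)) y =
   (\<Oplus>\<^bsub>P\<^esub>t\<in>{..<N}. \<Oplus>\<^bsub>P\<^esub>s\<in>{..<D j}. (phi a t (xi c t \<star> gamma j s) \<cdot> y) \<star> beta j s)"
   using conjunct2[OF F] y by (simp add: pairing_apply)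
  also have "... = (\<Oplus>\<^bsub>P\<^esub>s\<in>{..<D j}. \<Oplus>\<^bsub>P\<^esub>t\<in>{..<N}. (phi a t (xi c t \<star> gamma j s) \<cdot> y) \<star> beta j s)"
   using fC y ij by (intro l.M.finsum_swap) auto
  also have "... = (\<Oplus>\<^bsub>P\<^esub>s\<in>{..<D j}. ((if a = c then e i \<otimes> tau j (gamma j s) else \<zero>) \<cdot> y) \<star> beta j s)"
  proof (intro l.M.finsum_cong')
   fix s assume "s : {..<D j}" then have s: "s < D j" by simp
   have "(\<Oplus>\<^bsub>P\<^esub>t\<in>{..<N}. (phi a t (xi c t \<star> gamma j s) \<cdot> y) \<star> beta j s) = (\<Oplus>\<^bsub>P\<^esub>t\<in>{..<N}. phi a t (xi c t \<star> gamma j s) \<cdot> y) \<star> beta j s"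
    using fC s y ij by (subst rs_finsum) auto
   also have "(\<Oplus>\<^bsub>P\<^esub>t\<in>{..<N}. phi a t (xi c t \<star> gamma j s) \<cdot> y) = (\<Oplus>t\<in>{..<N}. phi a t (xi c t \<star> gamma j s)) \<cdot> y"
    using fC s y by (subst smult_finsum_left) auto
   finally show "(\<Oplus>\<^bsub>P\<^esub>t\<in>{..<N}. (phi a t (xi c t \<star> gamma j s) \<cdot> y) \<star> beta j s) =
    ((if a = c then e i \<otimes> tau j (gamma j s) else \<zero>) \<cdot> y) \<star> beta j s"
    using pair[OF a c gamma_closed[OF ij(2) s]] by simp
  qed (use y ij in auto)
  also have "... = (if a = c then ?epsilon else \<zero>\<^bsub>Op\<^esub>) y"
  proof (cases "a = c")
   case True
   have "(\<Oplus>\<^bsub>P\<^esub>s\<in>{..<D j}. ((e i \<otimes> tau j (gamma j s)) \<cdot> y) \<star> beta j s) = (\<Oplus>\<^bsub>P\<^esub>s\<in>{..<D j}. (e i \<cdot> y) \<star> (tau j (\<one> \<otimes> gamma j s) \<otimes> beta j s))"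
   proof (intro l.M.finsum_cong')
    fix s assume "s : {..<D j}" then have s: "s < D j" by simp
    have tC: "tau j (gamma j s) : CL" "tau j (gamma j s) : Z" using ij s trace_Z by auto
    have "(e i \<otimes> tau j (gamma j s)) \<cdot> y = tau j (gamma j s) \<cdot> (e i \<cdot> y)"
     using tC y ij by (simp add: l.smult_assoc1[symmetric] l.R.m_comm)
    then show "((e i \<otimes> tau j (gamma j s)) \<cdot> y) \<star> beta j s = (e i \<cdot> y) \<star> (tau j (\<one> \<otimes> gamma j s) \<otimes> beta j s)"
     using tC y ij s by (simp add: rs_central rs_ls)
   qed (use y ij in auto)
   also have "... = (e i \<cdot> y) \<star> (\<one> \<otimes> e j)"
    unfolding expand_beta[OF ij(2) l.R.one_closed] using y ij by (subst rs_finsum_right) auto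
   finally show ?thesis using True y ij by simp
  next
   case False
   then show ?thesis using y ij by (simp, intro l.M.add.finprod_one_eqI) auto
  qed
  finally show "(\<Oplus>\<^bsub>Op\<^esub>t\<in>{..<N}. pairing j (phi a t) (xi c t)) y = (if a = c then ?epsilon else \<zero>\<^bsub>Op\<^esub>) y" .
 qed
 have "EX x f. O.dual_at ?epsilon {..<r} x f"
 proof (rule O.dual_at_of_power[OF op_finite_dim[OF ij] A, of N "%a t. pairing j (phi a t)" xi])
  show "pairing j (phi a t) : duals Op OpM" if "a : A" "t < N" for a t
   using pairing_functional[OF ij(2) phi[OF that]] .
  show "xi a t : carrier OpM" if "a : A" "t < N" for a t using xi[OF that] by simp
 qed (use pairing_sum r in auto)
 then obtain x f where xf: "O.dual_at ?epsilon {..<r} x f" by blast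
 have x1: "x s : CP" "op (e i) (e j) (x s) = x s" if "s < r" for s
  using xf[unfolded O.dual_at_iff[OF epsilon]] that by (simp_all del: op_apply)
 have x: "x s : CP" "(e i \<cdot> x s) \<star> e j = x s" if "s < r" for s
  using x1[OF that] op_apply[OF x1(1)[OF that]] by metis+
 have f: "f s : duals Op OpM" if "s < r" for s
  using xf[unfolded O.dual_at_iff[OF epsilon]] that by auto
 have fx: "f s (x t) = (if s = t then ?epsilon else \<zero>\<^bsub>Op\<^esub>)" if "s < r" "t < r" for s t
  using xf[unfolded O.dual_at_iff[OF epsilon]] that by auto
 have fops: "f s y : ops" if "s < r" "y : CP" for s y
  using dualsD(1)[OF f[OF that(1)], of y] that by simp
 have fadd: "f s (y \<oplus>\<^bsub>P\<^esub> y') z = f s y z \<oplus>\<^bsub>P\<^esub> f s y' z" if "s < r" "y : CP" "y' : CP" "z : CP" for s y y' z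
  using dualsD(2)[OF f[OF that(1)], of y y'] that by simp
 have fop: "f s ((k \<cdot> y) \<star> l) z = (k \<cdot> f s y z) \<star> l"
  if "s < r" "y : CP" "z : CP" "k : CL" "l : CL" for s y z k l
 proof -
  have "f s (op k l y) = op k l \<otimes>\<^bsub>Op\<^esub> f s y"
   using dualsD(3)[OF f[OF that(1)], of "op k l" y] that by simp
  then show ?thesis using that fops by (simp add: ops_closed)
 qed
 obtain M psi w where psiw: "ALL t<M. psi t : duals L P & w t : CP"
  and tau: "ALL b:CL. tau j b = (\<Oplus>t\<in>{..<M::nat}. psi t (w t \<star> b))"
  using trace_coefficients[OF ij(2)] by blast
 have psi: "psi t : duals L P" and w: "w t : CP" if "t < M" for t using psiw that by auto
 \<comment> \<open>The extension of the trace form to operators: \<open>k \<otimes> l\<close> goes to \<open>k tau\<^sub>j(l)\<close>.\<close>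
 define Lambda where "Lambda S = (\<Oplus>t\<in>{..<M}. psi t (S (w t)))" for S
 have psiC: "psi t (S (w t)) : CL" if "t < M" "S : ops" for t S
  using dualsD(1)[OF psi[OF that(1)]] ops_closed[OF that(2) w[OF that(1)]] by simp
 define phi1 where "phi1 s = (%y. e i \<otimes> Lambda (f s y))" for s
 have LambdaC: "Lambda (f s y) : CL" if "s < r" "y : CP" for s y
  unfolding Lambda_def using psiC fops that by (intro l.R.finsum_closed) auto
 have "(%y. Lambda (f s y)) : duals L P" if s: "s < r" for s
  unfolding duals_def
 proof (intro CollectI conjI ballI)
  fix y assume y: "y : CP"
  show "Lambda (f s y) : CL" using LambdaC s y by simp
  fix y' assume y': "y' : CP"
  show "Lambda (f s (y \<oplus>\<^bsub>P\<^esub> y')) = Lambda (f s y) \<oplus> Lambda (f s y')"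
   unfolding Lambda_def using psiC fops s y y' w fadd dualsD(2)[OF psi] ops_closed
   by (intro trans[OF l.R.finsum_cong' l.R.finsum_addf]) auto
 next
  fix l y assume l: "l : CL" and y: "y : CP"
  have "f s (l \<cdot> y) z = l \<cdot> f s y z" if "z : CP" for z
   using fop[OF s y that l l.R.one_closed] l y that ops_closed[OF fops[OF s y]] by simp
  then show "Lambda (f s (l \<cdot> y)) = l \<otimes> Lambda (f s y)"
   unfolding Lambda_def using psiC fops s y l w dualsD(3)[OF psi] ops_closed
   by (subst l.R.finsum_rdistr) (auto intro!: l.R.finsum_cong')
 qed
 then have phi1f: "phi1 s : duals L P" if "s < r" for s
  unfolding phi1_def using that ij by (intro l.functional_scale) auto
 have phi1x: "phi1 s (x t \<star> b) = (if s = t then e i \<otimes> tau j b else \<zero>)" if s: "s < r" and t: "t < r" and b: "b : CL" for s t b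
 proof -
  have v: "f s (x t \<star> b) z = f s (x t) z \<star> b" if z: "z : CP" for z
   using fop[OF s x(1)[OF t] z l.R.one_closed b] x(1)[OF t] ops_closed[OF fops[OF s x(1)[OF t]] z] by simp
  show ?thesis
  proof (cases "s = t")
   case True
   have C: "psi q (w q \<star> (b \<otimes> e j)) : CL" if "q < M" for q
    using dualsD(1)[OF psi[OF that]] w[OF that] b ij by simp
   have "Lambda (f s (x t \<star> b)) = (\<Oplus>q\<in>{..<M}. e i \<otimes> psi q (w q \<star> (b \<otimes> e j)))"
    unfolding Lambda_def
   proof (intro l.R.finsum_cong')
    fix q assume "q : {..<M}" then have q: "q < M" by simp
    have "f s (x t \<star> b) (w q) = e i \<cdot> (w q \<star> (b \<otimes> e j))"
     using v[OF w[OF q]] fx[OF s t] True w[OF q] b ij by (simp add: rs_ls rs_assoc l.R.m_comm)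
    then show "psi q (f s (x t \<star> b) (w q)) = e i \<otimes> psi q (w q \<star> (b \<otimes> e j))"
     using dualsD(3)[OF psi[OF q], of "e i" "w q \<star> (b \<otimes> e j)"] w[OF q] b ij by simp
   qed (use C ij in auto)
   also have "... = e i \<otimes> tau j (b \<otimes> e j)" using bspec[OF tau, of "b \<otimes> e j"] C b ij by (simp add: l.R.finsum_rdistr Pi_def)
   finally show ?thesis
    using True trace_e[OF ij(2) b] b ij by (simp add: phi1_def l.R.m_assoc[symmetric])
  next
   case False
   have "psi q (f s (x t \<star> b) (w q)) = \<zero>" if q: "q < M" for q
    using v[OF w[OF q]] fx[OF s t] False w[OF q] b l.functional_zero[OF psi[OF q]] by simp
   then have "Lambda (f s (x t \<star> b)) = \<zero>" unfolding Lambda_def by (intro l.R.add.finprod_one_eqI) auto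
   then show ?thesis using False ij by (simp add: phi1_def)
  qed
 qed
 have "free_family i j {..<r} x phi1"
  unfolding free_family_def
 proof (intro conjI ballI)
  fix s assume "s : {..<r}" then have s: "s < r" by simp
  show "x s : CP" by (rule x(1)[OF s])
  have "e i \<cdot> ((e i \<cdot> x s) \<star> e j) = (e i \<cdot> x s) \<star> e j"
   using x(1)[OF s] ij by (simp add: rs_ls l.smult_assoc1[symmetric])
  then show "e i \<cdot> x s = x s" using x(2)[OF s] by simp
  have "(e i \<cdot> x s) \<star> e j \<star> e j = (e i \<cdot> x s) \<star> e j"
   using x(1)[OF s] ij by (simp add: rs_assoc)
  then show "x s \<star> e j = x s" using x(2)[OF s] by simp
  show "phi1 s : duals L P" by (rule phi1f[OF s])
  show "e i \<otimes> phi1 s y = phi1 s y" if "y : CP" for y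
   using LambdaC[OF s that] ij by (simp add: phi1_def l.R.m_assoc[symmetric])
  fix t b assume "t : {..<r}" "b : CL"
  then show "phi1 s (x t \<star> b) = (if s = t then e i \<otimes> tau j b else \<zero>)" using phi1x[OF s] by simp
 qed simp
 then show ?thesis by blast
qed

end

section \<open>Nonnegative integer matrices that are idempotent up to a factor\<close>

text \<open>
 For a matrix \<open>x\<close> with \<open>x\<^sup>2 = d x\<close>, positivity of entries is transitive, so the row supports are nested
 along positive entries. A minimal row support \<open>C\<close> is a closed class: rows in \<open>C\<close> have support exactly
 \<open>C\<close>. Multiplying the block of \<open>x\<^sup>2 = d x\<close> with rows outside and columns inside \<open>C\<close> by the positive block
 on \<open>C\<close> cancels both terms with a factor in \<open>C\<close>, so no positive entry leads into a positive entry
 leading into \<open>C\<close> from outside. As columns do not vanish, nothing leads into \<open>C\<close>, and connectedness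
 makes \<open>C\<close> everything.
\<close>

lemma connected_matrix_positive:
 fixes x :: "nat => nat => nat"
 assumes sq: "!!i k. i < n ==> k < n ==> (\<Sum>j<n. x i j * x j k) = d * x i k"
  and row: "!!i. i < n ==> EX j<n. 0 < x i j" and col: "!!k. k < n ==> EX i<n. 0 < x i k"
  and conn: "!!S. [|S \<subseteq> {..<n}; S ~= {}; !!i j. [|i : S; j < n; j \<notin> S|] ==> x i j = 0 & x j i = 0|] ==> S = {..<n}"
  and ij: "i < n" "j < n"
 shows "0 < x i j"
proof -
 have tr: "0 < x a c" if "a < n" "b < n" "c < n" "0 < x a b" "0 < x b c" for a b c
 proof -
  have "0 < x a b * x b c" using that by simp
  also have "... <= (\<Sum>j<n. x a j * x j c)" using that(2) by (intro member_le_sum) auto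
  finally show ?thesis using sq[OF that(1,3)] by simp
 qed
 define R where "R a = {b. b < n & 0 < x a b}" for a
 have "EX a. a < n & (ALL b. b < n --> card (R a) <= card (R b))"
  using exists_least_iff[of "%k. EX a<n. card (R a) = k"] ij(1)
   ex_has_least_nat[of "%a. a < n" i "%a. card (R a)"] by blast
 then obtain a0 where a0: "a0 < n" "!!b. b < n ==> card (R a0) <= card (R b)" by blast
 define C where "C = R a0"
 have finC: "finite C" and Cn: "C \<subseteq> {..<n}" by (auto simp: C_def R_def)
 have RC: "R b = C" if b: "b : C" for b
 proof (rule card_seteq[OF finC])
  have "b < n" "0 < x a0 b" using b by (auto simp: C_def R_def)
  then show "R b \<subseteq> C" using tr[OF a0(1), of b] by (auto simp: C_def R_def)
  show "card C <= card (R b)" using a0(2) `b < n` by (simp add: C_def)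
 qed
 have pos: "0 < x b c" if "b : C" "c : C" for b c using RC[OF that(1)] that(2) by (auto simp: R_def)
 have zero: "x b c = 0" if "b : C" "c < n" "c \<notin> C" for b c using RC[OF that(1)] that(2,3) by (auto simp: R_def)
 have nonempty: "C ~= {}" using row[OF a0(1)] by (auto simp: C_def R_def)
 define D where "D = {..<n} - C"
 have finD: "finite D" by (simp add: D_def)
 have split: "(\<Sum>j<n. g j) = (\<Sum>j\<in>C. g j) + (\<Sum>j\<in>D. g j)" for g :: "nat => nat"
  using sum.subset_diff[OF Cn, of g] by (simp add: D_def add.commute)
 have into: "x b c = 0" if b: "b : D" and c: "c : C" for b c
 proof (rule ccontr)
  assume "x b c ~= 0"
  have bn: "b < n" and cn: "c < n" using b c Cn by (auto simp: D_def)
  obtain a where a: "a < n" "0 < x a b" using col[OF bn] by blast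
  have aD: "a : D" using zero[of a b] a b by (auto simp: D_def)
  have 1: "(\<Sum>k\<in>C. x j k * x k c) = d * x j c" if "j : C" for j
  proof -
   have "(\<Sum>k\<in>D. x j k * x k c) = 0" using zero[OF that] by (simp add: D_def)
   then show ?thesis using sq[of j c] split[of "%k. x j k * x k c"] that Cn cn by auto
  qed
  have 2: "(\<Sum>j\<in>C. x a j * x j k) + (\<Sum>j\<in>D. x a j * x j k) = d * x a k" if "k : C" for k
   using sq[OF a(1), of k] split[of "%j. x a j * x j k"] that Cn by auto
  have "(\<Sum>k\<in>C. d * x a k * x k c) = (\<Sum>k\<in>C. (\<Sum>j\<in>C. x a j * x j k) * x k c) + (\<Sum>k\<in>C. (\<Sum>j\<in>D. x a j * x j k) * x k c)"
   by (simp add: 2[symmetric] distrib_right sum.distrib)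
  also have "(\<Sum>k\<in>C. (\<Sum>j\<in>C. x a j * x j k) * x k c) = (\<Sum>k\<in>C. \<Sum>j\<in>C. x a j * (x j k * x k c))"
   by (simp add: sum_distrib_right mult.assoc)
  also have "... = (\<Sum>j\<in>C. \<Sum>k\<in>C. x a j * (x j k * x k c))" by (rule sum.swap)
  also have "... = (\<Sum>j\<in>C. x a j * (d * x j c))" by (simp add: sum_distrib_left[symmetric] 1)
  finally have "(\<Sum>k\<in>C. (\<Sum>j\<in>D. x a j * x j k) * x k c) = 0" by (simp add: mult.left_commute mult.commute mult.assoc)
  then have "(\<Sum>j\<in>D. x a j * x j c) * x c c = 0" using finC c by simp
  then have "ALL j:D. x a j * x j c = 0" using pos[OF c c] finD by simp
  then show False using b a(2) `x b c ~= 0` by auto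
 qed
 have "C = {..<n}" using conn[OF Cn nonempty] zero into by (auto simp: D_def)
 then show ?thesis using pos ij by auto
qed

text \<open>
 An entry maximising the ratio \<open>\<rho> = r / x\<close> satisfies \<open>d r \<le> \<Sum> r r \<le> \<rho>\<^sup>2 \<Sum> x x = \<rho>\<^sup>2 d x\<close>,
 that is \<open>\<rho> \<le> \<rho>\<^sup>2\<close>, which is impossible for \<open>0 < \<rho> < 1\<close>.
\<close>

lemma defect_matrix_zero:
 fixes x r :: "nat => nat => nat"
 assumes sq: "!!i k. i < n ==> k < n ==> (\<Sum>j<n. x i j * x j k) = d * x i k"
  and less: "!!i j. i < n ==> j < n ==> r i j < x i j"
  and defect: "!!i k. i < n ==> k < n ==> d * r i k <= (\<Sum>j<n. r i j * r j k)"
  and ij: "i < n" "j < n"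
 shows "r i j = 0"
proof -
 define \<rho> where "\<rho> i j = real (r i j) / real (x i j)" for i j
 let ?S = "(%(i, j). \<rho> i j) ` ({..<n} \<times> {..<n})"
 have fin: "finite ?S" and ne: "?S ~= {}" using ij by auto
 obtain a c where ac: "a < n" "c < n" "Max ?S = \<rho> a c" using Max_in[OF fin ne] by auto
 have max: "\<rho> i j <= \<rho> a c" if "i < n" "j < n" for i j
  unfolding ac(3)[symmetric] using that by (intro Max_ge[OF fin]) auto
 have eq: "real (r i j) = \<rho> i j * real (x i j)" and lt: "\<rho> i j < 1" and nn: "0 <= \<rho> i j" if "i < n" "j < n" for i j
  using less[OF that] by (auto simp: \<rho>_def field_simps)
 have le: "real (r i j) <= \<rho> a c * real (x i j)" if "i < n" "j < n" for i j
  using eq[OF that] max[OF that] by (simp add: mult_right_mono)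
 have "0 < x a a * x a c" using less ac by (metis gr_implies_not0 nat_0_less_mult_iff neq0_conv)
 also have "... <= (\<Sum>j<n. x a j * x j c)" using ac by (intro member_le_sum) auto
 finally have dpos: "0 < real d * real (x a c)" using sq[OF ac(1,2)] by (simp flip: of_nat_mult)
 have "real d * (\<rho> a c * real (x a c)) = real (d * r a c)" using eq[OF ac(1,2)] by simp
 also have "... <= real (\<Sum>j<n. r a j * r j c)" using defect[OF ac(1,2)] by (simp only: of_nat_le_iff)
 also have "... = (\<Sum>j<n. real (r a j) * real (r j c))" by simp
 also have "... <= (\<Sum>j<n. (\<rho> a c * real (x a j)) * (\<rho> a c * real (x j c)))"
  using le ac nn by (intro sum_mono mult_mono) auto
 also have "... = \<rho> a c * \<rho> a c * real (\<Sum>j<n. x a j * x j c)"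
  by (simp add: sum_distrib_left mult.assoc mult.left_commute)
 also have "... = \<rho> a c * \<rho> a c * (real d * real (x a c))" using sq[OF ac(1,2)] by simp
 finally have "\<rho> a c * (real d * real (x a c)) <= \<rho> a c * \<rho> a c * (real d * real (x a c))"
  by (simp add: mult.left_commute)
 then have "\<rho> a c <= \<rho> a c * \<rho> a c" using dpos by (rule mult_right_le_imp_le)
 then have "\<rho> a c = 0" using lt[OF ac(1,2)] nn[OF ac(1,2)]
  by (cases "\<rho> a c = 0") (auto simp: mult_le_cancel_left1)
 then have "\<rho> i j = 0" using max[OF ij] nn[OF ij] by simp
 then show ?thesis using eq[OF ij] by simp
qed

text \<open>
 The row minimising the ratio of two columns attains it in every row, because \<open>m D m = d m\<close> writes that
 row as a positive combination of all the others. Hence the columns are proportional.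
\<close>

lemma positive_matrix_rank_one:
 fixes m :: "nat => nat => nat"
 assumes pos: "!!i j. i < n ==> j < n ==> 0 < m i j" and D: "!!j. j < n ==> 0 < D j"
  and sq: "!!i k. i < n ==> k < n ==> (\<Sum>j<n. m i j * D j * m j k) = d * m i k"
  and ij: "i < n" "j < n" and kl: "k < n" "l < n"
 shows "m i j * m k l = m i l * m k j"
proof -
 obtain a where a: "a < n" "!!b. b < n ==> real (m a j) / real (m a l) <= real (m b j) / real (m b l)"
 proof -
  have "finite {..<n}" "{..<n} ~= {}" using ij by auto
  from arg_min_if_finite[OF this, of "%b. real (m b j) / real (m b l)"] show thesis
   using that by (meson lessThan_iff not_less)
 qed
 have le: "m a j * m b l <= m a l * m b j" if "b < n" for b
 proof -
  have "real (m a j) * real (m b l) <= real (m a l) * real (m b j)"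
   using a(2)[OF that] pos[OF a(1) kl(2)] pos[OF that kl(2)] by (simp add: field_simps)
  then show ?thesis by (simp flip: of_nat_mult)
 qed
 have "(\<Sum>b<n. m a b * D b * (m a j * m b l)) = m a j * (\<Sum>b<n. m a b * D b * m b l)"
  by (simp add: sum_distrib_left mult.left_commute)
 also have "... = m a l * (\<Sum>b<n. m a b * D b * m b j)" using sq a ij kl by (simp add: mult.left_commute)
 also have "... = (\<Sum>b<n. m a b * D b * (m a l * m b j))" by (simp add: sum_distrib_left mult.left_commute)
 finally have sum: "(\<Sum>b<n. m a b * D b * (m a j * m b l)) = (\<Sum>b<n. m a b * D b * (m a l * m b j))" .
 have eq: "m a j * m b l = m a l * m b j" if b: "b < n" for b
 proof (rule ccontr)
  assume "m a j * m b l ~= m a l * m b j"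
  then have "m a b * D b * (m a j * m b l) < m a b * D b * (m a l * m b j)"
   using le[OF b] pos[OF a(1) b] D[OF b] by simp
  then have "(\<Sum>b<n. m a b * D b * (m a j * m b l)) < (\<Sum>b<n. m a b * D b * (m a l * m b j))"
   using b le by (intro sum_strict_mono_ex1) auto
  then show False using sum by simp
 qed
 have "m a l * (m i j * m k l) = (m a j * m i l) * m k l" using eq[OF ij(1)] by simp
 also have "... = m i l * (m a j * m k l)" by simp
 also have "... = m a l * (m i l * m k j)" using eq[OF kl(1)] by simp
 finally show ?thesis using pos[OF a(1) kl(2)] by simp
qed

text \<open>Dividing each row of a rank one matrix by its greatest common divisor gives the same primitive row.\<close>

lemma rank_one_factorization:
 fixes m :: "nat => nat => nat"
 assumes pos: "!!i j. i < n ==> j < n ==> 0 < m i j"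
  and one: "!!i j k l. [|i < n; j < n; k < n; l < n|] ==> m i j * m k l = m i l * m k j"
 shows "EX a r. (ALL i<n. 0 < a i & 0 < r i) & (ALL i<n. ALL j<n. m i j = a i * r j)"
proof -
 define a where "a i = Gcd (m i ` {..<n})" for i
 have m: "m i j = a i * (m i j div a i)" if "j < n" for i j
 proof -
  have "a i dvd m i j" using that unfolding a_def by (intro Gcd_dvd) auto
  then show ?thesis by simp
 qed
 have apos: "0 < a i" if "i < n" for i
  using m[OF that, of i] pos[OF that that] by (metis mult_eq_0_iff neq0_conv)
 have cross: "m i j * a k = a i * m k j" if "i < n" "j < n" "k < n" for i j k
 proof -
  have "m i j * a k = Gcd ((*) (m i j) ` (m k ` {..<n}))" by (simp add: a_def Gcd_mult)
  also have "(*) (m i j) ` (m k ` {..<n}) = (*) (m k j) ` (m i ` {..<n})"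
   unfolding image_image using one that by (intro image_cong) (auto simp: mult.commute)
  also have "Gcd ... = m k j * a i" by (simp add: a_def Gcd_mult)
  finally show ?thesis by simp
 qed
 define r where "r j = m 0 j div a 0" for j
 have mr: "m i j = a i * r j" if "i < n" "j < n" for i j
 proof -
  have n: "0 < n" using that by simp
  have "a 0 * m i j = a i * m 0 j" using cross[OF that n] by (simp only: mult.commute)
  also have "m 0 j = a 0 * r j" using m[OF that(2), of 0] by (simp add: r_def)
  finally have "a 0 * m i j = a 0 * (a i * r j)" by (simp only: mult.left_commute)
  then show ?thesis using apos[OF n] by simp
 qed
 have "0 < r j" if "j < n" for j using pos[OF that that] mr[OF that that] by simp
 then show ?thesis using apos mr by blast
qed

text \<open>
 In the Galois case all left dimensions agree, so \<open>a\<close> is constant, and the right dimensions are at least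
 as large; as \<open>a\<close> is constant, this bounds each \<open>r\<^sub>k\<close> below by the average of the \<open>r\<^sub>j\<close>.
\<close>

lemma equal_dimensions_constant:
 fixes a r D :: "nat => nat"
 assumes pos: "!!i. i < n ==> 0 < a i & 0 < r i & 0 < D i"
  and left: "!!i. i < n ==> (\<Sum>j<n. a i * r j * D j) = c"
  and right: "!!k. k < n ==> c <= (\<Sum>j<n. D j * (a j * r k))"
  and ij: "i < n" "j < n" and kl: "k < n" "l < n"
 shows "a i * r j = a k * r l"
proof -
 define R \<Delta> where "R = (\<Sum>j<n. r j * D j)" and "\<Delta> = (\<Sum>j<n. D j)"
 have Rpos: "0 < R" unfolding R_def using pos ij(1) by (intro sum_pos2[of _ i]) auto
 have aR: "a i * R = c" if "i < n" for i
  using left[OF that] by (simp add: R_def sum_distrib_left mult.assoc)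
 have ac: "a b = a i" if "b < n" for b using aR[OF that] aR[OF ij(1)] Rpos by (metis mult_right_cancel neq0_conv)
 have ge: "R <= \<Delta> * r b" if b: "b < n" for b
 proof -
  have "a i * R <= (\<Sum>j<n. D j * (a j * r b))" using aR[OF ij(1)] right[OF b] by simp
  also have "... = (\<Sum>j<n. a i * (D j * r b))" using ac by (intro sum.cong) auto
  also have "... = a i * (\<Delta> * r b)" by (simp add: \<Delta>_def sum_distrib_left sum_distrib_right)
  finally show ?thesis using pos[OF ij(1)] by simp
 qed
 have eq: "\<Delta> * r b = R" if b: "b < n" for b
 proof (rule ccontr)
  assume "\<Delta> * r b ~= R"
  then have "R < \<Delta> * r b" using ge[OF b] by simp
  then have "(\<Sum>j<n. D j * R) < (\<Sum>j<n. D j * (\<Delta> * r j))"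
   using b ge pos by (intro sum_strict_mono_ex1) auto
  also have "... = \<Delta> * R" by (simp add: R_def sum_distrib_left mult.left_commute mult.commute)
  finally show False by (simp add: \<Delta>_def sum_distrib_right)
 qed
 have "0 < \<Delta>" unfolding \<Delta>_def using pos ij(1) by (intro sum_pos2[of _ i]) auto
 then have "r j = r l" using eq[OF ij(2)] eq[OF kl(2)] by (metis mult_left_cancel neq0_conv)
 then show ?thesis using ac[OF kl(1)] by simp
qed

section \<open>Freeness of the blocks\<close>

context split_bimodule
begin

lemma left_dual_card_le:
 assumes ij: "i < n" "j < n" and D: "left_dual i j I x f"
 shows "card I <= card V"
proof -
 interpret projective_dual_setting L P "e i" "%x. x \<star> e j" V v v' by (rule left_setting[OF ij])
 have loc: "local_idem L (e i)" using l.R.field_idem_local[OF e_field[OF ij(1)]] .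
 then have "ideal (res_ideal L (e i)) L" by (simp add: local_idem_def)
 then show ?thesis
  by (intro dual_family_card_le[OF loc D V_finite v_closed])
   (auto intro: functional_in_ideal dual_familyD(2)[OF D])
qed

end

context traced_bimodule
begin

lemma free_familyD:
 assumes "free_family i j I x phi"
 shows "finite I" "a : I ==> x a : CP" "a : I ==> e i \<cdot> x a = x a" "a : I ==> x a \<star> e j = x a"
  "a : I ==> phi a : duals L P" "a : I ==> y : CP ==> e i \<otimes> phi a y = phi a y"
  "a : I ==> c : I ==> b : CL ==> phi a (x c \<star> b) = (if a = c then e i \<otimes> tau j b else \<zero>)"
  "a : I ==> y : CP ==> phi a y : CL"
 using assms by (auto simp: free_family_def dest: dualsD(1))

lemma functional_twist:
 assumes "phi : duals L P" "b : CL"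
 shows "(%y. phi (y \<star> b)) : duals L P"
 using assms(2) dualsD[OF assms(1)] by (auto simp: duals_def rs_add rs_ls)

text \<open>A free family over \<open>L\<^sub>i \<otimes> L\<^sub>j\<close> becomes a dual family over \<open>L\<^sub>i\<close> through the dual bases of \<open>L\<^sub>j\<close>.\<close>

lemma free_family_left_dual:
 assumes ij: "i < n" "j < n" and F: "free_family i j I x phi"
 shows "left_dual i j (I \<times> {..<D j}) (%(a, s). x a \<star> beta j s) (%(a, s) y. phi a (y \<star> gamma j s))"
proof -
 interpret projective_dual_setting L P "e i" "%x. x \<star> e j" V v v' by (rule left_setting[OF ij])
 note FD = free_familyD[OF F]
 have 1: "x a \<star> beta j s : CP & e i \<cdot> (x a \<star> beta j s) = x a \<star> beta j s & x a \<star> beta j s \<star> e j = x a \<star> beta j s"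
  if "a : I" "s < D j" for a s
  using FD(2,3)[OF that(1)] ij that(2) beta_e[OF ij(2) that(2)]
  by (simp add: rs_assoc rs_ls[symmetric])
 have 2: "y \<star> e j \<star> gamma j s = y \<star> gamma j s" if "y : CP" "s < D j" for y s
  using that ij gamma_e[OF ij(2) that(2)] by (simp add: rs_assoc l.R.m_comm)
 have 3: "phi a (x c \<star> beta j t \<star> gamma j s) = (if (a, s) = (c, t) then e i else \<zero>)"
  if "a : I" "c : I" "s < D j" "t < D j" for a c s t
  using that FD(2)[OF that(2)] ij FD(7)[OF that(1,2), of "beta j t \<otimes> gamma j s"]
   trace_dual[OF ij(2) that(4,3)] by (auto simp: rs_assoc)
 show ?thesis
  unfolding dual_family_def using FD(1,5,6) 1 2 3 ij by (auto simp: functional_twist)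
qed

text \<open>Trace pairings separate the elements of \<open>e\<^sub>j L\<close>.\<close>

lemma trace_nondegenerate:
 assumes j: "j < n" and kl: "k : CL" "l : CL"
  and eq: "!!b. b : CL ==> tau j (k \<otimes> b) = tau j (l \<otimes> b)"
 shows "k \<otimes> e j = l \<otimes> e j"
 unfolding expand_gamma[OF j kl(1)] expand_gamma[OF j kl(2)] using j kl eq
 by (intro l.R.finsum_cong') auto

text \<open>Every block contains a free vector, because the trace form is a coefficient.\<close>

lemma free_family_one:
 assumes ij: "i < n" "j < n"
 shows "EX x f. free_family i j {..<1::nat} x f"
proof -
 obtain M psi w where psiw: "ALL t<M. psi t : duals L P & w t : CP"
  and tau: "ALL b:CL. tau j b = (\<Oplus>t\<in>{..<M::nat}. psi t (w t \<star> b))"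
  using trace_coefficients[OF ij(2)] by blast
 have C: "psi t (w t \<star> b) : CL" if "t < M" "b : CL" for t b
  using dualsD(1)[of "psi t" L P "w t \<star> b"] psiw that by simp
 show ?thesis
 proof (rule free_family_of_power[OF ij, of "{()}" M "%_ t y. e i \<otimes> psi t y" "%_ t. w t"])
  fix a c :: unit and b assume b: "b : CL"
  have "(\<Oplus>t\<in>{..<M}. e i \<otimes> psi t (w t \<star> b)) = e i \<otimes> tau j b"
   using tau b C ij by (simp add: l.R.finsum_rdistr Pi_def)
  then show "(\<Oplus>t\<in>{..<M}. e i \<otimes> psi t (w t \<star> b)) = (if a = c then e i \<otimes> tau j b else \<zero>)" by simp
 qed (use psiw ij in "auto intro: l.functional_scale")
qed

lemma maximal_free_family:
 assumes ij: "i < n" "j < n"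
 shows "EX m x phi. free_family i j {..<m::nat} x phi & 0 < m & (ALL x phi. ~ free_family i j {..<Suc m} x phi)"
proof -
 define Q where "Q m \<longleftrightarrow> (EX x phi. free_family i j {..<m::nat} x phi)" for m
 have bound: "m <= card V" if Q: "Q m" for m
 proof -
  obtain x phi where "free_family i j {..<m} x phi" using Q by (auto simp: Q_def)
  from left_dual_card_le[OF ij free_family_left_dual[OF ij this]]
  have "m * D j <= card V" by (simp add: card_cartesian_product)
  moreover have "m * 1 <= m * D j" using degree_pos[OF ij(2)] by (intro mult_le_mono2) simp
  ultimately show ?thesis by linarith
 qed
 have Q1: "Q 1" unfolding Q_def by (rule free_family_one[OF ij])
 define m where "m = (GREATEST m. Q m)"
 have "Q m" "1 <= m" "~ Q (Suc m)"
  unfolding m_def using GreatestI_nat[of Q 1 "card V"] Greatest_le_nat[of Q 1 "card V"]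
   Greatest_le_nat[of Q "Suc (Greatest Q)" "card V"] Q1 bound by auto
 moreover from `Q m` obtain x phi where "free_family i j {..<m} x phi" unfolding Q_def by blast
 ultimately show ?thesis unfolding Q_def
  by (intro exI[of _ m] exI[of _ x] exI[of _ phi]) auto
qed

end

text \<open>
 For every block, a maximal free family \<open>x, phi\<close> of size \<open>m\<close>, a left frame \<open>u, f\<close> extending the dual
 family that it defines, and a right frame \<open>g, omega\<close>.
\<close>

locale framed_bimodule = traced_bimodule L P n e V v v' W w w' d T tau D beta gamma
 for L (structure) and P :: "('a, 'a, 'p) bimodule" and n e and V :: "'v set" and v v' and W :: "'w set" and w w' d T
  tau D beta gamma +
 fixes m :: "nat => nat => nat" and x :: "nat => nat => nat => 'p" and phi :: "nat => nat => nat => 'p => 'a"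
  and F :: "nat => nat => (nat \<times> nat) set" and u :: "nat => nat => nat \<times> nat => 'p" and f :: "nat => nat => nat \<times> nat => 'p => 'a"
  and G :: "nat => nat => nat set" and g :: "nat => nat => nat => 'p" and omega :: "nat => nat => nat => 'p => 'a"
 assumes free: "[|i < n; j < n|] ==> free_family i j {..<m i j} (x i j) (phi i j)"
  and m_pos: "[|i < n; j < n|] ==> 0 < m i j"
  and maximal: "[|i < n; j < n|] ==> ~ free_family i j {..<Suc (m i j)} x' phi1"
  and F_frame: "[|i < n; j < n|] ==> left_frame i j (F i j) (u i j) (f i j)"
  and F_extends: "[|i < n; j < n|] ==> {..<m i j} \<times> {..<D j} \<subseteq> F i j"
  and u_extends: "[|i < n; j < n; a < m i j; s < D j|] ==> u i j (a, s) = x i j a \<star> beta j s"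
  and f_extends: "[|i < n; j < n; a < m i j; s < D j|] ==> f i j (a, s) = (%y. phi i j a (y \<star> gamma j s))"
  and G_frame: "[|i < n; j < n|] ==> right_frame i j (G i j) (g i j) (omega i j)"

lemma (in traced_bimodule) framed_bimodule_exists:
 "EX m x phi F u f G g omega. framed_bimodule L P n e V v v' W w w' d T tau D beta gamma m x phi F u f G g omega"
proof -
 define Q where "Q i j m x phi F u f G g omega \<longleftrightarrow> free_family i j {..<m} x phi & 0 < m & (ALL x phi. ~ free_family i j {..<Suc m} x phi) &
  left_frame i j F u f & {..<m} \<times> {..<D j} \<subseteq> F &
  (ALL a<m. ALL s<D j. u (a, s) = x a \<star> beta j s & f (a, s) = (%y. phi a (y \<star> gamma j s))) & right_frame i j G g omega"
  for i j m x phi F u f and G :: "nat set" and g omega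
 have ex: "EX m x phi F u f G g omega. Q i j m x phi F u f G g omega" if ij: "i < n" "j < n" for i j
 proof -
  obtain m x phi where m: "free_family i j {..<m::nat} x phi & 0 < m & (ALL x phi. ~ free_family i j {..<Suc m} x phi)"
   using maximal_free_family[OF ij] by blast
  obtain G g omega where G: "right_frame i j (G :: nat set) g omega" using right_frame_exists[OF ij] by blast
  have inf: "infinite (UNIV :: (nat \<times> nat) set)" by (simp add: finite_prod)
  show ?thesis
  proof (rule left_dual_extend_frame[OF ij free_family_left_dual[OF ij conjunct1[OF m]] inf])
   fix I u f assume "{..<m} \<times> {..<D j} \<subseteq> I" "left_frame i j I u f"
    and "!!s. s : {..<m} \<times> {..<D j} ==> u s = (case s of (a, s) => x a \<star> beta j s)"
    and "!!s. s : {..<m} \<times> {..<D j} ==> f s = (case s of (a, s) => %y. phi a (y \<star> gamma j s))"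
   then have "Q i j m x phi I u f G g omega" using m G unfolding Q_def by auto
   then show ?thesis by (intro exI)
  qed
 qed
 have "ALL i j. EX m x phi F u f G g omega. i < n --> j < n --> Q i j m x phi F u f G g omega"
 proof (intro allI)
  fix i j
  show "EX m x phi F u f G g omega. i < n --> j < n --> Q i j m x phi F u f G g omega"
  proof (cases "i < n & j < n")
   case True
   then show ?thesis using ex[of i j] by simp
  next
   case False
   then show ?thesis by (intro exI impI) simp
  qed
 qed
 then have "EX m x phi F u f G g omega. ALL i j. i < n --> j < n -->
   Q i j (m i j) (x i j) (phi i j) (F i j) (u i j) (f i j) (G i j) (g i j) (omega i j)"
  unfolding choice_iff .
 then obtain m x phi F u f G g omega where *: "ALL i j. i < n --> j < n -->
   Q i j (m i j) (x i j) (phi i j) (F i j) (u i j) (f i j) (G i j) (g i j) (omega i j)"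
  by (elim exE)
 have "framed_bimodule L P n e V v v' W w w' d T tau D beta gamma m x phi F u f G g omega"
  by (unfold_locales) (use * in "auto simp: Q_def")
 then show ?thesis by (intro exI)
qed

context framed_bimodule
begin

lemma F_dual: "[|i < n; j < n|] ==> left_dual i j (F i j) (u i j) (f i j)"
 using F_frame by (simp add: left_frame_def)

lemma G_dual: "[|i < n; j < n|] ==> right_dual i j (G i j) (g i j) (omega i j)"
 using G_frame by (simp add: right_frame_def)

lemmas freeD = free_familyD[OF free]
lemmas FD = left_dualD[OF _ _ F_dual]
lemmas GD = right_dualD[OF _ _ G_dual]

lemma x_closed [simp]: "[|i < n; j < n; a < m i j|] ==> x i j a : CP"
 using freeD(2) by simp

lemma F_finite: "[|i < n; j < n|] ==> finite (F i j)"
 using FD(1) by blast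

text \<open>
 Each side bounds the dimension of the block over \<open>Z\<close>: the functionals \<open>tau\<^sub>j(f(\<cdot>) gamma)\<close> are linearly
 independent, even with coefficients in \<open>e\<^sub>j L\<close>, and the vectors \<open>g beta\<close> generate over \<open>Z\<close>.
\<close>

lemma left_dimension_le_right:
 assumes j: "j < n" and k: "k < n"
 shows "D j * card (F j k) <= card (G j k) * D k"
proof (rule ccontr)
 assume neg: "~ D j * card (F j k) <= card (G j k) * D k"
 let ?R = "G j k \<times> {..<D k}" and ?C = "{..<D j} \<times> F j k"
 have fin: "finite ?R" "finite ?C" using GD(1)[OF j k j k] F_finite[OF j k] by auto
 have card: "card ?R < card ?C" using neg by (simp add: card_cartesian_product)
 define Lambda where "Lambda q y = tau j (f j k (snd q) y \<otimes> gamma j (fst q))" for q y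
 have LambdaC: "Lambda q y : CL" if "q : ?C" "y : CP" for q y
  using that j k FD(9)[OF j k j k] by (auto simp: Lambda_def)
 have gC: "g j k c : CP" if "c : G j k" for c using GD(2)[OF j k j k that] .
 have W: "!!r q. r : ?R ==> q : ?C ==> Lambda q (g j k (fst r) \<star> beta k (snd r)) : CL"
  using LambdaC gC k by auto
 obtain c where c: "ALL q:?C. c q : CL" "EX q:?C. c q \<otimes> e j ~= \<zero>"
  "ALL r:?R. (\<Oplus>q\<in>?C. c q \<otimes> Lambda q (g j k (fst r) \<star> beta k (snd r))) \<otimes> e j = \<zero>"
  using l.R.field_idem_system[OF e_field[OF j] fin card, of "%r q. Lambda q (g j k (fst r) \<star> beta k (snd r))", OF W] by blast
 define \<Sigma> where "\<Sigma> y = (\<Oplus>q\<in>?C. c q \<otimes> Lambda q y) \<otimes> e j" for y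
 have Lambdaadd: "Lambda q (y \<oplus>\<^bsub>P\<^esub> y') = Lambda q y \<oplus> Lambda q y'" if "q : ?C" "y : CP" "y' : CP" for q y y'
  using that j k FD(9)[OF j k j k] dualsD(2)[OF FD(5)[OF j k j k]]
  by (auto simp: Lambda_def l.R.l_distr trace_add)
 have LambdaZ: "Lambda q (z \<cdot> y) = z \<otimes> Lambda q y" if "q : ?C" "y : CP" "z : Z" for q y z
  using that j k FD(9)[OF j k j k] dualsD(3)[OF FD(5)[OF j k j k]] ZD(1)[OF that(3)]
  by (auto simp: Lambda_def l.R.m_assoc trace_Z_linear)
 have \<Sigma>C: "\<Sigma> y : CL" if "y : CP" for y
  unfolding \<Sigma>_def using that c(1) LambdaC j by (intro l.R.m_closed l.R.finsum_closed) auto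
 have \<Sigma>add: "\<Sigma> (y \<oplus>\<^bsub>P\<^esub> y') = \<Sigma> y \<oplus> \<Sigma> y'" if "y : CP" "y' : CP" for y y'
 proof -
  have "(\<Oplus>q\<in>?C. c q \<otimes> Lambda q (y \<oplus>\<^bsub>P\<^esub> y')) = (\<Oplus>q\<in>?C. c q \<otimes> Lambda q y) \<oplus> (\<Oplus>q\<in>?C. c q \<otimes> Lambda q y')"
   using that c(1) LambdaC Lambdaadd
   by (intro trans[OF l.R.finsum_cong' l.R.finsum_addf]) (auto simp: l.R.r_distr)
  moreover have "(\<Oplus>q\<in>?C. c q \<otimes> Lambda q y) : CL" "(\<Oplus>q\<in>?C. c q \<otimes> Lambda q y') : CL"
   using that c(1) LambdaC by (auto intro!: l.R.finsum_closed)
  ultimately show ?thesis using j by (simp add: \<Sigma>_def l.R.l_distr)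
 qed
 have \<Sigma>Z: "\<Sigma> (z \<cdot> y) = z \<otimes> \<Sigma> y" if "y : CP" "z : Z" for y z
 proof -
  have z: "z : CL" using ZD(1)[OF that(2)] .
  have "(\<Oplus>q\<in>?C. c q \<otimes> Lambda q (z \<cdot> y)) = (\<Oplus>q\<in>?C. z \<otimes> (c q \<otimes> Lambda q y))"
   using that c(1) LambdaC LambdaZ z by (intro l.R.finsum_cong') (auto simp: l.R.m_lcomm)
  also have "... = z \<otimes> (\<Oplus>q\<in>?C. c q \<otimes> Lambda q y)"
   using that c(1) LambdaC z fin by (intro l.R.finsum_rdistr[symmetric]) auto
  finally show ?thesis using that c(1) LambdaC z j
   by (simp add: \<Sigma>_def l.R.m_assoc l.R.finsum_closed Pi_def)
 qed
 have \<Sigma>fin: "\<Sigma> (\<Oplus>\<^bsub>P\<^esub>s\<in>A. y s) = \<zero>" if "finite A" "!!s. s : A ==> y s : CP & \<Sigma> (y s) = \<zero>" for A :: "nat set" and y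
  using that
 proof (induction A rule: finite_induct)
  case empty
  show ?case using \<Sigma>Z[OF l.M.zero_closed Z_zero] \<Sigma>C by simp
 next
  case (insert s A)
  then have "(\<Oplus>\<^bsub>P\<^esub>t\<in>insert s A. y t) = y s \<oplus>\<^bsub>P\<^esub> (\<Oplus>\<^bsub>P\<^esub>t\<in>A. y t)" by (subst l.M.finsum_insert) auto
  then show ?case using insert by (simp add: \<Sigma>add l.M.finsum_closed Pi_def)
 qed
 have \<Sigma>0: "\<Sigma> y = \<zero>" if y: "y : CP" "e j \<cdot> (y \<star> e k) = y" for y
 proof -
  have wC: "omega j k a y : CL" if "a : G j k" for a using GD(9)[OF j k j k that y(1)] .
  have "g j k a \<star> omega j k a y = (\<Oplus>\<^bsub>P\<^esub>t\<in>{..<D k}. tau k (omega j k a y \<otimes> gamma k t) \<cdot> (g j k a \<star> beta k t))" if a: "a : G j k" for a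
  proof -
   have "g j k a \<star> omega j k a y = g j k a \<star> (omega j k a y \<otimes> e k)"
    using GD(6)[OF j k j k a y(1)] wC[OF a] k by (simp add: l.R.m_comm)
   also have "... = (\<Oplus>\<^bsub>P\<^esub>t\<in>{..<D k}. g j k a \<star> (tau k (omega j k a y \<otimes> gamma k t) \<otimes> beta k t))"
    unfolding expand_beta[OF k wC[OF a]] using gC[OF a] wC[OF a] k by (intro rs_finsum_right) auto
   also have "... = (\<Oplus>\<^bsub>P\<^esub>t\<in>{..<D k}. tau k (omega j k a y \<otimes> gamma k t) \<cdot> (g j k a \<star> beta k t))"
    using gC[OF a] wC[OF a] k by (intro l.M.finsum_cong') (auto simp: rs_central trace_Z)
   finally show ?thesis .
  qed
  moreover have "\<Sigma> (tau k (omega j k a y \<otimes> gamma k t) \<cdot> (g j k a \<star> beta k t)) = \<zero>" if "a : G j k" "t < D k" for a t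
  proof -
   have "\<Sigma> (g j k a \<star> beta k t) = \<zero>" unfolding \<Sigma>_def using bspec[OF c(3), of "(a, t)"] that by simp
   then show ?thesis using that gC wC k by (subst \<Sigma>Z) (auto simp: trace_Z ZD(1))
  qed
  ultimately have "\<Sigma> (g j k a \<star> omega j k a y) = \<zero>" if "a : G j k" for a
   using that gC[OF that] wC[OF that] k by (auto intro!: \<Sigma>fin simp: ZD(1)[OF trace_Z])
  then have "\<Sigma> (\<Oplus>\<^bsub>P\<^esub>a\<in>G j k. g j k a \<star> omega j k a y) = \<zero>"
   using gC wC fin GD(1)[OF j k j k] by (intro \<Sigma>fin) auto
  then show ?thesis using G_frame[OF j k] y by (simp add: right_frame_def)
 qed
 obtain s l where sl: "s < D j" "l : F j k" "c (s, l) \<otimes> e j ~= \<zero>" using c(2) by auto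
 have u: "u j k l : CP" "e j \<cdot> u j k l = u j k l" "u j k l \<star> e k = u j k l"
  using FD(2-4)[OF j k j k sl(2)] by auto
 define y where "y = beta j s \<cdot> u j k l"
 have y: "y : CP" "e j \<cdot> (y \<star> e k) = y"
  using u sl j k beta_e[OF j sl(1)] by (auto simp: y_def rs_ls l.smult_assoc1[symmetric] l.R.m_comm)
 have Lambday: "Lambda q y = (if q = (s, l) then \<one> else \<zero>)" if q: "q : ?C" for q
 proof -
  obtain s' l' where q': "q = (s', l')" "s' < D j" "l' : F j k" using q by auto
  have "f j k l' y = beta j s \<otimes> (if l' = l then e j else \<zero>)"
   using dualsD(3)[OF FD(5)[OF j k j k q'(3)], of "beta j s" "u j k l"] u sl j FD(8)[OF j k j k q'(3) sl(2)]
   by (simp add: y_def)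
  then show ?thesis
   using sl j q' beta_e[OF j sl(1)] trace_dual[OF j sl(1) q'(2)] trace_Z_linear[OF j _ Z_zero, of "gamma j s'"] trace_closed[OF j, of "gamma j s'"]
   by (auto simp: Lambda_def)
 qed
 have "(\<Oplus>q\<in>?C. c q \<otimes> Lambda q y) = c (s, l) \<otimes> Lambda (s, l) y"
  using Lambday c(1) sl fin(2) by (intro l.R.finsum_delta) auto
 then have "\<Sigma> y = c (s, l) \<otimes> e j" using c(1) sl Lambday[of "(s, l)"] by (simp add: \<Sigma>_def)
 then show False using \<Sigma>0[OF y] sl(3) by simp
qed

text \<open>
 The trace turns a right functional \<open>omega\<close> on \<open>e\<^sub>j P e\<^sub>k\<close> into a left functional \<open>theta\<close> with values in \<open>e\<^sub>j L\<close>,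
 determined by \<open>tau\<^sub>j(theta(y) b) = tau\<^sub>k(omega(b y))\<close>.
\<close>

definition theta :: "nat => nat => nat => 'p => 'a" where
 "theta j k c y = (\<Oplus>s\<in>{..<D j}. tau k (omega j k c (beta j s \<cdot> y)) \<otimes> gamma j s)"

lemma theta_closed:
 assumes "j < n" "k < n" "c : G j k" "y : CP"
 shows "theta j k c y : CL"
 unfolding theta_def using assms GD(9)[OF assms(1,2,1,2,3)] by (intro l.R.finsum_closed) auto

lemma theta_e:
 assumes "j < n" "k < n" "c : G j k" "y : CP"
 shows "theta j k c y \<otimes> e j = theta j k c y"
 unfolding theta_def using assms GD(9)[OF assms(1,2,1,2,3)] gamma_e[OF assms(1)]
 by (subst l.R.finsum_ldistr) (auto intro!: l.R.finsum_cong' simp: l.R.m_assoc)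

lemma theta_trace:
 assumes j: "j < n" and k: "k < n" and c: "c : G j k" and y: "y : CP" and b: "b : CL"
 shows "tau j (theta j k c y \<otimes> b) = tau k (omega j k c (b \<cdot> y))"
proof -
 note omega = GD[OF j k j k]
 have omegaC: "omega j k c y' : CL" if "y' : CP" for y' using omega(9)[OF c that] .
 note omegaD = dualsD[OF omega(5)[OF c], simplified]
 have hZ: "tau k (omega j k c (beta j s \<cdot> y)) : Z" if "s < D j" for s using that j k y omegaC trace_Z by simp
 have "tau j (theta j k c y \<otimes> b) = tau j (\<Oplus>s\<in>{..<D j}. tau k (omega j k c (beta j s \<cdot> y)) \<otimes> (b \<otimes> gamma j s))"
  unfolding theta_def using j k y b omegaC
  by (subst l.R.finsum_ldistr) (auto intro!: arg_cong[of _ _ "tau j"] l.R.finsum_cong' simp: l.R.m_assoc l.R.m_comm[of b])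
 also have "... = (\<Oplus>s\<in>{..<D j}. tau k (omega j k c (beta j s \<cdot> y)) \<otimes> tau j (b \<otimes> gamma j s))"
  using hZ b j by (intro Z_linear_finsum[OF trace_coefficient[OF j]]) auto
 also have "... = (\<Oplus>s\<in>{..<D j}. tau j (b \<otimes> gamma j s) \<otimes> tau k (omega j k c (beta j s \<cdot> y)))"
  using hZ b j by (intro l.R.finsum_cong') (auto simp: l.R.m_comm ZD(1))
 also have "... = tau k (\<Oplus>s\<in>{..<D j}. tau j (b \<otimes> gamma j s) \<otimes> omega j k c (beta j s \<cdot> y))"
  using b j y omegaC trace_Z[OF j] by (intro Z_linear_finsum[OF trace_coefficient[OF k], symmetric]) auto
 also have "(\<Oplus>s\<in>{..<D j}. tau j (b \<otimes> gamma j s) \<otimes> omega j k c (beta j s \<cdot> y)) =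
   (\<Oplus>s\<in>{..<D j}. omega j k c ((tau j (b \<otimes> gamma j s) \<otimes> beta j s) \<cdot> y))"
 proof (intro l.R.finsum_cong')
  fix s assume "s : {..<D j}"
  then have s: "s < D j" by simp
  have t: "tau j (b \<otimes> gamma j s) : Z" using s b j trace_Z by simp
  have "(tau j (b \<otimes> gamma j s) \<otimes> beta j s) \<cdot> y = (beta j s \<cdot> y) \<star> tau j (b \<otimes> gamma j s)"
   using s j y ZD[OF t] by (simp add: l.smult_assoc1)
  then show "tau j (b \<otimes> gamma j s) \<otimes> omega j k c (beta j s \<cdot> y) = omega j k c ((tau j (b \<otimes> gamma j s) \<otimes> beta j s) \<cdot> y)"
   using omegaD(3)[OF ZD(1)[OF t], of "beta j s \<cdot> y"] s j y by simp
 qed (use b j y omegaC in auto)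
 also have "... = omega j k c (\<Oplus>\<^bsub>P\<^esub>s\<in>{..<D j}. (tau j (b \<otimes> gamma j s) \<otimes> beta j s) \<cdot> y)"
  using r.functional_finsum[OF omega(5)[OF c], of "{..<D j}" "%s. (tau j (b \<otimes> gamma j s) \<otimes> beta j s) \<cdot> y"] b j y
  by simp
 also have "(\<Oplus>\<^bsub>P\<^esub>s\<in>{..<D j}. (tau j (b \<otimes> gamma j s) \<otimes> beta j s) \<cdot> y) = (b \<otimes> e j) \<cdot> y"
  unfolding expand_beta[OF j b] using b j y by (subst smult_finsum_left) auto
 also have "... = e j \<cdot> (b \<cdot> y)" using b j y by (simp add: l.smult_assoc1[symmetric] l.R.m_comm)
 also have "omega j k c ... = omega j k c (b \<cdot> y)" using omega(7)[OF c, of "b \<cdot> y"] b y by simp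
 finally show ?thesis .
qed

lemma theta_functional:
 assumes j: "j < n" and k: "k < n" and c: "c : G j k"
 shows "theta j k c : duals L P"
proof -
 note omega = GD[OF j k j k]
 note omegaC = omega(9)[OF c] and omegaD = dualsD[OF omega(5)[OF c], simplified]
 note C = theta_closed[OF j k c] and E = theta_e[OF j k c] and tr = theta_trace[OF j k c]
 have 1: "theta j k c (y \<oplus>\<^bsub>P\<^esub> y') = theta j k c y \<oplus> theta j k c y'" if y: "y : CP" "y' : CP" for y y'
 proof -
  have "theta j k c (y \<oplus>\<^bsub>P\<^esub> y') \<otimes> e j = (theta j k c y \<oplus> theta j k c y') \<otimes> e j"
   using y C omegaC k
   by (intro trace_nondegenerate[OF j]) (auto simp: tr l.R.l_distr trace_add[OF j] l.smult_r_distr omegaD(2) trace_add[OF k])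
  then show ?thesis using y C E j by (simp add: l.R.l_distr)
 qed
 have 2: "theta j k c (l \<cdot> y) = l \<otimes> theta j k c y" if y: "y : CP" and l: "l : CL" for y l
 proof -
  have "theta j k c (l \<cdot> y) \<otimes> e j = (l \<otimes> theta j k c y) \<otimes> e j"
  proof (rule trace_nondegenerate[OF j])
   fix b assume b: "b : CL"
   have "l \<otimes> theta j k c y \<otimes> b = theta j k c y \<otimes> (b \<otimes> l)" using l b y C by (simp add: l.R.m_ac)
   then show "tau j (theta j k c (l \<cdot> y) \<otimes> b) = tau j (l \<otimes> theta j k c y \<otimes> b)"
    using l b y by (simp add: tr l.smult_assoc1)
  qed (use y l C in auto)
  then show ?thesis using y l C E j by (simp add: l.R.m_assoc)
 qed
 show ?thesis using C 1 2 by (auto simp: duals_def)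
qed

text \<open>Frame vectors are orthogonal to \<open>x beta\<close>, hence to all \<open>x b\<close> by the expansion of \<open>b\<close> in dual bases.\<close>

lemma free_functional_residual:
 assumes ij: "i < n" "j < n" and a: "a < m i j" and l: "l : F i j - {..<m i j} \<times> {..<D j}" and b: "b : CL"
 shows "phi i j a (u i j l \<star> b) = \<zero>" and "f i j l (x i j a \<star> b) = \<zero>"
proof -
 have aI: "a : {..<m i j}" and lF: "l : F i j" using a l by auto
 have sF: "(a, s) : F i j" "l ~= (a, s)" if "s < D j" for s using that a l F_extends[OF ij] by auto
 have 0: "phi i j a (u i j l \<star> gamma j s) = \<zero>" if "s < D j" for s
  using FD(8)[OF ij ij sF(1)[OF that] lF] sF(2)[OF that] f_extends[OF ij a that] by auto
 have "phi i j a (u i j l \<star> b) = (\<Oplus>s\<in>{..<D j}. tau j (b \<otimes> beta j s) \<otimes> phi i j a (u i j l \<star> gamma j s))"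
  using FD(2,4)[OF ij ij lF] b freeD(5)[OF ij aI] by (intro functional_expand_gamma[OF ij(2)]) auto
 also have "... = (\<Oplus>s\<in>{..<D j}. \<zero>)" using 0 b ij by (intro l.R.finsum_cong') auto
 finally show "phi i j a (u i j l \<star> b) = \<zero>" by simp
 have fl: "f i j l : duals L P" using FD(5)[OF ij ij lF] .
 have "x i j a \<star> b = x i j a \<star> (b \<otimes> e j)"
  using freeD(4)[OF ij aI] a b ij rs_assoc[of "x i j a" "e j" b] by (simp add: l.R.m_comm)
 also have "... = (\<Oplus>\<^bsub>P\<^esub>s\<in>{..<D j}. x i j a \<star> (tau j (b \<otimes> gamma j s) \<otimes> beta j s))"
  unfolding expand_beta[OF ij(2) b] using a b ij by (intro rs_finsum_right) auto
 also have "... = (\<Oplus>\<^bsub>P\<^esub>s\<in>{..<D j}. tau j (b \<otimes> gamma j s) \<cdot> u i j (a, s))"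
  using a b ij by (intro l.M.finsum_cong') (auto simp: rs_central trace_Z u_extends)
 finally have "f i j l (x i j a \<star> b) = (\<Oplus>s\<in>{..<D j}. f i j l (tau j (b \<otimes> gamma j s) \<cdot> u i j (a, s)))"
  using l.functional_finsum[OF fl, of "{..<D j}" "%s. tau j (b \<otimes> gamma j s) \<cdot> u i j (a, s)"] a b ij
  by (simp add: u_extends)
 also have "... = (\<Oplus>s\<in>{..<D j}. \<zero>)"
 proof (intro l.R.finsum_cong')
  fix s assume "s : {..<D j}"
  then have s: "s < D j" by simp
  show "f i j l (tau j (b \<otimes> gamma j s) \<cdot> u i j (a, s)) = \<zero>"
   using dualsD(3)[OF fl, of "tau j (b \<otimes> gamma j s)" "u i j (a, s)"] FD(2)[OF ij ij sF(1)[OF s]]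
    FD(8)[OF ij ij lF sF(1)[OF s]] sF(2)[OF s] s b ij by simp
 qed auto
 finally show "f i j l (x i j a \<star> b) = \<zero>" by simp
qed

text \<open>
 In \<open>P \<otimes> P\<close>, the products \<open>x \<otimes> g\<close> of free vectors with right frames, and the products \<open>u \<otimes> x\<close> of the
 residual frame vectors with free vectors, form a free family. As \<open>P \<otimes> P\<close> is the \<open>d\<close>-th power of \<open>P\<close>,
 its size is at most \<open>d\<close> times the maximal one.
\<close>

lemma free_count:
 assumes i: "i < n" and k: "k < n"
 shows "(\<Sum>j<n. m i j * card (G j k) + (card (F i j) - m i j * D j) * m j k) <= d * m i k"
proof (rule ccontr)
 assume neg: "~ ?thesis"
 define E where "E j = F i j - {..<m i j} \<times> {..<D j}" for j
 define A where "A = (SIGMA j:{..<n}. ({..<m i j} \<times> G j k) <+> (E j \<times> {..<m j k}))"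
 define lv where "lv p = (case p of (j, Inl (a, c)) => x i j a | (j, Inr (l, c)) => u i j l)" for p :: "nat \<times> (nat \<times> nat + (nat \<times> nat) \<times> nat)"
 define rv where "rv p = (case p of (j, Inl (a, c)) => g j k c | (j, Inr (l, c)) => x j k c)" for p :: "nat \<times> (nat \<times> nat + (nat \<times> nat) \<times> nat)"
 define h where "h p = (case p of (j, Inl (a, c)) => phi i j a | (j, Inr (l, c)) => f i j l)" for p :: "nat \<times> (nat \<times> nat + (nat \<times> nat) \<times> nat)"
 define psi where "psi p = (case p of (j, Inl (a, c)) => theta j k c | (j, Inr (l, c)) => phi j k c)" for p :: "nat \<times> (nat \<times> nat + (nat \<times> nat) \<times> nat)"
 have cases: "(EX j a c. p = (j, Inl (a, c)) & j < n & a < m i j & c : G j k) |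
   (EX j l c. p = (j, Inr (l, c)) & j < n & l : E j & c < m j k)" if "p : A" for p
  using that by (auto simp: A_def)
 have finG: "finite (G j k)" if "j < n" for j using GD(1)[OF that k that k] .
 have A: "finite A" unfolding A_def E_def using F_finite[OF i] finG by auto
 have "card (E j) = card (F i j) - m i j * D j" if "j < n" for j
  unfolding E_def using F_extends[OF i that] by (subst card_Diff_subset) (auto simp: card_cartesian_product)
 then have "card A = (\<Sum>j<n. m i j * card (G j k) + (card (F i j) - m i j * D j) * m j k)"
  unfolding A_def using finG F_finite[OF i]
  by (subst card_SigmaI) (auto simp: card_Plus card_cartesian_product E_def intro!: sum.cong)
 then have cardA: "d * m i k < card A" using neg by simp
 have basic: "lv p : CP" "rv p : CP" "e (fst p) \<cdot> rv p = rv p"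
  "h p : duals L P" "psi p : duals L P" "fst p < n"
  "!!y. y : CP ==> e (fst p) \<otimes> psi p y = psi p y" if "p : A" for p
  using cases[OF that] i k FD(2,5)[OF i _ i] GD(2,3)[OF _ k _ k] freeD(3,5,6)[OF _ k] freeD(5)[OF i]
   theta_functional[OF _ k] theta_closed[OF _ k] theta_e[OF _ k]
  by (auto simp: lv_def rv_def h_def psi_def E_def l.R.m_comm)
 have dual: "h p (lv q \<star> psi p (rv q \<star> b)) = (if p = q then e i \<otimes> tau k b else \<zero>)"
  if p: "p : A" and q: "q : A" and b: "b : CL" for p q b
 proof (cases "fst p = fst q")
  case False
  have "psi p (rv q \<star> b) = psi p (e (fst q) \<cdot> (rv q \<star> b))"
   using basic(2,3,6)[OF q] b by (simp add: rs_ls[symmetric])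
  also have "... = e (fst q) \<otimes> (e (fst p) \<otimes> psi p (rv q \<star> b))"
   using dualsD(3)[OF basic(5)[OF p], of "e (fst q)" "rv q \<star> b"] basic(2,6)[OF q] basic(7)[OF p, of "rv q \<star> b"] b by simp
  also have "... = \<zero>"
   using e_orth[of "fst q" "fst p"] False basic(2,6)[OF q] basic(6)[OF p] dualsD(1)[OF basic(5)[OF p], of "rv q \<star> b"] b
   by (simp add: l.R.m_assoc[symmetric])
  finally show ?thesis using False basic(1)[OF q] l.functional_zero[OF basic(4)[OF p]] by auto
 next
  case True
  define j where "j = fst p"
  have j: "j < n" using basic(6)[OF p] by (simp add: j_def)
  have tC: "tau k b : CL" "tau k b : Z" using b k trace_Z by auto
  have thetag: "tau j (theta j k c (g j k c' \<star> b)) = (if c = c' then tau k b else \<zero>)" if c: "c : G j k" "c' : G j k" for c c'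
  proof -
   have gC: "g j k c' : CP" using GD(2)[OF j k j k c(2)] .
   have "tau j (theta j k c (g j k c' \<star> b)) = tau k (omega j k c (g j k c' \<star> b))"
    using theta_trace[OF j k c(1), of "g j k c' \<star> b" \<one>] theta_closed[OF j k c(1), of "g j k c' \<star> b"] gC b by simp
   also have "omega j k c (g j k c' \<star> b) = b \<otimes> omega j k c (g j k c')"
    using dualsD(3)[OF GD(5)[OF j k j k c(1)], of b "g j k c'"] gC b by simp
   also have "... = (if c = c' then b \<otimes> e k else \<zero>)" using GD(8)[OF j k j k c] b by simp
   finally show ?thesis using trace_e[OF k b] trace_Z_linear[OF k b Z_zero] b tC by (auto split: if_splits)
  qed
  have thetaC: "theta j k c (y \<star> b) : CL" if "c : G j k" "y : CP" for c y
   using theta_closed[OF j k that(1)] that(2) b by simp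
  have gC: "g j k c : CP" if "c : G j k" for c using GD(2)[OF j k j k that] .
  have uC: "u i j l : CP" "u i j l \<star> e j = u i j l" if "l : E j" for l
   using FD(2,4)[OF i j i j, of l] that by (auto simp: E_def)
  have phiC: "phi j k c (y \<star> b) : CL" if "c < m j k" "y : CP" for c y
   using freeD(8)[OF j k, of c "y \<star> b"] that b by simp
  show ?thesis
  proof (cases "snd p")
   case (Inl ac)
   then obtain a c where p': "p = (j, Inl (a, c))" "a < m i j" "c : G j k" using cases[OF p] by (auto simp: j_def)
   show ?thesis
   proof (cases "snd q")
    case (Inl ac')
    then obtain a' c' where q': "q = (j, Inl (a', c'))" "a' < m i j" "c' : G j k" using cases[OF q] True by (auto simp: j_def)
    have "h p (lv q \<star> psi p (rv q \<star> b)) = (if a = a' then e i \<otimes> tau j (theta j k c (g j k c' \<star> b)) else \<zero>)"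
     using freeD(7)[OF i j, of a a' "theta j k c (g j k c' \<star> b)"] p' q' thetaC gC by (simp add: h_def lv_def rv_def psi_def)
    then show ?thesis using p' q' thetag i by auto
   next
    case (Inr lc)
    then obtain l c' where q': "q = (j, Inr (l, c'))" "l : E j" "c' < m j k" using cases[OF q] True by (auto simp: j_def)
    then show ?thesis using free_functional_residual(1)[OF i j p'(2), of l "theta j k c (x j k c' \<star> b)"] p' thetaC j k
     by (simp add: h_def lv_def rv_def psi_def E_def)
   qed
  next
   case (Inr lc)
   then obtain l c where p': "p = (j, Inr (l, c))" "l : E j" "c < m j k" using cases[OF p] by (auto simp: j_def)
   show ?thesis
   proof (cases "snd q")
    case (Inl ac)
    then obtain a c' where q': "q = (j, Inl (a, c'))" "a < m i j" "c' : G j k" using cases[OF q] True by (auto simp: j_def)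
    then show ?thesis using free_functional_residual(2)[OF i j q'(2), of l "phi j k c (g j k c' \<star> b)"] p' phiC gC
     by (simp add: h_def lv_def rv_def psi_def E_def)
   next
    case (Inr lc')
    then obtain l' c' where q': "q = (j, Inr (l', c'))" "l' : E j" "c' < m j k" using cases[OF q] True by (auto simp: j_def)
    have lF: "l : F i j" "l' : F i j" using p' q' by (auto simp: E_def)
    have "phi j k c (x j k c' \<star> b) = (if c = c' then e j \<otimes> tau k b else \<zero>)"
     using freeD(7)[OF j k _ _ b] p' q' by simp
    moreover have "u i j l' \<star> (e j \<otimes> tau k b) = tau k b \<cdot> u i j l'"
     using uC[OF q'(2)] tC j rs_central[OF tC(2), of "u i j l'" "e j"] by (simp add: l.R.m_comm)
    moreover have "f i j l (tau k b \<cdot> u i j l') = (if l = l' then e i \<otimes> tau k b else \<zero>)"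
     using dualsD(3)[OF FD(5)[OF i j i j lF(1)] tC(1) uC(1)[OF q'(2)]] FD(8)[OF i j i j lF] tC i
     by (simp add: l.R.m_comm)
    ultimately show ?thesis
     using p' q' uC(1)[OF q'(2)] l.functional_zero[OF FD(5)[OF i j i j lF(1)]]
     by (auto simp: h_def lv_def rv_def psi_def)
   qed
  qed
 qed
 have "ALL p:A. EX chi. (ALL t<d. chi t : duals L P) &
   (ALL y:CP. ALL z:CP. h p (y \<star> psi p z) = (\<Oplus>t\<in>{..<d}. chi t (T t y z)))"
  using T_functional[OF balanced_compose[OF basic(4,5)]] by blast
 then obtain chi where chi: "ALL p:A. (ALL t<d. chi p t : duals L P) &
   (ALL y:CP. ALL z:CP. h p (y \<star> psi p z) = (\<Oplus>t\<in>{..<d}. chi p t (T t y z)))"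
  unfolding bchoice_iff by blast
 have "EX x' f'. free_family i k {..<Suc (m i k)} x' f'"
 proof (rule free_family_of_power[OF i k A, of d chi "%p t. T t (lv p) (rv p)"])
  fix p q b assume p: "p : A" and q: "q : A" and b: "b : CL"
  have "(\<Oplus>t\<in>{..<d}. chi p t (T t (lv q) (rv q) \<star> b)) = (\<Oplus>t\<in>{..<d}. chi p t (T t (lv q) (rv q \<star> b)))"
   using dualsD(1)[of "chi p _" L P] chi p b basic(1,2)[OF q] by (intro l.R.finsum_cong') (auto simp: T_rsmult)
  also have "... = h p (lv q \<star> psi p (rv q \<star> b))" using chi p b basic(1,2)[OF q] by simp
  finally show "(\<Oplus>t\<in>{..<d}. chi p t (T t (lv q) (rv q) \<star> b)) = (if p = q then e i \<otimes> tau k b else \<zero>)"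
   using dual[OF p q b] by simp
 next
  fix r' assume "r' < Suc (m i k)"
  then have "d * r' <= d * m i k" by (intro mult_le_mono2) simp
  then show "d * r' < card A" using cardA by linarith
 qed (use chi basic in auto)
 then show False using maximal[OF i k] by blast
qed

lemma frame_square:
 "i < n ==> k < n ==> (\<Sum>j<n. card (F i j) * card (F j k)) = d * card (F i k)"
 by (rule frame_matrix_square[OF _ _ F_frame])

text \<open>With the bounds above the defects \<open>r = x - m D\<close> satisfy \<open>d r \<le> r\<^sup>2\<close> as matrices.\<close>

lemma block_free:
 assumes ij: "i < n" "j < n"
 shows "F i j = {..<m i j} \<times> {..<D j}"
proof -
 define r where "r i j = card (F i j) - m i j * D j" for i j
 have split: "card (F i j) = m i j * D j + r i j" if "i < n" "j < n" for i j
  using card_mono[OF F_finite F_extends, OF that that] by (simp add: r_def card_cartesian_product)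
 have "r i j = 0"
 proof (rule defect_matrix_zero[of n "%i j. card (F i j)" d r])
  show "r i j < card (F i j)" if "i < n" "j < n" for i j
   using split[OF that] m_pos[OF that] degree_pos[OF that(2)] by simp
  fix i k assume i: "i < n" and k: "k < n"
  have "d * card (F i k) = (\<Sum>j<n. card (F i j) * card (F j k))" using frame_square[OF i k] by simp
  also have "... <= (\<Sum>j<n. (m i j * card (G j k) + r i j * m j k) * D k + r i j * r j k)"
  proof (rule sum_mono)
   fix j assume "j : {..<n}"
   then have j: "j < n" by simp
   have "m i j * (D j * card (F j k)) <= m i j * (card (G j k) * D k)"
    using left_dimension_le_right[OF j k] by (rule mult_le_mono2)
   moreover have "card (F i j) * card (F j k) = m i j * (D j * card (F j k)) + r i j * (m j k * D k + r j k)"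
    using split[OF i j] split[OF j k] by (simp add: algebra_simps)
   ultimately show "card (F i j) * card (F j k) <= (m i j * card (G j k) + r i j * m j k) * D k + r i j * r j k"
    by (simp add: algebra_simps)
  qed
  also have "... = (\<Sum>j<n. m i j * card (G j k) + r i j * m j k) * D k + (\<Sum>j<n. r i j * r j k)"
   by (simp add: sum.distrib sum_distrib_right distrib_right)
  also have "(\<Sum>j<n. m i j * card (G j k) + r i j * m j k) * D k <= d * m i k * D k"
   using free_count[OF i k] by (intro mult_le_mono1) (simp add: r_def)
  finally show "d * r i k <= (\<Sum>j<n. r i j * r j k)" using split[OF i k] by (simp add: algebra_simps)
 qed (use frame_square ij in auto)
 then have "card (F i j) <= card ({..<m i j} \<times> {..<D j})" using split[OF ij] by (simp add: card_cartesian_product)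
 then show ?thesis using card_seteq[OF F_finite[OF ij] F_extends[OF ij]] by simp
qed

lemma block_expand:
 assumes ij: "i < n" "j < n" and y: "y : CP"
 shows "e i \<cdot> (y \<star> e j) = (\<Oplus>\<^bsub>P\<^esub>a\<in>{..<m i j}. \<Oplus>\<^bsub>P\<^esub>s\<in>{..<D j}. phi i j a (y \<star> gamma j s) \<cdot> (x i j a \<star> beta j s))"
proof -
 have "e i \<cdot> (y \<star> e j) = (\<Oplus>\<^bsub>P\<^esub>s\<in>F i j. f i j s y \<cdot> u i j s)"
  using F_frame[OF ij] y by (simp add: left_frame_def)
 also have "... = (\<Oplus>\<^bsub>P\<^esub>a\<in>{..<m i j}. \<Oplus>\<^bsub>P\<^esub>s\<in>{..<D j}. f i j (a, s) y \<cdot> u i j (a, s))"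
  unfolding block_free[OF ij]
  using FD(2,9)[OF ij ij] F_extends[OF ij] y by (intro l.M.finsum_Sigma) auto
 also have "... = (\<Oplus>\<^bsub>P\<^esub>a\<in>{..<m i j}. \<Oplus>\<^bsub>P\<^esub>s\<in>{..<D j}. phi i j a (y \<star> gamma j s) \<cdot> (x i j a \<star> beta j s))"
  using y ij freeD(8)[OF ij]
  by (intro l.M.finsum_cong' l.M.finsum_closed) (auto simp: u_extends f_extends)
 finally show ?thesis .
qed

text \<open>Freeness turns the identity for the left dimensions \<open>m D\<close> into \<open>m D m = d m\<close>.\<close>

lemma multiplicity_factorization:
 "EX a r. (ALL i<n. 0 < a i & 0 < r i) & (ALL i<n. ALL j<n. m i j = a i * r j)"
proof (rule rank_one_factorization[OF m_pos])
 have "(\<Sum>j<n. m i j * D j * m j k) = d * m i k" if "i < n" "k < n" for i k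
 proof -
  have "(\<Sum>j<n. m i j * D j * m j k) * D k = d * m i k * D k"
   using frame_square[OF that] that by (simp add: block_free card_cartesian_product sum_distrib_right mult.assoc)
  then show ?thesis using degree_pos[OF that(2)] by simp
 qed
 then show "m i j * m k l = m i l * m k j" if "i < n" "j < n" "k < n" "l < n" for i j k l
  using that m_pos degree_pos by (intro positive_matrix_rank_one[of n m D d])
qed

end

context quasi_galois_bimodule
begin

text \<open>The dimensions of the blocks form a matrix to which \<^term>\<open>connected_matrix_positive\<close> applies.\<close>

lemma connected_blocks_nonzero:
 assumes row: "!!i. i < n ==> EX x:CP. e i \<cdot> x ~= \<zero>\<^bsub>P\<^esub>"
  and col: "!!k. k < n ==> EX x:CP. x \<star> e k ~= \<zero>\<^bsub>P\<^esub>"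
  and conn: "!!S. [|S \<subseteq> {..<n}; S ~= {}; !!i j y. [|i : S; j < n; j \<notin> S; y : CP|] ==>
    e i \<cdot> (y \<star> e j) = \<zero>\<^bsub>P\<^esub> & e j \<cdot> (y \<star> e i) = \<zero>\<^bsub>P\<^esub>|] ==> S = {..<n}"
  and ij: "i < n" "j < n"
 shows "EX y:CP. e i \<cdot> (y \<star> e j) ~= \<zero>\<^bsub>P\<^esub>"
proof -
 have "EX (F :: nat set) u f. left_frame i j F u f" if ij: "i < n" "j < n" for i j
 proof -
  interpret projective_dual_setting L P "e i" "%x. x \<star> e j" V v v' by (rule left_setting[OF ij])
  have D: "left_dual i j ({} :: nat set) undefined undefined" by (simp add: dual_family_def)
  show ?thesis by (rule left_dual_extend_frame[OF ij D infinite_UNIV_nat]) blast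
 qed
 then have "ALL i j. EX (F :: nat set) u f. i < n --> j < n --> left_frame i j F u f" by blast
 then have "EX (F :: nat => nat => nat set) u f. ALL i j. i < n --> j < n --> left_frame i j (F i j) (u i j) (f i j)"
  unfolding choice_iff .
 then obtain F :: "nat => nat => nat set" and u f where
  F: "!!i j. i < n ==> j < n ==> left_frame i j (F i j) (u i j) (f i j)" by blast
 have LD: "left_dual i j (F i j) (u i j) (f i j)" if "i < n" "j < n" for i j
  using F[OF that] by (simp add: left_frame_def)
 have pos: "0 < card (F i j) \<longleftrightarrow> (EX y:CP. e i \<cdot> (y \<star> e j) ~= \<zero>\<^bsub>P\<^esub>)" if ij: "i < n" "j < n" for i j
 proof
  note FD = left_dualD[OF ij LD[OF ij]]
  assume "0 < card (F i j)"
  then obtain s where s: "s : F i j" by (auto simp: card_gt_0_iff)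
  have "u i j s ~= \<zero>\<^bsub>P\<^esub>" using FD(8)[OF s s] l.functional_zero[OF FD(5)[OF s]] e_nonzero[OF ij(1)] by auto
  then show "EX y:CP. e i \<cdot> (y \<star> e j) ~= \<zero>\<^bsub>P\<^esub>" using FD(2-4)[OF s] by (intro bexI[of _ "u i j s"]) auto
 next
  assume "EX y:CP. e i \<cdot> (y \<star> e j) ~= \<zero>\<^bsub>P\<^esub>"
  then have "F i j ~= {}" using F[OF ij] by (auto simp: left_frame_def)
  then show "0 < card (F i j)" using left_dualD(1)[OF ij LD[OF ij]] by (simp add: card_gt_0_iff)
 qed
 have "0 < card (F i j)"
 proof (rule connected_matrix_positive[of n "%i j. card (F i j)" d])
  show "(\<Sum>j<n. card (F i j) * card (F j k)) = d * card (F i k)" if "i < n" "k < n" for i k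
   by (rule frame_matrix_square[OF that F])
 next
  fix i assume i: "i < n"
  obtain x where x: "x : CP" "e i \<cdot> x ~= \<zero>\<^bsub>P\<^esub>" using row[OF i] by blast
  have "EX j<n. e i \<cdot> x \<star> e j ~= \<zero>\<^bsub>P\<^esub>"
  proof (rule ccontr)
   assume "~ ?thesis"
   then have "(\<Oplus>\<^bsub>P\<^esub>j\<in>{..<n}. e i \<cdot> x \<star> e j) = (\<Oplus>\<^bsub>P\<^esub>j\<in>{..<n}. \<zero>\<^bsub>P\<^esub>)" by (intro l.M.finsum_cong') auto
   then show False using split_right[of "e i \<cdot> x"] x i by simp
  qed
  then obtain j where "j < n" "e i \<cdot> (x \<star> e j) ~= \<zero>\<^bsub>P\<^esub>" using x i by (auto simp: rs_ls)
  then show "EX j<n. 0 < card (F i j)" using pos[OF i, of j] x(1) by blast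
 next
  fix k assume k: "k < n"
  obtain x where x: "x : CP" "x \<star> e k ~= \<zero>\<^bsub>P\<^esub>" using col[OF k] by blast
  have "EX j<n. e j \<cdot> (x \<star> e k) ~= \<zero>\<^bsub>P\<^esub>"
  proof (rule ccontr)
   assume "~ ?thesis"
   then have "(\<Oplus>\<^bsub>P\<^esub>j\<in>{..<n}. e j \<cdot> (x \<star> e k)) = (\<Oplus>\<^bsub>P\<^esub>j\<in>{..<n}. \<zero>\<^bsub>P\<^esub>)" by (intro l.M.finsum_cong') auto
   then show False using split_left[of "x \<star> e k"] x k by simp
  qed
  then show "EX i<n. 0 < card (F i k)" using pos[OF _ k] x by blast
 next
  fix S assume S: "S \<subseteq> {..<n}" "S ~= {}" and 0: "!!i j. [|i : S; j < n; j \<notin> S|] ==> card (F i j) = 0 & card (F j i) = 0"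
  show "S = {..<n}"
  proof (rule conn[OF S])
   fix i j y assume "i : S" "j < n" "j \<notin> S" "y : CP"
   then show "e i \<cdot> (y \<star> e j) = \<zero>\<^bsub>P\<^esub> & e j \<cdot> (y \<star> e i) = \<zero>\<^bsub>P\<^esub>"
    using 0[of i j] pos[of i j] pos[of j i] S(1) by auto
  qed
 qed (use ij in auto)
 then show ?thesis using pos[OF ij] by simp
qed

end

text \<open>A coefficient \<open>a\<close> with \<open>a(z) = 1\<close> gives the inverse \<open>a(1)\<close> of \<open>z\<close>, because it is linear over \<open>Z\<close>.\<close>

lemma (in connected_quasi_galois_bimodule) Z_inverse:
 assumes z: "z : Z" "z ~= \<zero>"
 shows "EX w:Z. w \<otimes> z = \<one>"
proof -
 note zC = ZD(1)[OF z(1)]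
 obtain a where a: "coef a" "a z = \<one>" using coef_one[OF zC z(2)] by blast
 define w where "w = a \<one>"
 have w: "w : carrier L" using coef_closed[OF a(1)] by (simp add: w_def)
 have "z \<otimes> w = a z" using coef_Z_linear[OF a(1) _ z(1), of \<one>] zC by (simp add: w_def)
 then have wz: "w \<otimes> z = \<one>" using a(2) w zC by (simp add: l.R.m_comm)
 have "w : Z"
 proof (rule ZI[OF w])
  fix x assume x: "x : carrier P"
  have "x \<star> w = (w \<otimes> z) \<odot>\<^bsub>P\<^esub> (x \<star> w)" using x w wz by simp
  also have "... = w \<odot>\<^bsub>P\<^esub> (x \<star> z \<star> w)" using x w zC ZD(2)[OF z(1) x] by (simp add: l.smult_assoc1 rs_ls)
  also have "x \<star> z \<star> w = x" using x w zC wz by (simp add: rs_assoc l.R.m_comm)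
  finally show "x \<star> w = w \<odot>\<^bsub>P\<^esub> x" .
 qed
 then show ?thesis using wz by blast
qed

lemma (in cring) ideal_finsum:
 assumes I: "ideal I R" and "finite A" "!!a. a : A ==> f a : I"
 shows "(\<Oplus>a\<in>A. f a) : I"
proof -
 interpret I: ideal I R by (rule I)
 show ?thesis using assms(2,3)
 proof (induction A rule: finite_induct)
  case (insert a A)
  then have "(\<Oplus>a\<in>insert a A. f a) = f a \<oplus> (\<Oplus>a\<in>A. f a)" using I.Icarr by (subst finsum_insert) auto
  then show ?case using insert by simp
 qed simp
qed

lemma (in module) functional_finsum_in_ideal:
 assumes I: "ideal I R" and g: "g : duals R M" and A: "finite A"
  and y: "!!a. a : A ==> y a : carrier M & g (y a) : I"
 shows "(\<Oplus>\<^bsub>M\<^esub>a\<in>A. y a) : carrier M & g (\<Oplus>\<^bsub>M\<^esub>a\<in>A. y a) : I"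
 using y A by (auto simp: functional_finsum[OF g] intro!: M.finsum_closed R.ideal_finsum[OF I])

context framed_bimodule
begin

text \<open>
 If \<open>P\<close> is a free left module, its rank is the total left dimension of every row of blocks; if it is a
 free right module, its rank is at most the total right dimension of every column.
\<close>

lemma left_rank:
 assumes I: "finite (I :: 'i set)" and b: "!!r. r : I ==> b r : CP" and b': "!!r. r : I ==> b' r : duals L P"
  and dual: "!!r s. r : I ==> s : I ==> b' r (b s) = (if r = s then \<one> else \<zero>)"
  and exp: "!!y. y : CP ==> y = (\<Oplus>\<^bsub>P\<^esub>r\<in>I. b' r y \<cdot> b r)"
  and i: "i < n"
 shows "(\<Sum>j<n. m i j * D j) = card I"
proof -
 define J where "J = (SIGMA j:{..<n}. {..<m i j} \<times> {..<D j})"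
 have J: "finite J" "card J = (\<Sum>j<n. m i j * D j)" by (auto simp: J_def card_SigmaI card_cartesian_product)
 interpret S: projective_dual_setting L P "e i" "%x. x" I b b'
  using i I b b' exp by unfold_locales auto
 have loc: "local_idem L (e i)" using l.R.field_idem_local[OF e_field[OF i]] .
 then have idl: "ideal (res_ideal L (e i)) L" by (simp add: local_idem_def)
 interpret RI: ideal "res_ideal L (e i)" L by (rule idl)
 define y where "y p = (case p of (j, a, s) => x i j a \<star> beta j s)" for p :: "nat \<times> nat \<times> nat"
 define y' where "y' p = (case p of (j, a, s) => %z. phi i j a (z \<star> gamma j s))" for p :: "nat \<times> nat \<times> nat"
 have "card J <= card I"
 proof (rule S.dual_family_card_le[OF loc, where x = y and f = y' and v = b])
  have 1: "phi i j a (x i k c \<star> beta k t \<star> gamma j s) = (if (j, a, s) = (k, c, t) then e i else \<zero>)"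
   if "j < n" "k < n" "a < m i j" "c < m i k" "s < D j" "t < D k" for j k a c s t
  proof (cases "j = k")
   case True
   then show ?thesis
    using that freeD(7)[OF i that(1), of a c "beta j t \<otimes> gamma j s"] i trace_dual[of j t s]
    by (auto simp: rs_assoc)
  next
   case False
   have "beta k t \<otimes> gamma j s = (beta k t \<otimes> e k) \<otimes> (gamma j s \<otimes> e j)" using that beta_e gamma_e by simp
   also have "... = (beta k t \<otimes> gamma j s) \<otimes> (e k \<otimes> e j)" using that by (simp add: l.R.m_ac)
   also have "... = \<zero>" using that False e_orth[of k j] by simp
   finally show ?thesis
    using that False i l.functional_zero[OF freeD(5)[OF i that(1), of a]] by (simp add: rs_assoc)
  qed
  show "S.dual_family J y y'"
   unfolding S.dual_family_def using J(1) 1 i freeD(3,5,6)[OF i]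
   by (auto simp: y_def y'_def J_def functional_twist rs_ls[symmetric])
  show "g (y p) : res_ideal L (e i)"
   if "g : duals L P" "p : J" "ALL r:I. g (b r) : res_ideal L (e i)" for g p
   using that i by (intro S.functional_in_ideal[OF idl]) (auto simp: y_def J_def)
 qed (use I b in auto)
 moreover have "card I <= card J"
 proof (rule S.dual_family_card_le[OF loc, where x = "%r. e i \<cdot> b r" and f = "%r z. e i \<otimes> b' r z" and v = y])
  show "S.dual_family I (%r. e i \<cdot> b r) (%r z. e i \<otimes> b' r z)"
   unfolding S.dual_family_def using I b i dual dualsD(1,3)[OF b']
   by (auto simp: l.functional_scale[OF b'] l.smult_assoc1[symmetric] l.R.m_assoc[symmetric])
  fix g r assume g: "g : duals L P" and r: "r : I" and 0: "ALL p:J. g (y p) : res_ideal L (e i)"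
  note gD = dualsD[OF g]
  have phiC: "phi i j a (b r \<star> gamma j s) : CL" if "j < n" "a < m i j" "s < D j" for j a s
   using freeD(8)[OF i that(1), of a "b r \<star> gamma j s"] that b[OF r] by simp
  have "(\<Oplus>\<^bsub>P\<^esub>j\<in>{..<n}. e i \<cdot> b r \<star> e j) = (\<Oplus>\<^bsub>P\<^esub>j\<in>{..<n}. e i \<cdot> (b r \<star> e j))"
   using b[OF r] i by (intro l.M.finsum_cong') (auto simp: rs_ls)
  then have "e i \<cdot> b r = (\<Oplus>\<^bsub>P\<^esub>j\<in>{..<n}. e i \<cdot> (b r \<star> e j))"
   using split_right[of "e i \<cdot> b r"] b[OF r] i by (metis l.smult_closed e_closed)
  moreover have "g (e i \<cdot> (b r \<star> e j)) : res_ideal L (e i)" if j: "j < n" for j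
  proof -
   have "g (phi i j a (b r \<star> gamma j s) \<cdot> (x i j a \<star> beta j s)) : res_ideal L (e i)" if "a < m i j" "s < D j" for a s
    using gD(3)[OF phiC[OF j that], of "x i j a \<star> beta j s"] bspec[OF 0, of "(j, a, s)"] phiC[OF j that] that i j
    by (auto simp: J_def y_def intro: RI.I_l_closed)
   then show ?thesis
    unfolding block_expand[OF i j b[OF r]] using phiC[OF j] i j
    by (intro conjunct2[OF l.functional_finsum_in_ideal[OF idl g]] l.functional_finsum_in_ideal[OF idl g]) auto
  qed
  ultimately show "g (e i \<cdot> b r) : res_ideal L (e i)"
   using l.functional_finsum_in_ideal[OF idl g, of "{..<n}" "%j. e i \<cdot> (b r \<star> e j)"] b[OF r] i by simp
 qed (use J in "auto simp: y_def J_def i")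
 ultimately show ?thesis using J by simp
qed

lemma right_rank:
 assumes I: "finite (I :: 'i set)" and b: "!!r. r : I ==> b r : CP" and b': "!!r. r : I ==> b' r : duals L (right_module P)"
  and dual: "!!r s. r : I ==> s : I ==> b' r (b s) = (if r = s then \<one> else \<zero>)"
  and k: "k < n"
 shows "card I <= (\<Sum>j<n. D j * m j k)"
proof -
 define J where "J = (SIGMA j:{..<n}. {..<D j} \<times> {..<m j k})"
 have J: "finite J" "card J = (\<Sum>j<n. D j * m j k)" by (auto simp: J_def card_SigmaI card_cartesian_product)
 interpret S: dual_setting L "right_module P" "e k" "%x. x"
  using k by unfold_locales auto
 have loc: "local_idem L (e k)" using l.R.field_idem_local[OF e_field[OF k]] .
 then have idl: "ideal (res_ideal L (e k)) L" by (simp add: local_idem_def)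
 interpret RI: ideal "res_ideal L (e k)" L by (rule idl)
 define y where "y p = (case p of (j, t, a) => beta j t \<cdot> x j k a)" for p :: "nat \<times> nat \<times> nat"
 have "card I <= card J"
 proof (rule S.dual_family_card_le[OF loc, where x = "%r. b r \<star> e k" and f = "%r z. e k \<otimes> b' r z" and v = y])
  show "S.dual_family I (%r. b r \<star> e k) (%r z. e k \<otimes> b' r z)"
   unfolding S.dual_family_def using I b k dual dualsD(1,3)[OF b', simplified]
   by (auto simp: r.functional_scale[OF b'] rs_assoc l.R.m_assoc[symmetric])
  fix g r assume g: "g : duals L (right_module P)" and r: "r : I" and 0: "ALL p:J. g (y p) : res_ideal L (e k)"
  note gD = dualsD[OF g, simplified] and gsum = r.functional_finsum[OF g, simplified]
  have phiC: "phi j k a (b r \<star> gamma k s) : CL" if "j < n" "a < m j k" "s < D k" for j a s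
   using freeD(8)[OF that(1) k, of a "b r \<star> gamma k s"] that b[OF r] k by simp
  have in_ideal: "g (phi j k a (b r \<star> gamma k s) \<cdot> (x j k a \<star> beta k s)) : res_ideal L (e k)"
   if j: "j < n" and a: "a < m j k" and s: "s < D k" for j a s
  proof -
   define c where "c = phi j k a (b r \<star> gamma k s)"
   have c: "c : CL" "c \<otimes> e j = c"
    using phiC[OF j a s] freeD(6)[OF j k, of a "b r \<star> gamma k s"] a s b[OF r] j k by (auto simp: c_def l.R.m_comm)
   have z: "tau j (c \<otimes> gamma j t) : Z" if "t < D j" for t using that c j trace_Z by simp
   have "c \<cdot> (x j k a \<star> beta k s) = (\<Oplus>\<^bsub>P\<^esub>t\<in>{..<D j}. (tau j (c \<otimes> gamma j t) \<otimes> beta j t) \<cdot> (x j k a \<star> beta k s))"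
    using expand_beta[OF j c(1)] c j k a s z by (subst smult_finsum_left[symmetric]) (auto simp: ZD(1))
   also have "... = (\<Oplus>\<^bsub>P\<^esub>t\<in>{..<D j}. y (j, t, a) \<star> (tau j (c \<otimes> gamma j t) \<otimes> beta k s))"
    using c j k a s z by (intro l.M.finsum_cong')
     (auto simp: y_def ZD(1) rs_central l.smult_assoc1 rs_ls)
   finally have "g (c \<cdot> (x j k a \<star> beta k s)) = (\<Oplus>t\<in>{..<D j}. g (y (j, t, a) \<star> (tau j (c \<otimes> gamma j t) \<otimes> beta k s)))"
    using c j k a s z gsum[of "{..<D j}" "%t. y (j, t, a) \<star> (tau j (c \<otimes> gamma j t) \<otimes> beta k s)"]
    by (simp add: y_def ZD(1))
   also have "... : res_ideal L (e k)"
   proof (intro l.R.ideal_finsum[OF idl])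
    fix t assume "t : {..<D j}"
    then have t: "t < D j" by simp
    have yC: "y (j, t, a) : CP" using t j k a by (simp add: y_def)
    have "g (y (j, t, a) \<star> (tau j (c \<otimes> gamma j t) \<otimes> beta k s)) = tau j (c \<otimes> gamma j t) \<otimes> beta k s \<otimes> g (y (j, t, a))"
     using gD(3)[of "tau j (c \<otimes> gamma j t) \<otimes> beta k s" "y (j, t, a)"] yC c t j k s by simp
    moreover have "g (y (j, t, a)) : res_ideal L (e k)" using bspec[OF 0, of "(j, t, a)"] t j a by (simp add: J_def)
    ultimately show "g (y (j, t, a) \<star> (tau j (c \<otimes> gamma j t) \<otimes> beta k s)) : res_ideal L (e k)"
     using RI.I_l_closed c t j k s by simp
   qed simp
   finally show ?thesis by (simp add: c_def)
  qed
  have "b r \<star> e k = (\<Oplus>\<^bsub>P\<^esub>j\<in>{..<n}. e j \<cdot> (b r \<star> e k))"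
   using split_left[of "b r \<star> e k"] b[OF r] k by simp
  moreover have "g (e j \<cdot> (b r \<star> e k)) : res_ideal L (e k)" if j: "j < n" for j
   unfolding block_expand[OF j k b[OF r]] using phiC[OF j] in_ideal[OF j] j k
   by (intro conjunct2[OF r.functional_finsum_in_ideal[OF idl g, simplified]]
     r.functional_finsum_in_ideal[OF idl g, simplified]) auto
  ultimately show "g (b r \<star> e k) : res_ideal L (e k)"
   using r.functional_finsum_in_ideal[OF idl g, of "{..<n}" "%j. e j \<cdot> (b r \<star> e k)"] b[OF r] k by simp
 qed (use J in "auto simp: y_def J_def k")
 then show ?thesis using J by simp
qed

lemma galois_multiplicity:
 assumes left: "!!i. i < n ==> (\<Sum>j<n. m i j * D j) = c" and right: "!!k. k < n ==> c <= (\<Sum>j<n. D j * m j k)"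
  and ij: "i < n" "j < n" and kl: "k < n" "l < n"
 shows "m i j = m k l"
proof -
 obtain a r where pos: "ALL i<n. 0 < a i & 0 < r i" and m: "ALL i<n. ALL j<n. m i j = a i * r j"
  using multiplicity_factorization by blast
 have "a i * r j = a k * r l"
  using pos degree_pos m left right ij kl by (intro equal_dimensions_constant[of n a r D c]) auto
 then show ?thesis using m ij kl by simp
qed

end

section \<open>Tensor products\<close>

locale tensor_setting = M: comm_bimodule L M + N: comm_bimodule L N
 for L (structure) and M :: "('a, 'a, 'm) bimodule" and N :: "('a, 'a, 'n) bimodule" +
 fixes S :: "('a, 's) ring_scheme"
 assumes scalars: "carrier S \<subseteq> carrier L"
begin

abbreviation F where "F == tensor_free M N"
abbreviation H where "H == tensor_relations S M N"
abbreviation Q where "Q == tensor_product S M N"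

definition cls :: "('m \<times> 'n \<Rightarrow>\<^sub>0 int) => ('m \<times> 'n \<Rightarrow>\<^sub>0 int) set" where
 "cls c = H #>\<^bsub>F\<^esub> c"

definition pure :: "'m => 'n => ('m \<times> 'n \<Rightarrow>\<^sub>0 int) set" where
 "pure x y = cls (frag_of (x, y))"

definition relators :: "('m \<times> 'n \<Rightarrow>\<^sub>0 int) set" where
 "relators = {frag_of (x \<oplus>\<^bsub>M\<^esub> x', y) - frag_of (x, y) - frag_of (x', y) | x x' y.
    x : carrier M & x' : carrier M & y : carrier N} \<union>
   {frag_of (x, y \<oplus>\<^bsub>N\<^esub> y') - frag_of (x, y) - frag_of (x, y') | x y y'.
    x : carrier M & y : carrier N & y' : carrier N} \<union>
   {frag_of (rsmult M x s, y) - frag_of (x, module.smult N s y) | x s y.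
    x : carrier M & s : carrier S & y : carrier N}"

lemma H_generate: "H = generate F relators"
 by (simp add: tensor_relations_def relators_def)

lemma scalar [simp]: "s : carrier S ==> s : carrier L"
 using scalars by blast

lemma F_comm_group: "comm_group F"
 unfolding tensor_free_def by (rule abelian_free_Abelian_group)

lemma F_simps [simp]: "c : carrier F \<longleftrightarrow> Poly_Mapping.keys c \<subseteq> carrier M \<times> carrier N" "c \<otimes>\<^bsub>F\<^esub> c' = c + c'" "\<one>\<^bsub>F\<^esub> = 0"
 by (simp_all add: tensor_free_def)

lemma F_diff: "c : carrier F ==> c' : carrier F ==> c - c' : carrier F"
 using keys_diff[of c c'] by auto

lemma F_of: "x : carrier M ==> y : carrier N ==> frag_of (x, y) : carrier F"
 by simp

lemma F_add: "c : carrier F ==> c' : carrier F ==> c + c' : carrier F"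
 using keys_add[of c c'] by auto

lemma relators_closed: "relators \<subseteq> carrier F"
 unfolding relators_def
 by (auto simp del: F_simps intro!: F_diff F_of)

lemma H_subgroup: "subgroup H F"
 unfolding H_generate
 using group.generate_is_subgroup[OF comm_group.axioms(2)[OF F_comm_group] relators_closed] .

lemma H_normal: "H \<lhd> F"
 using comm_group.subgroup_imp_normal[OF F_comm_group H_subgroup] .

lemma H_0: "0 : H" using subgroup.one_closed[OF H_subgroup] by simp

lemma H_closed: "h : H ==> h : carrier F"
 using subgroup.subset[OF H_subgroup] by blast

lemma H_add: "h : H ==> h' : H ==> h + h' : H"
 using subgroup.m_closed[OF H_subgroup] by simp

lemma cls_iff: "cls c = {h + c | h. h : H}"
 by (auto simp: cls_def r_coset_def)

lemma cls_eqI: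
 assumes "c : carrier F" "c - c' : H"
 shows "cls c' = cls c"
proof -
 have "H #>\<^bsub>F\<^esub> c' = H #>\<^bsub>F\<^esub> c"
 proof (rule group.repr_independence[OF comm_group.axioms(2)[OF F_comm_group]])
  show "c : H #>\<^bsub>F\<^esub> c'" using assms(2) by (auto simp: r_coset_def intro!: bexI[of _ "c - c'"])
  have "c' = c - (c - c')" by simp
  then show "c' : carrier F" using F_diff[OF assms(1) H_closed[OF assms(2)]] by simp
 qed (rule H_subgroup)
 then show ?thesis by (simp add: cls_def)
qed

lemma Q_carrier: "carrier Q = cls ` carrier F"
 by (auto simp: tensor_product_def Let_def FactGroup_def RCOSETS_def cls_def)

lemma Q_zero: "\<zero>\<^bsub>Q\<^esub> = cls 0"
proof -
 have "\<zero>\<^bsub>Q\<^esub> = H" by (simp add: tensor_product_def Let_def FactGroup_def)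
 then show ?thesis by (simp add: cls_iff)
qed

lemma Q_add: "c : carrier F ==> c' : carrier F ==> cls c \<oplus>\<^bsub>Q\<^esub> cls c' = cls (c + c')"
 using normal.rcos_sum[OF H_normal, of c c'] by (simp add: tensor_product_def Let_def FactGroup_def cls_def)

lemma F_0: "0 : carrier F"
 by simp

lemma Q_abelian_group: "abelian_group Q"
proof (rule abelian_groupI)
 fix p assume "p : carrier Q"
 then obtain c where c: "c : carrier F" "p = cls c" by (auto simp: Q_carrier)
 have m: "- c : carrier F" using c(1) by simp
 then show "EX q:carrier Q. q \<oplus>\<^bsub>Q\<^esub> p = \<zero>\<^bsub>Q\<^esub>"
  using c Q_add[OF m c(1)] by (intro bexI[of _ "cls (- c)"]) (auto simp: Q_zero Q_carrier simp del: F_simps)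
qed (auto simp: Q_carrier Q_zero Q_add F_add F_0 add_ac simp del: F_simps intro!: imageI)

sublocale Q: abelian_group Q by (rule Q_abelian_group)

lemma pure_closed [simp]: "x : carrier M ==> y : carrier N ==> pure x y : carrier Q"
 by (auto simp: pure_def Q_carrier)

lemma relatorD: "r : relators ==> r : H"
 by (simp add: H_generate generate.incl)

lemma pure_add_left:
 assumes "x : carrier M" "x' : carrier M" "y : carrier N"
 shows "pure (x \<oplus>\<^bsub>M\<^esub> x') y = pure x y \<oplus>\<^bsub>Q\<^esub> pure x' y"
proof -
 have "frag_of (x \<oplus>\<^bsub>M\<^esub> x', y) - frag_of (x, y) - frag_of (x', y) : relators"
  unfolding relators_def using assms by blast
 then have "cls (frag_of (x, y) + frag_of (x', y)) = cls (frag_of (x \<oplus>\<^bsub>M\<^esub> x', y))"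
  using assms by (intro cls_eqI relatorD) (auto simp: diff_diff_eq)
 then show ?thesis using assms by (simp add: pure_def Q_add)
qed

lemma pure_add_right:
 assumes "x : carrier M" "y : carrier N" "y' : carrier N"
 shows "pure x (y \<oplus>\<^bsub>N\<^esub> y') = pure x y \<oplus>\<^bsub>Q\<^esub> pure x y'"
proof -
 have "frag_of (x, y \<oplus>\<^bsub>N\<^esub> y') - frag_of (x, y) - frag_of (x, y') : relators"
  unfolding relators_def using assms by blast
 then have "cls (frag_of (x, y) + frag_of (x, y')) = cls (frag_of (x, y \<oplus>\<^bsub>N\<^esub> y'))"
  using assms by (intro cls_eqI relatorD) (auto simp: diff_diff_eq)
 then show ?thesis using assms by (simp add: pure_def Q_add)
qed

lemma pure_balanced:
 assumes "x : carrier M" "s : carrier S" "y : carrier N"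
 shows "pure (rsmult M x s) y = pure x (s \<odot>\<^bsub>N\<^esub> y)"
proof -
 have "frag_of (rsmult M x s, y) - frag_of (x, s \<odot>\<^bsub>N\<^esub> y) : relators"
  unfolding relators_def using assms by blast
 then have "cls (frag_of (x, s \<odot>\<^bsub>N\<^esub> y)) = cls (frag_of (rsmult M x s, y))"
  using assms by (intro cls_eqI relatorD) auto
 then show ?thesis by (simp add: pure_def)
qed

lemma pure_zero_left: "y : carrier N ==> pure \<zero>\<^bsub>M\<^esub> y = \<zero>\<^bsub>Q\<^esub>"
 using pure_add_left[of "\<zero>\<^bsub>M\<^esub>" "\<zero>\<^bsub>M\<^esub>" y] Q.add.r_cancel_one[of "pure \<zero>\<^bsub>M\<^esub> y" "pure \<zero>\<^bsub>M\<^esub> y"] by simp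

lemma tensor_induct [consumes 1, case_names pure add]:
 assumes q: "q : carrier Q"
  and pure: "!!x y. x : carrier M ==> y : carrier N ==> R (pure x y)"
  and add: "!!p q. [|p : carrier Q; q : carrier Q; R p; R q|] ==> R (p \<oplus>\<^bsub>Q\<^esub> q)"
 shows "R q"
proof -
 obtain c where c: "c : carrier F" "q = cls c" using q by (auto simp: Q_carrier)
 have "Poly_Mapping.keys c \<subseteq> carrier M \<times> carrier N" using c(1) by simp
 then have "c : carrier F & R (cls c) & R (cls (- c))"
 proof (induction c rule: frag_induction)
  case zero
  have "R (pure \<zero>\<^bsub>M\<^esub> \<zero>\<^bsub>N\<^esub>)" by (rule pure) auto
  then show ?case by (simp add: pure_zero_left Q_zero)
 next
  case (one p)
  obtain x y where p: "p = (x, y)" "x : carrier M" "y : carrier N" using one by auto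
  have m: "- frag_of p : carrier F" "frag_of p : carrier F" using p by auto
  have "cls (- frag_of p) \<oplus>\<^bsub>Q\<^esub> pure x y = \<zero>\<^bsub>Q\<^esub>"
   using Q_add[OF m] p by (simp add: pure_def Q_zero)
  moreover have "pure (\<ominus>\<^bsub>M\<^esub> x) y \<oplus>\<^bsub>Q\<^esub> pure x y = \<zero>\<^bsub>Q\<^esub>"
   using pure_add_left[of "\<ominus>\<^bsub>M\<^esub> x" x y] p by (simp add: M.l.M.l_neg pure_zero_left)
  moreover have "cls (- frag_of p) : carrier Q" unfolding Q_carrier by (rule imageI[OF m(1)])
  ultimately have "cls (- frag_of p) = pure (\<ominus>\<^bsub>M\<^esub> x) y"
   using p Q.add.r_cancel[of "cls (- frag_of p)" "pure x y" "pure (\<ominus>\<^bsub>M\<^esub> x) y"] by simp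
  then show ?case using pure[of "\<ominus>\<^bsub>M\<^esub> x" y] pure[of x y] p by (simp add: pure_def)
 next
  case (diff a b)
  then have ab: "a : carrier F" "b : carrier F" "- a : carrier F" "- b : carrier F" by auto
  have "cls (a - b) = cls a \<oplus>\<^bsub>Q\<^esub> cls (- b)" "cls (- (a - b)) = cls b \<oplus>\<^bsub>Q\<^esub> cls (- a)"
   using Q_add[OF ab(1,4)] Q_add[OF ab(2,3)] by simp_all
  moreover have "!!c. c : carrier F ==> cls c : carrier Q" unfolding Q_carrier by (rule imageI)
  ultimately show ?case using diff add[of "cls a" "cls (- b)"] add[of "cls b" "cls (- a)"] ab F_diff by presburger
 qed
 then show ?thesis using c by simp
qed

text \<open>Scalars act on classes through the endomorphisms of the free group that preserve the relators.\<close>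

lemma action_cls:
 assumes E: "!!p. p : carrier M \<times> carrier N ==> k p : carrier M \<times> carrier N"
  and rel: "!!r. r : relators ==> frag_extend (%p. frag_of (k p)) r : H" and c: "c : carrier F"
 shows "H <#>\<^bsub>F\<^esub> frag_extend (%p. frag_of (k p)) ` cls c = cls (frag_extend (%p. frag_of (k p)) c)"
  and "frag_extend (%p. frag_of (k p)) c : carrier F"
proof -
 let ?E = "frag_extend (%p. frag_of (k p))"
 have EF: "?E c : carrier F" if "c : carrier F" for c
 proof -
  have "Poly_Mapping.keys c \<subseteq> carrier M \<times> carrier N" using that by simp
  then show ?thesis
  proof (induction c rule: frag_induction)
   case (diff a b)
   then show ?case using F_diff by (simp add: frag_extend_diff del: F_simps)
  qed (use E in auto)
 qed
 then show "?E c : carrier F" using c .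
 have "?E : hom F F" using EF by (intro homI) (auto simp: frag_extend_add simp del: F_simps(1))
 then interpret E: group_hom F F ?E
  using comm_group.axioms(2)[OF F_comm_group] by (simp add: group_hom_def group_hom_axioms_def)
 have "?E ` H = generate F (?E ` relators)"
  unfolding H_generate using E.generate_img[OF relators_closed] by simp
 also have "... \<subseteq> H" using E.generate_subgroup_incl[OF _ H_subgroup, of "?E ` relators"] rel by blast
 finally have EH: "?E h : H" if "h : H" for h using that by blast
 show "H <#>\<^bsub>F\<^esub> ?E ` cls c = cls (?E c)"
 proof (intro equalityI subsetI)
  fix a assume "a : H <#>\<^bsub>F\<^esub> ?E ` cls c"
  then obtain h h' where h: "h : H" "h' : H" "a = h + ?E (h' + c)" by (auto simp: set_mult_def cls_iff)
  then have "a = (h + ?E h') + ?E c" by (simp add: frag_extend_add add.assoc)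
  then show "a : cls (?E c)" using H_add[OF h(1) EH[OF h(2)]] by (auto simp: cls_iff)
 next
  fix a assume "a : cls (?E c)"
  then obtain h where h: "h : H" "a = h + ?E (0 + c)" by (auto simp: cls_iff)
  moreover have "0 + c : cls c" using H_0 unfolding cls_iff by blast
  ultimately show "a : H <#>\<^bsub>F\<^esub> ?E ` cls c" by (auto simp: set_mult_def)
 qed
qed

text \<open>Balanced endomorphisms \<open>a\<close> of \<open>M\<close> and \<open>b\<close> of \<open>N\<close> induce one of the tensor product.\<close>

lemma componentwise_cls:
 assumes a: "!!x. x : carrier M ==> a x : carrier M" "!!x x'. x : carrier M ==> x' : carrier M ==> a (x \<oplus>\<^bsub>M\<^esub> x') = a x \<oplus>\<^bsub>M\<^esub> a x'"
   "!!x s. x : carrier M ==> s : carrier S ==> a (rsmult M x s) = rsmult M (a x) s"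
  and b: "!!y. y : carrier N ==> b y : carrier N" "!!y y'. y : carrier N ==> y' : carrier N ==> b (y \<oplus>\<^bsub>N\<^esub> y') = b y \<oplus>\<^bsub>N\<^esub> b y'"
   "!!y s. y : carrier N ==> s : carrier S ==> b (s \<odot>\<^bsub>N\<^esub> y) = s \<odot>\<^bsub>N\<^esub> b y"
  and c: "c : carrier F"
 shows "H <#>\<^bsub>F\<^esub> frag_extend (%p. frag_of (a (fst p), b (snd p))) ` cls c = cls (frag_extend (%p. frag_of (a (fst p), b (snd p))) c)"
  and "frag_extend (%p. frag_of (a (fst p), b (snd p))) c : carrier F"
proof -
 let ?E = "frag_extend (%p. frag_of (a (fst p), b (snd p)))"
 have rel: "?E r : H" if "r : relators" for r
 proof (rule relatorD)
  show "?E r : relators"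
   using that unfolding relators_def
  proof (elim UnE, goal_cases)
   case 1
   then obtain x x' y where *: "x : carrier M" "x' : carrier M" "y : carrier N"
    "r = frag_of (x \<oplus>\<^bsub>M\<^esub> x', y) - frag_of (x, y) - frag_of (x', y)" by blast
   show ?case
    by (intro UnI1 CollectI exI[of _ "a x"] exI[of _ "a x'"] exI[of _ "b y"]) (simp add: * a b frag_extend_diff)
  next
   case 2
   then obtain x y y' where *: "x : carrier M" "y : carrier N" "y' : carrier N"
    "r = frag_of (x, y \<oplus>\<^bsub>N\<^esub> y') - frag_of (x, y) - frag_of (x, y')" by blast
   show ?case
    by (intro UnI1 UnI2 CollectI exI[of _ "a x"] exI[of _ "b y"] exI[of _ "b y'"]) (simp add: * a b frag_extend_diff)
  next
   case 3
   then obtain x s y where *: "x : carrier M" "s : carrier S" "y : carrier N"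
    "r = frag_of (rsmult M x s, y) - frag_of (x, s \<odot>\<^bsub>N\<^esub> y)" by blast
   show ?case
    by (intro UnI2 CollectI exI[of _ "a x"] exI[of _ s] exI[of _ "b y"]) (simp add: * a b frag_extend_diff)
  qed
 qed
 show "H <#>\<^bsub>F\<^esub> ?E ` cls c = cls (?E c)" "?E c : carrier F"
  using action_cls[of "%p. (a (fst p), b (snd p))", OF _ rel c] a(1) b(1) by auto
qed

lemma smult_cls:
 assumes r: "r : carrier L" and c: "c : carrier F"
 shows "r \<odot>\<^bsub>Q\<^esub> cls c = cls (frag_extend (%p. frag_of (r \<odot>\<^bsub>M\<^esub> fst p, snd p)) c)"
  and "frag_extend (%p. frag_of (r \<odot>\<^bsub>M\<^esub> fst p, snd p)) c : carrier F"
proof -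
 have "r \<odot>\<^bsub>Q\<^esub> cls c = H <#>\<^bsub>F\<^esub> frag_extend (%p. frag_of (r \<odot>\<^bsub>M\<^esub> fst p, snd p)) ` cls c"
  by (simp add: tensor_product_def Let_def case_prod_unfold)
 then show "r \<odot>\<^bsub>Q\<^esub> cls c = cls (frag_extend (%p. frag_of (r \<odot>\<^bsub>M\<^esub> fst p, snd p)) c)"
  "frag_extend (%p. frag_of (r \<odot>\<^bsub>M\<^esub> fst p, snd p)) c : carrier F"
  using componentwise_cls[of "%x. r \<odot>\<^bsub>M\<^esub> x" "%y. y", OF _ _ _ _ _ _ c] r
  by (simp_all add: M.l.smult_r_distr M.rs_ls)
qed

lemma rsmult_cls:
 assumes r: "r : carrier L" and c: "c : carrier F"
 shows "rsmult Q (cls c) r = cls (frag_extend (%p. frag_of (fst p, rsmult N (snd p) r)) c)"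
  and "frag_extend (%p. frag_of (fst p, rsmult N (snd p) r)) c : carrier F"
proof -
 have "rsmult Q (cls c) r = H <#>\<^bsub>F\<^esub> frag_extend (%p. frag_of (fst p, rsmult N (snd p) r)) ` cls c"
  by (simp add: tensor_product_def Let_def case_prod_unfold)
 then show "rsmult Q (cls c) r = cls (frag_extend (%p. frag_of (fst p, rsmult N (snd p) r)) c)"
  "frag_extend (%p. frag_of (fst p, rsmult N (snd p) r)) c : carrier F"
  using componentwise_cls[of "%x. x" "%y. rsmult N y r", OF _ _ _ _ _ _ c] r
  by (simp_all add: N.rs_add N.rs_ls)
qed

lemma smult_pure: "r : carrier L ==> x : carrier M ==> y : carrier N ==> r \<odot>\<^bsub>Q\<^esub> pure x y = pure (r \<odot>\<^bsub>M\<^esub> x) y"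
 by (simp add: pure_def smult_cls(1))

lemma rsmult_pure: "r : carrier L ==> x : carrier M ==> y : carrier N ==> rsmult Q (pure x y) r = pure x (rsmult N y r)"
 by (simp add: pure_def rsmult_cls(1))

lemma smult_Q:
 assumes r: "r : carrier L"
 shows "p : carrier Q ==> r \<odot>\<^bsub>Q\<^esub> p : carrier Q"
  and "p : carrier Q ==> q : carrier Q ==> r \<odot>\<^bsub>Q\<^esub> (p \<oplus>\<^bsub>Q\<^esub> q) = r \<odot>\<^bsub>Q\<^esub> p \<oplus>\<^bsub>Q\<^esub> r \<odot>\<^bsub>Q\<^esub> q"
 using smult_cls[OF r] F_add unfolding Q_carrier by (auto simp: Q_add frag_extend_add simp del: F_simps)

lemma rsmult_Q:
 assumes r: "r : carrier L"
 shows "p : carrier Q ==> rsmult Q p r : carrier Q"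
  and "p : carrier Q ==> q : carrier Q ==> rsmult Q (p \<oplus>\<^bsub>Q\<^esub> q) r = rsmult Q p r \<oplus>\<^bsub>Q\<^esub> rsmult Q q r"
 using rsmult_cls[OF r] F_add unfolding Q_carrier by (auto simp: Q_add frag_extend_add simp del: F_simps)

text \<open>The additive extension of a balanced map to the free group kills the relators.\<close>

lemma tensor_universal:
 fixes G :: "('g, 'x) ring_scheme"
 assumes "abelian_group G"
  and B: "!!x y. [|x : carrier M; y : carrier N|] ==> B x y : carrier G"
  and B_left: "!!x x' y. [|x : carrier M; x' : carrier M; y : carrier N|] ==> B (x \<oplus>\<^bsub>M\<^esub> x') y = B x y \<oplus>\<^bsub>G\<^esub> B x' y"
  and B_right: "!!x y y'. [|x : carrier M; y : carrier N; y' : carrier N|] ==> B x (y \<oplus>\<^bsub>N\<^esub> y') = B x y \<oplus>\<^bsub>G\<^esub> B x y'"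
  and B_balanced: "!!x s y. [|x : carrier M; s : carrier S; y : carrier N|] ==> B (rsmult M x s) y = B x (s \<odot>\<^bsub>N\<^esub> y)"
 shows "EX h. (ALL q:carrier Q. h q : carrier G) & (ALL p:carrier Q. ALL q:carrier Q. h (p \<oplus>\<^bsub>Q\<^esub> q) = h p \<oplus>\<^bsub>G\<^esub> h q) &
  (ALL x:carrier M. ALL y:carrier N. h (pure x y) = B x y)"
proof -
 interpret G: abelian_group G by fact
 obtain g where g: "g : hom (free_Abelian_group (carrier M \<times> carrier N)) (add_monoid G)"
  "!!p. p : carrier M \<times> carrier N ==> g (frag_of p) = case_prod B p"
 proof (rule comm_group.free_Abelian_group_universal[OF G.a_comm_group, of "case_prod B" "carrier M \<times> carrier N"])
  show "case_prod B ` (carrier M \<times> carrier N) \<subseteq> carrier (add_monoid G)" using B by auto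
 qed blast
 interpret g: group_hom F "add_monoid G" g
  using g(1) comm_group.axioms(2)[OF F_comm_group] G.a_group
  by (simp add: group_hom_def group_hom_axioms_def tensor_free_def)
 have gC: "g c : carrier G" if "c : carrier F" for c using g.hom_closed[OF that] by simp
 have gadd: "g (c + c') = g c \<oplus>\<^bsub>G\<^esub> g c'" if "c : carrier F" "c' : carrier F" for c c'
  using g.hom_mult[OF that] by simp
 have gdiff: "g (c - c') = g c \<ominus>\<^bsub>G\<^esub> g c'" if c: "c : carrier F" "c' : carrier F" for c c'
  using gadd[OF F_diff[OF c] c(2)] gC[OF c(1)] gC[OF c(2)] gC[OF F_diff[OF c]]
  by (simp add: a_minus_def G.a_assoc G.r_neg)
 have gof: "g (frag_of (x, y)) = B x y" if "x : carrier M" "y : carrier N" for x y using g(2)[of "(x, y)"] that by simp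
 have "relators \<subseteq> kernel F (add_monoid G) g"
 proof
  fix r assume r: "r : relators"
  have cancel: "(a \<oplus>\<^bsub>G\<^esub> b) \<ominus>\<^bsub>G\<^esub> a \<ominus>\<^bsub>G\<^esub> b = \<zero>\<^bsub>G\<^esub>" if "a : carrier G" "b : carrier G" for a b
  proof -
   have "(a \<oplus>\<^bsub>G\<^esub> b) \<ominus>\<^bsub>G\<^esub> a \<ominus>\<^bsub>G\<^esub> b = (a \<oplus>\<^bsub>G\<^esub> b) \<oplus>\<^bsub>G\<^esub> (\<ominus>\<^bsub>G\<^esub> a \<oplus>\<^bsub>G\<^esub> \<ominus>\<^bsub>G\<^esub> b)"
    using that by (simp add: a_minus_def G.a_assoc)
   also have "... = \<zero>\<^bsub>G\<^esub>"
    unfolding G.minus_add[OF that, symmetric] using that by (intro G.r_neg) simp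
   finally show ?thesis .
  qed
  have "g r = \<zero>\<^bsub>G\<^esub>"
   using r unfolding relators_def
  proof (elim UnE, goal_cases)
   case 1
   then obtain x x' y where *: "x : carrier M" "x' : carrier M" "y : carrier N"
    "r = frag_of (x \<oplus>\<^bsub>M\<^esub> x', y) - frag_of (x, y) - frag_of (x', y)" by blast
   then show ?case using cancel B B_left by (simp add: gdiff F_diff F_of gof del: F_simps)
  next
   case 2
   then obtain x y y' where *: "x : carrier M" "y : carrier N" "y' : carrier N"
    "r = frag_of (x, y \<oplus>\<^bsub>N\<^esub> y') - frag_of (x, y) - frag_of (x, y')" by blast
   then show ?case using cancel B B_right by (simp add: gdiff F_diff F_of gof del: F_simps)
  next
   case 3
   then obtain x s y where *: "x : carrier M" "s : carrier S" "y : carrier N"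
    "r = frag_of (rsmult M x s, y) - frag_of (x, s \<odot>\<^bsub>N\<^esub> y)" by blast
   then show ?case using B[of x "s \<odot>\<^bsub>N\<^esub> y"] B_balanced by (simp add: gdiff F_of gof a_minus_def G.r_neg del: F_simps)
  qed
  then show "r : kernel F (add_monoid G) g" using r relators_closed by (auto simp: kernel_def simp del: F_simps)
 qed
 then have "H \<subseteq> kernel F (add_monoid G) g"
  unfolding H_generate using g.generate_subgroup_incl g.subgroup_kernel by blast
 then obtain h where h: "h : hom (F Mod H) (add_monoid G)" "!!c. c : carrier F ==> h (H #>\<^bsub>F\<^esub> c) = g c"
  using g.FactGroup_universal_kernel[OF H_normal] by blast
 have hc: "h (cls c) = g c" if "c : carrier F" for c using h(2)[OF that] by (simp add: cls_def)
 show ?thesis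
 proof (rule exI[of _ h], intro conjI ballI)
  show "h q : carrier G" if "q : carrier Q" for q using that gC by (auto simp: Q_carrier hc simp del: F_simps)
  show "h (p \<oplus>\<^bsub>Q\<^esub> q) = h p \<oplus>\<^bsub>G\<^esub> h q" if "p : carrier Q" "q : carrier Q" for p q
   using that by (auto simp: Q_carrier Q_add F_add hc gadd simp del: F_simps)
  show "h (pure x y) = B x y" if "x : carrier M" "y : carrier N" for x y
   using that by (simp add: pure_def hc gof)
 qed
qed

end

section \<open>Isomorphisms of bimodules\<close>

lemma additive_finsum:
 assumes A: "abelian_group A" and B: "abelian_group B"
  and F: "!!x. x : carrier A ==> F x : carrier B"
   "!!x y. x : carrier A ==> y : carrier A ==> F (x \<oplus>\<^bsub>A\<^esub> y) = F x \<oplus>\<^bsub>B\<^esub> F y"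
  and I: "finite I" and y: "!!s. s : I ==> y s : carrier A"
 shows "F (finsum A y I) = (\<Oplus>\<^bsub>B\<^esub>s\<in>I. F (y s))"
 using I y
proof (induction I rule: finite_induct)
 case empty
 interpret A: abelian_group A by (rule A)
 interpret B: abelian_group B by (rule B)
 show ?case using F(2)[of "\<zero>\<^bsub>A\<^esub>" "\<zero>\<^bsub>A\<^esub>"] F(1)[of "\<zero>\<^bsub>A\<^esub>"] B.add.r_cancel_one[of "F \<zero>\<^bsub>A\<^esub>" "F \<zero>\<^bsub>A\<^esub>"] by simp
next
 case (insert s I)
 interpret A: abelian_group A by (rule A)
 interpret B: abelian_group B by (rule B)
 have "finsum A y (insert s I) = y s \<oplus>\<^bsub>A\<^esub> finsum A y I" using insert by (intro A.finsum_insert) auto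
 moreover have "(\<Oplus>\<^bsub>B\<^esub>s\<in>insert s I. F (y s)) = F (y s) \<oplus>\<^bsub>B\<^esub> (\<Oplus>\<^bsub>B\<^esub>s\<in>I. F (y s))"
  using insert F(1) by (intro B.finsum_insert) auto
 ultimately show ?case using insert F(2) by (simp add: A.finsum_closed Pi_def)
qed

text \<open>It suffices to check linearity on the inverse.\<close>

lemma bimodule_isomorphicI:
 assumes f: "!!x. x : carrier M ==> f x : carrier N" and g: "!!y. y : carrier N ==> g y : carrier M"
  and gf: "!!x. x : carrier M ==> g (f x) = x" and fg: "!!y. y : carrier N ==> f (g y) = y"
  and N_add: "!!y y'. y : carrier N ==> y' : carrier N ==> y \<oplus>\<^bsub>N\<^esub> y' : carrier N & g (y \<oplus>\<^bsub>N\<^esub> y') = g y \<oplus>\<^bsub>M\<^esub> g y'"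
  and N_smult: "!!r y. r : carrier R ==> y : carrier N ==> r \<odot>\<^bsub>N\<^esub> y : carrier N & g (r \<odot>\<^bsub>N\<^esub> y) = r \<odot>\<^bsub>M\<^esub> g y"
  and N_rsmult: "!!s y. s : carrier S ==> y : carrier N ==> rsmult N y s : carrier N & g (rsmult N y s) = rsmult M (g y) s"
 shows "bimodule_isomorphic R S M N"
proof -
 have "f : iso (add_monoid M) (add_monoid N)"
 proof (rule isoI)
  show "f : hom (add_monoid M) (add_monoid N)"
  proof (rule homI)
   fix x x' assume "x : carrier (add_monoid M)" "x' : carrier (add_monoid M)"
   then have x: "x : carrier M" "x' : carrier M" by auto
   have "f (x \<oplus>\<^bsub>M\<^esub> x') = f (g (f x \<oplus>\<^bsub>N\<^esub> f x'))" using x f gf N_add by simp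
   also have "... = f x \<oplus>\<^bsub>N\<^esub> f x'" using x f N_add by (intro fg) simp
   finally show "f (x \<otimes>\<^bsub>add_monoid M\<^esub> x') = f x \<otimes>\<^bsub>add_monoid N\<^esub> f x'" by simp
  qed (use f in simp)
  show "bij_betw f (carrier (add_monoid M)) (carrier (add_monoid N))"
   by (rule bij_betw_byWitness[of _ g]) (use f g gf fg in auto)
 qed
 moreover have "f (r \<odot>\<^bsub>M\<^esub> x) = r \<odot>\<^bsub>N\<^esub> f x" if "r : carrier R" "x : carrier M" for r x
  using fg[of "r \<odot>\<^bsub>N\<^esub> f x"] N_smult[OF that(1) f[OF that(2)]] gf[OF that(2)] by simp
 moreover have "f (rsmult M x s) = rsmult N (f x) s" if "s : carrier S" "x : carrier M" for s x
  using fg[of "rsmult N (f x) s"] N_rsmult[OF that(1) f[OF that(2)]] gf[OF that(2)] by simp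
 ultimately show ?thesis unfolding bimodule_isomorphic_def by blast
qed

lemma bimodule_sum_simps [simp]:
 "carrier (bimodule_sum I M) = (\<Pi>\<^sub>E i\<in>I. carrier (M i))"
 "\<zero>\<^bsub>bimodule_sum I M\<^esub> = (\<lambda>i\<in>I. \<zero>\<^bsub>M i\<^esub>)"
 "x \<oplus>\<^bsub>bimodule_sum I M\<^esub> y = (\<lambda>i\<in>I. x i \<oplus>\<^bsub>M i\<^esub> y i)"
 "r \<odot>\<^bsub>bimodule_sum I M\<^esub> x = (\<lambda>i\<in>I. r \<odot>\<^bsub>M i\<^esub> x i)"
 "rsmult (bimodule_sum I M) x s = (\<lambda>i\<in>I. rsmult (M i) (x i) s)"
 by (simp_all add: bimodule_sum_def)

lemma bimodule_isomorphic_sum_power: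
 fixes Q :: "'k => ('r, 's, 'm) bimodule"
 assumes "bimodule_isomorphic R S P (bimodule_sum (SIGMA k:K. {..<m k}) (%(k, a). Q k))"
 shows "bimodule_isomorphic R S P (bimodule_sum K (%k. bimodule_power (Q k) (m k)))"
proof -
 let ?A = "bimodule_sum (SIGMA k:K. {..<m k}) (%(k, a). Q k)"
 let ?B = "bimodule_sum K (%k. bimodule_power (Q k) (m k))"
 obtain f where f: "f : iso (add_monoid P) (add_monoid ?A)"
  "ALL r:carrier R. ALL x:carrier P. f (r \<odot>\<^bsub>P\<^esub> x) = r \<odot>\<^bsub>?A\<^esub> f x"
  "ALL s:carrier S. ALL x:carrier P. f (rsmult P x s) = rsmult ?A (f x) s"
  using assms by (auto simp: bimodule_isomorphic_def)
 define h where "h t = (\<lambda>k\<in>K. \<lambda>a\<in>{..<m k}. t (k, a))" for t :: "'k \<times> nat => 'm"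
 have fC: "f x : carrier ?A" if "x : carrier P" for x
  using f(1) that by (auto simp: iso_def hom_def Pi_def simp del: bimodule_sum_simps)
 have "h : iso (add_monoid ?A) (add_monoid ?B)"
 proof (rule isoI)
  show "h : hom (add_monoid ?A) (add_monoid ?B)"
   by (rule homI) (auto simp: h_def bimodule_power_def restrict_def PiE_iff extensional_def fun_eq_iff)
  show "bij_betw h (carrier (add_monoid ?A)) (carrier (add_monoid ?B))"
   by (rule bij_betw_byWitness[of _ "%u. \<lambda>(k, a)\<in>(SIGMA k:K. {..<m k}). u k a"])
    (auto simp: h_def bimodule_power_def restrict_def PiE_iff extensional_def fun_eq_iff split: if_splits)
 qed
 then have "h \<circ> f : iso (add_monoid P) (add_monoid ?B)" using f(1) by (rule iso_set_trans[rotated])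
 moreover have "(h \<circ> f) (r \<odot>\<^bsub>P\<^esub> x) = r \<odot>\<^bsub>?B\<^esub> (h \<circ> f) x" if "r : carrier R" "x : carrier P" for r x
  using f(2) that by (auto simp: h_def bimodule_power_def restrict_def fun_eq_iff)
 moreover have "(h \<circ> f) (rsmult P x s) = rsmult ?B ((h \<circ> f) x) s" if "s : carrier S" "x : carrier P" for s x
  using f(3) that by (auto simp: h_def bimodule_power_def restrict_def fun_eq_iff)
 ultimately show ?thesis unfolding bimodule_isomorphic_def by blast
qed

text \<open>
 The map from the sum of tensor products to \<open>P\<close> induced by the \<open>mu k\<close> is inverse to the map with
 components \<open>y \<mapsto> \<Sum> c(y) \<otimes> b\<close>.
\<close>

lemma (in comm_bimodule) tensor_decomposition:
 fixes M :: "'k => ('a, 'a, 'm) bimodule" and N :: "'k => ('a, 'a, 'n) bimodule" and I :: "'k => 'i set"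
 assumes K: "finite K" and setting: "!!k. k : K ==> tensor_setting L (M k) (N k) S"
  and mu: "!!k x y. [|k : K; x : carrier (M k); y : carrier (N k)|] ==> mu k x y : carrier P"
  and mu_left: "!!k x x' y. [|k : K; x : carrier (M k); x' : carrier (M k); y : carrier (N k)|] ==>
   mu k (x \<oplus>\<^bsub>M k\<^esub> x') y = mu k x y \<oplus>\<^bsub>P\<^esub> mu k x' y"
  and mu_right: "!!k x y y'. [|k : K; x : carrier (M k); y : carrier (N k); y' : carrier (N k)|] ==>
   mu k x (y \<oplus>\<^bsub>N k\<^esub> y') = mu k x y \<oplus>\<^bsub>P\<^esub> mu k x y'"
  and mu_balanced: "!!k x s y. [|k : K; x : carrier (M k); s : carrier S; y : carrier (N k)|] ==>
   mu k (rsmult (M k) x s) y = mu k x (s \<odot>\<^bsub>N k\<^esub> y)"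
  and mu_smult: "!!k x l y. [|k : K; x : carrier (M k); l : carrier L; y : carrier (N k)|] ==>
   mu k (l \<odot>\<^bsub>M k\<^esub> x) y = l \<odot>\<^bsub>P\<^esub> mu k x y"
  and mu_rsmult: "!!k x l y. [|k : K; x : carrier (M k); l : carrier L; y : carrier (N k)|] ==>
   mu k x (rsmult (N k) y l) = mu k x y \<star> l"
  and I: "!!k. k : K ==> finite (I k)"
  and b: "!!k s. [|k : K; s : I k|] ==> b k s : carrier (N k)"
  and c: "!!k s y. [|k : K; s : I k; y : carrier P|] ==> c k s y : carrier (M k)"
  and c_add: "!!k s y y'. [|k : K; s : I k; y : carrier P; y' : carrier P|] ==>
   c k s (y \<oplus>\<^bsub>P\<^esub> y') = c k s y \<oplus>\<^bsub>M k\<^esub> c k s y'"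
  and expand: "!!y. y : carrier P ==> (\<Oplus>\<^bsub>P\<^esub>k\<in>K. \<Oplus>\<^bsub>P\<^esub>s\<in>I k. mu k (c k s y) (b k s)) = y"
  and dual: "!!k k' x y. [|k : K; k' : K; x : carrier (M k'); y : carrier (N k')|] ==>
   (\<Oplus>\<^bsub>tensor_product S (M k) (N k)\<^esub>s\<in>I k. tensor_setting.pure (M k) (N k) S (c k s (mu k' x y)) (b k s)) =
   (if k = k' then tensor_setting.pure (M k) (N k) S x y else \<zero>\<^bsub>tensor_product S (M k) (N k)\<^esub>)"
 shows "bimodule_isomorphic L L P (bimodule_sum K (%k. tensor_product S (M k) (N k)))"
proof -
 let ?Q = "%k. tensor_product S (M k) (N k)"
 let ?p = "%k. tensor_setting.pure (M k) (N k) S"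
 note tensor = tensor_setting.tensor_universal[OF setting l.M.abelian_group_axioms mu mu_left mu_right mu_balanced]
 have "ALL k:K. EX h. (ALL q:carrier (?Q k). h q : carrier P) &
   (ALL p:carrier (?Q k). ALL q:carrier (?Q k). h (p \<oplus>\<^bsub>?Q k\<^esub> q) = h p \<oplus>\<^bsub>P\<^esub> h q) &
   (ALL x:carrier (M k). ALL y:carrier (N k). h (?p k x y) = mu k x y)"
  using tensor by simp
 then obtain h where h: "ALL k:K. (ALL q:carrier (?Q k). h k q : carrier P) &
   (ALL p:carrier (?Q k). ALL q:carrier (?Q k). h k (p \<oplus>\<^bsub>?Q k\<^esub> q) = h k p \<oplus>\<^bsub>P\<^esub> h k q) &
   (ALL x:carrier (M k). ALL y:carrier (N k). h k (?p k x y) = mu k x y)"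
  unfolding bchoice_iff by blast
 have hC: "h k q : carrier P" if "k : K" "q : carrier (?Q k)" for k q using h that by blast
 have hadd: "h k (p \<oplus>\<^bsub>?Q k\<^esub> q) = h k p \<oplus>\<^bsub>P\<^esub> h k q" if "k : K" "p : carrier (?Q k)" "q : carrier (?Q k)" for k p q
  using h that by blast
 have hp: "h k (?p k x y) = mu k x y" if "k : K" "x : carrier (M k)" "y : carrier (N k)" for k x y using h that by blast
 have hl: "h k (l \<odot>\<^bsub>?Q k\<^esub> q) = l \<odot>\<^bsub>P\<^esub> h k q" and hr: "h k (rsmult (?Q k) q l) = h k q \<star> l"
  if k: "k : K" and q: "q : carrier (?Q k)" and l: "l : carrier L" for k q l
 proof -
  interpret t: tensor_setting L "M k" "N k" S by (rule setting[OF k])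
  show "h k (l \<odot>\<^bsub>?Q k\<^esub> q) = l \<odot>\<^bsub>P\<^esub> h k q" using q
  proof (induction q rule: t.tensor_induct)
   case (pure x y)
   then show ?case using k l by (simp add: t.smult_pure hp mu_smult)
  next
   case (add p q)
   then show ?case using k l by (simp add: t.smult_Q hadd hC l.smult_r_distr)
  qed
  show "h k (rsmult (?Q k) q l) = h k q \<star> l" using q
  proof (induction q rule: t.tensor_induct)
   case (pure x y)
   then show ?case using k l by (simp add: t.rsmult_pure hp mu_rsmult)
  next
   case (add p q)
   then show ?case using k l by (simp add: t.rsmult_Q hadd hC rs_add)
  qed
 qed
 define F where "F k y = (\<Oplus>\<^bsub>?Q k\<^esub>s\<in>I k. ?p k (c k s y) (b k s))" for k y
 have F: "F k y : carrier (?Q k)" "h k (F k y) = (\<Oplus>\<^bsub>P\<^esub>s\<in>I k. mu k (c k s y) (b k s))"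
  if k: "k : K" and y: "y : carrier P" for k y
 proof -
  interpret t: tensor_setting L "M k" "N k" S by (rule setting[OF k])
  show "F k y : carrier (?Q k)" unfolding F_def using k y b c by (intro t.Q.finsum_closed) auto
  have "h k (F k y) = (\<Oplus>\<^bsub>P\<^esub>s\<in>I k. h k (?p k (c k s y) (b k s)))"
   unfolding F_def using k y b c I hC hadd
   by (intro additive_finsum[OF t.Q_abelian_group l.M.abelian_group_axioms]) auto
  also have "... = (\<Oplus>\<^bsub>P\<^esub>s\<in>I k. mu k (c k s y) (b k s))"
   using k y b c hp mu by (intro l.M.finsum_cong') auto
  finally show "h k (F k y) = (\<Oplus>\<^bsub>P\<^esub>s\<in>I k. mu k (c k s y) (b k s))" .
 qed
 have Fadd: "F k (y \<oplus>\<^bsub>P\<^esub> y') = F k y \<oplus>\<^bsub>?Q k\<^esub> F k y'" if k: "k : K" and y: "y : carrier P" "y' : carrier P" for k y y'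
 proof -
  interpret t: tensor_setting L "M k" "N k" S by (rule setting[OF k])
  have "(\<Oplus>\<^bsub>?Q k\<^esub>s\<in>I k. ?p k (c k s (y \<oplus>\<^bsub>P\<^esub> y')) (b k s)) = (\<Oplus>\<^bsub>?Q k\<^esub>s\<in>I k. ?p k (c k s y) (b k s) \<oplus>\<^bsub>?Q k\<^esub> ?p k (c k s y') (b k s))"
   using k y b c by (intro t.Q.finsum_cong') (auto simp: c_add t.pure_add_left)
  also have "... = F k y \<oplus>\<^bsub>?Q k\<^esub> F k y'"
   unfolding F_def using k y b c by (intro t.Q.finsum_addf) auto
  finally show ?thesis by (simp add: F_def)
 qed
 have Fh: "F k (h k' q) = (if k = k' then q else \<zero>\<^bsub>?Q k\<^esub>)" if k: "k : K" and k': "k' : K" and q: "q : carrier (?Q k')" for k k' q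
 proof -
  interpret t: tensor_setting L "M k" "N k" S by (rule setting[OF k])
  interpret t': tensor_setting L "M k'" "N k'" S by (rule setting[OF k'])
  show ?thesis using q
  proof (induction q rule: t'.tensor_induct)
   case (pure x y)
   then show ?case using dual[OF k k' pure] hp[OF k' pure] by (simp add: F_def)
  next
   case (add p q)
   then show ?case using k k' hC by (simp add: hadd Fadd)
  qed
 qed
 define g where "g t = (\<Oplus>\<^bsub>P\<^esub>k\<in>K. h k (t k))" for t
 have QQ: "t k \<oplus>\<^bsub>?Q k\<^esub> t' k : carrier (?Q k)" "l \<odot>\<^bsub>?Q k\<^esub> t k : carrier (?Q k)" "rsmult (?Q k) (t k) l : carrier (?Q k)"
  if "k : K" "t k : carrier (?Q k)" "t' k : carrier (?Q k)" "l : carrier L" for k t t' l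
 proof -
  interpret t: tensor_setting L "M k" "N k" S by (rule setting[OF that(1)])
  show "t k \<oplus>\<^bsub>?Q k\<^esub> t' k : carrier (?Q k)" "l \<odot>\<^bsub>?Q k\<^esub> t k : carrier (?Q k)" "rsmult (?Q k) (t k) l : carrier (?Q k)"
   using that by (auto intro: t.smult_Q t.rsmult_Q)
 qed
 show ?thesis
 proof (rule bimodule_isomorphicI[where f = "%y. \<lambda>k\<in>K. F k y" and g = g])
  fix y assume y: "y : carrier P"
  show "(\<lambda>k\<in>K. F k y) : carrier (bimodule_sum K ?Q)" using F y by auto
  have "g (\<lambda>k\<in>K. F k y) = (\<Oplus>\<^bsub>P\<^esub>k\<in>K. \<Oplus>\<^bsub>P\<^esub>s\<in>I k. mu k (c k s y) (b k s))"
   unfolding g_def using F y hC b c mu by (intro l.M.finsum_cong') (auto intro!: l.M.finsum_closed)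
  then show "g (\<lambda>k\<in>K. F k y) = y" using expand[OF y] by simp
 next
  fix t assume "t : carrier (bimodule_sum K ?Q)"
  then have t: "!!k. k : K ==> t k : carrier (?Q k)" "t : extensional K" by (auto simp: PiE_iff)
  show "g t : carrier P" unfolding g_def using t hC by (intro l.M.finsum_closed) auto
  show "(\<lambda>k\<in>K. F k (g t)) = t"
  proof (rule extensionalityI[OF _ t(2)])
   fix k assume k: "k : K"
   interpret t: tensor_setting L "M k" "N k" S by (rule setting[OF k])
   have "F k (g t) = (\<Oplus>\<^bsub>?Q k\<^esub>k'\<in>K. F k (h k' (t k')))"
    unfolding g_def using k K F t hC Fadd
    by (intro additive_finsum[OF l.M.abelian_group_axioms t.Q_abelian_group]) auto
   also have "... = F k (h k (t k))"
    using k K Fh t by (intro t.Q.finsum_delta) auto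
   also have "... = t k" using Fh[OF k k] t k by simp
   finally show "(\<lambda>k\<in>K. F k (g t)) k = t k" using k by simp
  qed simp
  show "r \<odot>\<^bsub>bimodule_sum K ?Q\<^esub> t : carrier (bimodule_sum K ?Q) & g (r \<odot>\<^bsub>bimodule_sum K ?Q\<^esub> t) = r \<odot>\<^bsub>P\<^esub> g t"
   if r: "r : carrier L" for r
  proof -
   have "g (\<lambda>k\<in>K. r \<odot>\<^bsub>?Q k\<^esub> t k) = (\<Oplus>\<^bsub>P\<^esub>k\<in>K. r \<odot>\<^bsub>P\<^esub> h k (t k))"
    unfolding g_def using t r hC hl by (intro l.M.finsum_cong') auto
   also have "... = r \<odot>\<^bsub>P\<^esub> g t" unfolding g_def using t r hC K by (intro l.finsum_smult_ldistr[symmetric]) auto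
   finally show ?thesis using QQ(2)[of _ t t] t r by simp
  qed
  show "rsmult (bimodule_sum K ?Q) t r : carrier (bimodule_sum K ?Q) & g (rsmult (bimodule_sum K ?Q) t r) = g t \<star> r"
   if r: "r : carrier L" for r
  proof -
   have "g (\<lambda>k\<in>K. rsmult (?Q k) (t k) r) = (\<Oplus>\<^bsub>P\<^esub>k\<in>K. h k (t k) \<star> r)"
    unfolding g_def using t r hC hr by (intro l.M.finsum_cong') auto
   also have "... = g t \<star> r" unfolding g_def using t r hC K by (subst rs_finsum) auto
   finally show ?thesis using QQ(3)[of _ t t] t r by simp
  qed
  fix t' assume "t' : carrier (bimodule_sum K ?Q)"
  then have t': "!!k. k : K ==> t' k : carrier (?Q k)" by (auto simp: PiE_iff)
  have "g (\<lambda>k\<in>K. t k \<oplus>\<^bsub>?Q k\<^esub> t' k) = (\<Oplus>\<^bsub>P\<^esub>k\<in>K. h k (t k) \<oplus>\<^bsub>P\<^esub> h k (t' k))"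
   unfolding g_def using t t' hC hadd by (intro l.M.finsum_cong') auto
  also have "... = g t \<oplus>\<^bsub>P\<^esub> g t'" unfolding g_def using t t' hC by (intro l.M.finsum_addf) auto
  finally show "t \<oplus>\<^bsub>bimodule_sum K ?Q\<^esub> t' : carrier (bimodule_sum K ?Q) & g (t \<oplus>\<^bsub>bimodule_sum K ?Q\<^esub> t') = g t \<oplus>\<^bsub>P\<^esub> g t'"
   using QQ(1)[of _ t t', OF _ _ _ l.R.zero_closed] t t' by simp
 qed
qed

section \<open>Bases and components from isomorphisms\<close>

text \<open>
 An isomorphism with a sum of quotient rings \<open>B\<close> of \<open>L\<close>, each split by a section \<open>epsilon\<close>, exhibits a
 projective basis.
\<close>

lemma projective_basis_of_isomorphism:
 fixes M :: "('a, 'm, 'x) module_scheme" and B :: "'i => ('b, 'c) ring_scheme"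
 assumes "module L M" and I: "finite I"
  and iso: "module_isomorphic L M (bimodule_sum I (%r. bimodule_via (\<pi> r) (B r)))"
  and B: "!!r. r : I ==> ring (B r)" and \<pi>: "!!r l. r : I ==> l : carrier L ==> \<pi> r l : carrier (B r)"
  and epsilon: "!!r b. r : I ==> b : carrier (B r) ==> epsilon r b : carrier L & \<pi> r (epsilon r b) = b"
  and epsilon_add: "!!r b b'. r : I ==> b : carrier (B r) ==> b' : carrier (B r) ==> epsilon r (b \<oplus>\<^bsub>B r\<^esub> b') = epsilon r b \<oplus>\<^bsub>L\<^esub> epsilon r b'"
  and epsilon_mult: "!!r l b. r : I ==> l : carrier L ==> b : carrier (B r) ==> epsilon r (\<pi> r l \<otimes>\<^bsub>B r\<^esub> b) = l \<otimes>\<^bsub>L\<^esub> epsilon r b"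
 shows "EX v v'. (ALL r:I. v r : carrier M & v' r : duals L M) &
  (ALL y:carrier M. y = (\<Oplus>\<^bsub>M\<^esub>r\<in>I. v' r y \<odot>\<^bsub>M\<^esub> v r)) &
  (ALL r:I. ALL s:I. v' r (v s) = (if r = s then epsilon r \<one>\<^bsub>B r\<^esub> else \<zero>\<^bsub>L\<^esub>))"
proof -
 interpret module L M by fact
 let ?S = "bimodule_sum I (%r. bimodule_via (\<pi> r) (B r))"
 obtain f where f: "f : iso (add_monoid M) (add_monoid ?S)"
  and f_smult: "ALL l:carrier L. ALL x:carrier M. f (l \<odot>\<^bsub>M\<^esub> x) = l \<odot>\<^bsub>?S\<^esub> f x"
  using iso by (auto simp: module_isomorphic_def)
 have bij: "bij_betw f (carrier M) (\<Pi>\<^sub>E r\<in>I. carrier (B r))"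
  using f by (simp add: iso_def bimodule_via_def)
 have fC: "f x r : carrier (B r)" if "x : carrier M" "r : I" for x r
  using bij_betwE[OF bij] that by (auto simp: PiE_iff)
 have fadd: "f (x \<oplus>\<^bsub>M\<^esub> y) r = f x r \<oplus>\<^bsub>B r\<^esub> f y r" if "x : carrier M" "y : carrier M" "r : I" for x y r
  using f that by (simp add: iso_def hom_def bimodule_via_def)
 have fsm: "f (l \<odot>\<^bsub>M\<^esub> x) r = \<pi> r l \<otimes>\<^bsub>B r\<^esub> f x r" if "l : carrier L" "x : carrier M" "r : I" for l x r
  using f_smult that by (simp add: bimodule_via_def)
 define u where "u r = (\<lambda>s\<in>I. if s = r then \<one>\<^bsub>B s\<^esub> else \<zero>\<^bsub>B s\<^esub>)" for r
 define v where "v r = inv_into (carrier M) f (u r)" for r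
 define v' where "v' r y = epsilon r (f y r)" for r y
 have uC: "u r : (\<Pi>\<^sub>E r\<in>I. carrier (B r))" for r
  using B by (auto simp: u_def ring.ring_simprules(2,6))
 have v: "v r : carrier M" "f (v r) = u r" for r
  using bij uC[of r] by (auto simp: v_def bij_betw_def inv_into_into f_inv_into_f)
 have v'C: "v' r y : carrier L" if "r : I" "y : carrier M" for r y using epsilon fC that by (simp add: v'_def)
 have v'f: "v' r : duals L M" if "r : I" for r
  unfolding duals_def v'_def using that epsilon epsilon_add epsilon_mult fC fadd fsm by auto
 have exp: "y = (\<Oplus>\<^bsub>M\<^esub>r\<in>I. v' r y \<odot>\<^bsub>M\<^esub> v r)" if y: "y : carrier M" for y
 proof (rule inj_onD[OF bij_betw_imp_inj_on[OF bij] _ y])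
  have sC: "(\<Oplus>\<^bsub>M\<^esub>r\<in>I. v' r y \<odot>\<^bsub>M\<^esub> v r) : carrier M" using v'C y v by (intro finsum_closed) auto
  then show "(\<Oplus>\<^bsub>M\<^esub>r\<in>I. v' r y \<odot>\<^bsub>M\<^esub> v r) : carrier M" .
  show "f y = f (\<Oplus>\<^bsub>M\<^esub>r\<in>I. v' r y \<odot>\<^bsub>M\<^esub> v r)"
  proof (rule PiE_ext[OF bij_betwE[OF bij, THEN bspec, OF y] bij_betwE[OF bij, THEN bspec, OF sC]])
   fix s assume s: "s : I"
   interpret B: ring "B s" by (rule B[OF s])
   have "f (\<Oplus>\<^bsub>M\<^esub>r\<in>I. v' r y \<odot>\<^bsub>M\<^esub> v r) s = (\<Oplus>\<^bsub>B s\<^esub>r\<in>I. f (v' r y \<odot>\<^bsub>M\<^esub> v r) s)"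
    using s I v v'C y fC fadd
    by (intro additive_finsum[of M "B s" "%x. f x s"] M.abelian_group_axioms B.abelian_group_axioms) auto
   also have "... = f (v' s y \<odot>\<^bsub>M\<^esub> v s) s"
   proof (intro B.finsum_delta I s)
    show "f (v' r y \<odot>\<^bsub>M\<^esub> v r) s : carrier (B s)" if "r : I" for r using that v v'C y s fC by simp
    show "f (v' r y \<odot>\<^bsub>M\<^esub> v r) s = \<zero>\<^bsub>B s\<^esub>" if "r : I" "r ~= s" for r
     using that v v'C y s fsm \<pi> by (simp add: u_def)
   qed
   also have "... = f y s" using s v v'C y fsm epsilon[OF s fC[OF y s]] fC by (simp add: u_def v'_def)
   finally show "f y s = f (\<Oplus>\<^bsub>M\<^esub>r\<in>I. v' r y \<odot>\<^bsub>M\<^esub> v r) s" by simp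
  qed
 qed
 have epsilon0: "epsilon r \<zero>\<^bsub>B r\<^esub> = \<zero>\<^bsub>L\<^esub>" if r: "r : I" for r
 proof -
  interpret B: ring "B r" by (rule B[OF r])
  show ?thesis using epsilon_mult[OF r R.zero_closed, of "\<zero>\<^bsub>B r\<^esub>"] epsilon[OF r, of "\<zero>\<^bsub>B r\<^esub>"] \<pi>[OF r, of "\<zero>\<^bsub>L\<^esub>"] by simp
 qed
 have "v' r (v s) = (if r = s then epsilon r \<one>\<^bsub>B r\<^esub> else \<zero>\<^bsub>L\<^esub>)" if "r : I" "s : I" for r s
  using that epsilon0 v(2)[of s] by (simp add: v'_def u_def)
 then show ?thesis using v v'f exp by (intro exI[of _ v] exI[of _ v']) auto
qed

text \<open>
 The isomorphism \<open>P \<otimes> P \<cong> P\<^sup>d\<close> in components. Balanced maps factor through the tensor product, hence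
 through the components, and the components of pure tensors generate \<open>P\<^sup>d\<close>.
\<close>

lemma (in comm_bimodule) tensor_components:
 assumes iso: "bimodule_isomorphic L L (tensor_product L P P) (bimodule_power P d)"
 shows "EX T. (ALL t<d. ALL x:carrier P. ALL y:carrier P. T t x y : carrier P) &
  (ALL t<d. ALL x:carrier P. ALL x':carrier P. ALL y:carrier P. T t (x \<oplus>\<^bsub>P\<^esub> x') y = T t x y \<oplus>\<^bsub>P\<^esub> T t x' y) &
  (ALL t<d. ALL x:carrier P. ALL y:carrier P. ALL y':carrier P. T t x (y \<oplus>\<^bsub>P\<^esub> y') = T t x y \<oplus>\<^bsub>P\<^esub> T t x y') &
  (ALL t<d. ALL l:carrier L. ALL x:carrier P. ALL y:carrier P. T t (l \<odot>\<^bsub>P\<^esub> x) y = l \<odot>\<^bsub>P\<^esub> T t x y &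
   T t x (y \<star> l) = T t x y \<star> l & T t (x \<star> l) y = T t x (l \<odot>\<^bsub>P\<^esub> y)) &
  (ALL B. balanced B --> (EX chi. (ALL t<d. chi t : duals L P) &
   (ALL x:carrier P. ALL y:carrier P. B x y = (\<Oplus>t\<in>{..<d}. chi t (T t x y))))) &
  (ALL chi. (ALL t<d. chi t : duals L P) -->
   (ALL x:carrier P. ALL y:carrier P. (\<Oplus>t\<in>{..<d}. chi t (T t x y)) = \<zero>) --> (ALL t<d. ALL x:carrier P. chi t x = \<zero>))"
proof -
 interpret t: tensor_setting L P P L by unfold_locales simp
 let ?Q = "tensor_product L P P"
 obtain f where f: "f : iso (add_monoid ?Q) (add_monoid (bimodule_power P d))"
  and f_smult: "ALL r:carrier L. ALL x:carrier ?Q. f (r \<odot>\<^bsub>?Q\<^esub> x) = r \<odot>\<^bsub>bimodule_power P d\<^esub> f x"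
  and f_rsmult: "ALL s:carrier L. ALL x:carrier ?Q. f (rsmult ?Q x s) = rsmult (bimodule_power P d) (f x) s"
  using iso by (auto simp: bimodule_isomorphic_def)
 have bij: "bij_betw f (carrier ?Q) (\<Pi>\<^sub>E t\<in>{..<d}. carrier P)"
  using f by (simp add: iso_def bimodule_power_def)
 have fC: "f q t : carrier P" if "q : carrier ?Q" "t < d" for q t
  using bij_betwE[OF bij] that by (auto simp: PiE_iff)
 have fadd: "f (p \<oplus>\<^bsub>?Q\<^esub> q) t = f p t \<oplus>\<^bsub>P\<^esub> f q t" if "p : carrier ?Q" "q : carrier ?Q" "t < d" for p q t
  using f that by (simp add: iso_def hom_def bimodule_power_def)
 have fl: "f (l \<odot>\<^bsub>?Q\<^esub> q) t = l \<odot>\<^bsub>P\<^esub> f q t" "f (rsmult ?Q q l) t = f q t \<star> l" if "q : carrier ?Q" "l : carrier L" "t < d" for q l t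
  using f_smult f_rsmult that by (simp_all add: bimodule_power_def)
 define T where "T t x y = f (t.pure x y) t" for t x y
 have TC: "T t x y : carrier P" if "t < d" "x : carrier P" "y : carrier P" for t x y
  using that fC by (simp add: T_def)
 define g where "g = inv_into (carrier ?Q) f"
 have g: "g p : carrier ?Q" "f (g p) = p" if "p : (\<Pi>\<^sub>E t\<in>{..<d}. carrier P)" for p
  using bij that by (auto simp: g_def bij_betw_def inv_into_into f_inv_into_f)
 have g_eq: "g p = q" if "p : (\<Pi>\<^sub>E t\<in>{..<d}. carrier P)" "q : carrier ?Q" "!!t. t < d ==> p t = f q t" for p q
 proof (rule inj_onD[OF bij_betw_imp_inj_on[OF bij] _ g(1)[OF that(1)] that(2)])
  show "f (g p) = f q" unfolding g(2)[OF that(1)]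
   by (rule PiE_ext[OF that(1) bij_betwE[OF bij, THEN bspec, OF that(2)]]) (use that(3) in auto)
 qed
 define \<iota> where "\<iota> t x = (\<lambda>s\<in>{..<d}. if s = t then x else \<zero>\<^bsub>P\<^esub>)" for t and x :: 'p
 have \<iota>: "\<iota> t x : (\<Pi>\<^sub>E t\<in>{..<d}. carrier P)" if "x : carrier P" for t x using that by (auto simp: \<iota>_def)
 have functional: "EX chi. (ALL t<d. chi t : duals L P) & (ALL x:carrier P. ALL y:carrier P. B x y = (\<Oplus>t\<in>{..<d}. chi t (T t x y)))"
  if B: "balanced B" for B
 proof -
  have "EX h. (ALL q:carrier ?Q. h q : carrier L) & (ALL p:carrier ?Q. ALL q:carrier ?Q. h (p \<oplus>\<^bsub>?Q\<^esub> q) = h p \<oplus> h q) &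
   (ALL x:carrier P. ALL y:carrier P. h (t.pure x y) = B x y)"
   using B by (intro t.tensor_universal[OF l.R.abelian_group_axioms]) (auto simp: balanced_def)
  then obtain h where hC: "!!q. q : carrier ?Q ==> h q : carrier L"
   and hadd: "!!p q. p : carrier ?Q ==> q : carrier ?Q ==> h (p \<oplus>\<^bsub>?Q\<^esub> q) = h p \<oplus> h q"
   and hB: "!!x y. x : carrier P ==> y : carrier P ==> h (t.pure x y) = B x y" by blast
  have hl: "h (l \<odot>\<^bsub>?Q\<^esub> q) = l \<otimes> h q" if q: "q : carrier ?Q" and l: "l : carrier L" for q l
   using q
  proof (induction q rule: t.tensor_induct)
   case (pure x y)
   then show ?case using l B by (simp add: t.smult_pure hB balanced_def)
  next
   case (add p q)
   then show ?case using l by (simp add: t.smult_Q hadd hC l.R.r_distr)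
  qed
  have g\<iota>: "g (\<iota> t x) : carrier ?Q" "!!s. s < d ==> f (g (\<iota> t x)) s = (if s = t then x else \<zero>\<^bsub>P\<^esub>)" if "x : carrier P" for t x
   using g[OF \<iota>[OF that]] by (auto simp: \<iota>_def)
  define chi where "chi t x = h (g (\<iota> t x))" for t x
  have "chi t : duals L P" for t
  proof -
   have "g (\<iota> t (x \<oplus>\<^bsub>P\<^esub> y)) = g (\<iota> t x) \<oplus>\<^bsub>?Q\<^esub> g (\<iota> t y)" if "x : carrier P" "y : carrier P" for x y
    by (rule g_eq) (use that \<iota> g\<iota> fadd in "auto simp: \<iota>_def")
   moreover have "g (\<iota> t (l \<odot>\<^bsub>P\<^esub> x)) = l \<odot>\<^bsub>?Q\<^esub> g (\<iota> t x)" if "x : carrier P" "l : carrier L" for x l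
    by (rule g_eq) (use that \<iota> g\<iota> fl t.smult_Q in "auto simp: \<iota>_def")
   ultimately show ?thesis using g\<iota>(1) hC hadd hl by (auto simp: chi_def duals_def)
  qed
  moreover have "B x y = (\<Oplus>t\<in>{..<d}. chi t (T t x y))" if xy: "x : carrier P" "y : carrier P" for x y
  proof -
   have qC: "g (\<iota> t (T t x y)) : carrier ?Q" if "t < d" for t using g\<iota>(1)[OF TC[OF that xy]] .
   have sC: "(\<Oplus>\<^bsub>?Q\<^esub>t\<in>{..<d}. g (\<iota> t (T t x y))) : carrier ?Q" using qC by (intro t.Q.finsum_closed) auto
   have "(\<Oplus>\<^bsub>?Q\<^esub>t\<in>{..<d}. g (\<iota> t (T t x y))) = t.pure x y"
   proof (rule inj_onD[OF bij_betw_imp_inj_on[OF bij] _ sC])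
    show "f (\<Oplus>\<^bsub>?Q\<^esub>t\<in>{..<d}. g (\<iota> t (T t x y))) = f (t.pure x y)"
    proof (rule PiE_ext[OF bij_betwE[OF bij, THEN bspec, OF sC] bij_betwE[OF bij, THEN bspec]])
     fix s assume "s : {..<d}"
     then have s: "s < d" by simp
     have "f (\<Oplus>\<^bsub>?Q\<^esub>t\<in>{..<d}. g (\<iota> t (T t x y))) s = (\<Oplus>\<^bsub>P\<^esub>t\<in>{..<d}. f (g (\<iota> t (T t x y))) s)"
      using s qC fC fadd
      by (intro additive_finsum[of ?Q P "%q. f q s"] t.Q_abelian_group l.M.abelian_group_axioms) auto
     also have "... = f (g (\<iota> s (T s x y))) s"
      using s qC fC g\<iota>(2)[OF TC[OF _ xy]] TC[OF s xy] by (intro l.M.finsum_delta) auto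
     also have "... = f (t.pure x y) s" using g\<iota>(2)[OF TC[OF s xy] s] by (simp add: T_def)
     finally show "f (\<Oplus>\<^bsub>?Q\<^esub>t\<in>{..<d}. g (\<iota> t (T t x y))) s = f (t.pure x y) s" .
    qed (use xy in simp)
   qed (use xy in simp)
   moreover have "h (\<Oplus>\<^bsub>?Q\<^esub>t\<in>{..<d}. g (\<iota> t (T t x y))) = (\<Oplus>t\<in>{..<d}. h (g (\<iota> t (T t x y))))"
    using qC hC hadd by (intro additive_finsum[OF t.Q_abelian_group l.R.abelian_group_axioms]) auto
   ultimately show ?thesis using hB[OF xy] by (simp add: chi_def)
  qed
  ultimately show ?thesis by blast
 qed
 have generate: "chi t0 x0 = \<zero>" if chi: "!!t. t < d ==> chi t : duals L P"
  and 0: "!!x y. x : carrier P ==> y : carrier P ==> (\<Oplus>t\<in>{..<d}. chi t (T t x y)) = \<zero>"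
  and t0: "t0 < d" and x0: "x0 : carrier P" for chi t0 x0
 proof -
  have chiC: "chi t (f q t) : carrier L" if "t < d" "q : carrier ?Q" for t q
   using dualsD(1)[OF chi] fC that by blast
  have "(\<Oplus>t\<in>{..<d}. chi t (f q t)) = \<zero>" if "q : carrier ?Q" for q
   using that
  proof (induction q rule: t.tensor_induct)
   case (pure x y)
   then show ?case using 0 by (simp add: T_def)
  next
   case (add p q)
   have "(\<Oplus>t\<in>{..<d}. chi t (f (p \<oplus>\<^bsub>?Q\<^esub> q) t)) = (\<Oplus>t\<in>{..<d}. chi t (f p t) \<oplus> chi t (f q t))"
    using add chiC fC fadd dualsD(2)[OF chi] by (intro l.R.finsum_cong') auto
   also have "... = (\<Oplus>t\<in>{..<d}. chi t (f p t)) \<oplus> (\<Oplus>t\<in>{..<d}. chi t (f q t))"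
    using add chiC by (intro l.R.finsum_addf) auto
   finally show ?case using add by simp
  qed
  then have "(\<Oplus>t\<in>{..<d}. chi t (f (g (\<iota> t0 x0)) t)) = \<zero>" using g(1)[OF \<iota>[OF x0]] by blast
  moreover have "(\<Oplus>t\<in>{..<d}. chi t (f (g (\<iota> t0 x0)) t)) = chi t0 (f (g (\<iota> t0 x0)) t0)"
   using t0 x0 g[OF \<iota>[OF x0]] chiC dualsD(1)[OF chi[OF t0] x0] l.functional_zero[OF chi]
   by (intro l.R.finsum_delta) (auto simp: \<iota>_def)
  ultimately show ?thesis using g(2)[OF \<iota>[OF x0]] t0 by (simp add: \<iota>_def)
 qed
 show ?thesis
  by (intro exI[of _ T] conjI allI ballI impI)
   (use TC functional generate in "auto simp: T_def fadd fl t.pure_add_left t.pure_add_right t.pure_balanced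
    t.smult_pure[symmetric] t.rsmult_pure[symmetric]")
qed

text \<open>
 The dimension is defined by adjoining one vector at a time, so independence is only required of each vector from the
 preceding ones.
\<close>

lemma (in ring) dimension_of_basis:
 assumes u: "!!s. s < d ==> u s : carrier R" and K: "K \<subseteq> carrier R"
  and indep: "!!t k. [|t < d; ALL s<t. k s : K|] ==> u t ~= (\<Oplus>s\<in>{..<t}. k s \<otimes> u s)"
 shows "dimension d K {\<Oplus>s\<in>{..<d}. k s \<otimes> u s | k. ALL s<d. k s : K}"
proof -
 have "dimension t K {\<Oplus>s\<in>{..<t}. k s \<otimes> u s | k. ALL s<t. k s : K}" if "t <= d" for t
  using that
 proof (induction t)
  case 0
  then show ?case by simp
 next
  case (Suc t)
  let ?E = "%t. {\<Oplus>s\<in>{..<t}. k s \<otimes> u s | k. ALL s<t. k s : K}"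
  have kC: "k s \<otimes> u s : carrier R" if "ALL s<t'. k s : K" "s < t'" "t' <= d" for k s t' using that K u by auto
  have step: "(\<Oplus>s\<in>{..<Suc t}. k s \<otimes> u s) = k t \<otimes> u t \<oplus> (\<Oplus>s\<in>{..<t}. k s \<otimes> u s)" if "ALL s<Suc t. k s : K" for k
   unfolding lessThan_Suc using kC[OF that _ Suc.prems] by (intro finsum_insert) auto
  have "?E (Suc t) = line_extension K (u t) (?E t)"
  proof (intro equalityI subsetI)
   fix y assume "y : ?E (Suc t)"
   then obtain k where k: "ALL s<Suc t. k s : K" "y = (\<Oplus>s\<in>{..<Suc t}. k s \<otimes> u s)" by auto
   then show "y : line_extension K (u t) (?E t)" unfolding line_extension_mem_iff using step[OF k(1)]
    by (intro bexI[of _ "k t"] bexI[of _ "\<Oplus>s\<in>{..<t}. k s \<otimes> u s"]) auto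
  next
   fix y assume "y : line_extension K (u t) (?E t)"
   then obtain a k where a: "a : K" and k: "ALL s<t. k s : K" "y = a \<otimes> u t \<oplus> (\<Oplus>s\<in>{..<t}. k s \<otimes> u s)"
    unfolding line_extension_mem_iff by auto
   define k' where "k' = k(t := a)"
   have k': "ALL s<Suc t. k' s : K" using a k by (auto simp: k'_def less_Suc_eq)
   have "(\<Oplus>s\<in>{..<t}. k' s \<otimes> u s) = (\<Oplus>s\<in>{..<t}. k s \<otimes> u s)"
    using kC[OF k(1)] Suc.prems by (intro finsum_cong') (auto simp: k'_def)
   then have "y = (\<Oplus>s\<in>{..<Suc t}. k' s \<otimes> u s)" using k step[OF k'] by (simp add: k'_def)
   then show "y : ?E (Suc t)" using k' by blast
  qed
  moreover have "u t \<notin> ?E t" using indep[of t] Suc.prems by auto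
  ultimately show ?case using Suc u by (simp add: Suc_dim)
 qed
 then show ?thesis by blast
qed

lemma bimodule_via_simps [simp]:
 "carrier (bimodule_via h B) = carrier B" "\<zero>\<^bsub>bimodule_via h B\<^esub> = \<zero>\<^bsub>B\<^esub>" "x \<oplus>\<^bsub>bimodule_via h B\<^esub> y = x \<oplus>\<^bsub>B\<^esub> y"
 "r \<odot>\<^bsub>bimodule_via h B\<^esub> x = h r \<otimes>\<^bsub>B\<^esub> x" "rsmult (bimodule_via h B) x r = x \<otimes>\<^bsub>B\<^esub> h r"
 by (simp_all add: bimodule_via_def)

lemma comm_bimodule_via:
 assumes L: "cring L" and B: "cring B" and h: "h : ring_hom L B"
 shows "comm_bimodule L (bimodule_via h B)"
proof -
 interpret L: cring L by (rule L)
 interpret B: cring B by (rule B)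
 note hD = ring_hom_closed[OF h] ring_hom_mult[OF h] ring_hom_add[OF h] ring_hom_one[OF h]
 have inv: "EX y:carrier B. y \<oplus>\<^bsub>B\<^esub> x = \<zero>\<^bsub>B\<^esub>" if "x : carrier B" for x
  using that by (intro bexI[of _ "\<ominus>\<^bsub>B\<^esub> x"]) (auto simp: B.l_neg)
 have 1: "abelian_group (bimodule_via h B)"
  by (rule abelian_groupI) (use inv in "auto simp: B.a_ac")
 have 2: "abelian_group (right_module (bimodule_via h B))"
  by (rule abelian_groupI) (use inv in "auto simp: B.a_ac")
 show ?thesis
  unfolding comm_bimodule_def comm_bimodule_axioms_def module_def module_axioms_def
  using L 1 2 hD by (simp add: B.l_distr B.r_distr B.m_ac)
qed

lemma finsum_bimodule_via:
 assumes "abelian_group B" "abelian_group (bimodule_via h B)" "finite I" "!!s. s : I ==> f s : carrier B"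
 shows "finsum (bimodule_via h B) f I = finsum B f I"
 using assms additive_finsum[of B "bimodule_via h B" "%x. x" I f] by simp

lemma (in tensor_setting) pure_zero_sum:
 assumes "!!s. s : I ==> c s = \<zero>\<^bsub>M\<^esub>" "!!s. s : I ==> b s : carrier N"
 shows "(\<Oplus>\<^bsub>Q\<^esub>s\<in>I. pure (c s) (b s)) = \<zero>\<^bsub>Q\<^esub>"
 using assms by (intro Q.add.finprod_one_eqI) (simp add: pure_zero_left)

lemma (in tensor_setting) pure_expand_right:
 assumes I: "finite I" and x: "x : carrier M" and z: "!!s. s : I ==> z s : carrier S" and b: "!!s. s : I ==> b s : carrier N"
  and c: "!!s. s : I ==> c s = rsmult M x (z s)" and y: "(\<Oplus>\<^bsub>N\<^esub>s\<in>I. z s \<odot>\<^bsub>N\<^esub> b s) = y"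
 shows "(\<Oplus>\<^bsub>Q\<^esub>s\<in>I. pure (c s) (b s)) = pure x y"
proof -
 have "(\<Oplus>\<^bsub>Q\<^esub>s\<in>I. pure (c s) (b s)) = (\<Oplus>\<^bsub>Q\<^esub>s\<in>I. pure x (z s \<odot>\<^bsub>N\<^esub> b s))"
  using x z b c by (intro Q.finsum_cong') (auto simp: pure_balanced)
 also have "... = pure x (\<Oplus>\<^bsub>N\<^esub>s\<in>I. z s \<odot>\<^bsub>N\<^esub> b s)"
  using x z b I pure_add_right
  by (intro additive_finsum[OF N.l.M.abelian_group_axioms Q_abelian_group, symmetric]) auto
 finally show ?thesis using y by simp
qed

context framed_bimodule
begin

text \<open>Free vectors of different blocks are orthogonal because the idempotents are.\<close>

lemma free_vectors_dual:
 assumes ij: "i < n" "j < n" "a < m i j" and kl: "k < n" "l < n" "c < m k l" and b: "b : CL" "b \<otimes> e j = b"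
 shows "phi i j a (x k l c \<star> b) = (if i = k & j = l & a = c then e i \<otimes> tau j b else \<zero>)"
proof -
 have phif: "phi i j a : duals L P" using freeD(5)[OF ij(1,2), of a] ij by simp
 have xC: "x k l c : CP" using kl by simp
 have xe: "e k \<cdot> x k l c = x k l c" "x k l c \<star> e l = x k l c" using freeD(3,4)[OF kl(1,2), of c] kl by auto
 consider "j ~= l" | "j = l" "i ~= k" | "j = l" "i = k" by blast
 then show ?thesis
 proof cases
  case 1
  have "x k l c \<star> b = x k l c \<star> e l \<star> (b \<otimes> e j)" using b xe by simp
  also have "... = x k l c \<star> (b \<otimes> (e l \<otimes> e j))" using b(1) xC kl ij by (simp add: rs_assoc l.R.m_lcomm)
  also have "... = \<zero>\<^bsub>P\<^esub>" using e_orth[of l j] 1 kl ij b(1) xC by simp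
  finally show ?thesis using 1 l.functional_zero[OF phif] by simp
 next
  case 2
  have "phi i j a (x k l c \<star> b) = phi i j a (e k \<cdot> (x k l c \<star> b))" using xe xC kl b(1) by (simp add: rs_ls[symmetric])
  also have "... = e k \<otimes> (e i \<otimes> phi i j a (x k l c \<star> b))"
   using dualsD(3)[OF phif, of "e k" "x k l c \<star> b"] freeD(6)[OF ij(1,2), of a "x k l c \<star> b"] ij kl xC b(1) by simp
  also have "... = \<zero>" using e_orth[of k i] 2 ij kl dualsD(1)[OF phif, of "x k l c \<star> b"] xC b(1)
   by (simp add: l.R.m_assoc[symmetric])
  finally show ?thesis using 2 by simp
 next
  case 3
  then show ?thesis using freeD(7)[OF ij(1,2), of a c b] ij kl b by simp
 qed
qed

lemma full_expand:
 assumes y: "y : CP"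
 shows "y = (\<Oplus>\<^bsub>P\<^esub>i\<in>{..<n}. \<Oplus>\<^bsub>P\<^esub>j\<in>{..<n}. \<Oplus>\<^bsub>P\<^esub>a\<in>{..<m i j}. \<Oplus>\<^bsub>P\<^esub>s\<in>{..<D j}. phi i j a (y \<star> gamma j s) \<cdot> (x i j a \<star> beta j s))"
proof -
 have "y = (\<Oplus>\<^bsub>P\<^esub>i\<in>{..<n}. e i \<cdot> y)" by (rule split_left[OF y])
 also have "... = (\<Oplus>\<^bsub>P\<^esub>i\<in>{..<n}. \<Oplus>\<^bsub>P\<^esub>j\<in>{..<n}. e i \<cdot> (y \<star> e j))"
 proof (intro l.M.finsum_cong')
  fix i assume "i : {..<n}"
  then have "e i \<cdot> y = (\<Oplus>\<^bsub>P\<^esub>j\<in>{..<n}. e i \<cdot> y \<star> e j)" using split_right[of "e i \<cdot> y"] y by simp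
  also have "... = (\<Oplus>\<^bsub>P\<^esub>j\<in>{..<n}. e i \<cdot> (y \<star> e j))"
   using y `i : {..<n}` by (intro l.M.finsum_cong') (auto simp: rs_ls)
  finally show "e i \<cdot> y = (\<Oplus>\<^bsub>P\<^esub>j\<in>{..<n}. e i \<cdot> (y \<star> e j))" .
 qed (use y in "auto intro!: l.M.finsum_closed")
 also have "... = (\<Oplus>\<^bsub>P\<^esub>i\<in>{..<n}. \<Oplus>\<^bsub>P\<^esub>j\<in>{..<n}. \<Oplus>\<^bsub>P\<^esub>a\<in>{..<m i j}. \<Oplus>\<^bsub>P\<^esub>s\<in>{..<D j}. phi i j a (y \<star> gamma j s) \<cdot> (x i j a \<star> beta j s))"
  using y freeD(8) block_expand[OF _ _ y]
  by (intro l.M.finsum_cong' l.M.finsum_closed) auto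
 finally show ?thesis .
qed

text \<open>If all multiplicities agree, the sums \<open>xi\<close> of the free vectors over all blocks are free over \<open>L \<otimes> L\<close>.\<close>

lemma galois_decomposition:
 fixes Zr :: "('a, 'z) ring_scheme"
 assumes M: "!!i j. i < n ==> j < n ==> m i j = M" and Zr: "carrier Zr = Z"
 shows "bimodule_isomorphic L L P (bimodule_power (tensor_product Zr (bimodule_via id L) (bimodule_via id L)) M)"
proof -
 let ?L = "bimodule_via id L :: ('a, 'a, 'a) bimodule"
 have id: "id : ring_hom L L" by (auto simp: ring_hom_def)
 interpret T: tensor_setting L ?L ?L Zr
  using comm_bimodule_via[OF l.R.cring_axioms l.R.cring_axioms id] ZD(1) Zr
  by (simp add: tensor_setting_def tensor_setting_axioms_def subset_iff)
 define I where "I = (SIGMA j:{..<n}. {..<D j})"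
 define xi where "xi a = (\<Oplus>\<^bsub>P\<^esub>i\<in>{..<n}. \<Oplus>\<^bsub>P\<^esub>j\<in>{..<n}. x i j a)" for a
 define c where "c a p y = (\<Oplus>i\<in>{..<n}. phi i (fst p) a (y \<star> gamma (fst p) (snd p)))" for a p y
 have xiC: "xi a : CP" if "a < M" for a unfolding xi_def using that M by (intro l.M.finsum_closed) auto
 have phif: "phi i j a : duals L P" and phie: "!!y. y : CP ==> e i \<otimes> phi i j a y = phi i j a y"
  and phiC: "!!y. y : CP ==> phi i j a y : CL" if "i < n" "j < n" "a < M" for i j a
  using freeD(5,6,8)[OF that(1,2), of a] M[OF that(1,2)] that(3) by auto
 have exi: "e i \<cdot> (xi a \<star> b) = x i j a \<star> b"
  if ij: "i < n" "j < n" and a: "a < M" and b: "b : CL" "b \<otimes> e j = b" for i j a b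
 proof -
  have xe: "e k \<cdot> x k l a = x k l a" "x k l a \<star> e l = x k l a" "x k l a : CP" if "k < n" "l < n" for k l
   using freeD(2,3,4)[OF that, of a] M[OF that] a by auto
  have sC: "(\<Oplus>\<^bsub>P\<^esub>j\<in>{..<n}. x k j a) : CP" if "k < n" for k using xe that by (intro l.M.finsum_closed) auto
  have "e i \<cdot> xi a = (\<Oplus>\<^bsub>P\<^esub>k\<in>{..<n}. e i \<cdot> (\<Oplus>\<^bsub>P\<^esub>j\<in>{..<n}. x k j a))"
   unfolding xi_def using ij sC by (intro l.finsum_smult_ldistr) auto
  also have "... = e i \<cdot> (\<Oplus>\<^bsub>P\<^esub>j\<in>{..<n}. x i j a)"
  proof (intro l.M.finsum_delta)
   fix k assume k: "k : {..<n}" "k ~= i"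
   have "e i \<cdot> x k j a = \<zero>\<^bsub>P\<^esub>" if "j < n" for j
   proof -
    have "e i \<cdot> x k j a = (e i \<otimes> e k) \<cdot> x k j a" using xe[of k j] k ij that by (simp add: l.smult_assoc1)
    then show ?thesis using e_orth[of i k] k ij that xe[of k j] by simp
   qed
   then have "(\<Oplus>\<^bsub>P\<^esub>j\<in>{..<n}. e i \<cdot> x k j a) = \<zero>\<^bsub>P\<^esub>" by (intro l.M.add.finprod_one_eqI) auto
   moreover have "e i \<cdot> (\<Oplus>\<^bsub>P\<^esub>j\<in>{..<n}. x k j a) = (\<Oplus>\<^bsub>P\<^esub>j\<in>{..<n}. e i \<cdot> x k j a)"
    using k ij xe by (intro l.finsum_smult_ldistr) auto
   ultimately show "e i \<cdot> (\<Oplus>\<^bsub>P\<^esub>j\<in>{..<n}. x k j a) = \<zero>\<^bsub>P\<^esub>" by simp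
  qed (use ij sC in auto)
  also have "... = (\<Oplus>\<^bsub>P\<^esub>j\<in>{..<n}. e i \<cdot> x i j a)" using ij xe by (intro l.finsum_smult_ldistr) auto
  also have "... = (\<Oplus>\<^bsub>P\<^esub>j\<in>{..<n}. x i j a)" using ij xe by (intro l.M.finsum_cong') auto
  finally have "e i \<cdot> (xi a \<star> b) = (\<Oplus>\<^bsub>P\<^esub>j\<in>{..<n}. x i j a) \<star> b"
   using ij b xiC[OF a] by (simp add: rs_ls[symmetric])
  also have "... = (\<Oplus>\<^bsub>P\<^esub>j\<in>{..<n}. x i j a \<star> b)" using ij b xe by (intro rs_finsum) auto
  also have "... = x i j a \<star> b"
  proof (intro l.M.finsum_delta)
   fix l assume l: "l : {..<n}" "l ~= j"
   have "x i l a \<star> b = x i l a \<star> e l \<star> (b \<otimes> e j)" using b xe[of i l] ij l by simp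
   also have "... = x i l a \<star> (b \<otimes> (e l \<otimes> e j))" using b(1) xe(3)[of i l] l ij by (simp add: rs_assoc l.R.m_lcomm)
   also have "... = \<zero>\<^bsub>P\<^esub>" using e_orth[of l j] l ij b(1) xe[of i l] by simp
   finally show "x i l a \<star> b = \<zero>\<^bsub>P\<^esub>" .
  qed (use ij b xe in auto)
  finally show ?thesis .
 qed
 have cdual: "c a p (k \<cdot> (xi a' \<star> l)) = (if a = a' then k \<otimes> tau (fst p) (l \<otimes> gamma (fst p) (snd p)) else \<zero>)"
  if a: "a < M" "a' < M" and p: "p : I" and k: "k : CL" and l: "l : CL" for a a' p k l
 proof -
  obtain j s where js: "p = (j, s)" "j < n" "s < D j" using p by (auto simp: I_def)
  define b where "b = l \<otimes> gamma j s"
  have b: "b : CL" "b \<otimes> e j = b" using l js gamma_e[OF js(2,3)] by (auto simp: b_def l.R.m_assoc)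
  have "phi i j a (k \<cdot> (xi a' \<star> l) \<star> gamma j s) = (k \<otimes> (if a = a' then tau j b else \<zero>)) \<otimes> e i" if i: "i < n" for i
  proof -
   have "k \<cdot> (xi a' \<star> l) \<star> gamma j s = k \<cdot> (xi a' \<star> b)"
    using k l js xiC[OF a(2)] by (simp add: rs_ls rs_assoc b_def)
   moreover have "phi i j a (k \<cdot> (xi a' \<star> b)) = k \<otimes> (e i \<otimes> phi i j a (xi a' \<star> b))"
    using dualsD(3)[OF phif[OF i js(2) a(1)] k, of "xi a' \<star> b"] phie[OF i js(2) a(1)] xiC[OF a(2)] b by simp
   moreover have "e i \<otimes> phi i j a (xi a' \<star> b) = phi i j a (x i j a' \<star> b)"
    using dualsD(3)[OF phif[OF i js(2) a(1)] e_closed[OF i], of "xi a' \<star> b"] exi[OF i js(2) a(2) b] xiC[OF a(2)] b by simp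
   moreover have "phi i j a (x i j a' \<star> b) = e i \<otimes> (if a = a' then tau j b else \<zero>)"
    using free_vectors_dual[OF i js(2) _ i js(2) _ b, of a a'] a M[OF i js(2)] i by simp
   ultimately show ?thesis using i k b js by (simp add: l.R.m_assoc l.R.m_comm[of "e i"])
  qed
  then have "c a p (k \<cdot> (xi a' \<star> l)) = (\<Oplus>i\<in>{..<n}. (k \<otimes> (if a = a' then tau j b else \<zero>)) \<otimes> e i)"
   unfolding c_def using k b js by (intro l.R.finsum_cong') auto
  also have "... = k \<otimes> (if a = a' then tau j b else \<zero>)"
   using k b js by (intro split_scalar[symmetric]) auto
  finally show ?thesis using js k by (simp add: b_def)
 qed
 have cC: "c a p y : CL" if "a < M" "p : I" "y : CP" for a p y
  unfolding c_def using that phiC by (intro l.R.finsum_closed) (auto simp: I_def)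
 have betaI: "beta (fst p) (snd p) : CL" if "p : I" for p using that by (auto simp: I_def)
 have "bimodule_isomorphic L L P (bimodule_sum {..<M} (%k. tensor_product Zr ?L ?L))"
 proof (rule tensor_decomposition[where mu = "%a k l. k \<cdot> (xi a \<star> l)" and I = "%_. I" and c = c
    and b = "%_ p. beta (fst p) (snd p)" and M = "%_. ?L" and N = "%_. ?L"])
  show "tensor_setting L ?L ?L Zr" by (rule T.tensor_setting_axioms)
  show "finite I" by (simp add: I_def)
 next
  fix a k s l assume *: "a : {..<M}" "k : carrier ?L" "s : carrier Zr" "l : carrier ?L"
  then have s: "s : Z" "s : CL" using Zr ZD(1) by auto
  show "rsmult ?L k s \<cdot> (xi a \<star> l) = k \<cdot> (xi a \<star> (s \<odot>\<^bsub>?L\<^esub> l))"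
   using * s xiC by (simp add: l.smult_assoc1 rs_central)
 next
  fix a p y y' assume "a : {..<M}" "p : I" "y : CP" "y' : CP"
  then have a: "a < M" and p: "fst p < n" "snd p < D (fst p)" and y: "y : CP" "y' : CP" by (auto simp: I_def)
  have "c a p (y \<oplus>\<^bsub>P\<^esub> y') = c a p y \<oplus> c a p y'"
   unfolding c_def using phiC dualsD(2)[OF phif] a p y
   by (intro trans[OF l.R.finsum_cong' l.R.finsum_addf]) (auto simp: rs_add)
  then show "c a p (y \<oplus>\<^bsub>P\<^esub> y') = c a p y \<oplus>\<^bsub>?L\<^esub> c a p y'" by simp
 next
  fix y assume y: "y : CP"
  define t where "t i j a s = phi i j a (y \<star> gamma j s) \<cdot> (x i j a \<star> beta j s)" for i j a s
  have tC: "t i j a s : CP" if "i < n" "j < n" "a < M" "s < D j" for i j a s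
   unfolding t_def using that phiC y M by simp
  have "c a (j, s) y \<cdot> (xi a \<star> beta j s) = (\<Oplus>\<^bsub>P\<^esub>i\<in>{..<n}. t i j a s)" if "j < n" "a < M" "s < D j" for j a s
  proof -
   have "c a (j, s) y \<cdot> (xi a \<star> beta j s) = (\<Oplus>\<^bsub>P\<^esub>i\<in>{..<n}. phi i j a (y \<star> gamma j s) \<cdot> (xi a \<star> beta j s))"
    unfolding c_def fst_conv snd_conv using that phiC y xiC by (intro smult_finsum_left) auto
   also have "... = (\<Oplus>\<^bsub>P\<^esub>i\<in>{..<n}. t i j a s)"
   proof (intro l.M.finsum_cong')
    fix i assume "i : {..<n}"
    then have i: "i < n" by simp
    have C: "phi i j a (y \<star> gamma j s) : CL" using phiC[OF i that(1,2)] y that by simp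
    have "phi i j a (y \<star> gamma j s) \<cdot> (xi a \<star> beta j s) = (phi i j a (y \<star> gamma j s) \<otimes> e i) \<cdot> (xi a \<star> beta j s)"
     using phie[OF i that(1,2), of "y \<star> gamma j s"] y that C i by (simp add: l.R.m_comm)
    also have "... = phi i j a (y \<star> gamma j s) \<cdot> (e i \<cdot> (xi a \<star> beta j s))"
     using C i that xiC by (simp add: l.smult_assoc1)
    also have "e i \<cdot> (xi a \<star> beta j s) = x i j a \<star> beta j s"
     using i that beta_e by (intro exi) auto
    finally show "phi i j a (y \<star> gamma j s) \<cdot> (xi a \<star> beta j s) = t i j a s" by (simp add: t_def)
   qed (use tC that in auto)
   finally show ?thesis .
  qed
  then have c_sum: "c a p y \<cdot> (xi a \<star> beta (fst p) (snd p)) = (\<Oplus>\<^bsub>P\<^esub>i\<in>{..<n}. t i (fst p) a (snd p))" if "a < M" "p : I" for a p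
   using that by (auto simp: I_def)
  have tI: "t i (fst p) a (snd p) : CP" if "i < n" "a < M" "p : I" for i a p
   using that tC by (auto simp: I_def)
  have swap1: "(\<Oplus>\<^bsub>P\<^esub>p\<in>I. (\<Oplus>\<^bsub>P\<^esub>i\<in>{..<n}. t i (fst p) a (snd p))) = (\<Oplus>\<^bsub>P\<^esub>i\<in>{..<n}. (\<Oplus>\<^bsub>P\<^esub>p\<in>I. t i (fst p) a (snd p)))" if "a < M" for a
   using that tI by (intro l.M.finsum_swap) (auto simp: I_def)
  have sigma: "(\<Oplus>\<^bsub>P\<^esub>p\<in>I. t i (fst p) a (snd p)) = (\<Oplus>\<^bsub>P\<^esub>j\<in>{..<n}. (\<Oplus>\<^bsub>P\<^esub>s\<in>{..<D j}. t i j a s))" if "i < n" "a < M" for i a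
   unfolding I_def using that tC by (intro trans[OF l.M.finsum_Sigma]) auto
  have tCs: "(\<Oplus>\<^bsub>P\<^esub>s\<in>{..<D j}. t i j a s) : CP" if "i < n" "j < n" "a < M" for i j a
   using that tC by (intro l.M.finsum_closed) auto
  have swap2: "(\<Oplus>\<^bsub>P\<^esub>a\<in>{..<M}. (\<Oplus>\<^bsub>P\<^esub>j\<in>{..<n}. (\<Oplus>\<^bsub>P\<^esub>s\<in>{..<D j}. t i j a s))) = (\<Oplus>\<^bsub>P\<^esub>j\<in>{..<n}. (\<Oplus>\<^bsub>P\<^esub>a\<in>{..<M}. (\<Oplus>\<^bsub>P\<^esub>s\<in>{..<D j}. t i j a s)))" if "i < n" for i
   using that tCs by (intro l.M.finsum_swap) auto
  have "(\<Oplus>\<^bsub>P\<^esub>a\<in>{..<M}. (\<Oplus>\<^bsub>P\<^esub>p\<in>I. c a p y \<cdot> (xi a \<star> beta (fst p) (snd p)))) = (\<Oplus>\<^bsub>P\<^esub>a\<in>{..<M}. (\<Oplus>\<^bsub>P\<^esub>p\<in>I. (\<Oplus>\<^bsub>P\<^esub>i\<in>{..<n}. t i (fst p) a (snd p))))"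
   by (rule l.M.finsum_cong') (use tI c_sum in "auto intro!: l.M.finsum_closed l.M.finsum_cong'")
  also have "... = (\<Oplus>\<^bsub>P\<^esub>a\<in>{..<M}. (\<Oplus>\<^bsub>P\<^esub>i\<in>{..<n}. (\<Oplus>\<^bsub>P\<^esub>p\<in>I. t i (fst p) a (snd p))))"
   by (rule l.M.finsum_cong') (use tI swap1 in "auto intro!: l.M.finsum_closed")
  also have "... = (\<Oplus>\<^bsub>P\<^esub>i\<in>{..<n}. (\<Oplus>\<^bsub>P\<^esub>a\<in>{..<M}. (\<Oplus>\<^bsub>P\<^esub>p\<in>I. t i (fst p) a (snd p))))"
   using tI by (intro l.M.finsum_swap) (auto intro!: l.M.finsum_closed)
  also have "... = (\<Oplus>\<^bsub>P\<^esub>i\<in>{..<n}. (\<Oplus>\<^bsub>P\<^esub>a\<in>{..<M}. (\<Oplus>\<^bsub>P\<^esub>j\<in>{..<n}. (\<Oplus>\<^bsub>P\<^esub>s\<in>{..<D j}. t i j a s))))"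
   by (rule l.M.finsum_cong') (use tC sigma in "auto intro!: l.M.finsum_closed l.M.finsum_cong'")
  also have "... = (\<Oplus>\<^bsub>P\<^esub>i\<in>{..<n}. (\<Oplus>\<^bsub>P\<^esub>j\<in>{..<n}. (\<Oplus>\<^bsub>P\<^esub>a\<in>{..<M}. (\<Oplus>\<^bsub>P\<^esub>s\<in>{..<D j}. t i j a s))))"
   by (rule l.M.finsum_cong') (use tCs swap2 in "auto intro!: l.M.finsum_closed")
  also have "... = (\<Oplus>\<^bsub>P\<^esub>i\<in>{..<n}. (\<Oplus>\<^bsub>P\<^esub>j\<in>{..<n}. (\<Oplus>\<^bsub>P\<^esub>a\<in>{..<m i j}. (\<Oplus>\<^bsub>P\<^esub>s\<in>{..<D j}. t i j a s))))"
   by (rule l.M.finsum_cong') (use tC M in "auto intro!: l.M.finsum_closed l.M.finsum_cong'")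
  also have "... = y" using full_expand[OF y] by (simp add: t_def)
  finally show "(\<Oplus>\<^bsub>P\<^esub>a\<in>{..<M}. \<Oplus>\<^bsub>P\<^esub>p\<in>I. c a p y \<cdot> (xi a \<star> beta (fst p) (snd p))) = y" .
 next
  fix a a' k l assume "a : {..<M}" "a' : {..<M}" "k : carrier ?L" "l : carrier ?L"
  then have *: "a < M" "a' < M" "k : CL" "l : CL" by auto
  show "(\<Oplus>\<^bsub>T.Q\<^esub>p\<in>I. T.pure (c a p (k \<cdot> (xi a' \<star> l))) (beta (fst p) (snd p))) = (if a = a' then T.pure k l else \<zero>\<^bsub>T.Q\<^esub>)"
  proof (cases "a = a'")
   case True
   have finI: "finite I" by (simp add: I_def)
   have cl: "tau (fst p) (l \<otimes> gamma (fst p) (snd p)) \<otimes> beta (fst p) (snd p) : CL" if "p : I" for p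
    using that * by (auto simp: I_def)
   have "(\<Oplus>p\<in>I. tau (fst p) (l \<otimes> gamma (fst p) (snd p)) \<otimes> beta (fst p) (snd p)) =
     (\<Oplus>j\<in>{..<n}. \<Oplus>s\<in>{..<D j}. tau j (l \<otimes> gamma j s) \<otimes> beta j s)"
    unfolding I_def using * by (intro trans[OF l.R.finsum_Sigma]) auto
   also have "... = (\<Oplus>j\<in>{..<n}. l \<otimes> e j)"
    using * expand_beta[OF _ *(4)] by (intro l.R.finsum_cong') auto
   also have "... = l" using split_scalar[OF *(4)] by simp
   finally have "(\<Oplus>\<^bsub>?L\<^esub>p\<in>I. tau (fst p) (l \<otimes> gamma (fst p) (snd p)) \<odot>\<^bsub>?L\<^esub> beta (fst p) (snd p)) = l"
    using finsum_bimodule_via[OF l.R.abelian_group_axioms T.M.l.M.abelian_group_axioms finI cl] by simp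
   then have "(\<Oplus>\<^bsub>T.Q\<^esub>p\<in>I. T.pure (c a p (k \<cdot> (xi a' \<star> l))) (beta (fst p) (snd p))) = T.pure k l"
    using * cdual True betaI trace_Z Zr
    by (intro T.pure_expand_right[where z = "%p. tau (fst p) (l \<otimes> gamma (fst p) (snd p))"]) (auto simp: I_def)
   then show ?thesis using True by simp
  next
   case False
   then show ?thesis using * cdual betaI T.pure_zero_sum[of I "%p. c a p (k \<cdot> (xi a' \<star> l))"] by simp
  qed
 qed (use xiC cC betaI in "auto simp: l.smult_l_distr l.smult_r_distr rs_distr l.smult_assoc1 rs_assoc rs_ls")
 then show ?thesis by (simp add: bimodule_power_def)
qed

end

section \<open>The direct sum of fields\<close>

lemma RDirProd_list_nth:
 assumes "y : carrier (RDirProd_list Rs)" "z : carrier (RDirProd_list Rs)" "i < length Rs"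
 shows "(y \<otimes>\<^bsub>RDirProd_list Rs\<^esub> z) ! i = y ! i \<otimes>\<^bsub>Rs ! i\<^esub> z ! i &
  (y \<oplus>\<^bsub>RDirProd_list Rs\<^esub> z) ! i = y ! i \<oplus>\<^bsub>Rs ! i\<^esub> z ! i"
 using assms
proof (induction Rs arbitrary: y z i)
 case (Cons R Rs)
 let ?h = "%(a, as). a # as"
 obtain a as b bs where y: "y = a # as" "a : carrier R" "as : carrier (RDirProd_list Rs)"
  and z: "z = b # bs" "b : carrier R" "bs : carrier (RDirProd_list Rs)"
  using Cons.prems by (auto simp: RDirProd_list_carrier)
 have C: "(a, as) : carrier (RDirProd R (RDirProd_list Rs))" "(b, bs) : carrier (RDirProd R (RDirProd_list Rs))"
  using y z by (auto simp: RDirProd_carrier)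
 have "y \<otimes>\<^bsub>RDirProd_list (R # Rs)\<^esub> z = ?h ((a, as) \<otimes>\<^bsub>RDirProd R (RDirProd_list Rs)\<^esub> (b, bs))"
  "y \<oplus>\<^bsub>RDirProd_list (R # Rs)\<^esub> z = ?h ((a, as) \<oplus>\<^bsub>RDirProd R (RDirProd_list Rs)\<^esub> (b, bs))"
  using ring_hom_mult[OF RDirProd_list_hom1 C] ring_hom_add[OF RDirProd_list_hom1 C] y z by simp_all
 then have eq: "y \<otimes>\<^bsub>RDirProd_list (R # Rs)\<^esub> z = (a \<otimes>\<^bsub>R\<^esub> b) # (as \<otimes>\<^bsub>RDirProd_list Rs\<^esub> bs)"
  "y \<oplus>\<^bsub>RDirProd_list (R # Rs)\<^esub> z = (a \<oplus>\<^bsub>R\<^esub> b) # (as \<oplus>\<^bsub>RDirProd_list Rs\<^esub> bs)"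
  by (simp_all add: RDirProd_def DirProd_def monoid.defs)
 show ?case
  using Cons.IH[OF y(3) z(3), of "i - 1"] Cons.prems(3) eq y z by (cases i) auto
qed auto

lemma RDirProd_list_zero_nth: "i < length Rs ==> \<zero>\<^bsub>RDirProd_list Rs\<^esub> ! i = \<zero>\<^bsub>Rs ! i\<^esub>"
 unfolding RDirProd_list_zero by (induction Rs arbitrary: i) (auto simp: nth_Cons split: nat.splits)

lemma RDirProd_list_one_nth: "i < length Rs ==> \<one>\<^bsub>RDirProd_list Rs\<^esub> ! i = \<one>\<^bsub>Rs ! i\<^esub>"
 unfolding RDirProd_list_one by (induction Rs arbitrary: i) (auto simp: nth_Cons split: nat.splits)

locale field_sum =
 fixes Ls :: "'a ring list"
 assumes fields: "i < length Ls ==> field (Ls ! i)"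
begin

abbreviation n where "n == length Ls"
abbreviation L where "L == RDirProd_list Ls"

lemma summand_cring: "i < n ==> cring (Ls ! i)"
 using fields field.axioms(1) domain.axioms(1) by blast

lemma summand_ring: "i < n ==> ring (Ls ! i)"
 using summand_cring cring.axioms(1) by blast

lemma nth_closed: "y : carrier L ==> i < n ==> y ! i : carrier (Ls ! i)"
 using RDirProd_list_carrier_mem(2) by blast

lemma L_ext: "y : carrier L ==> z : carrier L ==> (!!i. i < n ==> y ! i = z ! i) ==> y = z"
 using RDirProd_list_carrier_mem(1) by (metis nth_equalityI)

lemma L_ring: "ring L"
 using RDirProd_list_is_ring summand_ring by blast

lemma L_cring: "cring L"
proof -
 interpret ring L by (rule L_ring)
 show ?thesis
 proof (unfold_locales)
  fix y z assume yz: "y : carrier L" "z : carrier L"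
  show "y \<otimes>\<^bsub>L\<^esub> z = z \<otimes>\<^bsub>L\<^esub> y"
  proof (rule L_ext)
   fix i assume i: "i < n"
   interpret Li: cring "Ls ! i" by (rule summand_cring[OF i])
   show "(y \<otimes>\<^bsub>L\<^esub> z) ! i = (z \<otimes>\<^bsub>L\<^esub> y) ! i"
    using RDirProd_list_nth[OF yz i] RDirProd_list_nth[OF yz(2,1) i] nth_closed i yz by (simp add: Li.m_comm)
  qed (use yz in auto)
 qed
qed

sublocale L: cring "RDirProd_list Ls" by (rule L_cring)

lemma nth_mult: "y : carrier L ==> z : carrier L ==> i < n ==> (y \<otimes>\<^bsub>L\<^esub> z) ! i = y ! i \<otimes>\<^bsub>Ls ! i\<^esub> z ! i"
 and nth_add: "y : carrier L ==> z : carrier L ==> i < n ==> (y \<oplus>\<^bsub>L\<^esub> z) ! i = y ! i \<oplus>\<^bsub>Ls ! i\<^esub> z ! i"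
 and nth_zero: "i < n ==> \<zero>\<^bsub>L\<^esub> ! i = \<zero>\<^bsub>Ls ! i\<^esub>"
 and nth_one: "i < n ==> \<one>\<^bsub>L\<^esub> ! i = \<one>\<^bsub>Ls ! i\<^esub>"
 by (simp_all add: RDirProd_list_nth RDirProd_list_zero_nth RDirProd_list_one_nth)

lemma nth_hom: "i < n ==> (%z. z ! i) : ring_hom L (Ls ! i)"
 by (auto simp: ring_hom_def nth_closed nth_mult nth_add nth_one)

lemma nth_finsum:
 assumes "i < n" "finite A" "!!s. s : A ==> y s : carrier L"
 shows "finsum L y A ! i = (\<Oplus>\<^bsub>Ls ! i\<^esub>s\<in>A. y s ! i)"
 using assms summand_ring[OF assms(1)] nth_closed nth_add
 by (intro additive_finsum[of L "Ls ! i" "%z. z ! i"] L.abelian_group_axioms) (auto intro: ring.is_abelian_group)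

definition emb :: "nat => 'a => 'a list" where
 "emb i k = map (%j. if j = i then k else \<zero>\<^bsub>Ls ! j\<^esub>) [0..<n]"

abbreviation e where "e == summand_idem Ls"

lemma emb_nth: "j < n ==> emb i k ! j = (if j = i then k else \<zero>\<^bsub>Ls ! j\<^esub>)"
 by (simp add: emb_def)

lemma emb_closed [simp]: "k : carrier (Ls ! i) ==> emb i k : carrier L"
 by (rule RDirProd_list_carrier_memI) (auto simp: emb_def ring.ring_simprules(2)[OF summand_ring])

lemma e_emb: "i < n ==> e i = emb i \<one>\<^bsub>Ls ! i\<^esub>"
 by (auto simp: summand_idem_def emb_def)

lemma one_closed [simp]: "i < n ==> \<one>\<^bsub>Ls ! i\<^esub> : carrier (Ls ! i)"
 by (rule ring.ring_simprules(6)[OF summand_ring])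

lemma emb_add:
 assumes i: "i < n" and k: "k : carrier (Ls ! i)" "k' : carrier (Ls ! i)"
 shows "emb i (k \<oplus>\<^bsub>Ls ! i\<^esub> k') = emb i k \<oplus>\<^bsub>L\<^esub> emb i k'"
proof -
 have C: "k \<oplus>\<^bsub>Ls ! i\<^esub> k' : carrier (Ls ! i)" using k summand_ring[OF i] by (simp add: ring.ring_simprules)
 show ?thesis
 proof (rule L_ext)
  fix j assume j: "j < n"
  interpret Lj: cring "Ls ! j" by (rule summand_cring[OF j])
  show "emb i (k \<oplus>\<^bsub>Ls ! i\<^esub> k') ! j = (emb i k \<oplus>\<^bsub>L\<^esub> emb i k') ! j"
   using j k by (simp add: nth_add emb_nth)
 qed (use k C in auto)
qed

lemma emb_mult:
 assumes i: "i < n" and k: "k : carrier (Ls ! i)" and l: "l : carrier L"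
 shows "emb i (k \<otimes>\<^bsub>Ls ! i\<^esub> l ! i) = emb i k \<otimes>\<^bsub>L\<^esub> l"
proof -
 have C: "k \<otimes>\<^bsub>Ls ! i\<^esub> l ! i : carrier (Ls ! i)" using k nth_closed[OF l i] summand_ring[OF i] by (simp add: ring.ring_simprules)
 show ?thesis
 proof (rule L_ext)
  fix j assume j: "j < n"
  interpret Lj: cring "Ls ! j" by (rule summand_cring[OF j])
  show "emb i (k \<otimes>\<^bsub>Ls ! i\<^esub> l ! i) ! j = (emb i k \<otimes>\<^bsub>L\<^esub> l) ! j"
   using j k l nth_closed[OF l j] by (simp add: nth_mult emb_nth)
 qed (use k l C in auto)
qed

lemma emb_mult': "i < n ==> k : carrier (Ls ! i) ==> l : carrier L ==> emb i (l ! i \<otimes>\<^bsub>Ls ! i\<^esub> k) = l \<otimes>\<^bsub>L\<^esub> emb i k"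
 using emb_mult[of i k l] cring.cring_simprules(14)[OF summand_cring, of i k "l ! i"] nth_closed
 by (simp add: L.m_comm)

lemma emb_e: "i < n ==> k : carrier (Ls ! i) ==> emb i k \<otimes>\<^bsub>L\<^esub> e i = emb i k"
 using emb_mult[of i k "e i"] ring.ring_simprules(12)[OF summand_ring, of i k]
 by (simp add: e_emb emb_nth monoid.r_one[OF ring.is_monoid[OF summand_ring]])

lemma e_in [simp]: "i < n ==> e i : carrier L"
 by (simp add: e_emb)

lemma e_nth: "i < n ==> j < n ==> e i ! j = (if j = i then \<one>\<^bsub>Ls ! j\<^esub> else \<zero>\<^bsub>Ls ! j\<^esub>)"
 by (auto simp: e_emb emb_nth)

lemma mult_e: "i < n ==> l : carrier L ==> l \<otimes>\<^bsub>L\<^esub> e i = emb i (l ! i)"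
 using emb_mult'[of i "\<one>\<^bsub>Ls ! i\<^esub>" l] nth_closed[of l i] monoid.r_one[OF ring.is_monoid[OF summand_ring]] by (simp add: e_emb)

lemma e_orthogonal:
 assumes "i < n" "j < n" "i ~= j"
 shows "e i \<otimes>\<^bsub>L\<^esub> e j = \<zero>\<^bsub>L\<^esub>"
proof (rule L_ext)
 fix k assume k: "k < n"
 interpret Lk: cring "Ls ! k" by (rule summand_cring[OF k])
 show "(e i \<otimes>\<^bsub>L\<^esub> e j) ! k = \<zero>\<^bsub>L\<^esub> ! k" using assms k by (cases "j = k"; cases "i = k") (simp_all add: nth_mult e_nth nth_zero)
qed (use assms in auto)

lemma e_sum_one: "(\<Oplus>\<^bsub>L\<^esub>i\<in>{..<n}. e i) = \<one>\<^bsub>L\<^esub>"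
proof (rule L_ext)
 fix k assume k: "k < n"
 interpret Lk: cring "Ls ! k" by (rule summand_cring[OF k])
 have "(\<Oplus>\<^bsub>L\<^esub>i\<in>{..<n}. e i) ! k = (\<Oplus>\<^bsub>Ls ! k\<^esub>i\<in>{..<n}. e i ! k)" using k by (intro nth_finsum) auto
 also have "... = e k ! k" using k by (intro Lk.finsum_delta) (auto simp: e_nth)
 finally show "(\<Oplus>\<^bsub>L\<^esub>i\<in>{..<n}. e i) ! k = \<one>\<^bsub>L\<^esub> ! k" using k by (simp add: e_nth nth_one)
qed (auto intro!: L.finsum_closed)

lemma e_field_idem:
 assumes i: "i < n"
 shows "field_idem L (e i)"
 unfolding field_idem_def
proof (intro conjI ballI impI)
 interpret Li: field "Ls ! i" by (rule fields[OF i])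
 show "e i : carrier L" using i by simp
 show "e i \<otimes>\<^bsub>L\<^esub> e i = e i" using emb_e[of i "\<one>\<^bsub>Ls ! i\<^esub>"] i by (simp add: e_emb)
 show "e i ~= \<zero>\<^bsub>L\<^esub>" using e_nth[OF i i] nth_zero[OF i] by auto
 fix b assume b: "b : carrier L" "b \<otimes>\<^bsub>L\<^esub> e i ~= \<zero>\<^bsub>L\<^esub>"
 have "b ! i ~= \<zero>\<^bsub>Ls ! i\<^esub>"
 proof
  assume "b ! i = \<zero>\<^bsub>Ls ! i\<^esub>"
  then have "b \<otimes>\<^bsub>L\<^esub> e i = emb i \<zero>\<^bsub>Ls ! i\<^esub>" using mult_e[OF i b(1)] by simp
  also have "... = \<zero>\<^bsub>L\<^esub>" by (rule L_ext) (auto simp: emb_nth nth_zero)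
  finally show False using b(2) by simp
 qed
 then have u: "b ! i : Units (Ls ! i)" using nth_closed[OF b(1) i] by (simp add: Li.field_Units)
 let ?y = "emb i (inv\<^bsub>Ls ! i\<^esub> (b ! i))"
 have "?y \<otimes>\<^bsub>L\<^esub> b \<otimes>\<^bsub>L\<^esub> e i = emb i (inv\<^bsub>Ls ! i\<^esub> (b ! i) \<otimes>\<^bsub>Ls ! i\<^esub> b ! i) \<otimes>\<^bsub>L\<^esub> e i"
  using emb_mult[OF i _ b(1), of "inv\<^bsub>Ls ! i\<^esub> (b ! i)"] u by simp
 also have "... = e i" using u emb_e[OF i, of "\<one>\<^bsub>Ls ! i\<^esub>"] i by (simp add: e_emb)
 finally show "EX y:carrier L. y \<otimes>\<^bsub>L\<^esub> b \<otimes>\<^bsub>L\<^esub> e i = e i" using u by (intro bexI[of _ ?y]) auto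
qed

lemma summand_comm_bimodule: "i < n ==> comm_bimodule L (summand Ls i)"
 unfolding summand_def by (intro comm_bimodule_via L_cring summand_cring nth_hom)

text \<open>
 Each free vector of the block \<open>(i, j)\<close> generates a copy of \<open>L\<^sub>i \<otimes>\<^sub>Z L\<^sub>j\<close>; the coordinates of \<open>y\<close> in it are
 \<open>\<Sum> phi(y gamma\<^sub>s) \<otimes> beta\<^sub>s\<close>.
\<close>

lemma summand_decomposition:
 assumes framed: "framed_bimodule L P n e V v v' W w w' d T tau D beta gamma m x phi F u f G g omega"
  and M: "!!i j. i < n ==> j < n ==> m i j = M (i, j)" and Zr: "carrier Zr = bimodule_center L P"
 shows "bimodule_isomorphic L L P (bimodule_sum ({..<n} \<times> {..<n})
  (%(i, j). bimodule_power (tensor_product Zr (summand Ls i) (summand Ls j)) (M (i, j))))"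
proof -
 interpret framed_bimodule L P n e V v v' W w w' d T tau D beta gamma m x phi F u f G g omega by (rule framed)
 define K where "K = (SIGMA ij:{..<n} \<times> {..<n}. {..<M ij})"
 have KD: "fst (fst k) < n" "snd (fst k) < n" "snd k < m (fst (fst k)) (snd (fst k))" if "k : K" for k
  using that M by (auto simp: K_def)
 let ?M = "%k :: (nat \<times> nat) \<times> nat. summand Ls (fst (fst k))"
 let ?N = "%k :: (nat \<times> nat) \<times> nat. summand Ls (snd (fst k))"
 define xi where "xi k = x (fst (fst k)) (snd (fst k)) (snd k)" for k :: "(nat \<times> nat) \<times> nat"
 define mu where "mu k y z = emb (fst (fst k)) y \<odot>\<^bsub>P\<^esub> (xi k \<star> emb (snd (fst k)) z)" for k :: "(nat \<times> nat) \<times> nat" and y z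
 define c where "c k s y = phi (fst (fst k)) (snd (fst k)) (snd k) (y \<star> gamma (snd (fst k)) s) ! fst (fst k)" for k :: "(nat \<times> nat) \<times> nat" and s y
 define b where "b k s = beta (snd (fst k)) s ! snd (fst k)" for k :: "(nat \<times> nat) \<times> nat" and s
 have xiC: "xi k : carrier P" if "k : K" for k using KD[OF that] by (simp add: xi_def)
 have phif: "phi (fst (fst k)) (snd (fst k)) (snd k) : duals L P"
  and phiC: "!!y. y : carrier P ==> phi (fst (fst k)) (snd (fst k)) (snd k) y : carrier L" if "k : K" for k
  using freeD(5,8)[OF KD(1,2)[OF that]] KD(3)[OF that] by auto
 have setting: "tensor_setting L (?M k) (?N k) Zr" if "k : K" for k
  using summand_comm_bimodule KD[OF that] ZD(1) Zr
  by (simp add: tensor_setting_def tensor_setting_axioms_def subset_iff)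
 have cval: "phi (fst (fst k)) (snd (fst k)) (snd k) (mu k' y z \<star> gamma (snd (fst k)) s) ! fst (fst k) =
   (if k = k' then y \<otimes>\<^bsub>Ls ! fst (fst k)\<^esub> tau (snd (fst k)) (emb (snd (fst k)) z \<otimes>\<^bsub>L\<^esub> gamma (snd (fst k)) s) ! fst (fst k) else \<zero>\<^bsub>Ls ! fst (fst k)\<^esub>)"
  if k: "k : K" "k' : K" and y: "y : carrier (?M k')" and z: "z : carrier (?N k')" and s: "s < D (snd (fst k))" for k k' y z s
 proof -
  obtain i j a where k': "k = ((i, j), a)" by (metis prod.collapse)
  obtain i' j' a' where k'': "k' = ((i', j'), a')" by (metis prod.collapse)
  note KD = KD[OF k(1), unfolded k' fst_conv snd_conv] KD[OF k(2), unfolded k'' fst_conv snd_conv]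
  have y: "y : carrier (Ls ! i')" and z: "z : carrier (Ls ! j')" using y z by (simp_all add: k'' summand_def)
  have s: "s < D j" using s by (simp add: k')
  interpret Li: cring "Ls ! i" by (rule summand_cring[OF KD(1)])
  define l where "l = emb j' z \<otimes>\<^bsub>L\<^esub> gamma j s"
  have l: "l : carrier L" "l \<otimes>\<^bsub>L\<^esub> e j = l"
   using z s KD gamma_e[OF KD(2) s] by (auto simp: l_def L.m_assoc)
  have "mu k' y z \<star> gamma j s = emb i' y \<odot>\<^bsub>P\<^esub> (x i' j' a' \<star> l)"
   using y z s KD by (simp add: mu_def xi_def k'' l_def rs_ls rs_assoc)
  then have "phi i j a (mu k' y z \<star> gamma j s) = emb i' y \<otimes>\<^bsub>L\<^esub> phi i j a (x i' j' a' \<star> l)"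
   using dualsD(3)[OF phif[OF k(1), unfolded k' fst_conv snd_conv], of "emb i' y" "x i' j' a' \<star> l"] y l KD by simp
  also have "... = emb i' y \<otimes>\<^bsub>L\<^esub> (if i = i' & j = j' & a = a' then e i \<otimes>\<^bsub>L\<^esub> tau j l else \<zero>\<^bsub>L\<^esub>)"
   using free_vectors_dual[OF KD l] by simp
  finally have val: "phi i j a (mu k' y z \<star> gamma j s) = (if k = k' then emb i y \<otimes>\<^bsub>L\<^esub> tau j l else \<zero>\<^bsub>L\<^esub>)"
   using y l KD emb_e[OF KD(1), of y] by (auto simp: k' k'' L.m_assoc[symmetric])
  show ?thesis
   using val y z l KD nth_closed[OF trace_closed[OF KD(2) l(1)] KD(1)]
   by (auto simp: k' k'' nth_zero nth_mult emb_nth l_def)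
 qed
 have "bimodule_isomorphic L L P (bimodule_sum K (%k. tensor_product Zr (?M k) (?N k)))"
 proof (rule tensor_decomposition[where mu = mu and c = c and b = b and I = "%k. {..<D (snd (fst k))}"])
  show "finite K" by (simp add: K_def)
  show "tensor_setting L (?M k) (?N k) Zr" if "k : K" for k by (rule setting[OF that])
  show "finite {..<D (snd (fst k))}" for k :: "(nat \<times> nat) \<times> nat" by simp
 next
  fix k y z assume k: "k : K" and "y : carrier (?M k)" "z : carrier (?N k)"
  then have y: "y : carrier (Ls ! fst (fst k))" and z: "z : carrier (Ls ! snd (fst k))" by (simp_all add: summand_def)
  show "mu k y z : carrier P" using k y z xiC by (simp add: mu_def)
  show "mu k (y \<oplus>\<^bsub>?M k\<^esub> y') z = mu k y z \<oplus>\<^bsub>P\<^esub> mu k y' z" if "y' : carrier (?M k)" for y'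
   using that k y z xiC KD by (simp add: mu_def summand_def emb_add l.smult_l_distr)
  show "mu k y (z \<oplus>\<^bsub>?N k\<^esub> z') = mu k y z \<oplus>\<^bsub>P\<^esub> mu k y z'" if "z' : carrier (?N k)" for z'
   using that k y z xiC KD by (simp add: mu_def summand_def emb_add rs_distr l.smult_r_distr)
  show "mu k (rsmult (?M k) y s) z = mu k y (s \<odot>\<^bsub>?N k\<^esub> z)" if "s : carrier Zr" for s
  proof -
   have s: "s : carrier L" "s : Z" using that Zr ZD(1) by auto
   show ?thesis using s k y z xiC KD
    by (simp add: mu_def summand_def emb_mult emb_mult' l.smult_assoc1 rs_central)
  qed
  show "mu k (l \<odot>\<^bsub>?M k\<^esub> y) z = l \<odot>\<^bsub>P\<^esub> mu k y z" if "l : carrier L" for l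
   using that k y z xiC KD by (simp add: mu_def summand_def emb_mult' l.smult_assoc1)
  show "mu k y (rsmult (?N k) z l) = mu k y z \<star> l" if "l : carrier L" for l
   using that k y z xiC KD by (simp add: mu_def summand_def emb_mult rs_assoc rs_ls)
 next
  fix k s assume "k : K" "s : {..<D (snd (fst k))}"
  then show "b k s : carrier (?N k)" using KD by (simp add: b_def summand_def nth_closed)
 next
  fix k s y assume "k : K" "s : {..<D (snd (fst k))}" "y : carrier P"
  then show "c k s y : carrier (?M k)" using KD phiC by (simp add: c_def summand_def nth_closed)
 next
  fix k s y y' assume "k : K" "s : {..<D (snd (fst k))}" "y : carrier P" "y' : carrier P"
  then show "c k s (y \<oplus>\<^bsub>P\<^esub> y') = c k s y \<oplus>\<^bsub>?M k\<^esub> c k s y'"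
   using KD phiC dualsD(2)[OF phif] by (simp add: c_def summand_def rs_add nth_add)
 next
  fix y assume y: "y : carrier P"
  define t where "t k s = phi (fst (fst k)) (snd (fst k)) (snd k) (y \<star> gamma (snd (fst k)) s) \<odot>\<^bsub>P\<^esub> (xi k \<star> beta (snd (fst k)) s)"
   for k :: "(nat \<times> nat) \<times> nat" and s
  have tC: "t k s : carrier P" if "k : K" "s < D (snd (fst k))" for k s
   using that phiC[OF that(1)] xiC[OF that(1)] KD[OF that(1)] y by (simp add: t_def)
  have "mu k (c k s y) (b k s) = t k s" if k: "k : K" and s: "s < D (snd (fst k))" for k s
  proof -
   let ?i = "fst (fst k)" and ?j = "snd (fst k)" and ?a = "snd k"
   note KD = KD[OF k]
   have p: "phi ?i ?j ?a (y \<star> gamma ?j s) : carrier L" using phiC[OF k] y s KD by simp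
   have "emb ?i (c k s y) = phi ?i ?j ?a (y \<star> gamma ?j s)"
    using mult_e[OF KD(1) p] freeD(6)[OF KD(1,2), of ?a "y \<star> gamma ?j s"] KD s y p by (simp add: c_def L.m_comm)
   moreover have "emb ?j (b k s) = beta ?j s" using mult_e[OF KD(2), of "beta ?j s"] beta_e[OF KD(2) s] KD s by (simp add: b_def)
   ultimately show ?thesis by (simp add: mu_def t_def)
  qed
  then have "(\<Oplus>\<^bsub>P\<^esub>k\<in>K. \<Oplus>\<^bsub>P\<^esub>s\<in>{..<D (snd (fst k))}. mu k (c k s y) (b k s)) = (\<Oplus>\<^bsub>P\<^esub>k\<in>K. \<Oplus>\<^bsub>P\<^esub>s\<in>{..<D (snd (fst k))}. t k s)"
   by (intro l.M.finsum_cong' refl) (use tC in "auto intro!: l.M.finsum_closed l.M.finsum_cong'")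
  also have "... = (\<Oplus>\<^bsub>P\<^esub>ij\<in>{..<n} \<times> {..<n}. \<Oplus>\<^bsub>P\<^esub>a\<in>{..<M ij}. \<Oplus>\<^bsub>P\<^esub>s\<in>{..<D (snd ij)}. t (ij, a) s)"
  proof -
   have "(\<Oplus>\<^bsub>P\<^esub>k\<in>K. \<Oplus>\<^bsub>P\<^esub>s\<in>{..<D (snd (fst k))}. t k s) =
     (\<Oplus>\<^bsub>P\<^esub>ij\<in>{..<n} \<times> {..<n}. \<Oplus>\<^bsub>P\<^esub>a\<in>{..<M ij}. \<Oplus>\<^bsub>P\<^esub>s\<in>{..<D (snd (fst (ij, a)))}. t (ij, a) s)"
    unfolding K_def by (rule l.M.finsum_Sigma) (use tC in "auto simp: K_def intro!: l.M.finsum_closed")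
   then show ?thesis by simp
  qed
  also have "... = (\<Oplus>\<^bsub>P\<^esub>i\<in>{..<n}. \<Oplus>\<^bsub>P\<^esub>j\<in>{..<n}. \<Oplus>\<^bsub>P\<^esub>a\<in>{..<M (i, j)}. \<Oplus>\<^bsub>P\<^esub>s\<in>{..<D (snd (i, j))}. t ((i, j), a) s)"
   by (rule l.M.finsum_Sigma) (use tC in "auto simp: K_def intro!: l.M.finsum_closed")
  also have "... = (\<Oplus>\<^bsub>P\<^esub>i\<in>{..<n}. \<Oplus>\<^bsub>P\<^esub>j\<in>{..<n}. \<Oplus>\<^bsub>P\<^esub>a\<in>{..<m i j}. \<Oplus>\<^bsub>P\<^esub>s\<in>{..<D j}. t ((i, j), a) s)"
   by (rule l.M.finsum_cong') (use tC M in "auto simp: K_def intro!: l.M.finsum_closed l.M.finsum_cong'")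
  also have "... = y" using full_expand[OF y] by (simp add: t_def xi_def)
  finally show "(\<Oplus>\<^bsub>P\<^esub>k\<in>K. \<Oplus>\<^bsub>P\<^esub>s\<in>{..<D (snd (fst k))}. mu k (c k s y) (b k s)) = y" .
 next
  fix k k' y z assume k: "k : K" "k' : K" and y: "y : carrier (?M k')" and z: "z : carrier (?N k')"
  let ?j = "snd (fst k)"
  note KD = KD[OF k(1)]
  interpret t: tensor_setting L "?M k" "?N k" Zr by (rule setting[OF k(1)])
  interpret Li: cring "Ls ! fst (fst k)" by (rule summand_cring[OF KD(1)])
  interpret Lj: cring "Ls ! ?j" by (rule summand_cring[OF KD(2)])
  have bC: "b k s : carrier (?N k)" if "s : {..<D ?j}" for s using that KD by (simp add: b_def summand_def nth_closed)
  show "(\<Oplus>\<^bsub>t.Q\<^esub>s\<in>{..<D ?j}. t.pure (c k s (mu k' y z)) (b k s)) = (if k = k' then t.pure y z else \<zero>\<^bsub>t.Q\<^esub>)"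
  proof (cases "k = k'")
   case True
   have yz: "y : carrier (?M k)" "z : carrier (Ls ! ?j)" using y z True by (auto simp: summand_def)
   define zeta where "zeta s = tau ?j (emb ?j z \<otimes>\<^bsub>L\<^esub> gamma ?j s)" for s
   have zeta: "zeta s : carrier L" "zeta s : carrier Zr" if "s < D ?j" for s
    using that yz KD trace_Z[OF KD(2)] by (auto simp: zeta_def Zr)
   have "(\<Oplus>\<^bsub>?N k\<^esub>s\<in>{..<D ?j}. zeta s \<odot>\<^bsub>?N k\<^esub> b k s) = (\<Oplus>\<^bsub>Ls ! ?j\<^esub>s\<in>{..<D ?j}. (zeta s \<otimes>\<^bsub>L\<^esub> beta ?j s) ! ?j)"
   proof -
    have "(\<Oplus>\<^bsub>Ls ! ?j\<^esub>s\<in>{..<D ?j}. (zeta s \<otimes>\<^bsub>L\<^esub> beta ?j s) ! ?j) = (\<Oplus>\<^bsub>?N k\<^esub>s\<in>{..<D ?j}. (zeta s \<otimes>\<^bsub>L\<^esub> beta ?j s) ! ?j)"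
     unfolding summand_def using zeta KD t.N.l.M.abelian_group_axioms
     by (intro finsum_bimodule_via[symmetric]) (auto intro!: nth_closed simp: summand_def Lj.abelian_group_axioms)
    also have "... = (\<Oplus>\<^bsub>?N k\<^esub>s\<in>{..<D ?j}. zeta s \<odot>\<^bsub>?N k\<^esub> b k s)"
     by (rule t.N.l.M.finsum_cong') (use zeta KD in "auto simp: summand_def b_def nth_mult nth_closed")
    finally show ?thesis by simp
   qed
   also have "... = (\<Oplus>\<^bsub>L\<^esub>s\<in>{..<D ?j}. zeta s \<otimes>\<^bsub>L\<^esub> beta ?j s) ! ?j"
    using zeta KD by (intro nth_finsum[symmetric]) auto
   also have "(\<Oplus>\<^bsub>L\<^esub>s\<in>{..<D ?j}. zeta s \<otimes>\<^bsub>L\<^esub> beta ?j s) = emb ?j z \<otimes>\<^bsub>L\<^esub> e ?j"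
    unfolding zeta_def using expand_beta[OF KD(2), of "emb ?j z"] yz by simp
   also have "... ! ?j = z" using emb_e[OF KD(2) yz(2)] KD by (simp add: emb_nth)
   finally have "(\<Oplus>\<^bsub>?N k\<^esub>s\<in>{..<D ?j}. zeta s \<odot>\<^bsub>?N k\<^esub> b k s) = z" .
   moreover have "c k s (mu k' y z) = rsmult (?M k) y (zeta s)" if "s : {..<D ?j}" for s
    using cval[OF k y z, of s] that True by (simp add: c_def summand_def zeta_def)
   ultimately have "(\<Oplus>\<^bsub>t.Q\<^esub>s\<in>{..<D ?j}. t.pure (c k s (mu k' y z)) (b k s)) = t.pure y z"
    using yz(1) zeta bC by (intro t.pure_expand_right[where z = zeta]) auto
   then show ?thesis using True by simp
  next
   case False
   have "c k s (mu k' y z) = \<zero>\<^bsub>?M k\<^esub>" if "s : {..<D ?j}" for s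
    using cval[OF k y z, of s] that False by (simp add: c_def summand_def)
   then have "(\<Oplus>\<^bsub>t.Q\<^esub>s\<in>{..<D ?j}. t.pure (c k s (mu k' y z)) (b k s)) = \<zero>\<^bsub>t.Q\<^esub>"
    using bC by (intro t.pure_zero_sum)
   then show ?thesis using False by simp
  qed
 qed
 moreover have "(%k. tensor_product Zr (?M k) (?N k)) = (%(ij, a). (%(i, j). tensor_product Zr (summand Ls i) (summand Ls j)) ij)"
  by (auto simp: fun_eq_iff)
 ultimately have "bimodule_isomorphic L L P (bimodule_sum ({..<n} \<times> {..<n})
   (%ij. bimodule_power ((%(i, j). tensor_product Zr (summand Ls i) (summand Ls j)) ij) (M ij)))"
  unfolding K_def by (intro bimodule_isomorphic_sum_power) simp
 then show ?thesis by (simp add: case_prod_unfold)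
qed

end

section \<open>The structure theorem\<close>

text \<open>A set of vertices that no arc enters or leaves is a union of components.\<close>

lemma connected_closed_set:
 assumes conn: "Digraph_Component.connected G" and S: "S \<subseteq> verts G" "S ~= {}"
  and arcs: "!!a. a : arcs G ==> tail G a : S \<longleftrightarrow> head G a : S"
 shows "S = verts G"
proof
 obtain s where s: "s : S" using S(2) by blast
 show "verts G \<subseteq> S"
 proof
  fix y assume y: "y : verts G"
  have "(s, y) : rtrancl_on (verts G) (parcs (mk_symmetric G))"
   using conn y s S(1) by (auto simp: Digraph_Component.connected_def strongly_connected_def reachable_def)
  then show "y : S"
  proof (induction rule: rtrancl_on_induct)
   case (step y z)
   then show ?case using arcs by (auto simp: parcs_mk_symmetric)
  qed (rule s)
 qed
qed (rule S(1))

lemma module_isomorphic_right_sum: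
 assumes iso: "module_isomorphic L M (right_module (bimodule_sum I (%r. bimodule_via (\<pi> r) (B r))))"
  and B: "!!r. r : I ==> cring (B r)" and \<pi>: "!!r l. r : I ==> l : carrier L ==> \<pi> r l : carrier (B r)"
 shows "module_isomorphic L M (bimodule_sum I (%r. bimodule_via (\<pi> r) (B r)))"
proof -
 let ?S = "bimodule_sum I (%r. bimodule_via (\<pi> r) (B r))"
 obtain f where f: "f : iso (add_monoid M) (add_monoid (right_module ?S))"
  and fl: "ALL l:carrier L. ALL x:carrier M. f (l \<odot>\<^bsub>M\<^esub> x) = rsmult ?S (f x) l"
  using iso by (auto simp: module_isomorphic_def)
 have f': "f : iso (add_monoid M) (add_monoid ?S)" using f by (simp add: iso_def hom_def)
 have fC: "f x r : carrier (B r)" if "x : carrier M" "r : I" for x r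
  using f' that by (auto simp: iso_def hom_def PiE_iff Pi_iff)
 have "f (l \<odot>\<^bsub>M\<^esub> x) = l \<odot>\<^bsub>?S\<^esub> f x" if "l : carrier L" "x : carrier M" for l x
  using fl that fC \<pi> B by (auto simp: cring.cring_simprules(14))
 then show ?thesis using f' unfolding module_isomorphic_def by blast
qed

context field_sum
begin

text \<open>The last clause records that a summand with positive exponent is visible in \<open>M\<close>.\<close>

lemma multi_power_basis:
 assumes M: "module L M" and iso: "module_isomorphic L M (multi_power Ls p)"
 shows "EX v v'. (ALL r:(SIGMA i:{..<n}. {..<p i}). v r : carrier M & v' r : duals L M) &
  (ALL y:carrier M. y = (\<Oplus>\<^bsub>M\<^esub>r\<in>(SIGMA i:{..<n}. {..<p i}). v' r y \<odot>\<^bsub>M\<^esub> v r)) &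
  (ALL i<n. 0 < p i --> (EX y:carrier M. e i \<odot>\<^bsub>M\<^esub> y ~= \<zero>\<^bsub>M\<^esub>))"
proof -
 interpret module L M by (rule M)
 let ?I = "SIGMA i:{..<n}. {..<p i}"
 have eq: "multi_power Ls p = bimodule_sum ?I (%r. bimodule_via (%z. z ! fst r) (Ls ! fst r))"
  by (simp add: multi_power_def summand_def case_prod_unfold)
 have "EX v v'. (ALL r:?I. v r : carrier M & v' r : duals L M) &
  (ALL y:carrier M. y = (\<Oplus>\<^bsub>M\<^esub>r\<in>?I. v' r y \<odot>\<^bsub>M\<^esub> v r)) &
  (ALL r:?I. ALL s:?I. v' r (v s) = (if r = s then emb (fst r) \<one>\<^bsub>Ls ! fst r\<^esub> else \<zero>\<^bsub>L\<^esub>))"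
  by (rule projective_basis_of_isomorphism[OF M _ iso[unfolded eq]])
   (auto simp: summand_ring nth_closed emb_nth emb_add emb_mult')
 then obtain v v' where v: "ALL r:?I. v r : carrier M & v' r : duals L M"
  and exp: "ALL y:carrier M. y = (\<Oplus>\<^bsub>M\<^esub>r\<in>?I. v' r y \<odot>\<^bsub>M\<^esub> v r)"
  and dual: "ALL r:?I. ALL s:?I. v' r (v s) = (if r = s then emb (fst r) \<one>\<^bsub>Ls ! fst r\<^esub> else \<zero>\<^bsub>L\<^esub>)"
  by blast
 have "EX y:carrier M. e i \<odot>\<^bsub>M\<^esub> y ~= \<zero>\<^bsub>M\<^esub>" if i: "i < n" and p: "0 < p i" for i
 proof (intro bexI notI)
  have r: "(i, 0) : ?I" using i p by simp
  show "v (i, 0) : carrier M" using v r by blast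
  assume "e i \<odot>\<^bsub>M\<^esub> v (i, 0) = \<zero>\<^bsub>M\<^esub>"
  then have "\<zero>\<^bsub>L\<^esub> = v' (i, 0) (e i \<odot>\<^bsub>M\<^esub> v (i, 0))" using functional_zero v r by metis
  also have "... = e i \<otimes>\<^bsub>L\<^esub> v' (i, 0) (v (i, 0))"
   using dualsD(3)[of "v' (i, 0)" L M "e i" "v (i, 0)"] v r i by simp
  also have "... = e i" using dual r i e_field_idem[OF i] by (simp add: e_emb field_idem_def)
  finally show False using e_field_idem[OF i] by (simp add: field_idem_def)
 qed
 then show ?thesis using v exp by blast
qed

lemma free_basis:
 assumes M: "module L M" and iso: "module_isomorphic L M (bimodule_power (bimodule_via id L) c)"
 shows "EX v v'. (ALL r:{..<c}. v r : carrier M & v' r : duals L M) &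
  (ALL y:carrier M. y = (\<Oplus>\<^bsub>M\<^esub>r\<in>{..<c}. v' r y \<odot>\<^bsub>M\<^esub> v r)) &
  (ALL r:{..<c}. ALL s:{..<c}. v' r (v s) = (if r = s then \<one>\<^bsub>L\<^esub> else \<zero>\<^bsub>L\<^esub>))"
 by (rule projective_basis_of_isomorphism[where \<pi> = "%_. id" and B = "%_. L" and epsilon = "%_. id", OF M finite_lessThan
   iso[unfolded bimodule_power_def], unfolded id_apply]) (use L_ring in auto)

text \<open>
 The module isomorphisms provide projective bases on both sides, the tensor square isomorphism the components \<open>T\<close>, and
 connectedness of the incidence graph rules out proper sets of indices closed under nonzero blocks.
\<close>

lemma framed_bimodule_of_quasi_galois:
 fixes P :: "('a list, 'a list, 'p) bimodule"
 assumes quasi: "quasi_galois Ls d p q P" and conn: "connected_bimodule Ls P"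
  and pos: "ALL i<n. 0 < p i & 0 < q i"
 shows "EX (V :: (nat \<times> nat) set) v v' (W :: (nat \<times> nat) set) w w' T tau D beta gamma m x phi F u f G g omega.
  framed_bimodule L P n e V v v' W w w' d T tau D beta gamma m x phi F u f G g omega"
proof -
 have bim: "bimodule L L P" and left_iso: "module_isomorphic L P (multi_power Ls p)"
  and right_iso: "module_isomorphic L (right_module P) (right_module (multi_power Ls q))"
  and tensor_iso: "bimodule_isomorphic L L (tensor_product L P P) (bimodule_power P d)"
  using quasi by (auto simp: quasi_galois_def Let_def)
 interpret comm_bimodule L P
  using bim by (auto simp: bimodule_def comm_bimodule_def comm_bimodule_axioms_def)
 let ?V = "SIGMA i:{..<n}. {..<p i}" and ?W = "SIGMA i:{..<n}. {..<q i}"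
 have "module_isomorphic L (right_module P) (multi_power Ls q)"
  using module_isomorphic_right_sum[of L "right_module P" ?W "%r z. z ! fst r" "%r. Ls ! fst r"] right_iso
  by (auto simp: multi_power_def summand_def case_prod_unfold summand_cring nth_closed)
 from multi_power_basis[OF r.module_axioms this] obtain w w' where
  w: "ALL r:?W. w r : carrier P & w' r : duals L (right_module P)"
  and w_exp: "ALL y:carrier P. y = (\<Oplus>\<^bsub>P\<^esub>r\<in>?W. w r \<star> w' r y)"
  and col: "ALL i<n. 0 < q i --> (EX y:carrier P. y \<star> e i ~= \<zero>\<^bsub>P\<^esub>)" by auto
 from multi_power_basis[OF l.module_axioms left_iso] obtain v v' where
  v: "ALL r:?V. v r : carrier P & v' r : duals L P"
  and v_exp: "ALL y:carrier P. y = (\<Oplus>\<^bsub>P\<^esub>r\<in>?V. v' r y \<odot>\<^bsub>P\<^esub> v r)"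
  and row: "ALL i<n. 0 < p i --> (EX y:carrier P. e i \<odot>\<^bsub>P\<^esub> y ~= \<zero>\<^bsub>P\<^esub>)" by auto
 have split: "split_bimodule L P n e ?V v v' ?W w w'"
 proof unfold_locales
  show "field_idem L (e i)" if "i < n" for i using e_field_idem[OF that] .
  show "e i \<otimes>\<^bsub>L\<^esub> e j = \<zero>\<^bsub>L\<^esub>" if "i < n" "j < n" "i ~= j" for i j using e_orthogonal[OF that] .
  show "(\<Oplus>\<^bsub>L\<^esub>i\<in>{..<n}. e i) = \<one>\<^bsub>L\<^esub>" by (rule e_sum_one)
  show "finite ?V" "finite ?W" by auto
  show "v r : carrier P" "v' r : duals L P" if "r : ?V" for r using v that by auto
  show "w r : carrier P" "w' r : duals L (right_module P)" if "r : ?W" for r using w that by auto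
  show "y = (\<Oplus>\<^bsub>P\<^esub>r\<in>?V. v' r y \<odot>\<^bsub>P\<^esub> v r)" if "y : carrier P" for y using v_exp that by blast
  show "y = (\<Oplus>\<^bsub>P\<^esub>r\<in>?W. w r \<star> w' r y)" if "y : carrier P" for y using w_exp that by blast
 qed
 obtain T where T1: "ALL t<d. ALL x:carrier P. ALL y:carrier P. T t x y : carrier P"
  and T2: "ALL t<d. ALL x:carrier P. ALL x':carrier P. ALL y:carrier P. T t (x \<oplus>\<^bsub>P\<^esub> x') y = T t x y \<oplus>\<^bsub>P\<^esub> T t x' y"
  and T3: "ALL t<d. ALL x:carrier P. ALL y:carrier P. ALL y':carrier P. T t x (y \<oplus>\<^bsub>P\<^esub> y') = T t x y \<oplus>\<^bsub>P\<^esub> T t x y'"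
  and T4: "ALL t<d. ALL l:carrier L. ALL x:carrier P. ALL y:carrier P. T t (l \<odot>\<^bsub>P\<^esub> x) y = l \<odot>\<^bsub>P\<^esub> T t x y &
   T t x (y \<star> l) = T t x y \<star> l & T t (x \<star> l) y = T t x (l \<odot>\<^bsub>P\<^esub> y)"
  and T5: "ALL B. balanced B --> (EX chi. (ALL t<d. chi t : duals L P) &
   (ALL x:carrier P. ALL y:carrier P. B x y = (\<Oplus>\<^bsub>L\<^esub>t\<in>{..<d}. chi t (T t x y))))"
  and T6: "ALL chi. (ALL t<d. chi t : duals L P) -->
   (ALL x:carrier P. ALL y:carrier P. (\<Oplus>\<^bsub>L\<^esub>t\<in>{..<d}. chi t (T t x y)) = \<zero>\<^bsub>L\<^esub>) --> (ALL t<d. ALL x:carrier P. chi t x = \<zero>\<^bsub>L\<^esub>)"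
  using tensor_components[OF tensor_iso] by (elim exE conjE) rule
 have quasi': "quasi_galois_bimodule L P n e ?V v v' ?W w w' d T"
  unfolding quasi_galois_bimodule_def quasi_galois_bimodule_axioms_def
  by (intro conjI split allI impI) (use T1 T2 T3 T4 T5 T6 in "simp_all")
 interpret quasi_galois_bimodule L P n e ?V v v' ?W w w' d T by (rule quasi')
 have block: "block Ls P i j = {\<zero>\<^bsub>P\<^esub>} \<longleftrightarrow> (ALL y:carrier P. e i \<odot>\<^bsub>P\<^esub> (y \<star> e j) = \<zero>\<^bsub>P\<^esub>)" if "i < n" "j < n" for i j
 proof -
  have "block Ls P i j = (%y. e i \<odot>\<^bsub>P\<^esub> (y \<star> e j)) ` carrier P"
   unfolding block_def using that by (intro image_cong refl rs_ls) auto
  moreover have "carrier P ~= {}" using l.M.zero_closed by blast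
  ultimately show ?thesis by (auto simp: image_constant_conv)
 qed
 have "connected_quasi_galois_bimodule L P n e ?V v v' ?W w w' d T"
 proof (unfold_locales, rule connected_blocks_nonzero)
  show "EX x:carrier P. e i \<odot>\<^bsub>P\<^esub> x ~= \<zero>\<^bsub>P\<^esub>" if "i < n" for i using row pos that by blast
  show "EX x:carrier P. x \<star> e k ~= \<zero>\<^bsub>P\<^esub>" if "k < n" for k using col pos that by blast
  fix S assume S: "S \<subseteq> {..<n}" "S ~= {}" and 0: "!!i j y. [|i : S; j < n; j \<notin> S; y : carrier P|] ==>
    e i \<odot>\<^bsub>P\<^esub> (y \<star> e j) = \<zero>\<^bsub>P\<^esub> & e j \<odot>\<^bsub>P\<^esub> (y \<star> e i) = \<zero>\<^bsub>P\<^esub>"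
  have "S = verts (incidence_graph Ls P)"
  proof (rule connected_closed_set)
   show "Digraph_Component.connected (incidence_graph Ls P)" using conn by (simp add: connected_bimodule_def)
   fix a assume "a : arcs (incidence_graph Ls P)"
   then obtain i j where a: "a = (i, j)" "i < n" "j < n" "block Ls P j i ~= {\<zero>\<^bsub>P\<^esub>}" by (auto simp: incidence_graph_def)
   then have "i : S \<longleftrightarrow> j : S" using 0[of i j] 0[of j i] block[of j i] by blast
   then show "tail (incidence_graph Ls P) a : S \<longleftrightarrow> head (incidence_graph Ls P) a : S"
    by (simp add: incidence_graph_def a)
  qed (use S in "auto simp: incidence_graph_def")
  then show "S = {..<n}" by (simp add: incidence_graph_def)
 qed
 then interpret connected_quasi_galois_bimodule L P n e ?V v v' ?W w w' d T .
 have "ALL j. EX tau D beta gamma. j < n --> trace_form j tau D beta gamma"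
  using trace_form_exists by blast
 then have "EX tau D beta gamma. ALL j. j < n --> trace_form j (tau j) (D j) (beta j) (gamma j)"
  unfolding choice_iff .
 then obtain tau D beta gamma where tr: "ALL j. j < n --> trace_form j (tau j) (D j) (beta j) (gamma j)" by (elim exE)
 interpret traced_bimodule L P n e ?V v v' ?W w w' d T tau D beta gamma
  by unfold_locales (use tr in blast)
 obtain m x phi F u f G g omega where "framed_bimodule L P n e ?V v v' ?W w w' d T tau D beta gamma m x phi F u f G g omega"
  using framed_bimodule_exists by (elim exE)
 then show ?thesis by (intro exI)
qed

text \<open>
 The trace dual basis \<open>beta i\<close> of \<open>e\<^sub>i L\<close> is a basis of \<open>L\<^sub>i\<close> over the image of the center: \<open>gamma\<close> separates its vectors,
 and the coordinates are traces.
\<close>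

lemma center_field:
 fixes Zr :: "'a list ring"
 assumes framed: "framed_bimodule L P n e V v v' W w w' d T tau D beta gamma m x phi F u f G g omega" and n: "0 < n"
  and Zr: "Zr = L\<lparr>carrier := bimodule_center L P\<rparr>"
 shows "field Zr"
  and "i < n ==> (%z. z ! i) : ring_hom Zr (Ls ! i) & inj_on (%z. z ! i) (carrier Zr) &
   ring.dimension (Ls ! i) (D i) ((%z. z ! i) ` carrier Zr) (carrier (Ls ! i))"
proof -
 interpret framed_bimodule L P n e V v v' W w w' d T tau D beta gamma m x phi F u f G g omega by (rule framed)
 have ZC: "Z \<subseteq> carrier L" using ZD(1) by blast
 have "subring Z L"
  using ZC Z_one Z_minus Z_mult Z_add by (intro L.subringI) auto
 then have cring: "cring Zr"
  using L.subcringI' L.subcring_iff[OF ZC] Zr by simp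
 interpret Zr: cring Zr by (rule cring)
 have one: "\<one>\<^bsub>L\<^esub> ~= \<zero>\<^bsub>L\<^esub>" using e_nonzero[OF n] L.r_one[OF e_in[OF n]] L.r_null[OF e_in[OF n]] by auto
 show "field Zr"
 proof (rule Zr.cring_fieldI)
  have "z : Units Zr" if "z : Z" "z ~= \<zero>\<^bsub>L\<^esub>" for z
   using Z_inverse[OF that] that ZD(1) by (auto simp: Units_def Zr L.m_comm)
  moreover have "\<zero>\<^bsub>L\<^esub> \<notin> Units Zr" using one ZD(1) by (auto simp: Units_def Zr)
  ultimately show "Units Zr = carrier Zr - {\<zero>\<^bsub>Zr\<^esub>}" by (auto simp: Units_def Zr)
 qed
 assume i: "i < n"
 interpret Li: field "Ls ! i" by (rule fields[OF i])
 have hom: "(%z. z ! i) : ring_hom Zr (Ls ! i)"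
  by (intro ring_hom_memI) (use i in "auto simp: Zr nth_mult nth_add nth_one nth_closed ZD(1)")
 have eq0: "z = \<zero>\<^bsub>L\<^esub>" if z: "z : Z" "z ! i = \<zero>\<^bsub>Ls ! i\<^esub>" for z
 proof (rule ccontr)
  assume "z ~= \<zero>\<^bsub>L\<^esub>"
  then obtain w where w: "w : Z" "w \<otimes>\<^bsub>L\<^esub> z = \<one>\<^bsub>L\<^esub>" using Z_inverse[OF z(1)] by blast
  have "(w \<otimes>\<^bsub>L\<^esub> z) ! i = \<zero>\<^bsub>Ls ! i\<^esub>" using nth_mult[OF ZD(1)[OF w(1)] ZD(1)[OF z(1)] i] z(2) nth_closed[OF ZD(1)[OF w(1)] i] by simp
  then show False using w(2) nth_one[OF i] by simp
 qed
 have inj: "inj_on (%z. z ! i) (carrier Zr)"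
 proof (rule inj_onI)
  fix z z' assume zz: "z : carrier Zr" "z' : carrier Zr" "z ! i = z' ! i"
  then have z: "z : Z" "z' : Z" by (auto simp: Zr)
  have m: "z \<ominus>\<^bsub>L\<^esub> z' : Z" using z Z_add[OF z(1) Z_minus[OF z(2)]] by (simp add: a_minus_def)
  have C: "z : carrier L" "z' : carrier L" "z \<ominus>\<^bsub>L\<^esub> z' : carrier L" using z m ZD(1) by auto
  have "(z \<ominus>\<^bsub>L\<^esub> z' \<oplus>\<^bsub>L\<^esub> z') ! i = z ! i" using C by (simp add: a_minus_def L.a_assoc L.l_neg)
  then have "(z \<ominus>\<^bsub>L\<^esub> z') ! i \<oplus>\<^bsub>Ls ! i\<^esub> z' ! i = z' ! i" using nth_add[OF C(3,2) i] zz(3) by simp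
  then have "(z \<ominus>\<^bsub>L\<^esub> z') ! i = \<zero>\<^bsub>Ls ! i\<^esub>"
   using Li.add.r_cancel_one[of "z' ! i" "(z \<ominus>\<^bsub>L\<^esub> z') ! i"] nth_closed[OF C(3) i] nth_closed[OF C(2) i] by auto
  then have "z \<ominus>\<^bsub>L\<^esub> z' = \<zero>\<^bsub>L\<^esub>" by (rule eq0[OF m])
  then show "z = z'" by (rule L.eq_if_minus_zero[OF _ C(1,2)])
 qed
 have sum: "(\<Oplus>\<^bsub>Ls ! i\<^esub>s\<in>{..<t}. z s ! i \<otimes>\<^bsub>Ls ! i\<^esub> beta i s ! i) = (\<Oplus>\<^bsub>L\<^esub>s\<in>{..<t}. z s \<otimes>\<^bsub>L\<^esub> beta i s) ! i"
  if "ALL s<t. z s : Z" "t <= D i" for z t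
 proof -
  have C: "z s : carrier L" "beta i s : carrier L" if "s < t" for s using that `ALL s<t. z s : Z` `t <= D i` i ZD(1) by auto
  have "(\<Oplus>\<^bsub>L\<^esub>s\<in>{..<t}. z s \<otimes>\<^bsub>L\<^esub> beta i s) ! i = (\<Oplus>\<^bsub>Ls ! i\<^esub>s\<in>{..<t}. (z s \<otimes>\<^bsub>L\<^esub> beta i s) ! i)"
   using C i by (intro nth_finsum) auto
  also have "... = (\<Oplus>\<^bsub>Ls ! i\<^esub>s\<in>{..<t}. z s ! i \<otimes>\<^bsub>Ls ! i\<^esub> beta i s ! i)"
   using C i by (intro Li.finsum_cong') (auto simp: nth_mult nth_closed)
  finally show ?thesis by simp
 qed
 let ?K = "(%z. z ! i) ` carrier Zr"
 have K: "?K \<subseteq> carrier (Ls ! i)" using ZC i by (auto simp: Zr nth_closed)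
 have lift: "EX z. ALL s<t. z s : Z & k s = z s ! i" if "ALL s<t. k s : ?K" for t k
  using that by (intro choice allI) (auto simp: Zr)
 have "Li.dimension (D i) ?K {\<Oplus>\<^bsub>Ls ! i\<^esub>s\<in>{..<D i}. k s \<otimes>\<^bsub>Ls ! i\<^esub> beta i s ! i | k. ALL s<D i. k s : ?K}"
 proof (rule Li.dimension_of_basis)
  show "beta i s ! i : carrier (Ls ! i)" if "s < D i" for s using that i by (simp add: nth_closed)
  show "?K \<subseteq> carrier (Ls ! i)" by (rule K)
  fix t k assume t: "t < D i" and k: "ALL s<t. k s : ?K"
  obtain z where z: "ALL s<t. z s : Z & k s = z s ! i" using lift[OF k] by blast
  have C: "z s : carrier L" "z s : Z" "beta i s : carrier L" if "s < t" for s using that z t i ZD(1) by auto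
  define y where "y = (\<Oplus>\<^bsub>L\<^esub>s\<in>{..<t}. z s \<otimes>\<^bsub>L\<^esub> beta i s)"
  have yC: "y : carrier L" unfolding y_def using C by (intro L.finsum_closed) auto
  show "beta i t ! i ~= (\<Oplus>\<^bsub>Ls ! i\<^esub>s\<in>{..<t}. k s \<otimes>\<^bsub>Ls ! i\<^esub> beta i s ! i)"
  proof
   assume "beta i t ! i = (\<Oplus>\<^bsub>Ls ! i\<^esub>s\<in>{..<t}. k s \<otimes>\<^bsub>Ls ! i\<^esub> beta i s ! i)"
   also have "... = (\<Oplus>\<^bsub>Ls ! i\<^esub>s\<in>{..<t}. z s ! i \<otimes>\<^bsub>Ls ! i\<^esub> beta i s ! i)"
    using z C i by (intro Li.finsum_cong') (auto simp: nth_closed)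
   also have "... = y ! i" unfolding y_def using sum[of t z] z t by simp
   finally have "beta i t \<otimes>\<^bsub>L\<^esub> e i = y \<otimes>\<^bsub>L\<^esub> e i" using mult_e[OF i] yC t i by simp
   moreover have "y \<otimes>\<^bsub>L\<^esub> e i = y"
    unfolding y_def using C t i beta_e[OF i]
    by (subst L.finsum_ldistr) (auto intro!: L.finsum_cong' simp: L.m_assoc)
   ultimately have "beta i t = (\<Oplus>\<^bsub>L\<^esub>s\<in>{..<t}. z s \<otimes>\<^bsub>L\<^esub> beta i s)" using beta_e[OF i t] by (simp add: y_def)
   then have "\<one>\<^bsub>L\<^esub> = tau i ((\<Oplus>\<^bsub>L\<^esub>s\<in>{..<t}. z s \<otimes>\<^bsub>L\<^esub> beta i s) \<otimes>\<^bsub>L\<^esub> gamma i t)" using trace_dual[OF i t t] by simp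
   also have "(\<Oplus>\<^bsub>L\<^esub>s\<in>{..<t}. z s \<otimes>\<^bsub>L\<^esub> beta i s) \<otimes>\<^bsub>L\<^esub> gamma i t = (\<Oplus>\<^bsub>L\<^esub>s\<in>{..<t}. z s \<otimes>\<^bsub>L\<^esub> (beta i s \<otimes>\<^bsub>L\<^esub> gamma i t))"
    using C t i by (subst L.finsum_ldistr) (auto intro!: L.finsum_cong' simp: L.m_assoc)
   also have "tau i ... = (\<Oplus>\<^bsub>L\<^esub>s\<in>{..<t}. z s \<otimes>\<^bsub>L\<^esub> tau i (beta i s \<otimes>\<^bsub>L\<^esub> gamma i t))"
    using C t i by (intro Z_linear_finsum[OF trace_coefficient[OF i]]) auto
   also have "... = \<zero>\<^bsub>L\<^esub>" using C t trace_dual[OF i _ t] by (intro L.add.finprod_one_eqI) auto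
   finally show False using one by simp
  qed
 qed
 also have "{\<Oplus>\<^bsub>Ls ! i\<^esub>s\<in>{..<D i}. k s \<otimes>\<^bsub>Ls ! i\<^esub> beta i s ! i | k. ALL s<D i. k s : ?K} = carrier (Ls ! i)"
 proof (intro equalityI subsetI)
  fix y assume "y : {\<Oplus>\<^bsub>Ls ! i\<^esub>s\<in>{..<D i}. k s \<otimes>\<^bsub>Ls ! i\<^esub> beta i s ! i | k. ALL s<D i. k s : ?K}"
  then obtain k where k: "ALL s<D i. k s : ?K" "y = (\<Oplus>\<^bsub>Ls ! i\<^esub>s\<in>{..<D i}. k s \<otimes>\<^bsub>Ls ! i\<^esub> beta i s ! i)" by blast
  have "k s : carrier (Ls ! i)" if "s < D i" for s using k(1) that K by blast
  then show "y : carrier (Ls ! i)" unfolding k(2) using i by (intro Li.finsum_closed) (auto simp: nth_closed)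
 next
  fix y assume y: "y : carrier (Ls ! i)"
  define z where "z s = tau i (emb i y \<otimes>\<^bsub>L\<^esub> gamma i s)" for s
  have z: "ALL s<D i. z s : Z" using y i trace_Z[OF i] by (simp add: z_def)
  have "y = (emb i y \<otimes>\<^bsub>L\<^esub> e i) ! i" using emb_e[OF i y] i by (simp add: emb_nth)
  also have "... = (\<Oplus>\<^bsub>L\<^esub>s\<in>{..<D i}. z s \<otimes>\<^bsub>L\<^esub> beta i s) ! i" using expand_beta[OF i, of "emb i y"] y by (simp add: z_def)
  also have "... = (\<Oplus>\<^bsub>Ls ! i\<^esub>s\<in>{..<D i}. z s ! i \<otimes>\<^bsub>Ls ! i\<^esub> beta i s ! i)" using sum[OF z] by simp
  finally show "y : {\<Oplus>\<^bsub>Ls ! i\<^esub>s\<in>{..<D i}. k s \<otimes>\<^bsub>Ls ! i\<^esub> beta i s ! i | k. ALL s<D i. k s : ?K}"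
   using z by (intro CollectI exI[of _ "%s. z s ! i"]) (auto simp: Zr)
 qed
 finally show "(%z. z ! i) : ring_hom Zr (Ls ! i) & inj_on (%z. z ! i) (carrier Zr) &
   ring.dimension (Ls ! i) (D i) ?K (carrier (Ls ! i))"
  using hom inj by blast
qed

text \<open>Both ranks of a Galois bimodule equal \<open>c\<close>, which makes the multiplicities constant.\<close>

lemma multiplicity_of_galois:
 assumes framed: "framed_bimodule L P n e V v v' W w w' d T tau D beta gamma m x phi F u f G g omega"
  and galois: "galois Ls c P" and ij: "i < n" "j < n"
 shows "m i j = m 0 0"
proof -
 interpret framed_bimodule L P n e V v v' W w w' d T tau D beta gamma m x phi F u f G g omega by (rule framed)
 have left_iso: "module_isomorphic L P (bimodule_power (bimodule_via id L) c)"
  and right_iso: "module_isomorphic L (right_module P) (right_module (bimodule_power (bimodule_via id L) c))"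
  using galois by (auto simp: galois_def Let_def)
 have right_iso': "module_isomorphic L (right_module P) (bimodule_power (bimodule_via id L) c)"
  using module_isomorphic_right_sum[of L "right_module P" "{..<c}" "%_. id" "%_. L"] right_iso L_cring
  by (simp add: bimodule_power_def)
 obtain b b' where b: "ALL r:{..<c}. b r : carrier P & b' r : duals L P"
  "ALL y:carrier P. y = (\<Oplus>\<^bsub>P\<^esub>r\<in>{..<c}. b' r y \<odot>\<^bsub>P\<^esub> b r)"
  "ALL r:{..<c}. ALL s:{..<c}. b' r (b s) = (if r = s then \<one>\<^bsub>L\<^esub> else \<zero>\<^bsub>L\<^esub>)"
  using free_basis[OF l.module_axioms left_iso] by blast
 obtain a a' where a: "ALL r:{..<c}. a r : carrier P & a' r : duals L (right_module P)"
  "ALL r:{..<c}. ALL s:{..<c}. a' r (a s) = (if r = s then \<one>\<^bsub>L\<^esub> else \<zero>\<^bsub>L\<^esub>)"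
  using free_basis[OF r.module_axioms right_iso'] by auto
 have l: "(\<Sum>j<n. m i j * D j) = c" if "i < n" for i
  using left_rank[of "{..<c}" b b' i] b that by auto
 have r: "c <= (\<Sum>j<n. D j * m j k)" if "k < n" for k
  using right_rank[of "{..<c}" a a' k] a that by auto
 show ?thesis using ij by (intro galois_multiplicity[OF l r]) auto
qed

end

theorem theorem4p3:
  fixes Ls :: "'a ring list" and P :: "('a list, 'a list, 'p) bimodule"
    and p q :: "nat \<Rightarrow> nat" and d n :: nat
    and L Z :: "'a list ring"
  assumes n: "n = length Ls"
    and L: "L = RDirProd_list Ls"
    and Z: "Z = L\<lparr>carrier := bimodule_center L P\<rparr>"
    and fields: "\<forall>i<n. field (Ls ! i)"
    and same_char: "\<forall>i<n. \<forall>j<n. ring_char (Ls ! i) = ring_char (Ls ! j)"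
    and quasi: "quasi_galois Ls d p q P"
    and conn: "connected_bimodule Ls P"
    and type_pos: "\<forall>i<n. 0 < p i \<and> 0 < q i"
  shows "field Z \<and>
    (\<exists>dd :: nat \<Rightarrow> nat. \<forall>i<n.
       (\<lambda>z. z ! i) \<in> ring_hom Z (Ls ! i) \<and> inj_on (\<lambda>z. z ! i) (carrier Z) \<and>
       ring.dimension (Ls ! i) (dd i) ((\<lambda>z. z ! i) ` carrier Z) (carrier (Ls ! i))) \<and>
    (\<exists>a r :: nat \<Rightarrow> nat. (\<forall>i<n. 0 < a i \<and> 0 < r i) \<and>
       bimodule_isomorphic L L P
         (bimodule_sum ({..<n} \<times> {..<n})
           (\<lambda>(i, j). bimodule_power (tensor_product Z (summand Ls i) (summand Ls j)) (a i * r j)))) \<and>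
    ((\<exists>e. galois Ls e P) \<longrightarrow>
       (\<exists>m>0. bimodule_isomorphic L L P
          (bimodule_power (tensor_product Z (bimodule_via id L) (bimodule_via id L)) m)))"
proof -
 interpret fs: field_sum Ls by (rule field_sum.intro) (use fields n in simp)
 have ne: "0 < length Ls"
  using conn by (auto simp: connected_bimodule_def Digraph_Component.connected_def strongly_connected_def incidence_graph_def)
 obtain V :: "(nat \<times> nat) set" and v v' and W :: "(nat \<times> nat) set" and w w' T tau D beta gamma m x phi F u f G g omega where
  framed: "framed_bimodule (RDirProd_list Ls) P (length Ls) (summand_idem Ls) V v v' W w w' d T tau D beta gamma m x phi F u f G g omega"
  using fs.framed_bimodule_of_quasi_galois[OF quasi conn type_pos[unfolded n]] by (elim exE)
 interpret framed_bimodule "RDirProd_list Ls" P "length Ls" "summand_idem Ls" V v v' W w w' d T tau D beta gamma m x phi F u f G g omega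
  by (rule framed)
 have Zc: "carrier Z = bimodule_center (RDirProd_list Ls) P" by (simp add: Z L)
 have Zr: "Z = RDirProd_list Ls\<lparr>carrier := bimodule_center (RDirProd_list Ls) P\<rparr>" by (simp add: Z L)
 obtain a r where pos: "ALL i<length Ls. 0 < a i & 0 < r i" and m: "ALL i<length Ls. ALL j<length Ls. m i j = a i * r j"
  using multiplicity_factorization by blast
 have "bimodule_isomorphic L L P (bimodule_sum ({..<n} \<times> {..<n})
   (%(i, j). bimodule_power (tensor_product Z (summand Ls i) (summand Ls j)) (a i * r j)))"
  using fs.summand_decomposition[OF framed, of "%(i, j). a i * r j" Z] m Zc n L by simp
 moreover have "EX m>0. bimodule_isomorphic L L P
   (bimodule_power (tensor_product Z (bimodule_via id L) (bimodule_via id L)) m)" if "galois Ls c P" for c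
  using galois_decomposition[OF fs.multiplicity_of_galois[OF framed that] Zc] m_pos[OF ne ne] L by auto
 ultimately show ?thesis
  using fs.center_field[OF framed ne Zr] pos n by (intro conjI exI[of _ D] exI[of _ a] exI[of _ r]) auto
qed

end
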